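(* Let $\mathcal{E}$ be a cartesian closed category with finite limits. Then the monoidal category $(\mathbf{Poly}_{\mathcal{E}},y,\otimes)$ has a closure given by $[-,-]$; that is, for each polynomial $p$ the functor $[p,-]$ is right adjoint to $p\otimes-$, naturally in $p$.
   Context: For $f\colon B\to A$ in $\mathcal{E}$, $\Delta_f\colon\mathcal{E}/A\to\mathcal{E}/B$ denotes pullback along $f$; $f$ is exponentiable if $\Delta_f$ has a right adjoint $\Pi_f$. A polynomial in $\mathcal{E}$ is an exponentiable morphism $p\colon P_*\to P$. A morphism of polynomials $\phi\colon p\to q$ is a pair $\phi_1\colon P\to Q$, $\phi^\sharp\colon P\times_Q Q_*\to P_*$ with $p\circ\phi^\sharp$ the projection to $P$, up to isomorphism of the choice of pullback. Composition is $(\psi\circ\phi)_1=\psi_1\circ\phi_1$, $(\psi\circ\phi)^\sharp=\phi^\sharp\circ(P\times_Q\psi^\sharp)$ (using $P\times_R R_*\cong P\times_Q(Q\times_R R_* )$). This gives the category $\mathbf{Poly}_{\mathcal{E}}$. The monoidal structure $(y,\otimes)$: $y=\mathrm{id}_1$; $p\otimes q$ is the product morphism $P_*\times Q_*\to P\times Q$; on morphisms $(\phi\otimes\psi)_1=\phi_1\times\psi_1$ and $(\phi\otimes\psi)^\sharp=\phi^\sharp\times\psi^\sharp$. Definition of $[p,q]$ (every map $A\to1$ is exponentiable since $\mathcal{E}$ is cartesian closed): (1) Let $R=\Pi_{q\times\mathrm{id}_P}(Q_*\times P_* )\to Q\times P$, where $Q_*\times P_*$ lies over $Q_*\times P$ via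 $\mathrm{id}\times p$ and $q\times\mathrm{id}_P\colon Q_*\times P\to Q\times P$. (2) Let $Q^P=\Pi_{P\to1}(Q\times P\to P)$ be the exponential, with counit $Q^P\times P\to Q\times P$, and let $B=R\times_{Q\times P}(Q^P\times P)\to Q^P\times P$. (3) Let $q^p=\Pi_{\pi}(B)\to Q^P$, where $\pi\colon Q^P\times P\to Q^P$ is the projection, with counit $q^p\times P\to B$. (4) Let $q^p\times P\to Q$ be the composite $q^p\times P\to B\to Q^P\times P\to Q\times P\to Q$. Then $[p,q]$ is the polynomial given by the composite of projections $Q_*\times_Q(q^p\times P)\to q^p\times P\to q^p$. It is functorial covariantly in $q$ and contravariantly in $p$. *)

theory Defs
  imports Main
begin

section \<open>Categories, functors, adjunctions\<close>

record ('o, 'a) cat =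
  Obj :: "'o set"
  Arr :: "'a set"
  Dom :: "'a \<Rightarrow> 'o"
  Cod :: "'a \<Rightarrow> 'o"
  Ide :: "'o \<Rightarrow> 'a"
  Comp :: "'a \<Rightarrow> 'a \<Rightarrow> 'a" (infixl "\<cdot>\<index>" 70)

definition Hom :: "('o, 'a) cat \<Rightarrow> 'o \<Rightarrow> 'o \<Rightarrow> 'a set" where
  "Hom C a b = {f \<in> Arr C. Dom C f = a \<and> Cod C f = b}"

locale category =
  fixes C :: "('o, 'a) cat" (structure)
  assumes Dom_Obj: "f \<in> Arr C \<Longrightarrow> Dom C f \<in> Obj C"
    and Cod_Obj: "f \<in> Arr C \<Longrightarrow> Cod C f \<in> Obj C"
    and Ide_Hom: "a \<in> Obj C \<Longrightarrow> Ide C a \<in> Hom C a a"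
    and Comp_Hom: "f \<in> Hom C a b \<Longrightarrow> g \<in> Hom C b c \<Longrightarrow> g \<cdot> f \<in> Hom C a c"
    and Comp_assoc:
      "f \<in> Hom C a b \<Longrightarrow> g \<in> Hom C b c \<Longrightarrow> h \<in> Hom C c d \<Longrightarrow> h \<cdot> (g \<cdot> f) = (h \<cdot> g) \<cdot> f"
    and Comp_Ide: "f \<in> Hom C a b \<Longrightarrow> f \<cdot> Ide C a = f"
    and Ide_Comp: "f \<in> Hom C a b \<Longrightarrow> Ide C b \<cdot> f = f"

definition iso :: "('o, 'a) cat \<Rightarrow> 'a \<Rightarrow> bool" where
  "iso C f \<longleftrightarrow> f \<in> Arr C \<and>
     (\<exists>g \<in> Hom C (Cod C f) (Dom C f).
        Comp C g f = Ide C (Dom C f) \<and> Comp C f g = Ide C (Cod C f))"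

definition op_cat :: "('o, 'a) cat \<Rightarrow> ('o, 'a) cat" where
  "op_cat C = \<lparr>Obj = Obj C, Arr = Arr C, Dom = Cod C, Cod = Dom C, Ide = Ide C,
     Comp = (\<lambda>g f. Comp C f g)\<rparr>"

definition prod_cat :: "('o, 'a) cat \<Rightarrow> ('p, 'b) cat \<Rightarrow> ('o \<times> 'p, 'a \<times> 'b) cat" where
  "prod_cat C D = \<lparr>Obj = Obj C \<times> Obj D, Arr = Arr C \<times> Arr D,
     Dom = (\<lambda>(f, g). (Dom C f, Dom D g)), Cod = (\<lambda>(f, g). (Cod C f, Cod D g)),
     Ide = (\<lambda>(a, b). (Ide C a, Ide D b)),
     Comp = (\<lambda>(f', g') (f, g). (Comp C f' f, Comp D g' g))\<rparr>"

record ('o, 'a, 'p, 'b) func =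
  fobj :: "'o \<Rightarrow> 'p"
  farr :: "'a \<Rightarrow> 'b"

definition is_functor ::
  "('o, 'a) cat \<Rightarrow> ('p, 'b) cat \<Rightarrow> ('o, 'a, 'p, 'b) func \<Rightarrow> bool" where
  "is_functor C D F \<longleftrightarrow> category C \<and> category D \<and>
     (\<forall>a \<in> Obj C. fobj F a \<in> Obj D) \<and>
     (\<forall>a b. \<forall>f \<in> Hom C a b. farr F f \<in> Hom D (fobj F a) (fobj F b)) \<and>
     (\<forall>a \<in> Obj C. farr F (Ide C a) = Ide D (fobj F a)) \<and>
     (\<forall>a b c. \<forall>f \<in> Hom C a b. \<forall>g \<in> Hom C b c.
        farr F (Comp C g f) = Comp D (farr F g) (farr F f))"

text \<open>\<open>adjunction C D L R \<Phi>\<close>: the functor \<open>L : C \<rightarrow> D\<close> is left adjoint to \<open>R : D \<rightarrow> C\<close> via the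
  bijections \<open>\<Phi> c d : D(L c, d) \<rightarrow> C(c, R d)\<close>, natural in \<open>c\<close> and \<open>d\<close>.\<close>

definition adjunction ::
  "('o, 'a) cat \<Rightarrow> ('p, 'b) cat \<Rightarrow> ('o, 'a, 'p, 'b) func \<Rightarrow> ('p, 'b, 'o, 'a) func
    \<Rightarrow> ('o \<Rightarrow> 'p \<Rightarrow> 'b \<Rightarrow> 'a) \<Rightarrow> bool" where
  "adjunction C D L R \<Phi> \<longleftrightarrow> is_functor C D L \<and> is_functor D C R \<and>
     (\<forall>c \<in> Obj C. \<forall>d \<in> Obj D. bij_betw (\<Phi> c d) (Hom D (fobj L c) d) (Hom C c (fobj R d))) \<and>
     (\<forall>c' c d d'. \<forall>f \<in> Hom C c' c. \<forall>g \<in> Hom D d d'. \<forall>h \<in> Hom D (fobj L c) d.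
        \<Phi> c' d' (Comp D (Comp D g h) (farr L f)) = Comp C (Comp C (farr R g) (\<Phi> c d h)) f)"

definition has_right_adjoint ::
  "('o, 'a) cat \<Rightarrow> ('p, 'b) cat \<Rightarrow> ('o, 'a, 'p, 'b) func \<Rightarrow> bool" where
  "has_right_adjoint C D L \<longleftrightarrow> (\<exists>R \<Phi>. adjunction C D L R \<Phi>)"

section \<open>Finite limits\<close>

definition is_cone ::
  "('j, 'i) cat \<Rightarrow> ('o, 'a) cat \<Rightarrow> ('j, 'i, 'o, 'a) func \<Rightarrow> 'o \<Rightarrow> ('j \<Rightarrow> 'a) \<Rightarrow> bool" where
  "is_cone J E D c \<pi> \<longleftrightarrow> c \<in> Obj E \<and> (\<forall>j \<in> Obj J. \<pi> j \<in> Hom E c (fobj D j)) \<and>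
     (\<forall>j k. \<forall>f \<in> Hom J j k. Comp E (farr D f) (\<pi> j) = \<pi> k)"

definition is_limit_cone ::
  "('j, 'i) cat \<Rightarrow> ('o, 'a) cat \<Rightarrow> ('j, 'i, 'o, 'a) func \<Rightarrow> 'o \<Rightarrow> ('j \<Rightarrow> 'a) \<Rightarrow> bool" where
  "is_limit_cone J E D c \<pi> \<longleftrightarrow> is_cone J E D c \<pi> \<and>
     (\<forall>c' \<pi>'. is_cone J E D c' \<pi>' \<longrightarrow>
        (\<exists>!h. h \<in> Hom E c' c \<and> (\<forall>j \<in> Obj J. Comp E (\<pi> j) h = \<pi>' j)))"

text \<open>Every finite category is isomorphic to one whose objects and arrows are natural numbers, so
  it is enough to let the diagram shapes range over those.\<close>

definition has_finite_limits :: "('o, 'a) cat \<Rightarrow> bool" where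
  "has_finite_limits E \<longleftrightarrow>
     (\<forall>(J :: (nat, nat) cat) D. finite (Obj J) \<and> finite (Arr J) \<and> is_functor J E D \<longrightarrow>
        (\<exists>c \<pi>. is_limit_cone J E D c \<pi>))"

context
  fixes E :: "('o, 'a) cat" (structure)
begin

definition is_terminal :: "'o \<Rightarrow> bool" where
  "is_terminal t \<longleftrightarrow> t \<in> Obj E \<and> (\<forall>a \<in> Obj E. \<exists>!h. h \<in> Hom E a t)"

definition is_product :: "'o \<Rightarrow> 'o \<Rightarrow> 'a \<Rightarrow> 'a \<Rightarrow> bool" where
  "is_product a b u v \<longleftrightarrow> u \<in> Hom E (Dom E u) a \<and> v \<in> Hom E (Dom E u) b \<and>
     (\<forall>c. \<forall>f \<in> Hom E c a. \<forall>g \<in> Hom E c b.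
        \<exists>!h. h \<in> Hom E c (Dom E u) \<and> u \<cdot> h = f \<and> v \<cdot> h = g)"

definition is_pullback :: "'a \<Rightarrow> 'a \<Rightarrow> 'a \<Rightarrow> 'a \<Rightarrow> bool" where
  "is_pullback f g u v \<longleftrightarrow>
     u \<in> Hom E (Dom E u) (Dom E f) \<and> v \<in> Hom E (Dom E u) (Dom E g) \<and> f \<cdot> u = g \<cdot> v \<and>
     (\<forall>c. \<forall>s \<in> Hom E c (Dom E f). \<forall>t \<in> Hom E c (Dom E g). f \<cdot> s = g \<cdot> t \<longrightarrow>
        (\<exists>!h. h \<in> Hom E c (Dom E u) \<and> u \<cdot> h = s \<and> v \<cdot> h = t))"

text \<open>A fixed choice of the terminal object, of binary products and of pullbacks.  A product or
  pullback is given by its pair of projections.\<close>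

definition one :: 'o where
  "one = (SOME t. is_terminal t)"

definition bang :: "'o \<Rightarrow> 'a" where
  "bang a = (THE h. h \<in> Hom E a one)"

definition prod_proj :: "'o \<Rightarrow> 'o \<Rightarrow> 'a \<times> 'a" where
  "prod_proj a b = (SOME (u, v). is_product a b u v)"

definition p1 :: "'o \<Rightarrow> 'o \<Rightarrow> 'a" where "p1 a b = fst (prod_proj a b)"
definition p2 :: "'o \<Rightarrow> 'o \<Rightarrow> 'a" where "p2 a b = snd (prod_proj a b)"
definition prd :: "'o \<Rightarrow> 'o \<Rightarrow> 'o" where "prd a b = Dom E (p1 a b)"

definition pair :: "'a \<Rightarrow> 'a \<Rightarrow> 'a" where
  "pair f g = (THE h. h \<in> Hom E (Dom E f) (prd (Cod E f) (Cod E g)) \<and>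
     p1 (Cod E f) (Cod E g) \<cdot> h = f \<and> p2 (Cod E f) (Cod E g) \<cdot> h = g)"

definition prodmap :: "'a \<Rightarrow> 'a \<Rightarrow> 'a" where
  "prodmap f g =
     pair (f \<cdot> p1 (Dom E f) (Dom E g)) (g \<cdot> p2 (Dom E f) (Dom E g))"

definition pb_proj :: "'a \<Rightarrow> 'a \<Rightarrow> 'a \<times> 'a" where
  "pb_proj f g = (SOME (u, v). is_pullback f g u v)"

definition pr1 :: "'a \<Rightarrow> 'a \<Rightarrow> 'a" where "pr1 f g = fst (pb_proj f g)"
definition pr2 :: "'a \<Rightarrow> 'a \<Rightarrow> 'a" where "pr2 f g = snd (pb_proj f g)"
definition pb :: "'a \<Rightarrow> 'a \<Rightarrow> 'o" where "pb f g = Dom E (pr1 f g)"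

text \<open>\<open>pbpair f g s t\<close> is the map \<open>(s, t)\<close> into the pullback of \<open>f\<close> and \<open>g\<close>.\<close>

definition pbpair :: "'a \<Rightarrow> 'a \<Rightarrow> 'a \<Rightarrow> 'a \<Rightarrow> 'a" where
  "pbpair f g s t = (THE h. h \<in> Hom E (Dom E s) (pb f g) \<and> pr1 f g \<cdot> h = s \<and> pr2 f g \<cdot> h = t)"

definition prod_functor :: "'o \<Rightarrow> ('o, 'a, 'o, 'a) func" where
  "prod_functor a = \<lparr>fobj = (\<lambda>x. prd x a), farr = (\<lambda>f. prodmap f (Ide E a))\<rparr>"

definition cartesian_closed :: bool where
  "cartesian_closed \<longleftrightarrow> (\<exists>t. is_terminal t) \<and>
     (\<forall>a \<in> Obj E. \<forall>b \<in> Obj E. \<exists>u v. is_product a b u v) \<and>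
     (\<forall>a \<in> Obj E. has_right_adjoint E E (prod_functor a))"

section \<open>Slices and exponentiable morphisms\<close>

text \<open>A morphism \<open>(x, h, y)\<close> of \<open>E/a\<close> is a map \<open>h\<close> with \<open>y \<circ> h = x\<close>.\<close>

definition slice :: "'o \<Rightarrow> ('a, 'a \<times> 'a \<times> 'a) cat" where
  "slice a = \<lparr>Obj = {x \<in> Arr E. Cod E x = a},
     Arr = {(x, h, y). x \<in> Arr E \<and> Cod E x = a \<and> y \<in> Arr E \<and> Cod E y = a \<and>
        h \<in> Hom E (Dom E x) (Dom E y) \<and> y \<cdot> h = x},
     Dom = (\<lambda>(x, h, y). x), Cod = (\<lambda>(x, h, y). y),
     Ide = (\<lambda>x. (x, Ide E (Dom E x), x)),
     Comp = (\<lambda>(x', h', y') (x, h, y). (x, h' \<cdot> h, y'))\<rparr>"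

definition Delta :: "'a \<Rightarrow> ('a, 'a \<times> 'a \<times> 'a, 'a, 'a \<times> 'a \<times> 'a) func" where
  "Delta f = \<lparr>fobj = (\<lambda>x. pr2 x f),
     farr = (\<lambda>(x, h, y). (pr2 x f, pbpair y f (h \<cdot> pr1 x f) (pr2 x f), pr2 y f))\<rparr>"

definition exponentiable :: "'a \<Rightarrow> bool" where
  "exponentiable f \<longleftrightarrow> f \<in> Arr E \<and>
     has_right_adjoint (slice (Cod E f)) (slice (Dom E f)) (Delta f)"

definition Pi_adj :: "'a \<Rightarrow>
    ('a, 'a \<times> 'a \<times> 'a, 'a, 'a \<times> 'a \<times> 'a) func \<times> ('a \<Rightarrow> 'a \<Rightarrow> 'a \<times> 'a \<times> 'a \<Rightarrow> 'a \<times> 'a \<times> 'a)" where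
  "Pi_adj f = (SOME (R, \<Phi>). adjunction (slice (Cod E f)) (slice (Dom E f)) (Delta f) R \<Phi>)"

definition Pi :: "'a \<Rightarrow> 'a \<Rightarrow> 'a" where
  "Pi f x = fobj (fst (Pi_adj f)) x"

text \<open>\<open>Pi_transpose f z x k : Dom z \<rightarrow> Dom (\<Pi>\<^sub>f x)\<close> is the transpose of
  \<open>k : \<Delta>\<^sub>f z \<rightarrow> x\<close>, and \<open>Pi_counit f x : \<Delta>\<^sub>f (\<Pi>\<^sub>f x) \<rightarrow> x\<close>.\<close>

definition Pi_transpose :: "'a \<Rightarrow> 'a \<Rightarrow> 'a \<Rightarrow> 'a \<Rightarrow> 'a" where
  "Pi_transpose f z x k = fst (snd (snd (Pi_adj f) z x (pr2 z f, k, x)))"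

definition Pi_counit :: "'a \<Rightarrow> 'a \<Rightarrow> 'a" where
  "Pi_counit f x =
     fst (snd (inv_into (Hom (slice (Dom E f)) (pr2 (Pi f x) f) x)
       (snd (Pi_adj f) (Pi f x) x) (Ide (slice (Cod E f)) (Pi f x))))"

end

section \<open>The category of polynomials\<close>

text \<open>Since pullbacks are chosen, a morphism \<open>\<phi> : p \<rightarrow> q\<close> is a pair \<open>base = \<phi>\<^sub>1\<close>,
  \<open>sharp = \<phi>\<^sup>\<sharp>\<close>, the latter defined on the chosen pullback of \<open>\<phi>\<^sub>1\<close> and \<open>q\<close>: every pair
  using another pullback has exactly one such representative.\<close>

datatype 'a poly_mor = PMor (pdom: 'a) (pcod: 'a) (base: 'a) (sharp: 'a)

context
  fixes E :: "('o, 'a) cat" (structure)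
begin

text \<open>The morphism \<open>p \<rightarrow> q\<close> induced by an isomorphism \<open>f : P \<rightarrow> Q\<close> and an isomorphism
  \<open>g : Q\<^sub>* \<rightarrow> P\<^sub>*\<close> with \<open>f \<circ> p \<circ> g = q\<close>.\<close>

definition poly_of_iso :: "'a \<Rightarrow> 'a \<Rightarrow> 'a \<Rightarrow> 'a \<Rightarrow> 'a poly_mor" where
  "poly_of_iso p q f g = PMor p q f (g \<cdot> pr2 E f q)"

definition poly_id :: "'a \<Rightarrow> 'a poly_mor" where
  "poly_id p = poly_of_iso p p (Ide E (Cod E p)) (Ide E (Dom E p))"

text \<open>For \<open>\<psi> : q \<rightarrow> r\<close>, the inner map below is the composite
  \<open>P \<times>\<^sub>R R\<^sub>* \<cong> P \<times>\<^sub>Q (Q \<times>\<^sub>R R\<^sub>*) \<rightarrow> P \<times>\<^sub>Q Q\<^sub>*\<close>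
  of the canonical isomorphism with \<open>P \<times>\<^sub>Q \<psi>\<^sup>\<sharp>\<close>.\<close>

definition poly_comp :: "'a poly_mor \<Rightarrow> 'a poly_mor \<Rightarrow> 'a poly_mor" where
  "poly_comp \<psi> \<phi> =
     (let q = pdom \<psi>; r = pcod \<psi>; b = base \<psi> \<cdot> base \<phi> in
      PMor (pdom \<phi>) r b
        (sharp \<phi> \<cdot> pbpair E (base \<phi>) q (pr1 E b r)
           (sharp \<psi> \<cdot> pbpair E (base \<psi>) r (base \<phi> \<cdot> pr1 E b r) (pr2 E b r))))"

definition Poly :: "('a, 'a poly_mor) cat" where
  "Poly = \<lparr>Obj = {p. exponentiable E p},
     Arr = {\<phi>. exponentiable E (pdom \<phi>) \<and> exponentiable E (pcod \<phi>) \<and>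
        base \<phi> \<in> Hom E (Cod E (pdom \<phi>)) (Cod E (pcod \<phi>)) \<and>
        sharp \<phi> \<in> Hom E (pb E (base \<phi>) (pcod \<phi>)) (Dom E (pdom \<phi>)) \<and>
        pdom \<phi> \<cdot> sharp \<phi> = pr1 E (base \<phi>) (pcod \<phi>)},
     Dom = pdom, Cod = pcod, Ide = poly_id, Comp = poly_comp\<rparr>"

text \<open>On morphisms, \<open>\<phi>\<^sup>\<sharp> \<times> \<psi>\<^sup>\<sharp>\<close> is precomposed with the canonical isomorphism
  \<open>(P \<times> P') \<times>\<^bsub>Q \<times> Q'\<^esub> (Q\<^sub>* \<times> Q'\<^sub>*) \<cong> (P \<times>\<^sub>Q Q\<^sub>*) \<times> (P' \<times>\<^bsub>Q'\<^esub> Q'\<^sub>*)\<close>.\<close>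

definition poly_tensor_mor :: "'a poly_mor \<Rightarrow> 'a poly_mor \<Rightarrow> 'a poly_mor" where
  "poly_tensor_mor \<phi> \<psi> =
     (let p = pdom \<phi>; p' = pdom \<psi>; q = pcod \<phi>; q' = pcod \<psi>;
          b = prodmap E (base \<phi>) (base \<psi>); qq = prodmap E q q';
          u = pr1 E b qq; v = pr2 E b qq in
      PMor (prodmap E p p') qq b
        (prodmap E (sharp \<phi>) (sharp \<psi>) \<cdot>
         pair E
           (pbpair E (base \<phi>) q
              (p1 E (Cod E p) (Cod E p') \<cdot> u) (p1 E (Dom E q) (Dom E q') \<cdot> v))
           (pbpair E (base \<psi>) q'
              (p2 E (Cod E p) (Cod E p') \<cdot> u) (p2 E (Dom E q) (Dom E q') \<cdot> v))))"

definition prod_assoc :: "'o \<Rightarrow> 'o \<Rightarrow> 'o \<Rightarrow> 'a" where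
  "prod_assoc a b c =
     pair E (p1 E a b \<cdot> p1 E (prd E a b) c)
       (pair E (p2 E a b \<cdot> p1 E (prd E a b) c) (p2 E (prd E a b) c))"

definition prod_assoc_inv :: "'o \<Rightarrow> 'o \<Rightarrow> 'o \<Rightarrow> 'a" where
  "prod_assoc_inv a b c =
     pair E (pair E (p1 E a (prd E b c)) (p1 E b c \<cdot> p2 E a (prd E b c)))
       (p2 E b c \<cdot> p2 E a (prd E b c))"

definition poly_assoc :: "'a \<Rightarrow> 'a \<Rightarrow> 'a \<Rightarrow> 'a poly_mor" where
  "poly_assoc p q r =
     poly_of_iso (prodmap E (prodmap E p q) r) (prodmap E p (prodmap E q r))
       (prod_assoc (Cod E p) (Cod E q) (Cod E r)) (prod_assoc_inv (Dom E p) (Dom E q) (Dom E r))"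

definition poly_lunit :: "'a \<Rightarrow> 'a poly_mor" where
  "poly_lunit p = poly_of_iso (prodmap E (Ide E (one E)) p) p
     (p2 E (one E) (Cod E p)) (pair E (bang E (Dom E p)) (Ide E (Dom E p)))"

definition poly_runit :: "'a \<Rightarrow> 'a poly_mor" where
  "poly_runit p = poly_of_iso (prodmap E p (Ide E (one E))) p
     (p1 E (Cod E p) (one E)) (pair E (Ide E (Dom E p)) (bang E (Dom E p)))"

end

section \<open>Monoidal categories and closures\<close>

record ('o, 'a) moncat =
  Mcat :: "('o, 'a) cat"
  Mtensor :: "('o \<times> 'o, 'a \<times> 'a, 'o, 'a) func"
  Munit :: 'o
  Massoc :: "'o \<Rightarrow> 'o \<Rightarrow> 'o \<Rightarrow> 'a"
  Mlunit :: "'o \<Rightarrow> 'a"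
  Mrunit :: "'o \<Rightarrow> 'a"

definition tens :: "('o, 'a) moncat \<Rightarrow> 'o \<Rightarrow> 'o \<Rightarrow> 'o" where
  "tens M a b = fobj (Mtensor M) (a, b)"

definition tensm :: "('o, 'a) moncat \<Rightarrow> 'a \<Rightarrow> 'a \<Rightarrow> 'a" where
  "tensm M f g = farr (Mtensor M) (f, g)"

locale monoidal_category =
  fixes M :: "('o, 'a) moncat"
  fixes C defines "C \<equiv> Mcat M"
  assumes tensor: "is_functor (prod_cat C C) C (Mtensor M)"
    and unit: "Munit M \<in> Obj C"
    and assoc: "\<lbrakk>a \<in> Obj C; b \<in> Obj C; c \<in> Obj C\<rbrakk> \<Longrightarrow>
      Massoc M a b c \<in> Hom C (tens M (tens M a b) c) (tens M a (tens M b c)) \<and>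
      iso C (Massoc M a b c)"
    and lunit: "a \<in> Obj C \<Longrightarrow>
      Mlunit M a \<in> Hom C (tens M (Munit M) a) a \<and> iso C (Mlunit M a)"
    and runit: "a \<in> Obj C \<Longrightarrow>
      Mrunit M a \<in> Hom C (tens M a (Munit M)) a \<and> iso C (Mrunit M a)"
    and assoc_natural: "\<lbrakk>f \<in> Hom C a a'; g \<in> Hom C b b'; h \<in> Hom C c c'\<rbrakk> \<Longrightarrow>
      Comp C (tensm M f (tensm M g h)) (Massoc M a b c) =
      Comp C (Massoc M a' b' c') (tensm M (tensm M f g) h)"
    and lunit_natural: "f \<in> Hom C a a' \<Longrightarrow>
      Comp C f (Mlunit M a) = Comp C (Mlunit M a') (tensm M (Ide C (Munit M)) f)"
    and runit_natural: "f \<in> Hom C a a' \<Longrightarrow>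
      Comp C f (Mrunit M a) = Comp C (Mrunit M a') (tensm M f (Ide C (Munit M)))"
    and pentagon: "\<lbrakk>a \<in> Obj C; b \<in> Obj C; c \<in> Obj C; d \<in> Obj C\<rbrakk> \<Longrightarrow>
      Comp C (Massoc M a b (tens M c d)) (Massoc M (tens M a b) c d) =
      Comp C (tensm M (Ide C a) (Massoc M b c d))
        (Comp C (Massoc M a (tens M b c) d) (tensm M (Massoc M a b c) (Ide C d)))"
    and triangle: "\<lbrakk>a \<in> Obj C; b \<in> Obj C\<rbrakk> \<Longrightarrow>
      Comp C (tensm M (Ide C a) (Mlunit M b)) (Massoc M a (Munit M) b) =
      tensm M (Mrunit M a) (Ide C b)"

definition tensor_left :: "('o, 'a) moncat \<Rightarrow> 'o \<Rightarrow> ('o, 'a, 'o, 'a) func" where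
  "tensor_left M p = \<lparr>fobj = tens M p, farr = tensm M (Ide (Mcat M) p)\<rparr>"

definition hom_right ::
  "('o, 'a) moncat \<Rightarrow> ('o \<times> 'o, 'a \<times> 'a, 'o, 'a) func \<Rightarrow> 'o \<Rightarrow> ('o, 'a, 'o, 'a) func" where
  "hom_right M H p =
     \<lparr>fobj = (\<lambda>q. fobj H (p, q)), farr = (\<lambda>g. farr H (Ide (Mcat M) p, g))\<rparr>"

text \<open>The last clause is naturality of the adjunctions in \<open>p\<close>.\<close>

definition is_closure ::
  "('o, 'a) moncat \<Rightarrow> ('o \<times> 'o, 'a \<times> 'a, 'o, 'a) func \<Rightarrow> bool" where
  "is_closure M H \<longleftrightarrow>
     (let C = Mcat M in
      is_functor (prod_cat (op_cat C) C) C H \<and>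
      (\<exists>\<Phi>. (\<forall>p \<in> Obj C. adjunction C C (tensor_left M p) (hom_right M H p) (\<Phi> p)) \<and>
        (\<forall>p' p r q. \<forall>k \<in> Hom C p' p. \<forall>h \<in> Hom C (tens M p r) q. r \<in> Obj C \<longrightarrow>
           \<Phi> p' r q (Comp C h (tensm M k (Ide C r))) =
           Comp C (farr H (k, Ide C q)) (\<Phi> p r q h))))"

definition Poly_moncat :: "('o, 'a) cat \<Rightarrow> ('a, 'a poly_mor) moncat" where
  "Poly_moncat E = \<lparr>Mcat = Poly E,
     Mtensor = \<lparr>fobj = (\<lambda>(p, q). prodmap E p q), farr = (\<lambda>(\<phi>, \<psi>). poly_tensor_mor E \<phi> \<psi>)\<rparr>,
     Munit = Ide E (one E),
     Massoc = poly_assoc E, Mlunit = poly_lunit E, Mrunit = poly_runit E\<rparr>"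

section \<open>The polynomial \<open>[p, q]\<close>\<close>

context
  fixes E :: "('o, 'a) cat" (structure)
begin

context
  fixes p q :: 'a
begin

text \<open>\<open>R \<rightarrow> Q \<times> P\<close>, and the second component
  \<open>R \<times>\<^bsub>Q \<times> P\<^esub> (Q\<^sub>* \<times> P) \<rightarrow> P\<^sub>*\<close> of its counit.\<close>

definition R_map :: 'a where
  "R_map = Pi E (prodmap E q (Ide E (Cod E p))) (prodmap E (Ide E (Dom E q)) p)"

definition R_counit :: 'a where
  "R_counit = p2 E (Dom E q) (Dom E p) \<cdot>
     Pi_counit E (prodmap E q (Ide E (Cod E p))) (prodmap E (Ide E (Dom E q)) p)"

text \<open>\<open>Q\<^sup>P \<rightarrow> 1\<close> and the counit \<open>Q\<^sup>P \<times> P \<rightarrow> Q \<times> P\<close>, precomposed with the canonical isomorphism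
  from \<open>Q\<^sup>P \<times> P\<close> to the pullback of \<open>Q\<^sup>P \<rightarrow> 1 \<leftarrow> P\<close>.\<close>

definition exp_map :: 'a where
  "exp_map = Pi E (bang E (Cod E p)) (p2 E (Cod E q) (Cod E p))"

definition exp_obj :: 'o where
  "exp_obj = Dom E exp_map"

definition exp_counit :: 'a where
  "exp_counit = Pi_counit E (bang E (Cod E p)) (p2 E (Cod E q) (Cod E p)) \<cdot>
     pbpair E exp_map (bang E (Cod E p)) (p1 E exp_obj (Cod E p)) (p2 E exp_obj (Cod E p))"

text \<open>\<open>B \<rightarrow> Q\<^sup>P \<times> P\<close>.\<close>

definition B_map :: 'a where
  "B_map = pr2 E R_map exp_counit"

text \<open>\<open>q\<^sup>p \<rightarrow> Q\<^sup>P\<close> and the counit \<open>q\<^sup>p \<times> P \<rightarrow> B\<close>, precomposed with the canonical isomorphism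
  from \<open>q\<^sup>p \<times> P\<close> to the pullback of \<open>q\<^sup>p \<rightarrow> Q\<^sup>P \<leftarrow> Q\<^sup>P \<times> P\<close>.\<close>

definition qp_map :: 'a where
  "qp_map = Pi E (p1 E exp_obj (Cod E p)) B_map"

definition qp_obj :: 'o where
  "qp_obj = Dom E qp_map"

definition qp_counit :: 'a where
  "qp_counit = Pi_counit E (p1 E exp_obj (Cod E p)) B_map \<cdot>
     pbpair E qp_map (p1 E exp_obj (Cod E p))
       (p1 E qp_obj (Cod E p)) (prodmap E qp_map (Ide E (Cod E p)))"

definition qp_eval :: 'a where
  "qp_eval = p1 E (Cod E q) (Cod E p) \<cdot> (exp_counit \<cdot> (B_map \<cdot> qp_counit))"

definition poly_hom :: 'a where
  "poly_hom = p1 E qp_obj (Cod E p) \<cdot> pr2 E q qp_eval"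

text \<open>The object \<open>q\<^sup>p\<close> represents the presheaf \<open>X \<mapsto> Poly(id\<^sub>X \<otimes> p, q)\<close> on \<open>E\<close>.
  \<open>qp_univ\<close> is the universal element \<open>id \<otimes> p \<rightarrow> q\<close>, assembled from the three counits, and
  \<open>qp_curry X m : X \<rightarrow> q\<^sup>p\<close> classifies \<open>m : id\<^sub>X \<otimes> p \<rightarrow> q\<close>, by successive transposition to
  \<open>X \<times> P \<rightarrow> R\<close>, \<open>X \<rightarrow> Q\<^sup>P\<close> and \<open>X \<rightarrow> q\<^sup>p\<close>.\<close>

definition qp_univ :: "'a poly_mor" where
  "qp_univ =
     (let u = pr1 E qp_eval q; v = pr2 E qp_eval q in
      PMor (prodmap E (Ide E qp_obj) p) q qp_eval
        (pair E (p1 E qp_obj (Cod E p) \<cdot> u)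
          (R_counit \<cdot> pbpair E R_map (prodmap E q (Ide E (Cod E p)))
             (pr1 E R_map exp_counit \<cdot> (qp_counit \<cdot> u))
             (pair E v (p2 E qp_obj (Cod E p) \<cdot> u)))))"

definition qp_curry :: "'o \<Rightarrow> 'a poly_mor \<Rightarrow> 'a" where
  "qp_curry X m =
     (let P = Cod E p; Q = Cod E q; Ps = Dom E p; Qs = Dom E q;
          f = prodmap E q (Ide E P);
          z = pair E (base m) (p2 E X P);
          to_R = Pi_transpose E f z (prodmap E (Ide E Qs) p)
            (pair E (p1 E Qs P \<cdot> pr2 E z f)
              (p2 E X Ps \<cdot> (sharp m \<cdot>
                 pbpair E (base m) q (pr1 E z f) (p1 E Qs P \<cdot> pr2 E z f))));
          to_exp = Pi_transpose E (bang E P) (bang E X) (p2 E Q P)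
            (z \<cdot> pair E (pr1 E (bang E X) (bang E P)) (pr2 E (bang E X) (bang E P)));
          to_B = pbpair E R_map exp_counit to_R (prodmap E to_exp (Ide E P));
          \<pi> = p1 E exp_obj P
      in Pi_transpose E \<pi> to_exp B_map
           (to_B \<cdot> pair E (pr1 E to_exp \<pi>) (p2 E exp_obj P \<cdot> pr2 E to_exp \<pi>)))"

end

text \<open>The action of \<open>[-, -]\<close> on \<open>\<phi> : p' \<rightarrow> p\<close> and \<open>\<psi> : q \<rightarrow> q'\<close>.  On bases,
  \<open>q\<^sup>p \<rightarrow> q'\<^bsup>p'\<^esup>\<close> classifies \<open>id \<otimes> p' \<rightarrow> id \<otimes> p \<rightarrow> q \<rightarrow> q'\<close>.  In terms of generalised elements
  \<open>x\<close> of \<open>q\<^sup>p\<close>, \<open>b'\<close> of \<open>Q'\<^sub>*\<close> and \<open>a'\<close> of \<open>P'\<close>, the map \<open>sharp\<close> sends \<open>(x, b', a')\<close> to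
  \<open>(\<psi>\<^sup>\<sharp> (x (\<phi>\<^sub>1 a'), b'), (x, \<phi>\<^sub>1 a'))\<close>.\<close>

definition poly_hom_mor :: "'a poly_mor \<Rightarrow> 'a poly_mor \<Rightarrow> 'a poly_mor" where
  "poly_hom_mor \<phi> \<psi> =
     (let p' = pdom \<phi>; p = pcod \<phi>; q = pdom \<psi>; q' = pcod \<psi>;
          b = qp_curry p' q' (qp_obj p q)
                (poly_comp E \<psi> (poly_comp E (qp_univ p q)
                   (poly_tensor_mor E (poly_id E (Ide E (qp_obj p q))) \<phi>)));
          h' = poly_hom p' q';
          x = pr1 E b h';
          b' = pr1 E q' (qp_eval p' q') \<cdot> pr2 E b h';
          a' = p2 E (qp_obj p' q') (Cod E p') \<cdot> (pr2 E q' (qp_eval p' q') \<cdot> pr2 E b h');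
          w = pair E x (base \<phi> \<cdot> a')
      in PMor (poly_hom p q) h' b
           (pbpair E q (qp_eval p q)
              (sharp \<psi> \<cdot> pbpair E (base \<psi>) q' (qp_eval p q \<cdot> w) b') w))"

definition poly_hom_functor :: "('a \<times> 'a, 'a poly_mor \<times> 'a poly_mor, 'a, 'a poly_mor) func" where
  "poly_hom_functor = \<lparr>fobj = (\<lambda>(p, q). poly_hom p q), farr = (\<lambda>(\<phi>, \<psi>). poly_hom_mor \<phi> \<psi>)\<rparr>"

end

end

(* A morphism of polynomials is treated through generalised elements. It is determined by its map on
   bases and by the values phi#(s, t), natural in s : Z -> P and t : Z -> Q_* over the same element
   of Q, and conversely every such natural family comes from a morphism. In these terms composition
   reads (psi o phi)#(s, t) = phi#(s, psi#(phi_1 s, t)) and the tensor product acts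
   componentwise, so that the monoidal axioms become identities between tuples.

   Products of exponentiable maps and the maps entering the definition of [p, q] are exponentiable
   because exponentiable maps include all A -> 1 and are stable under composition and pullback.
   Transposing through the three right adjoints that define q^p shows that a map x : X -> q^p is the
   same as a function a |-> ev x a from P to Q together with a function (a, t) |-> us x a t sending
   t over ev x a to an element of P_* over a. This is the datum of a morphism id_X (x) p -> q, so
   a morphism p (x) r -> q splits into a map from the base of r to q^p and, with the remaining
   component of its sharp map, a morphism r -> [p, q]. Naturality is checked on elements, maps to
   q^p being determined by ev and us. *)

theory Submission
  imports Defs
begin

section \<open>Products and pullbacks\<close>

text \<open>Only cartesian closedness is available, not local cartesian closedness, so
  \<open>Pi\<close> is meaningful just along exponentiable maps. Exponentiability is therefore
  broken up into the pointwise statement \<open>is_Pi\<close>, a universal arrow for a single object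
  of the slice: closure under composition and pullback can then be constructed object by object, and
  the adjoint functor is assembled only once, in \<open>exponentiableI\<close>.

  The second obstacle is that products, pullbacks and right adjoints are arbitrary choices, so that
  canonical isomorphisms between iterated pullbacks would fill every equation. On generalised
  elements they disappear: composites are nested to the right, elements of products and pullbacks
  are written as \<open>pair\<close> and \<open>pbpair\<close>, and precomposition is pushed into
  these tuples. Universal properties are restated for all elements instead of the generic one given
  by the projections; the generic one is inserted only to pass between a map and the family of its
  values.\<close>

lemma Hom_iff [simp]: "f \<in> Hom C a b \<longleftrightarrow> f \<in> Arr C \<and> Dom C f = a \<and> Cod C f = b"
  by (simp add: Hom_def)

context category
begin

lemma comp_simps [simp]:
  assumes "f \<in> Arr C" "g \<in> Arr C" "Cod C f = Dom C g"
  shows "g \<cdot> f \<in> Arr C" "Dom C (g \<cdot> f) = Dom C f" "Cod C (g \<cdot> f) = Cod C g"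
  using Comp_Hom[of f "Dom C f" "Dom C g" g "Cod C g"] assms by auto

lemma comp_assoc [simp]:
  assumes "f \<in> Arr C" "g \<in> Arr C" "h \<in> Arr C" "Cod C f = Dom C g" "Cod C g = Dom C h"
  shows "(h \<cdot> g) \<cdot> f = h \<cdot> (g \<cdot> f)"
  using Comp_assoc[of f _ _ g _ h] assms by auto

lemma ide_simps [simp]:
  assumes "a \<in> Obj C"
  shows "Ide C a \<in> Arr C" "Dom C (Ide C a) = a" "Cod C (Ide C a) = a"
  using Ide_Hom[OF assms] by auto

lemma dom_cod_obj [simp]:
  assumes "f \<in> Arr C"
  shows "Dom C f \<in> Obj C" "Cod C f \<in> Obj C"
  using assms Dom_Obj Cod_Obj by auto

text \<open>Because \<open>comp_assoc\<close> nests composites to the right, an equation between two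
  composites no longer occurs as a subterm once both are precomposed with \<open>h\<close>. This
  form carries it there.\<close>

lemma comp_eq_comp:
  assumes "g \<cdot> f = g' \<cdot> f'"
    and "f \<in> Arr C" "g \<in> Arr C" "Cod C f = Dom C g"
    and "f' \<in> Arr C" "g' \<in> Arr C" "Cod C f' = Dom C g'"
    and "h \<in> Arr C" "Cod C h = Dom C f" "Cod C h = Dom C f'"
  shows "g \<cdot> (f \<cdot> h) = g' \<cdot> (f' \<cdot> h)"
  using comp_assoc[of h f g] comp_assoc[of h f' g'] assms by simp

lemma comp_ide [simp]:
  assumes "f \<in> Arr C"
  shows "Dom C f = a \<Longrightarrow> f \<cdot> Ide C a = f" "Cod C f = b \<Longrightarrow> Ide C b \<cdot> f = f"
  using assms Comp_Ide Ide_Comp by auto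

end

text \<open>The shape \<open>2 \<rightarrow> 4 \<leftarrow> 3\<close>: 5 and 6 are the two legs, and
  each object doubles as its own identity, whence \<open>Comp\<close> returns whichever factor is a
  leg, if there is one. Numbers serve as labels since \<open>has_finite_limits\<close> ranges over
  shapes on natural numbers.\<close>

definition cospan :: "(nat, nat) cat" where
  "cospan = \<lparr>Obj = {2, 3, 4}, Arr = {2, 3, 4, 5, 6},
     Dom = (\<lambda>f. if f = 5 then 2 else if f = 6 then 3 else f),
     Cod = (\<lambda>f. if f = 5 \<or> f = 6 then 4 else f), Ide = (\<lambda>a. a),
     Comp = (\<lambda>g f. if g = 5 \<or> g = 6 then g else f)\<rparr>"

lemma Hom_cospan: "f \<in> Hom cospan a b \<longleftrightarrow>
    (f, a, b) \<in> {(2, 2, 2), (3, 3, 3), (4, 4, 4), (5, 2, 4), (6, 3, 4)}"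
  by (auto simp: cospan_def split: if_splits)

lemma all_Hom_cospan: "(\<forall>a b. \<forall>f \<in> Hom cospan a b. P a b f) \<longleftrightarrow>
    P 2 2 2 \<and> P 3 3 3 \<and> P 4 4 4 \<and> P 2 4 5 \<and> P 3 4 6"
  unfolding Ball_def Hom_cospan by blast

lemma category_cospan: "category cospan"
proof
  show "h \<in> Obj cospan \<Longrightarrow> Ide cospan h \<in> Hom cospan h h" for h
    by (auto simp: cospan_def)
  show "Comp cospan g f \<in> Hom cospan a c" if "f \<in> Hom cospan a b" "g \<in> Hom cospan b c" for f g a b c
    using that unfolding Hom_cospan by (elim insertE) (simp_all add: cospan_def)
  show "Comp cospan h (Comp cospan g f) = Comp cospan (Comp cospan h g) f"
    if "f \<in> Hom cospan a b" "g \<in> Hom cospan b c" "h \<in> Hom cospan c d" for f g h a b c d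
    by (simp add: cospan_def)
  show "Comp cospan f (Ide cospan a) = f" if "f \<in> Hom cospan a b" for f a b
    using that unfolding Hom_cospan by (elim insertE) (simp_all add: cospan_def)
  show "Comp cospan (Ide cospan b) f = f" if "f \<in> Hom cospan a b" for f a b
    using that unfolding Hom_cospan by (elim insertE) (simp_all add: cospan_def)
qed (auto simp: cospan_def)

text \<open>\<open>closed\<close> supplies the terminal object, products and exponentials,
  \<open>finite_limits\<close> the pullbacks.\<close>

locale ccc = category E for E :: "('o, 'a) cat" (structure) +
  assumes finite_limits: "has_finite_limits E"
    and closed: "cartesian_closed E"
begin

section \<open>The terminal object and binary products\<close>

lemma terminal_one: "is_terminal E (one E)"
  unfolding one_def using closed by (auto simp: cartesian_closed_def intro: someI_ex)

lemma one_obj [simp]: "one E \<in> Obj E"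
  using terminal_one by (simp add: is_terminal_def)

lemma to_one_eq:
  assumes "f \<in> Arr E" "g \<in> Arr E" "Dom E f = Dom E g" "Cod E f = one E" "Cod E g = one E"
  shows "f = g"
  using terminal_one assms unfolding is_terminal_def
  by (metis Hom_iff dom_cod_obj(1))

lemma bang_simps [simp]:
  assumes "a \<in> Obj E"
  shows "bang E a \<in> Arr E" "Dom E (bang E a) = a" "Cod E (bang E a) = one E"
proof -
  have "bang E a \<in> Hom E a (one E)"
    unfolding bang_def by (rule theI') (use terminal_one assms in \<open>auto simp: is_terminal_def\<close>)
  then show "bang E a \<in> Arr E" "Dom E (bang E a) = a" "Cod E (bang E a) = one E" by auto
qed

lemma bang_unique:
  assumes "f \<in> Arr E" "Cod E f = one E" "Dom E f = a"
  shows "f = bang E a"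
  using assms by (auto intro!: to_one_eq)

lemma bang_comp [simp]:
  assumes "f \<in> Arr E" "Cod E f = a"
  shows "bang E a \<cdot> f = bang E (Dom E f)"
  using assms by (auto intro!: bang_unique)

lemma is_product_proj:
  assumes "a \<in> Obj E" "b \<in> Obj E"
  shows "is_product E a b (p1 E a b) (p2 E a b)"
proof -
  have "\<exists>uv. case uv of (u, v) \<Rightarrow> is_product E a b u v"
    using closed assms by (auto simp: cartesian_closed_def)
  from someI_ex[OF this] show ?thesis
    by (simp add: p1_def p2_def prod_proj_def split: prod.splits)
qed

lemma proj_simps [simp]:
  assumes "a \<in> Obj E" "b \<in> Obj E"
  shows "p1 E a b \<in> Arr E" "Dom E (p1 E a b) = prd E a b" "Cod E (p1 E a b) = a"
    "p2 E a b \<in> Arr E" "Dom E (p2 E a b) = prd E a b" "Cod E (p2 E a b) = b"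
    "prd E a b \<in> Obj E"
  using is_product_proj[OF assms] by (auto simp: is_product_def prd_def)

text \<open>The universal property in the exact shape of the definite description that defines
  \<open>pair\<close>, so that \<open>theI'\<close> applies. \<open>pbpair_ex1\<close> does the same
  for pullbacks.\<close>

lemma pair_ex1:
  assumes "f \<in> Arr E" "g \<in> Arr E" "Dom E f = Dom E g"
  shows "\<exists>!h. h \<in> Hom E (Dom E f) (prd E (Cod E f) (Cod E g)) \<and>
    p1 E (Cod E f) (Cod E g) \<cdot> h = f \<and> p2 E (Cod E f) (Cod E g) \<cdot> h = g"
  using is_product_proj[of "Cod E f" "Cod E g"] assms
  unfolding is_product_def prd_def by auto

lemma pair_simps [simp]:
  assumes "f \<in> Arr E" "g \<in> Arr E" "Dom E f = Dom E g"
  shows "pair E f g \<in> Arr E" "Dom E (pair E f g) = Dom E f"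
    "Cod E (pair E f g) = prd E (Cod E f) (Cod E g)"
    "Cod E f = a \<Longrightarrow> Cod E g = b \<Longrightarrow> p1 E a b \<cdot> pair E f g = f"
    "Cod E f = a \<Longrightarrow> Cod E g = b \<Longrightarrow> p2 E a b \<cdot> pair E f g = g"
  using theI'[OF pair_ex1[OF assms]] by (auto simp: pair_def)

lemma prod_eqI:
  assumes "h \<in> Arr E" "k \<in> Arr E" "Dom E h = Dom E k" "Cod E h = prd E a b" "Cod E k = prd E a b"
    and "a \<in> Obj E" "b \<in> Obj E"
    and "p1 E a b \<cdot> h = p1 E a b \<cdot> k" "p2 E a b \<cdot> h = p2 E a b \<cdot> k"
  shows "h = k"
  using pair_ex1[of "p1 E a b \<cdot> h" "p2 E a b \<cdot> h"] assms by auto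

lemma pair_comp [simp]:
  assumes "f \<in> Arr E" "g \<in> Arr E" "Dom E f = Dom E g" "h \<in> Arr E" "Cod E h = Dom E f"
  shows "pair E f g \<cdot> h = pair E (f \<cdot> h) (g \<cdot> h)"
  by (rule prod_eqI[of _ _ "Cod E f" "Cod E g"])
    (use assms in \<open>simp_all flip: comp_assoc\<close>)

lemma pair_eta [simp]:
  assumes "a \<in> Obj E" "b \<in> Obj E"
  shows "h \<in> Arr E \<Longrightarrow> Cod E h = prd E a b \<Longrightarrow> pair E (p1 E a b \<cdot> h) (p2 E a b \<cdot> h) = h"
    "pair E (p1 E a b) (p2 E a b) = Ide E (prd E a b)"
  by (rule prod_eqI[of _ _ a b]; use assms in simp)+

lemma pair_inject [simp]:
  assumes "f \<in> Arr E" "g \<in> Arr E" "Dom E f = Dom E g"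
    and "f' \<in> Arr E" "g' \<in> Arr E" "Dom E f' = Dom E g'"
    and "Cod E f = Cod E f'" "Cod E g = Cod E g'"
  shows "pair E f g = pair E f' g' \<longleftrightarrow> f = f' \<and> g = g'"
  using pair_simps(4,5)[OF assms(1-3) refl refl] pair_simps(4,5)[OF assms(4-6) refl refl] assms(7,8)
  by metis

text \<open>Every element of a product is a pair. Splitting elements in this way is what reduces
  later equations to the rewriting of tuples.\<close>

lemma prod_elim:
  assumes "x \<in> Arr E" "Dom E x = c" "Cod E x = prd E a b" "a \<in> Obj E" "b \<in> Obj E"
  obtains y z where "x = pair E y z" "y \<in> Arr E" "z \<in> Arr E" "Dom E y = c" "Dom E z = c"
    "Cod E y = a" "Cod E z = b"
  by (rule that[of "p1 E a b \<cdot> x" "p2 E a b \<cdot> x"]) (use assms in auto)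

text \<open>Testing on the two projections already suffices, as their pair is the identity of the
  product.\<close>

lemma prod_map_eqI:
  assumes "f \<in> Arr E" "g \<in> Arr E" "Dom E f = prd E a b" "Dom E g = prd E a b"
    and "a \<in> Obj E" "b \<in> Obj E"
    and "\<And>x y. \<lbrakk>x \<in> Arr E; y \<in> Arr E; Dom E x = Dom E y; Cod E x = a; Cod E y = b\<rbrakk>
      \<Longrightarrow> f \<cdot> pair E x y = g \<cdot> pair E x y"
  shows "f = g"
  using assms(7)[of "p1 E a b" "p2 E a b"] assms(1-6) by simp

lemma prodmap_simps [simp]:
  assumes "f \<in> Arr E" "g \<in> Arr E"
  shows "prodmap E f g \<in> Arr E" "Dom E (prodmap E f g) = prd E (Dom E f) (Dom E g)"
    "Cod E (prodmap E f g) = prd E (Cod E f) (Cod E g)"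
  using assms by (simp_all add: prodmap_def)

lemma prodmap_comp [simp]:
  assumes "f \<in> Arr E" "g \<in> Arr E" "h \<in> Arr E" "Cod E h = prd E (Dom E f) (Dom E g)"
  shows "prodmap E f g \<cdot> h =
    pair E (f \<cdot> (p1 E (Dom E f) (Dom E g) \<cdot> h)) (g \<cdot> (p2 E (Dom E f) (Dom E g) \<cdot> h))"
  using assms by (simp add: prodmap_def)

lemma proj_prodmap [simp]:
  assumes "f \<in> Arr E" "g \<in> Arr E" "Cod E f = a" "Cod E g = b"
  shows "p1 E a b \<cdot> prodmap E f g = f \<cdot> p1 E (Dom E f) (Dom E g)"
    "p2 E a b \<cdot> prodmap E f g = g \<cdot> p2 E (Dom E f) (Dom E g)"
  using assms by (simp_all add: prodmap_def)

lemma prodmap_ide [simp]: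
  "a \<in> Obj E \<Longrightarrow> b \<in> Obj E \<Longrightarrow> prodmap E (Ide E a) (Ide E b) = Ide E (prd E a b)"
  by (simp add: prodmap_def)

text \<open>A limit over \<open>cospan\<close> is a pullback once the component at the vertex,
  determined by the others, is dropped from its cones.\<close>

lemma pullback_exists:
  assumes f: "f \<in> Arr E" and g: "g \<in> Arr E" and fg: "Cod E f = Cod E g"
  shows "\<exists>u v. is_pullback E f g u v"
proof -
  define D :: "(nat, nat, 'o, 'a) func" where
    "D = \<lparr>fobj = (\<lambda>j. if j = 2 then Dom E f else if j = 3 then Dom E g else Cod E g),
      farr = (\<lambda>j. if j = 2 then Ide E (Dom E f) else if j = 3 then Ide E (Dom E g)
        else if j = 4 then Ide E (Cod E g) else if j = 5 then f else g)\<rparr>"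
  have "is_functor cospan E D"
  proof -
    have "\<forall>j k. \<forall>h \<in> Hom cospan j k. farr D h \<in> Hom E (fobj D j) (fobj D k)"
      unfolding all_Hom_cospan using assms by (simp add: D_def)
    moreover have "farr D (Comp cospan h' h) = farr D h' \<cdot> farr D h"
      if "h \<in> Hom cospan i j" "h' \<in> Hom cospan j k" for h h' i j k
      using that assms unfolding Hom_cospan by (elim insertE) (simp_all add: D_def cospan_def)
    ultimately show ?thesis
      unfolding is_functor_def using assms category_cospan category_axioms
      by (simp add: cospan_def D_def del: Hom_iff)
  qed
  moreover have "finite (Obj cospan)" "finite (Arr cospan)"
    by (auto simp: cospan_def)
  ultimately obtain c \<pi> where lim: "is_limit_cone cospan E D c \<pi>"
    using finite_limits unfolding has_finite_limits_def by meson
  \<comment> \<open>The leg 5 forces \<open>\<rho> 4 = f \<cdot> \<rho> 2\<close> and the leg 6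
    forces \<open>\<rho> 4 = g \<cdot> \<rho> 3\<close>, so a cone is a commuting square with its
    diagonal named.\<close>
  have cone_iff: "is_cone cospan E D c \<rho> \<longleftrightarrow> c \<in> Obj E \<and> \<rho> 2 \<in> Hom E c (Dom E f) \<and>
      \<rho> 3 \<in> Hom E c (Dom E g) \<and> f \<cdot> \<rho> 2 = \<rho> 4 \<and> g \<cdot> \<rho> 3 = \<rho> 4" for c \<rho>
  proof -
    have "\<rho> 4 \<in> Hom E c (Cod E g)" if "\<rho> 3 \<in> Hom E c (Dom E g)" "g \<cdot> \<rho> 3 = \<rho> 4"
      using that g by (metis comp_simps Hom_iff)
    then show ?thesis
      unfolding is_cone_def all_Hom_cospan using f g fg by (auto simp: cospan_def D_def)
  qed
  have pi: "\<pi> 2 \<in> Hom E c (Dom E f)" "\<pi> 3 \<in> Hom E c (Dom E g)" "f \<cdot> \<pi> 2 = \<pi> 4" "g \<cdot> \<pi> 3 = \<pi> 4"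
    using lim by (auto simp: is_limit_cone_def cone_iff)
  have "\<exists>!h. h \<in> Hom E c' c \<and> \<pi> 2 \<cdot> h = s \<and> \<pi> 3 \<cdot> h = t"
    if st: "s \<in> Hom E c' (Dom E f)" "t \<in> Hom E c' (Dom E g)" "f \<cdot> s = g \<cdot> t" for c' s t
  proof -
    let ?\<rho> = "\<lambda>j::nat. if j = 2 then s else if j = 3 then t else f \<cdot> s"
    have "is_cone cospan E D c' ?\<rho>" using st f by (auto simp: cone_iff)
    then have "\<exists>!h. h \<in> Hom E c' c \<and> (\<forall>j \<in> Obj cospan. \<pi> j \<cdot> h = ?\<rho> j)"
      using lim by (auto simp: is_limit_cone_def)
    moreover have "h \<in> Hom E c' c \<and> (\<forall>j \<in> Obj cospan. \<pi> j \<cdot> h = ?\<rho> j) \<longleftrightarrow>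
        h \<in> Hom E c' c \<and> \<pi> 2 \<cdot> h = s \<and> \<pi> 3 \<cdot> h = t" for h
    proof -
      have "\<pi> 4 \<cdot> h = f \<cdot> (\<pi> 2 \<cdot> h)" if "h \<in> Hom E c' c"
        using that pi(1) f by (simp flip: pi(3))
      then show ?thesis by (auto simp: cospan_def)
    qed
    ultimately show ?thesis by (simp del: Hom_iff)
  qed
  moreover have "Dom E (\<pi> 2) = c" using pi by simp
  ultimately have "is_pullback E f g (\<pi> 2) (\<pi> 3)"
    unfolding is_pullback_def using pi by (simp del: Hom_iff)
  then show ?thesis by blast
qed

lemma is_pullback_proj:
  assumes "f \<in> Arr E" "g \<in> Arr E" "Cod E f = Cod E g"
  shows "is_pullback E f g (pr1 E f g) (pr2 E f g)"
proof -
  have "\<exists>uv. case uv of (u, v) \<Rightarrow> is_pullback E f g u v"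
    using pullback_exists[OF assms] by auto
  from someI_ex[OF this] show ?thesis
    by (simp add: pr1_def pr2_def pb_proj_def split: prod.splits)
qed

lemma pb_simps [simp]:
  assumes "f \<in> Arr E" "g \<in> Arr E" "Cod E f = Cod E g"
  shows "pr1 E f g \<in> Arr E" "Dom E (pr1 E f g) = pb E f g" "Cod E (pr1 E f g) = Dom E f"
    "pr2 E f g \<in> Arr E" "Dom E (pr2 E f g) = pb E f g" "Cod E (pr2 E f g) = Dom E g"
    "pb E f g \<in> Obj E"
  using is_pullback_proj[OF assms] by (auto simp: is_pullback_def pb_def)

text \<open>The second form is the square precomposed with an element; inside a composite nested to
  the right the first form does not match.\<close>

lemma pb_square:
  assumes "f \<in> Arr E" "g \<in> Arr E" "Cod E f = Cod E g"
  shows "f \<cdot> pr1 E f g = g \<cdot> pr2 E f g"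
    "h \<in> Arr E \<Longrightarrow> Cod E h = pb E f g \<Longrightarrow> f \<cdot> (pr1 E f g \<cdot> h) = g \<cdot> (pr2 E f g \<cdot> h)"
proof -
  show 1: "f \<cdot> pr1 E f g = g \<cdot> pr2 E f g"
    using is_pullback_proj[OF assms] by (auto simp: is_pullback_def)
  show "f \<cdot> (pr1 E f g \<cdot> h) = g \<cdot> (pr2 E f g \<cdot> h)" if "h \<in> Arr E" "Cod E h = pb E f g"
    using 1 that assms by (simp flip: comp_assoc)
qed

lemma pbpair_ex1:
  assumes "f \<in> Arr E" "g \<in> Arr E" "Cod E f = Cod E g"
    and "s \<in> Arr E" "t \<in> Arr E" "Dom E s = Dom E t" "Cod E s = Dom E f" "Cod E t = Dom E g"
    and "f \<cdot> s = g \<cdot> t"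
  shows "\<exists>!h. h \<in> Hom E (Dom E s) (pb E f g) \<and> pr1 E f g \<cdot> h = s \<and> pr2 E f g \<cdot> h = t"
  using is_pullback_proj[of f g] assms unfolding is_pullback_def pb_def by auto

lemma pbpair_simps [simp]:
  assumes "f \<in> Arr E" "g \<in> Arr E" "Cod E f = Cod E g"
    and "s \<in> Arr E" "t \<in> Arr E" "Dom E s = Dom E t" "Cod E s = Dom E f" "Cod E t = Dom E g"
    and "f \<cdot> s = g \<cdot> t"
  shows "pbpair E f g s t \<in> Arr E" "Dom E (pbpair E f g s t) = Dom E s"
    "Cod E (pbpair E f g s t) = pb E f g"
    "pr1 E f g \<cdot> pbpair E f g s t = s" "pr2 E f g \<cdot> pbpair E f g s t = t"
  using theI'[OF pbpair_ex1[OF assms]] by (auto simp: pbpair_def)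

lemma pb_eqI:
  assumes "f \<in> Arr E" "g \<in> Arr E" "Cod E f = Cod E g"
    and "h \<in> Arr E" "k \<in> Arr E" "Dom E h = Dom E k" "Cod E h = pb E f g" "Cod E k = pb E f g"
    and "pr1 E f g \<cdot> h = pr1 E f g \<cdot> k" "pr2 E f g \<cdot> h = pr2 E f g \<cdot> k"
  shows "h = k"
  using pbpair_ex1[of f g "pr1 E f g \<cdot> h" "pr2 E f g \<cdot> h"] assms by (auto simp: pb_square)

lemma pbpair_comp [simp]:
  assumes "f \<in> Arr E" "g \<in> Arr E" "Cod E f = Cod E g"
    and "s \<in> Arr E" "t \<in> Arr E" "Dom E s = Dom E t" "Cod E s = Dom E f" "Cod E t = Dom E g"
    and "f \<cdot> s = g \<cdot> t" "h \<in> Arr E" "Cod E h = Dom E s"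
  shows "pbpair E f g s t \<cdot> h = pbpair E f g (s \<cdot> h) (t \<cdot> h)"
proof -
  have 1: "f \<cdot> (s \<cdot> h) = g \<cdot> (t \<cdot> h)"
    by (rule comp_eq_comp) (use assms in auto)
  have 2: "pr1 E f g \<cdot> (pbpair E f g s t \<cdot> h) = s \<cdot> h" "pr2 E f g \<cdot> (pbpair E f g s t \<cdot> h) = t \<cdot> h"
    using comp_assoc[of h "pbpair E f g s t" "pr1 E f g"]
      comp_assoc[of h "pbpair E f g s t" "pr2 E f g"] assms by simp_all
  show ?thesis
    by (rule pb_eqI[of f g]) (use assms 1 2 in simp_all)
qed

lemma pbpair_eta [simp]:
  assumes "f \<in> Arr E" "g \<in> Arr E" "Cod E f = Cod E g"
  shows "h \<in> Arr E \<Longrightarrow> Cod E h = pb E f g \<Longrightarrow> pbpair E f g (pr1 E f g \<cdot> h) (pr2 E f g \<cdot> h) = h"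
    "pbpair E f g (pr1 E f g) (pr2 E f g) = Ide E (pb E f g)"
  by (rule pb_eqI[of f g]; use assms in \<open>simp add: pb_square\<close>)+

lemma pb_elim:
  assumes "x \<in> Arr E" "Dom E x = c" "Cod E x = pb E f g" "f \<in> Arr E" "g \<in> Arr E" "Cod E f = Cod E g"
  obtains s t where "x = pbpair E f g s t" "s \<in> Arr E" "t \<in> Arr E" "Dom E s = c" "Dom E t = c"
    "Cod E s = Dom E f" "Cod E t = Dom E g" "f \<cdot> s = g \<cdot> t"
  by (rule that[of "pr1 E f g \<cdot> x" "pr2 E f g \<cdot> x"]) (use assms in \<open>auto simp: pb_square\<close>)

end

section \<open>Exponentiable morphisms\<close>

text \<open>\<open>is_Pi E f x y e\<close>: the object \<open>y\<close> of the slice over the codomain of \<open>f\<close>, with counit \<open>e\<close>, is a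
  value at \<open>x\<close> of the right adjoint of \<open>\<Delta>\<^sub>f\<close>.\<close>

definition is_Pi :: "('o, 'a) cat \<Rightarrow> 'a \<Rightarrow> 'a \<Rightarrow> 'a \<Rightarrow> 'a \<Rightarrow> bool" where
  "is_Pi E f x y e \<longleftrightarrow> y \<in> Arr E \<and> Cod E y = Cod E f \<and> e \<in> Arr E \<and> Dom E e = pb E y f \<and>
     Cod E e = Dom E x \<and> Comp E x e = pr2 E y f \<and>
     (\<forall>z k. z \<in> Arr E \<and> Cod E z = Cod E f \<and> k \<in> Arr E \<and> Dom E k = pb E z f \<and> Cod E k = Dom E x \<and>
        Comp E x k = pr2 E z f \<longrightarrow>
        (\<exists>!h. h \<in> Hom E (Dom E z) (Dom E y) \<and> Comp E y h = z \<and>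
           Comp E e (pbpair E y f (Comp E h (pr1 E z f)) (pr2 E z f)) = k))"

context ccc
begin

section \<open>Pointwise right adjoints in terms of elements\<close>

lemma is_Pi_simps:
  assumes "is_Pi E f x y e"
  shows "y \<in> Arr E" "Cod E y = Cod E f" "e \<in> Arr E" "Dom E e = pb E y f" "Cod E e = Dom E x"
  using assms unfolding is_Pi_def by auto

lemma is_Pi_app:
  assumes "is_Pi E f x y e" "f \<in> Arr E" "x \<in> Arr E" "Cod E x = Dom E f"
    and "r \<in> Arr E" "b \<in> Arr E" "Dom E r = Dom E b" "Cod E r = Dom E y" "Cod E b = Dom E f"
    and "y \<cdot> r = f \<cdot> b"
  shows "x \<cdot> (e \<cdot> pbpair E y f r b) = b"
proof -
  note y = is_Pi_simps[OF assms(1)]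
  have "x \<cdot> e = pr2 E y f" using assms(1) by (simp add: is_Pi_def)
  then show ?thesis
    using comp_assoc[of "pbpair E y f r b" e x] y assms(2-) by simp
qed

text \<open>The definition of \<open>is_Pi\<close> describes the transpose only at the generic
  element, the pair of projections; precomposing with \<open>pbpair E z f s b\<close> gives its
  value at every \<open>b\<close>.\<close>

lemma is_Pi_transpose:
  assumes P: "is_Pi E f x y e" and f: "f \<in> Arr E" "x \<in> Arr E" "Cod E x = Dom E f"
    and k: "z \<in> Arr E" "Cod E z = Cod E f" "k \<in> Arr E" "Dom E k = pb E z f" "Cod E k = Dom E x"
      "x \<cdot> k = pr2 E z f"
  obtains h where "h \<in> Arr E" "Dom E h = Dom E z" "Cod E h = Dom E y" "y \<cdot> h = z"
    "\<And>s b. \<lbrakk>s \<in> Arr E; b \<in> Arr E; Dom E s = Dom E b; Cod E s = Dom E z; Cod E b = Dom E f;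
      z \<cdot> s = f \<cdot> b\<rbrakk> \<Longrightarrow> e \<cdot> pbpair E y f (h \<cdot> s) b = k \<cdot> pbpair E z f s b"
proof -
  note y = is_Pi_simps[OF P]
  obtain h where h: "h \<in> Hom E (Dom E z) (Dom E y)" "y \<cdot> h = z"
    "e \<cdot> pbpair E y f (h \<cdot> pr1 E z f) (pr2 E z f) = k"
    using P k unfolding is_Pi_def by metis
  show ?thesis
  proof (rule that)
    fix s b assume s: "s \<in> Arr E" "b \<in> Arr E" "Dom E s = Dom E b" "Cod E s = Dom E z"
      "Cod E b = Dom E f" "z \<cdot> s = f \<cdot> b"
    have sq: "y \<cdot> (h \<cdot> pr1 E z f) = f \<cdot> pr2 E z f"
      using h(1,2) y f k pb_square(1)[of z f] comp_assoc[of "pr1 E z f" h y] by simp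
    have "(e \<cdot> pbpair E y f (h \<cdot> pr1 E z f) (pr2 E z f)) \<cdot> pbpair E z f s b = k \<cdot> pbpair E z f s b"
      using h(3) by simp
    then show "e \<cdot> pbpair E y f (h \<cdot> s) b = k \<cdot> pbpair E z f s b"
      using h(1) y f k s sq by simp
  qed (use h in auto)
qed

text \<open>Sections with equal values are equal: \<open>h\<close> and \<open>h'\<close> both
  transpose the map \<open>k\<close> of their common values, and transposes are unique.\<close>

lemma is_Pi_eqI:
  assumes P: "is_Pi E f x y e" and f: "f \<in> Arr E" "x \<in> Arr E" "Cod E x = Dom E f"
    and h: "h \<in> Arr E" "h' \<in> Arr E" "Dom E h = Dom E h'" "Cod E h = Dom E y" "Cod E h' = Dom E y"
    and yh: "y \<cdot> h = y \<cdot> h'"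
    and eq: "\<And>s b. \<lbrakk>s \<in> Arr E; b \<in> Arr E; Dom E s = Dom E b; Cod E s = Dom E h; Cod E b = Dom E f;
      y \<cdot> (h \<cdot> s) = f \<cdot> b; y \<cdot> (h' \<cdot> s) = f \<cdot> b\<rbrakk> \<Longrightarrow> e \<cdot> pbpair E y f (h \<cdot> s) b = e \<cdot> pbpair E y f (h' \<cdot> s) b"
  shows "h = h'"
proof -
  note y = is_Pi_simps[OF P]
  define z where "z = y \<cdot> h"
  have z: "z \<in> Arr E" "Dom E z = Dom E h" "Cod E z = Cod E f"
    using y h by (auto simp: z_def)
  have sq: "y \<cdot> (h \<cdot> pr1 E z f) = f \<cdot> pr2 E z f" "y \<cdot> (h' \<cdot> pr1 E z f) = f \<cdot> pr2 E z f"
    using y h f z yh pb_square(1)[of z f] comp_assoc[of "pr1 E z f" h y] comp_assoc[of "pr1 E z f" h' y]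
    by (simp_all add: z_def)
  define k where "k = e \<cdot> pbpair E y f (h \<cdot> pr1 E z f) (pr2 E z f)"
  have k: "k \<in> Arr E" "Dom E k = pb E z f" "Cod E k = Dom E x" "x \<cdot> k = pr2 E z f"
    using y h f z sq is_Pi_app[OF P f] by (simp_all add: k_def)
  have "k = e \<cdot> pbpair E y f (h' \<cdot> pr1 E z f) (pr2 E z f)"
    unfolding k_def by (rule eq) (use y h f z sq in simp_all)
  moreover have "\<exists>!h. h \<in> Hom E (Dom E z) (Dom E y) \<and> y \<cdot> h = z \<and>
      e \<cdot> pbpair E y f (h \<cdot> pr1 E z f) (pr2 E z f) = k"
    using P k z(1,3) unfolding is_Pi_def by blast
  moreover have "h \<in> Hom E (Dom E z) (Dom E y)" "h' \<in> Hom E (Dom E z) (Dom E y)" "y \<cdot> h' = z"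
    using h z yh by (auto simp: z_def)
  ultimately show ?thesis
    using k_def z_def by metis
qed

text \<open>The passage back from elements to \<open>is_Pi\<close>. Existence of transposes and
  extensionality are asked for on all elements; in return \<open>ex\<close> may assume that the
  values of \<open>k\<close> lie over \<open>b\<close>, which is
  \<open>x \<cdot> k = pr2 E z f\<close> read on elements.\<close>

lemma is_PiI:
  assumes f: "f \<in> Arr E" "x \<in> Arr E" "Cod E x = Dom E f"
    and y: "y \<in> Arr E" "Cod E y = Cod E f" and e: "e \<in> Arr E" "Dom E e = pb E y f" "Cod E e = Dom E x"
    and app: "x \<cdot> e = pr2 E y f"
    and ex: "\<And>z k. \<lbrakk>z \<in> Arr E; Cod E z = Cod E f; k \<in> Arr E; Dom E k = pb E z f; Cod E k = Dom E x;
      \<And>s b. \<lbrakk>s \<in> Arr E; b \<in> Arr E; Dom E s = Dom E b; Cod E s = Dom E z; Cod E b = Dom E f;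
        z \<cdot> s = f \<cdot> b\<rbrakk> \<Longrightarrow> x \<cdot> (k \<cdot> pbpair E z f s b) = b\<rbrakk>
      \<Longrightarrow> \<exists>h. h \<in> Hom E (Dom E z) (Dom E y) \<and> y \<cdot> h = z \<and>
        (\<forall>s b. s \<in> Arr E \<longrightarrow> b \<in> Arr E \<longrightarrow> Dom E s = Dom E b \<longrightarrow> Cod E s = Dom E z \<longrightarrow>
          Cod E b = Dom E f \<longrightarrow> z \<cdot> s = f \<cdot> b \<longrightarrow> y \<cdot> (h \<cdot> s) = f \<cdot> b \<longrightarrow>
          e \<cdot> pbpair E y f (h \<cdot> s) b = k \<cdot> pbpair E z f s b)"
    and un: "\<And>h h'. \<lbrakk>h \<in> Arr E; h' \<in> Arr E; Dom E h = Dom E h'; Cod E h = Dom E y; Cod E h' = Dom E y;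
      y \<cdot> h = y \<cdot> h';
      \<And>s b. \<lbrakk>s \<in> Arr E; b \<in> Arr E; Dom E s = Dom E b; Cod E s = Dom E h'; Cod E b = Dom E f;
        y \<cdot> (h \<cdot> s) = f \<cdot> b; y \<cdot> (h' \<cdot> s) = f \<cdot> b\<rbrakk>
        \<Longrightarrow> e \<cdot> pbpair E y f (h \<cdot> s) b = e \<cdot> pbpair E y f (h' \<cdot> s) b\<rbrakk> \<Longrightarrow> h = h'"
  shows "is_Pi E f x y e"
  unfolding is_Pi_def
proof (intro conjI allI impI; (elim conjE)?)
  fix z k assume k: "z \<in> Arr E" "Cod E z = Cod E f" "k \<in> Arr E" "Dom E k = pb E z f"
    "Cod E k = Dom E x" "x \<cdot> k = pr2 E z f"
  let ?Q = "\<lambda>h. h \<in> Hom E (Dom E z) (Dom E y) \<and> y \<cdot> h = z \<and>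
    e \<cdot> pbpair E y f (h \<cdot> pr1 E z f) (pr2 E z f) = k"
  have sq: "y \<cdot> (h \<cdot> pr1 E z f) = f \<cdot> pr2 E z f" if "h \<in> Hom E (Dom E z) (Dom E y)" "y \<cdot> h = z" for h
    using that y f k pb_square(1)[of z f] comp_assoc[of "pr1 E z f" h y] by simp
  have "x \<cdot> (k \<cdot> pbpair E z f s b) = b"
    if "s \<in> Arr E" "b \<in> Arr E" "Dom E s = Dom E b" "Cod E s = Dom E z" "Cod E b = Dom E f"
      "z \<cdot> s = f \<cdot> b" for s b
    using comp_assoc[of "pbpair E z f s b" k x] k f that by simp
  from ex[OF k(1-5) this] obtain h where h: "h \<in> Hom E (Dom E z) (Dom E y)" "y \<cdot> h = z"
    and hk: "\<And>s b. \<lbrakk>s \<in> Arr E; b \<in> Arr E; Dom E s = Dom E b; Cod E s = Dom E z; Cod E b = Dom E f;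
      z \<cdot> s = f \<cdot> b; y \<cdot> (h \<cdot> s) = f \<cdot> b\<rbrakk> \<Longrightarrow> e \<cdot> pbpair E y f (h \<cdot> s) b = k \<cdot> pbpair E z f s b"
    by blast
  \<comment> \<open>The equation for all elements is used at the generic one.\<close>
  have "?Q h"
    using hk[of "pr1 E z f" "pr2 E z f"] h k f sq[OF h] pb_square(1)[of z f] by simp
  moreover have "h' = h''" if h': "?Q h'" "?Q h''" for h' h''
  proof (rule un)
    fix s b assume s: "s \<in> Arr E" "b \<in> Arr E" "Dom E s = Dom E b" "Cod E s = Dom E h''"
      "Cod E b = Dom E f" "y \<cdot> (h' \<cdot> s) = f \<cdot> b" "y \<cdot> (h'' \<cdot> s) = f \<cdot> b"
    have "z \<cdot> s = f \<cdot> b"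
      using comp_assoc[of s h' y] s h' y by auto
    moreover have "(e \<cdot> pbpair E y f (h' \<cdot> pr1 E z f) (pr2 E z f)) \<cdot> pbpair E z f s b =
        (e \<cdot> pbpair E y f (h'' \<cdot> pr1 E z f) (pr2 E z f)) \<cdot> pbpair E z f s b"
      using h' by simp
    moreover have "h' \<in> Arr E" "Dom E h' = Dom E z" "Cod E h' = Dom E y"
      "h'' \<in> Arr E" "Dom E h'' = Dom E z" "Cod E h'' = Dom E y"
      "y \<cdot> (h' \<cdot> pr1 E z f) = f \<cdot> pr2 E z f" "y \<cdot> (h'' \<cdot> pr1 E z f) = f \<cdot> pr2 E z f"
      using sq[of h'] sq[of h''] h' by auto
    ultimately show "e \<cdot> pbpair E y f (h' \<cdot> s) b = e \<cdot> pbpair E y f (h'' \<cdot> s) b"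
      using e y f k s by simp
  qed (use h' in auto)
  ultimately show "\<exists>!h. ?Q h" by blast
qed (use f y e app in auto)

text \<open>Pulling back along \<open>f \<cdot> g\<close> is pulling back along \<open>f\<close> and
  then along \<open>g\<close>, so the right adjoints compose as well: the value at \<open>x\<close>
  is the value along \<open>f\<close> of the value \<open>y1\<close> along \<open>g\<close>.\<close>

lemma is_Pi_comp:
  assumes g: "g \<in> Arr E" and f: "f \<in> Arr E" "Cod E g = Dom E f" and x: "x \<in> Arr E" "Cod E x = Dom E g"
    and P1: "is_Pi E g x y1 e1" and P2: "is_Pi E f y1 y2 e2"
  shows "\<exists>e. is_Pi E (f \<cdot> g) x y2 e"
proof -
  note y1 = is_Pi_simps[OF P1] and y2 = is_Pi_simps[OF P2]
  have app1: "x \<cdot> (e1 \<cdot> pbpair E y1 g r b) = b"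
    if "r \<in> Arr E" "b \<in> Arr E" "Dom E r = Dom E b" "Cod E r = Dom E y1" "Cod E b = Dom E g"
      "y1 \<cdot> r = g \<cdot> b" for r b
    using is_Pi_app[OF P1] that g x by simp
  have app2: "y1 \<cdot> (e2 \<cdot> pbpair E y2 f r b) = b"
    if "r \<in> Arr E" "b \<in> Arr E" "Dom E r = Dom E b" "Cod E r = Dom E y2" "Cod E b = Dom E f"
      "y2 \<cdot> r = f \<cdot> b" for r b
    using is_Pi_app[OF P2] that f g y1 by simp
  \<comment> \<open>Evaluation in two stages: at \<open>g \<cdot> b\<close> the element
    \<open>r\<close> yields a section of \<open>x\<close> over a fibre of \<open>g\<close>, which is
    then evaluated at \<open>b\<close>.\<close>
  define app where "app r b = e1 \<cdot> pbpair E y1 g (e2 \<cdot> pbpair E y2 f r (g \<cdot> b)) b" for r b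
  have sq: "y2 \<cdot> pr1 E y2 (f \<cdot> g) = f \<cdot> (g \<cdot> pr2 E y2 (f \<cdot> g))"
    using pb_square(1)[of y2 "f \<cdot> g"] y2 f g by simp
  define e where "e = app (pr1 E y2 (f \<cdot> g)) (pr2 E y2 (f \<cdot> g))"
  have e: "e \<in> Arr E" "Dom E e = pb E y2 (f \<cdot> g)" "Cod E e = Dom E x" "x \<cdot> e = pr2 E y2 (f \<cdot> g)"
    using g f x y1 y2 sq by (simp_all add: e_def app_def app1 app2)
  have e_app: "e \<cdot> pbpair E y2 (f \<cdot> g) r b = app r b"
    if "r \<in> Arr E" "b \<in> Arr E" "Dom E r = Dom E b" "Cod E r = Dom E y2" "Cod E b = Dom E g"
      "y2 \<cdot> r = f \<cdot> (g \<cdot> b)" for r b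
    using g f x y1 y2 sq that by (simp add: e_def app_def app1 app2)
  have "is_Pi E (f \<cdot> g) x y2 e"
  proof (rule is_PiI)
    fix z k assume z: "z \<in> Arr E" "Cod E z = Cod E (f \<cdot> g)" and k: "k \<in> Arr E"
      "Dom E k = pb E z (f \<cdot> g)" "Cod E k = Dom E x"
      and xk: "\<And>s b. \<lbrakk>s \<in> Arr E; b \<in> Arr E; Dom E s = Dom E b; Cod E s = Dom E z;
        Cod E b = Dom E (f \<cdot> g); z \<cdot> s = (f \<cdot> g) \<cdot> b\<rbrakk> \<Longrightarrow> x \<cdot> (k \<cdot> pbpair E z (f \<cdot> g) s b) = b"
    have zf: "Cod E z = Cod E f" using z f g by simp
    let ?p = "pr2 E z f"
    \<comment> \<open>\<open>?s\<close> and \<open>?b\<close> present the iterated pullback of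
      \<open>z\<close> along \<open>f\<close> and then \<open>g\<close> as a pullback along
      \<open>f \<cdot> g\<close>, which lets \<open>k\<close> be transposed first along
      \<open>g\<close> and then along \<open>f\<close>.\<close>
    let ?s = "pr1 E z f \<cdot> pr1 E ?p g" and ?b = "pr2 E ?p g"
    have sq1: "z \<cdot> ?s = f \<cdot> (g \<cdot> ?b)"
      using z zf f g pb_square(2)[of z f "pr1 E ?p g"] pb_square(1)[of "pr2 E z f" g] by simp
    define k1 where "k1 = k \<cdot> pbpair E z (f \<cdot> g) ?s ?b"
    have k1: "k1 \<in> Arr E" "Dom E k1 = pb E ?p g" "Cod E k1 = Dom E x" "x \<cdot> k1 = ?b"
      using xk[of ?s ?b] sq1 z zf f g k x by (simp_all add: k1_def)
    obtain h1 where h1: "h1 \<in> Arr E" "Dom E h1 = Dom E ?p" "Cod E h1 = Dom E y1" "y1 \<cdot> h1 = ?p"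
      and h1k: "\<And>s b. \<lbrakk>s \<in> Arr E; b \<in> Arr E; Dom E s = Dom E b; Cod E s = Dom E ?p; Cod E b = Dom E g;
        ?p \<cdot> s = g \<cdot> b\<rbrakk> \<Longrightarrow> e1 \<cdot> pbpair E y1 g (h1 \<cdot> s) b = k1 \<cdot> pbpair E ?p g s b"
      by (rule is_Pi_transpose[OF P1 g x, of ?p k1]) (use z zf f g k1 in simp_all)
    obtain h where h: "h \<in> Arr E" "Dom E h = Dom E z" "Cod E h = Dom E y2" "y2 \<cdot> h = z"
      and hk: "\<And>s b. \<lbrakk>s \<in> Arr E; b \<in> Arr E; Dom E s = Dom E b; Cod E s = Dom E z; Cod E b = Dom E f;
        z \<cdot> s = f \<cdot> b\<rbrakk> \<Longrightarrow> e2 \<cdot> pbpair E y2 f (h \<cdot> s) b = h1 \<cdot> pbpair E z f s b"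
      by (rule is_Pi_transpose[OF P2 f(1), of z h1]) (use z zf f g h1 y1 in simp_all)
    have "e \<cdot> pbpair E y2 (f \<cdot> g) (h \<cdot> s) b = k \<cdot> pbpair E z (f \<cdot> g) s b"
      if s: "s \<in> Arr E" "b \<in> Arr E" "Dom E s = Dom E b" "Cod E s = Dom E z" "Cod E b = Dom E (f \<cdot> g)"
        "z \<cdot> s = (f \<cdot> g) \<cdot> b" "y2 \<cdot> (h \<cdot> s) = (f \<cdot> g) \<cdot> b" for s b
    proof -
      have zs: "z \<cdot> s = f \<cdot> (g \<cdot> b)" "y2 \<cdot> (h \<cdot> s) = f \<cdot> (g \<cdot> b)" "Cod E b = Dom E g" using s f g by simp_all
      have "e \<cdot> pbpair E y2 (f \<cdot> g) (h \<cdot> s) b = app (h \<cdot> s) b"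
        by (rule e_app) (use s zs h z zf f g in simp_all)
      also have "\<dots> = e1 \<cdot> pbpair E y1 g (h1 \<cdot> pbpair E z f s (g \<cdot> b)) b"
        unfolding app_def using hk[of s "g \<cdot> b"] s zs f g by simp
      also have "\<dots> = k1 \<cdot> pbpair E ?p g (pbpair E z f s (g \<cdot> b)) b"
        by (rule h1k) (use s zs z zf f g in simp_all)
      also have "\<dots> = k \<cdot> pbpair E z (f \<cdot> g) s b"
        unfolding k1_def using sq1 s zs z zf f g k by simp
      finally show ?thesis .
    qed
    then show "\<exists>h. h \<in> Hom E (Dom E z) (Dom E y2) \<and> y2 \<cdot> h = z \<and>
        (\<forall>s b. s \<in> Arr E \<longrightarrow> b \<in> Arr E \<longrightarrow> Dom E s = Dom E b \<longrightarrow> Cod E s = Dom E z \<longrightarrow>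
          Cod E b = Dom E (f \<cdot> g) \<longrightarrow> z \<cdot> s = (f \<cdot> g) \<cdot> b \<longrightarrow> y2 \<cdot> (h \<cdot> s) = (f \<cdot> g) \<cdot> b \<longrightarrow>
          e \<cdot> pbpair E y2 (f \<cdot> g) (h \<cdot> s) b = k \<cdot> pbpair E z (f \<cdot> g) s b)"
      using h by (intro exI[of _ h]) (simp del: comp_assoc)
  next
    fix h h' assume h: "h \<in> Arr E" "h' \<in> Arr E" "Dom E h = Dom E h'" "Cod E h = Dom E y2"
      "Cod E h' = Dom E y2" "y2 \<cdot> h = y2 \<cdot> h'"
      and eq: "\<And>s b. \<lbrakk>s \<in> Arr E; b \<in> Arr E; Dom E s = Dom E b; Cod E s = Dom E h';
        Cod E b = Dom E (f \<cdot> g); y2 \<cdot> (h \<cdot> s) = (f \<cdot> g) \<cdot> b; y2 \<cdot> (h' \<cdot> s) = (f \<cdot> g) \<cdot> b\<rbrakk>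
        \<Longrightarrow> e \<cdot> pbpair E y2 (f \<cdot> g) (h \<cdot> s) b = e \<cdot> pbpair E y2 (f \<cdot> g) (h' \<cdot> s) b"
    show "h = h'"
    \<comment> \<open>Extensionality along \<open>f\<close> leaves two sections over a fibre of
      \<open>g\<close>, to which extensionality along \<open>g\<close> is applied.\<close>
    proof (rule is_Pi_eqI[OF P2 f(1) _ _ h])
      fix s b assume s: "s \<in> Arr E" "b \<in> Arr E" "Dom E s = Dom E b" "Cod E s = Dom E h"
        "Cod E b = Dom E f" "y2 \<cdot> (h \<cdot> s) = f \<cdot> b" "y2 \<cdot> (h' \<cdot> s) = f \<cdot> b"
      show "e2 \<cdot> pbpair E y2 f (h \<cdot> s) b = e2 \<cdot> pbpair E y2 f (h' \<cdot> s) b"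
      proof (rule is_Pi_eqI[OF P1 g x])
        fix t c assume t: "t \<in> Arr E" "c \<in> Arr E" "Dom E t = Dom E c"
          "Cod E t = Dom E (e2 \<cdot> pbpair E y2 f (h \<cdot> s) b)" "Cod E c = Dom E g"
          "y1 \<cdot> ((e2 \<cdot> pbpair E y2 f (h \<cdot> s) b) \<cdot> t) = g \<cdot> c"
        have t': "Cod E t = Dom E s" using t(4) s h f y2 by simp
        have bt: "b \<cdot> t = g \<cdot> c"
          using t(6) t' t s h f g y1 y2 comp_eq_comp[OF s(6), of t] by (simp add: app2)
        have sq: "y2 \<cdot> (h \<cdot> (s \<cdot> t)) = f \<cdot> (g \<cdot> c)" "y2 \<cdot> (h' \<cdot> (s \<cdot> t)) = f \<cdot> (g \<cdot> c)"
          using comp_eq_comp[OF s(6), of t] comp_eq_comp[OF s(7), of t] s t t' h f g y2 bt by simp_all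
        have "app (h \<cdot> (s \<cdot> t)) c = app (h' \<cdot> (s \<cdot> t)) c"
          using eq[of "s \<cdot> t" c] e_app[of "h \<cdot> (s \<cdot> t)" c] e_app[of "h' \<cdot> (s \<cdot> t)" c] sq s t t' h f g
          by simp
        then show "e1 \<cdot> pbpair E y1 g ((e2 \<cdot> pbpair E y2 f (h \<cdot> s) b) \<cdot> t) c =
            e1 \<cdot> pbpair E y1 g ((e2 \<cdot> pbpair E y2 f (h' \<cdot> s) b) \<cdot> t) c"
          using s t t' h f g y2 bt by (simp add: app_def)
      qed (use s h f g y1 y2 in \<open>simp_all add: app2\<close>)
    qed (use h f g y1 in simp_all)
  qed (use g f x y1 y2 e in simp_all)
  then show ?thesis by blast
qed

text \<open>For the pullback \<open>f'\<close> of \<open>f\<close> along \<open>a\<close>, with \<open>b\<close> the other projection, \<open>\<Pi>\<^bsub>f'\<^esub> x\<close> is the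
  pullback of \<open>\<Pi>\<^sub>f (b \<circ> x) \<rightarrow> \<Pi>\<^sub>f b\<close> along the map to \<open>\<Pi>\<^sub>f b\<close> that transposes \<open>b\<close>.\<close>

lemma is_Pi_pullback:
  assumes pb: "is_pullback E a f f' b" and fa: "f \<in> Arr E" "a \<in> Arr E" "Cod E a = Cod E f"
    and x: "x \<in> Arr E" "Cod E x = Dom E f'"
    and P1: "is_Pi E f (b \<cdot> x) y1 e1" and P2: "is_Pi E f b y2 e2"
  shows "\<exists>y e. is_Pi E f' x y e"
proof -
  note y1 = is_Pi_simps[OF P1] and y2 = is_Pi_simps[OF P2]
  have f': "f' \<in> Arr E" "Cod E f' = Dom E a" and b: "b \<in> Arr E" "Dom E b = Dom E f'" "Cod E b = Dom E f"
    and af': "a \<cdot> f' = f \<cdot> b"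
    using pb by (auto simp: is_pullback_def)
  have af'': "a \<cdot> (f' \<cdot> h) = f \<cdot> (b \<cdot> h)" if "h \<in> Arr E" "Cod E h = Dom E f'" for h
    by (rule comp_eq_comp) (use af' f' b fa that in simp_all)
  \<comment> \<open>The given square is an arbitrary pullback and not the chosen one, so its
    mediating map is named by a description of its own.\<close>
  define can where "can s t = (THE h. h \<in> Hom E (Dom E s) (Dom E f') \<and> f' \<cdot> h = s \<and> b \<cdot> h = t)" for s t
  have can: "can s t \<in> Arr E" "Dom E (can s t) = Dom E s" "Cod E (can s t) = Dom E f'"
      "f' \<cdot> can s t = s" "b \<cdot> can s t = t"
    and can_unique: "\<And>h. h \<in> Arr E \<Longrightarrow> Dom E h = Dom E s \<Longrightarrow> Cod E h = Dom E f' \<Longrightarrow> f' \<cdot> h = s \<Longrightarrow>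
      b \<cdot> h = t \<Longrightarrow> can s t = h"
    if "s \<in> Arr E" "t \<in> Arr E" "Dom E s = Dom E t" "Cod E s = Dom E a" "Cod E t = Dom E f"
      "a \<cdot> s = f \<cdot> t" for s t
  proof -
    have ex1: "\<exists>!h. h \<in> Hom E (Dom E s) (Dom E f') \<and> f' \<cdot> h = s \<and> b \<cdot> h = t"
      using pb that unfolding is_pullback_def by simp
    note th = theI'[OF ex1, folded can_def]
    show "can s t \<in> Arr E" "Dom E (can s t) = Dom E s" "Cod E (can s t) = Dom E f'"
      "f' \<cdot> can s t = s" "b \<cdot> can s t = t"
      using th by auto
    show "can s t = h" if "h \<in> Arr E" "Dom E h = Dom E s" "Cod E h = Dom E f'" "f' \<cdot> h = s" "b \<cdot> h = t" for h
      using ex1 th that by auto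
  qed
  have can_f'b: "can (f' \<cdot> h) (b \<cdot> h) = h" if "h \<in> Arr E" "Cod E h = Dom E f'" for h
    by (rule can_unique) (use that f' b fa af'' in simp_all)
  have can_comp: "can s t \<cdot> h = can (s \<cdot> h) (t \<cdot> h)"
    if s: "s \<in> Arr E" "t \<in> Arr E" "Dom E s = Dom E t" "Cod E s = Dom E a" "Cod E t = Dom E f"
      "a \<cdot> s = f \<cdot> t" and h: "h \<in> Arr E" "Cod E h = Dom E t" for s t h
    using can_f'b[of "can s t \<cdot> h"] can[OF s] h f' b s
      comp_assoc[of h "can s t" f'] comp_assoc[of h "can s t" b] by simp

  have sqa: "a \<cdot> pr1 E a f = f \<cdot> pr2 E a f" using pb_square(1)[of a f] fa by simp
  \<comment> \<open>\<open>n\<close> sends \<open>s\<close> to the section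
    \<open>c \<mapsto> can s c\<close> of \<open>b\<close>, the tautological lift of the fibre of
    \<open>f\<close> over \<open>a \<cdot> s\<close> to the fibre of \<open>f'\<close> over
    \<open>s\<close>.\<close>
  obtain n where n: "n \<in> Arr E" "Dom E n = Dom E a" "Cod E n = Dom E y2" "y2 \<cdot> n = a"
    and n_app: "\<And>s c. \<lbrakk>s \<in> Arr E; c \<in> Arr E; Dom E s = Dom E c; Cod E s = Dom E a; Cod E c = Dom E f;
      a \<cdot> s = f \<cdot> c\<rbrakk> \<Longrightarrow> e2 \<cdot> pbpair E y2 f (n \<cdot> s) c = can (pr1 E a f) (pr2 E a f) \<cdot> pbpair E a f s c"
    by (rule is_Pi_transpose[OF P2 fa(1) b(1,3), of a "can (pr1 E a f) (pr2 E a f)"])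
      (use can[of "pr1 E a f" "pr2 E a f"] fa b sqa in simp_all)
  have n_can: "e2 \<cdot> pbpair E y2 f (n \<cdot> s) c = can s c"
    if "s \<in> Arr E" "c \<in> Arr E" "Dom E s = Dom E c" "Cod E s = Dom E a" "Cod E c = Dom E f"
      "a \<cdot> s = f \<cdot> c" for s c
    using n_app[OF that] that fa sqa by (simp add: can_comp)

  \<comment> \<open>\<open>u\<close> is the action of \<open>\<Pi>\<^sub>f\<close> on
    \<open>x\<close>: it composes a section of \<open>b \<cdot> x\<close> with \<open>x\<close>,
    leaving a section of \<open>b\<close>.\<close>
  obtain u where u: "u \<in> Arr E" "Dom E u = Dom E y1" "Cod E u = Dom E y2" "y2 \<cdot> u = y1"
    and u_app: "\<And>s c. \<lbrakk>s \<in> Arr E; c \<in> Arr E; Dom E s = Dom E c; Cod E s = Dom E y1; Cod E c = Dom E f;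
      y1 \<cdot> s = f \<cdot> c\<rbrakk> \<Longrightarrow> e2 \<cdot> pbpair E y2 f (u \<cdot> s) c = (x \<cdot> e1) \<cdot> pbpair E y1 f s c"
  proof (rule is_Pi_transpose[OF P2 fa(1) b(1,3), of y1 "x \<cdot> e1"])
    show "b \<cdot> (x \<cdot> e1) = pr2 E y1 f"
      using P1 x b y1 by (simp add: is_Pi_def)
  qed (use fa b x y1 in simp_all)
  have u_app': "e2 \<cdot> pbpair E y2 f (u \<cdot> s) c = x \<cdot> (e1 \<cdot> pbpair E y1 f s c)"
    if "s \<in> Arr E" "c \<in> Arr E" "Dom E s = Dom E c" "Cod E s = Dom E y1" "Cod E c = Dom E f"
      "y1 \<cdot> s = f \<cdot> c" for s c
    using u_app[OF that] that fa x b y1 by simp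

  \<comment> \<open>An element of this pullback is some \<open>s\<close> with a section of
    \<open>b \<cdot> x\<close> over the fibre of \<open>f\<close> at \<open>a \<cdot> s\<close>
    whose composite with \<open>x\<close> is the tautological lift. This is the same as a section of
    \<open>x\<close> over the fibre of \<open>f'\<close> at \<open>s\<close>.\<close>
  define y where "y = pr1 E n u"
  have nu: "Cod E n = Cod E u" using n u by simp
  have y: "y \<in> Arr E" "Dom E y = pb E n u" "Cod E y = Dom E a"
    using n u by (simp_all add: y_def)
  have y2n: "y2 \<cdot> (n \<cdot> h) = a \<cdot> h" if "h \<in> Arr E" "Cod E h = Dom E a" for h
    using comp_assoc[of h n y2] n y2 that by simp
  have y2u: "y2 \<cdot> (u \<cdot> h) = y1 \<cdot> h" if "h \<in> Arr E" "Cod E h = Dom E y1" for h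
    using comp_assoc[of h u y2] u y2 that by simp
  have ya: "y1 \<cdot> (pr2 E n u \<cdot> h) = a \<cdot> (y \<cdot> h)" if "h \<in> Arr E" "Cod E h = pb E n u" for h
    using y2u[of "pr2 E n u \<cdot> h"] y2n[of "pr1 E n u \<cdot> h"] pb_square(2)[of n u h] nu n u that
    by (simp add: y_def)
  define app where "app r c = e1 \<cdot> pbpair E y1 f (pr2 E n u \<cdot> r) (b \<cdot> c)" for r c
  have sq: "y \<cdot> pr1 E y f' = f' \<cdot> pr2 E y f'"
    using pb_square(1)[of y f'] y f' by simp
  have yaf: "y1 \<cdot> (pr2 E n u \<cdot> r) = f \<cdot> (b \<cdot> c)"
    if "r \<in> Arr E" "c \<in> Arr E" "Dom E r = Dom E c" "Cod E r = pb E n u" "Cod E c = Dom E f'"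
      "y \<cdot> r = f' \<cdot> c" for r c
    using ya[of r] that af'' by simp
  have app: "app r c \<in> Arr E" "Dom E (app r c) = Dom E c" "Cod E (app r c) = Dom E x" "x \<cdot> app r c = c"
    if "r \<in> Arr E" "c \<in> Arr E" "Dom E r = Dom E c" "Cod E r = pb E n u" "Cod E c = Dom E f'"
      "y \<cdot> r = f' \<cdot> c" for r c
  proof -
    note [simp] = yaf[OF that]
    show "app r c \<in> Arr E" "Dom E (app r c) = Dom E c" "Cod E (app r c) = Dom E x"
      using that n u y1 x fa b by (simp_all add: app_def)
    have "x \<cdot> app r c = e2 \<cdot> pbpair E y2 f (u \<cdot> (pr2 E n u \<cdot> r)) (b \<cdot> c)"
      unfolding app_def by (rule u_app'[symmetric]) (use that n u y1 x fa b in simp_all)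
    also have "u \<cdot> (pr2 E n u \<cdot> r) = n \<cdot> (f' \<cdot> c)"
      using pb_square(2)[of n u r] nu n u that by (simp add: y_def)
    also have "e2 \<cdot> pbpair E y2 f (n \<cdot> (f' \<cdot> c)) (b \<cdot> c) = can (f' \<cdot> c) (b \<cdot> c)"
      by (rule n_can) (use that f' b af'' in simp_all)
    also have "\<dots> = c" using can_f'b that by simp
    finally show "x \<cdot> app r c = c" .
  qed
  define e where "e = app (pr1 E y f') (pr2 E y f')"
  have e: "e \<in> Arr E" "Dom E e = pb E y f'" "Cod E e = Dom E x" "x \<cdot> e = pr2 E y f'"
    unfolding e_def using app[of "pr1 E y f'" "pr2 E y f'"] y f' sq by simp_all
  have e_app: "e \<cdot> pbpair E y f' r c = app r c"
    if "r \<in> Arr E" "c \<in> Arr E" "Dom E r = Dom E c" "Cod E r = pb E n u" "Cod E c = Dom E f'"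
      "y \<cdot> r = f' \<cdot> c" for r c
    using yaf[of "pr1 E y f'" "pr2 E y f'"] that y f' b sq n u nu y1 fa
    by (simp add: e_def app_def)
  have "is_Pi E f' x y e"
  proof (rule is_PiI)
    fix z k assume z: "z \<in> Arr E" "Cod E z = Cod E f'" and k: "k \<in> Arr E"
      "Dom E k = pb E z f'" "Cod E k = Dom E x"
      and xk: "\<And>s c. \<lbrakk>s \<in> Arr E; c \<in> Arr E; Dom E s = Dom E c; Cod E s = Dom E z;
        Cod E c = Dom E f'; z \<cdot> s = f' \<cdot> c\<rbrakk> \<Longrightarrow> x \<cdot> (k \<cdot> pbpair E z f' s c) = c"
    have za: "Cod E z = Dom E a" using z f' by simp
    \<comment> \<open>Transposing along \<open>f\<close> supplies elements of the domain of
      \<open>f\<close>; \<open>can\<close> lifts them to the domain of \<open>f'\<close>, where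
      \<open>k\<close> can be applied.\<close>
    define k1 where "k1 = k \<cdot> pbpair E z f' (pr1 E (a \<cdot> z) f) (can (z \<cdot> pr1 E (a \<cdot> z) f) (pr2 E (a \<cdot> z) f))"
    have sqz: "a \<cdot> (z \<cdot> pr1 E (a \<cdot> z) f) = f \<cdot> pr2 E (a \<cdot> z) f"
      using pb_square(1)[of "a \<cdot> z" f] fa z za by simp
    note canz = can[of "z \<cdot> pr1 E (a \<cdot> z) f" "pr2 E (a \<cdot> z) f"]
    have k1: "k1 \<in> Arr E" "Dom E k1 = pb E (a \<cdot> z) f" "Cod E k1 = Dom E x" "b \<cdot> (x \<cdot> k1) = pr2 E (a \<cdot> z) f"
      unfolding k1_def
      using canz xk[of "pr1 E (a \<cdot> z) f" "can (z \<cdot> pr1 E (a \<cdot> z) f) (pr2 E (a \<cdot> z) f)"]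
        sqz fa z za f' k x by simp_all
    obtain h1 where h1: "h1 \<in> Arr E" "Dom E h1 = Dom E z" "Cod E h1 = Dom E y1" "y1 \<cdot> h1 = a \<cdot> z"
      and h1k: "\<And>s c. \<lbrakk>s \<in> Arr E; c \<in> Arr E; Dom E s = Dom E c; Cod E s = Dom E z; Cod E c = Dom E f;
        (a \<cdot> z) \<cdot> s = f \<cdot> c\<rbrakk> \<Longrightarrow> e1 \<cdot> pbpair E y1 f (h1 \<cdot> s) c = k1 \<cdot> pbpair E (a \<cdot> z) f s c"
      by (rule is_Pi_transpose[OF P1 fa(1), of "a \<cdot> z" k1]) (use fa z za k1 x b in simp_all)
    have h1k': "e1 \<cdot> pbpair E y1 f (h1 \<cdot> s) c = k \<cdot> pbpair E z f' s (can (z \<cdot> s) c)"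
      if "s \<in> Arr E" "c \<in> Arr E" "Dom E s = Dom E c" "Cod E s = Dom E z" "Cod E c = Dom E f"
        "a \<cdot> (z \<cdot> s) = f \<cdot> c" for s c
      using h1k[of s c] that fa z za canz sqz k f' by (simp add: k1_def can_comp)
    \<comment> \<open>This equality is what a map into the pullback of \<open>n\<close> and
      \<open>u\<close> needs. It says that the values of \<open>k\<close> lie over their
      arguments.\<close>
    have uh1: "n \<cdot> z = u \<cdot> h1"
    proof (rule is_Pi_eqI[OF P2 fa(1) b(1,3)])
      show "y2 \<cdot> (n \<cdot> z) = y2 \<cdot> (u \<cdot> h1)"
        using y2n[of z] y2u[of h1] z za h1 by simp
      fix s c assume s: "s \<in> Arr E" "c \<in> Arr E" "Dom E s = Dom E c" "Cod E s = Dom E (n \<cdot> z)"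
        "Cod E c = Dom E f" "y2 \<cdot> ((n \<cdot> z) \<cdot> s) = f \<cdot> c" "y2 \<cdot> ((u \<cdot> h1) \<cdot> s) = f \<cdot> c"
      have s': "Cod E s = Dom E z" using s(4) n z za by simp
      have azs: "a \<cdot> (z \<cdot> s) = f \<cdot> c" using s(1,6) y2n[of "z \<cdot> s"] s' n(1-3) z za y2 by simp
      have yhs: "y1 \<cdot> (h1 \<cdot> s) = f \<cdot> c" using s(7) y2u[of "h1 \<cdot> s"] s(1-3,5) s' u h1 by simp
      note canzs = can[of "z \<cdot> s" c]
      have "e2 \<cdot> pbpair E y2 f ((n \<cdot> z) \<cdot> s) c = can (z \<cdot> s) c"
        using n_can[of "z \<cdot> s" c] s(1-3,5) s' n z za azs by simp
      also have "\<dots> = x \<cdot> (k \<cdot> pbpair E z f' s (can (z \<cdot> s) c))"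
        by (rule xk[symmetric]) (use s(1-3,5) s' z za azs canzs in simp_all)
      also have "\<dots> = e2 \<cdot> pbpair E y2 f ((u \<cdot> h1) \<cdot> s) c"
        using u_app'[of "h1 \<cdot> s" c] h1k'[of s c] azs s(1-3,5) s' z h1 u yhs by simp
      finally show "e2 \<cdot> pbpair E y2 f ((n \<cdot> z) \<cdot> s) c = e2 \<cdot> pbpair E y2 f ((u \<cdot> h1) \<cdot> s) c" .
    qed (use n u z za h1 in simp_all)
    define h where "h = pbpair E n u z h1"
    have h: "h \<in> Arr E" "Dom E h = Dom E z" "Cod E h = pb E n u" "y \<cdot> h = z" "pr2 E n u \<cdot> h = h1"
      using n u z za h1 uh1 by (simp_all add: h_def y_def)
    have "e \<cdot> pbpair E y f' (h \<cdot> s) c = k \<cdot> pbpair E z f' s c"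
      if s: "s \<in> Arr E" "c \<in> Arr E" "Dom E s = Dom E c" "Cod E s = Dom E z" "Cod E c = Dom E f'"
        "z \<cdot> s = f' \<cdot> c" "y \<cdot> (h \<cdot> s) = f' \<cdot> c" for s c
    proof -
      have "e \<cdot> pbpair E y f' (h \<cdot> s) c = app (h \<cdot> s) c"
        by (rule e_app) (use s h in simp_all)
      also have "pr2 E n u \<cdot> (h \<cdot> s) = h1 \<cdot> s"
        using comp_assoc[of s h "pr2 E n u"] h s n u by simp
      then have "app (h \<cdot> s) c = e1 \<cdot> pbpair E y1 f (h1 \<cdot> s) (b \<cdot> c)"
        by (simp add: app_def)
      also have "\<dots> = k \<cdot> pbpair E z f' s (can (z \<cdot> s) (b \<cdot> c))"
        by (rule h1k') (use s b af'' in simp_all)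
      also have "can (z \<cdot> s) (b \<cdot> c) = c" using can_f'b s by simp
      finally show ?thesis .
    qed
    then show "\<exists>h. h \<in> Hom E (Dom E z) (Dom E y) \<and> y \<cdot> h = z \<and>
        (\<forall>s c. s \<in> Arr E \<longrightarrow> c \<in> Arr E \<longrightarrow> Dom E s = Dom E c \<longrightarrow> Cod E s = Dom E z \<longrightarrow>
          Cod E c = Dom E f' \<longrightarrow> z \<cdot> s = f' \<cdot> c \<longrightarrow> y \<cdot> (h \<cdot> s) = f' \<cdot> c \<longrightarrow>
          e \<cdot> pbpair E y f' (h \<cdot> s) c = k \<cdot> pbpair E z f' s c)"
      using h y by (intro exI[of _ h]) simp
  next
    fix h h' assume h: "h \<in> Arr E" "h' \<in> Arr E" "Dom E h = Dom E h'" "Cod E h = Dom E y"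
      "Cod E h' = Dom E y" "y \<cdot> h = y \<cdot> h'"
      and eq: "\<And>s c. \<lbrakk>s \<in> Arr E; c \<in> Arr E; Dom E s = Dom E c; Cod E s = Dom E h';
        Cod E c = Dom E f'; y \<cdot> (h \<cdot> s) = f' \<cdot> c; y \<cdot> (h' \<cdot> s) = f' \<cdot> c\<rbrakk>
        \<Longrightarrow> e \<cdot> pbpair E y f' (h \<cdot> s) c = e \<cdot> pbpair E y f' (h' \<cdot> s) c"
    have h': "Cod E h = pb E n u" "Cod E h' = pb E n u" using h y by simp_all
    show "h = h'"
    proof (rule pb_eqI[of n u])
      show "pr2 E n u \<cdot> h = pr2 E n u \<cdot> h'"
      proof (rule is_Pi_eqI[OF P1 fa(1)])
        show "y1 \<cdot> (pr2 E n u \<cdot> h) = y1 \<cdot> (pr2 E n u \<cdot> h')"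
          using ya[of h] ya[of h'] h h' by simp
        fix s c assume s: "s \<in> Arr E" "c \<in> Arr E" "Dom E s = Dom E c" "Cod E s = Dom E (pr2 E n u \<cdot> h)"
          "Cod E c = Dom E f" "y1 \<cdot> ((pr2 E n u \<cdot> h) \<cdot> s) = f \<cdot> c" "y1 \<cdot> ((pr2 E n u \<cdot> h') \<cdot> s) = f \<cdot> c"
        have s': "Cod E s = Dom E h" using s(4) n u h h' by simp
        have ayh: "a \<cdot> (y \<cdot> (h \<cdot> s)) = f \<cdot> c"
          using s(6) ya[of "h \<cdot> s"] s(1-3,5) s' n u h(1-5) h' by simp
        have yh: "y \<cdot> (h \<cdot> s) = y \<cdot> (h' \<cdot> s)"
          using comp_eq_comp[OF h(6), of s] h(1-5) y s(1-3,5) s' by simp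
        \<comment> \<open>Each \<open>c\<close> over the base point lifts to the fibre of
          \<open>f'\<close>, so agreement of \<open>h\<close> and \<open>h'\<close> at the lifts
          gives agreement at every \<open>c\<close>.\<close>
        define d where "d = can (y \<cdot> (h \<cdot> s)) c"
        have d: "d \<in> Arr E" "Dom E d = Dom E c" "Cod E d = Dom E f'" "f' \<cdot> d = y \<cdot> (h \<cdot> s)" "b \<cdot> d = c"
          unfolding d_def using can[of "y \<cdot> (h \<cdot> s)" c] ayh y h(1-5) s(1-3,5) s' by simp_all
        have "app (h \<cdot> s) d = app (h' \<cdot> s) d"
        proof -
          have "app (h \<cdot> s) d = e \<cdot> pbpair E y f' (h \<cdot> s) d"
            by (rule e_app[symmetric]) (use d s(1-3,5) s' h(1-5) h' in simp_all)
          also have "\<dots> = e \<cdot> pbpair E y f' (h' \<cdot> s) d"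
            by (rule eq) (use d s(1-3,5) s' h(1-5) yh in simp_all)
          also have "\<dots> = app (h' \<cdot> s) d"
            by (rule e_app) (use d s(1-3,5) s' h(1-5) h' yh in simp_all)
          finally show ?thesis .
        qed
        then show "e1 \<cdot> pbpair E y1 f ((pr2 E n u \<cdot> h) \<cdot> s) c = e1 \<cdot> pbpair E y1 f ((pr2 E n u \<cdot> h') \<cdot> s) c"
          using d s(1-3,5) s' h(1-5) h' n u by (simp add: app_def)
      qed (use b x n u h h' y1 in simp_all)
    qed (use h h' n u y_def in simp_all)
  qed (use f' x y e in simp_all)
  then show ?thesis by blast
qed

end

text \<open>The counit is the preimage of an identity, the same expression as in
  \<open>Pi_counit\<close>. Naturality in \<open>c\<close> gives the first factorisation; the second
  follows from it because \<open>\<Phi> c d\<close> is injective.\<close>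

lemma adjunction_counit:
  fixes L :: "('o, 'a, 'p, 'b) func" and R :: "('p, 'b, 'o, 'a) func"
  assumes adj: "adjunction C D L R \<Phi>" and d: "d \<in> Obj D"
  defines "\<epsilon> \<equiv> inv_into (Hom D (fobj L (fobj R d)) d) (\<Phi> (fobj R d) d) (Ide C (fobj R d))"
  shows "\<epsilon> \<in> Hom D (fobj L (fobj R d)) d"
    and "h \<in> Hom C c (fobj R d) \<Longrightarrow> \<Phi> c d (Comp D \<epsilon> (farr L h)) = h"
    and "c \<in> Obj C \<Longrightarrow> k \<in> Hom D (fobj L c) d \<Longrightarrow> Comp D \<epsilon> (farr L (\<Phi> c d k)) = k"
proof -
  have L: "is_functor C D L" and R: "is_functor D C R"
    and bij: "\<And>c d. c \<in> Obj C \<Longrightarrow> d \<in> Obj D \<Longrightarrow> bij_betw (\<Phi> c d) (Hom D (fobj L c) d) (Hom C c (fobj R d))"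
    and nat: "\<And>c' c d d' f g h. f \<in> Hom C c' c \<Longrightarrow> g \<in> Hom D d d' \<Longrightarrow> h \<in> Hom D (fobj L c) d \<Longrightarrow>
        \<Phi> c' d' (Comp D (Comp D g h) (farr L f)) = Comp C (Comp C (farr R g) (\<Phi> c d h)) f"
    using adj unfolding adjunction_def by blast+
  interpret C: category C using L by (simp add: is_functor_def)
  interpret D: category D using L by (simp add: is_functor_def)
  have Rd: "fobj R d \<in> Obj C" using R d by (simp add: is_functor_def)
  have "Ide C (fobj R d) \<in> \<Phi> (fobj R d) d ` Hom D (fobj L (fobj R d)) d"
    using bij[OF Rd d] Rd unfolding bij_betw_def by auto
  then have eps: "\<epsilon> \<in> Hom D (fobj L (fobj R d)) d" "\<Phi> (fobj R d) d \<epsilon> = Ide C (fobj R d)"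
    unfolding \<epsilon>_def by (rule inv_into_into, rule f_inv_into_f)
  show "\<epsilon> \<in> Hom D (fobj L (fobj R d)) d" by fact
  show *: "\<Phi> c d (Comp D \<epsilon> (farr L h)) = h" if h: "h \<in> Hom C c (fobj R d)" for h c
  proof -
    have "\<Phi> c d (Comp D (Comp D (Ide D d) \<epsilon>) (farr L h)) =
        Comp C (Comp C (farr R (Ide D d)) (\<Phi> (fobj R d) d \<epsilon>)) h"
      by (rule nat) (use h d eps in simp_all)
    also have "Comp D (Ide D d) \<epsilon> = \<epsilon>" using eps by simp
    also have "farr R (Ide D d) = Ide C (fobj R d)" using R d by (simp add: is_functor_def)
    finally show ?thesis using eps h Rd by simp
  qed
  show "Comp D \<epsilon> (farr L (\<Phi> c d k)) = k" if c: "c \<in> Obj C" and k: "k \<in> Hom D (fobj L c) d" for c k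
  proof -
    have Pk: "\<Phi> c d k \<in> Hom C c (fobj R d)"
      using bij[OF c d] k unfolding bij_betw_def by blast
    have "farr L (\<Phi> c d k) \<in> Hom D (fobj L c) (fobj L (fobj R d))"
      using L Pk unfolding is_functor_def by blast
    then have "Comp D \<epsilon> (farr L (\<Phi> c d k)) \<in> Hom D (fobj L c) d"
      using eps by simp
    with *[OF Pk] k bij[OF c d] show ?thesis
      unfolding bij_betw_def inj_on_def by blast
  qed
qed

lemma adjunction_Hom:
  assumes "adjunction C D L R \<Phi>" "c \<in> Obj C" "d \<in> Obj D" "k \<in> Hom D (fobj L c) d"
  shows "\<Phi> c d k \<in> Hom C c (fobj R d)"
  using assms unfolding adjunction_def bij_betw_def by blast

context ccc
begin

text \<open>\<open>r\<close> is the exponential of \<open>x\<close> by \<open>a\<close> and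
  \<open>ev\<close> its evaluation. The universal property is unpacked into existence and
  extensionality on elements, the two halves that \<open>is_PiI\<close> asks for along
  \<open>a \<rightarrow> 1\<close>.\<close>

lemma exponential:
  assumes a: "a \<in> Obj E" and x: "x \<in> Obj E"
  obtains r ev where "r \<in> Obj E" "ev \<in> Arr E" "Dom E ev = prd E r a" "Cod E ev = x"
    "\<And>z k. \<lbrakk>z \<in> Obj E; k \<in> Arr E; Dom E k = prd E z a; Cod E k = x\<rbrakk> \<Longrightarrow>
      \<exists>h. h \<in> Hom E z r \<and> (\<forall>s b. s \<in> Arr E \<longrightarrow> b \<in> Arr E \<longrightarrow> Dom E s = Dom E b \<longrightarrow> Cod E s = z \<longrightarrow>
        Cod E b = a \<longrightarrow> ev \<cdot> pair E (h \<cdot> s) b = k \<cdot> pair E s b)"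
    "\<And>h h'. \<lbrakk>h \<in> Arr E; h' \<in> Arr E; Dom E h = Dom E h'; Cod E h = r; Cod E h' = r;
      \<And>s b. \<lbrakk>s \<in> Arr E; b \<in> Arr E; Dom E s = Dom E b; Cod E s = Dom E h'; Cod E b = a\<rbrakk> \<Longrightarrow>
        ev \<cdot> pair E (h \<cdot> s) b = ev \<cdot> pair E (h' \<cdot> s) b\<rbrakk> \<Longrightarrow> h = h'"
proof -
  have "has_right_adjoint E E (prod_functor E a)"
    using closed a by (simp add: cartesian_closed_def)
  then obtain R \<Phi> where adj: "adjunction E E (prod_functor E a) R \<Phi>"
    unfolding has_right_adjoint_def by blast
  define r where "r = fobj R x"
  have r: "r \<in> Obj E" using adj x by (simp add: r_def adjunction_def is_functor_def)
  define ev where "ev = inv_into (Hom E (fobj (prod_functor E a) (fobj R x)) x) (\<Phi> (fobj R x) x) (Ide E (fobj R x))"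
  note counit = adjunction_counit[OF adj x, folded ev_def, folded r_def]
  have ev: "ev \<in> Arr E" "Dom E ev = prd E r a" "Cod E ev = x"
    using counit(1) by (simp_all add: prod_functor_def)
  show ?thesis
  proof (rule that[OF r ev])
    fix z k assume k: "z \<in> Obj E" "k \<in> Arr E" "Dom E k = prd E z a" "Cod E k = x"
    have hk: "ev \<cdot> prodmap E (\<Phi> z x k) (Ide E a) = k"
      using counit(3)[of z k] k by (simp add: prod_functor_def)
    have h: "\<Phi> z x k \<in> Hom E z r"
      unfolding r_def by (rule adjunction_Hom[OF adj]) (use k x in \<open>simp_all add: prod_functor_def\<close>)
    have "ev \<cdot> pair E (\<Phi> z x k \<cdot> s) b = k \<cdot> pair E s b"
      if "s \<in> Arr E" "b \<in> Arr E" "Dom E s = Dom E b" "Cod E s = z" "Cod E b = a" for s b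
    proof -
      have "(ev \<cdot> prodmap E (\<Phi> z x k) (Ide E a)) \<cdot> pair E s b = k \<cdot> pair E s b"
        using hk by simp
      then show ?thesis using that h ev a by simp
    qed
    then show "\<exists>h. h \<in> Hom E z r \<and> (\<forall>s b. s \<in> Arr E \<longrightarrow> b \<in> Arr E \<longrightarrow> Dom E s = Dom E b \<longrightarrow> Cod E s = z \<longrightarrow>
        Cod E b = a \<longrightarrow> ev \<cdot> pair E (h \<cdot> s) b = k \<cdot> pair E s b)"
      using h by blast
  next
    fix h h' assume h: "h \<in> Arr E" "h' \<in> Arr E" "Dom E h = Dom E h'" "Cod E h = r" "Cod E h' = r"
      and eq: "\<And>s b. \<lbrakk>s \<in> Arr E; b \<in> Arr E; Dom E s = Dom E b; Cod E s = Dom E h'; Cod E b = a\<rbrakk> \<Longrightarrow>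
        ev \<cdot> pair E (h \<cdot> s) b = ev \<cdot> pair E (h' \<cdot> s) b"
    have "ev \<cdot> prodmap E h (Ide E a) = ev \<cdot> prodmap E h' (Ide E a)"
      unfolding prodmap_def using eq[of "p1 E (Dom E h') a" "p2 E (Dom E h') a"] h a by simp
    then show "h = h'"
      using counit(2)[of h "Dom E h"] counit(2)[of h' "Dom E h'"] h by (simp add: prod_functor_def)
  qed
qed

text \<open>Along \<open>a \<rightarrow> 1\<close> the right adjoint yields the internal object of
  sections of \<open>x\<close>: the maps from \<open>a\<close> to the domain of \<open>x\<close>
  whose composite with \<open>x\<close> is the identity of \<open>a\<close>, cut out of an
  exponential by a pullback.\<close>

lemma is_Pi_bang:
  assumes a: "a \<in> Obj E" and x: "x \<in> Arr E" "Cod E x = a"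
  shows "\<exists>y e. is_Pi E (bang E a) x y e"
proof -
  obtain r ev where r: "r \<in> Obj E" and ev: "ev \<in> Arr E" "Dom E ev = prd E r a" "Cod E ev = Dom E x"
    and ev_ex: "\<And>z k. \<lbrakk>z \<in> Obj E; k \<in> Arr E; Dom E k = prd E z a; Cod E k = Dom E x\<rbrakk> \<Longrightarrow>
      \<exists>h. h \<in> Hom E z r \<and> (\<forall>s b. s \<in> Arr E \<longrightarrow> b \<in> Arr E \<longrightarrow> Dom E s = Dom E b \<longrightarrow> Cod E s = z \<longrightarrow>
        Cod E b = a \<longrightarrow> ev \<cdot> pair E (h \<cdot> s) b = k \<cdot> pair E s b)"
    and ev_eqI: "\<And>h h'. \<lbrakk>h \<in> Arr E; h' \<in> Arr E; Dom E h = Dom E h'; Cod E h = r; Cod E h' = r;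
      \<And>s b. \<lbrakk>s \<in> Arr E; b \<in> Arr E; Dom E s = Dom E b; Cod E s = Dom E h'; Cod E b = a\<rbrakk> \<Longrightarrow>
        ev \<cdot> pair E (h \<cdot> s) b = ev \<cdot> pair E (h' \<cdot> s) b\<rbrakk> \<Longrightarrow> h = h'"
    by (rule exponential[OF a dom_cod_obj(1)[OF x(1)]]) blast
  obtain r' ev' where r': "r' \<in> Obj E" and ev': "ev' \<in> Arr E" "Dom E ev' = prd E r' a" "Cod E ev' = a"
    and ev'_ex: "\<And>z k. \<lbrakk>z \<in> Obj E; k \<in> Arr E; Dom E k = prd E z a; Cod E k = a\<rbrakk> \<Longrightarrow>
      \<exists>h. h \<in> Hom E z r' \<and> (\<forall>s b. s \<in> Arr E \<longrightarrow> b \<in> Arr E \<longrightarrow> Dom E s = Dom E b \<longrightarrow> Cod E s = z \<longrightarrow>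
        Cod E b = a \<longrightarrow> ev' \<cdot> pair E (h \<cdot> s) b = k \<cdot> pair E s b)"
    and ev'_eqI: "\<And>h h'. \<lbrakk>h \<in> Arr E; h' \<in> Arr E; Dom E h = Dom E h'; Cod E h = r'; Cod E h' = r';
      \<And>s b. \<lbrakk>s \<in> Arr E; b \<in> Arr E; Dom E s = Dom E b; Cod E s = Dom E h'; Cod E b = a\<rbrakk> \<Longrightarrow>
        ev' \<cdot> pair E (h \<cdot> s) b = ev' \<cdot> pair E (h' \<cdot> s) b\<rbrakk> \<Longrightarrow> h = h'"
    by (rule exponential[OF a a]) blast
  \<comment> \<open>The name of the identity of \<open>a\<close>, a point of the exponential of
    \<open>a\<close> by itself.\<close>
  obtain n where n: "n \<in> Arr E" "Dom E n = one E" "Cod E n = r'"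
    and n_ev: "\<And>s b. \<lbrakk>s \<in> Arr E; b \<in> Arr E; Dom E s = Dom E b; Cod E s = one E; Cod E b = a\<rbrakk> \<Longrightarrow>
      ev' \<cdot> pair E (n \<cdot> s) b = b"
    using ev'_ex[of "one E" "p2 E (one E) a"] a by auto
  \<comment> \<open>Postcomposition with \<open>x\<close>, from the exponential of its domain to
    that of \<open>a\<close>.\<close>
  obtain u where u: "u \<in> Arr E" "Dom E u = r" "Cod E u = r'"
    and u_ev: "\<And>s b. \<lbrakk>s \<in> Arr E; b \<in> Arr E; Dom E s = Dom E b; Cod E s = r; Cod E b = a\<rbrakk> \<Longrightarrow>
      ev' \<cdot> pair E (u \<cdot> s) b = x \<cdot> (ev \<cdot> pair E s b)"
    using ev'_ex[of r "x \<cdot> ev"] a ev x r by auto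
  define y where "y = bang E (pb E n u)"
  have y: "y \<in> Arr E" "Dom E y = pb E n u" "Cod E y = one E"
    using n u by (simp_all add: y_def)
  define app where "app s b = ev \<cdot> pair E (pr2 E n u \<cdot> s) b" for s b
  have app: "app s b \<in> Arr E" "Dom E (app s b) = Dom E b" "Cod E (app s b) = Dom E x" "x \<cdot> app s b = b"
    if "s \<in> Arr E" "b \<in> Arr E" "Dom E s = Dom E b" "Cod E s = pb E n u" "Cod E b = a" for s b
  proof -
    show "app s b \<in> Arr E" "Dom E (app s b) = Dom E b" "Cod E (app s b) = Dom E x"
      using that n u ev by (simp_all add: app_def)
    have "x \<cdot> app s b = ev' \<cdot> pair E (u \<cdot> (pr2 E n u \<cdot> s)) b"
      unfolding app_def by (rule u_ev[symmetric]) (use that n u in simp_all)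
    also have "u \<cdot> (pr2 E n u \<cdot> s) = n \<cdot> (pr1 E n u \<cdot> s)"
      using pb_square(2)[of n u s] n u that by simp
    also have "ev' \<cdot> pair E (n \<cdot> (pr1 E n u \<cdot> s)) b = b"
      by (rule n_ev) (use that n u in simp_all)
    finally show "x \<cdot> app s b = b" .
  qed
  define e where "e = app (pr1 E y (bang E a)) (pr2 E y (bang E a))"
  have e: "e \<in> Arr E" "Dom E e = pb E y (bang E a)" "Cod E e = Dom E x" "x \<cdot> e = pr2 E y (bang E a)"
    unfolding e_def using app[of "pr1 E y (bang E a)" "pr2 E y (bang E a)"] y a by simp_all
  have e_app: "e \<cdot> pbpair E y (bang E a) s b = app s b"
    if "s \<in> Arr E" "b \<in> Arr E" "Dom E s = Dom E b" "Cod E s = pb E n u" "Cod E b = a" for s b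
    unfolding e_def app_def using that y a n u ev by (simp add: y_def)
  have "is_Pi E (bang E a) x y e"
  proof (rule is_PiI)
    fix z k assume z: "z \<in> Arr E" "Cod E z = Cod E (bang E a)" and k: "k \<in> Arr E"
      "Dom E k = pb E z (bang E a)" "Cod E k = Dom E x"
      and xk: "\<And>s b. \<lbrakk>s \<in> Arr E; b \<in> Arr E; Dom E s = Dom E b; Cod E s = Dom E z;
        Cod E b = Dom E (bang E a); z \<cdot> s = bang E a \<cdot> b\<rbrakk> \<Longrightarrow> x \<cdot> (k \<cdot> pbpair E z (bang E a) s b) = b"
    have z1: "Cod E z = one E" using z a by simp
    have zs: "z \<cdot> s = bang E a \<cdot> b"
      if "s \<in> Arr E" "b \<in> Arr E" "Dom E s = Dom E b" "Cod E s = Dom E z" "Cod E b = a" for s b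
      by (rule to_one_eq) (use that z z1 a in simp_all)
    define k1 where "k1 = k \<cdot> pbpair E z (bang E a) (p1 E (Dom E z) a) (p2 E (Dom E z) a)"
    have k1: "k1 \<in> Arr E" "Dom E k1 = prd E (Dom E z) a" "Cod E k1 = Dom E x"
      using zs[of "p1 E (Dom E z) a" "p2 E (Dom E z) a"] z z1 k a by (simp_all add: k1_def)
    have k1s: "k1 \<cdot> pair E s b = k \<cdot> pbpair E z (bang E a) s b"
      if "s \<in> Arr E" "b \<in> Arr E" "Dom E s = Dom E b" "Cod E s = Dom E z" "Cod E b = a" for s b
      using zs[of "p1 E (Dom E z) a" "p2 E (Dom E z) a"] that z z1 k a by (simp add: k1_def)
    obtain h1 where h1: "h1 \<in> Arr E" "Dom E h1 = Dom E z" "Cod E h1 = r"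
      and h1k: "\<And>s b. \<lbrakk>s \<in> Arr E; b \<in> Arr E; Dom E s = Dom E b; Cod E s = Dom E z; Cod E b = a\<rbrakk> \<Longrightarrow>
        ev \<cdot> pair E (h1 \<cdot> s) b = k \<cdot> pbpair E z (bang E a) s b"
      using ev_ex[of "Dom E z" k1] k1 z(1) k1s by auto
    \<comment> \<open>Because the values of \<open>k\<close> lie over their arguments,
      \<open>h1\<close> takes its values among the sections.\<close>
    have uh1: "n \<cdot> z = u \<cdot> h1"
    proof (rule ev'_eqI)
      fix s b assume s: "s \<in> Arr E" "b \<in> Arr E" "Dom E s = Dom E b" "Cod E s = Dom E (u \<cdot> h1)" "Cod E b = a"
      have s': "Cod E s = Dom E z" using s(4) u h1 by simp
      have "ev' \<cdot> pair E (n \<cdot> (z \<cdot> s)) b = b"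
        by (rule n_ev) (use s(1-3,5) s' z z1 in simp_all)
      also have "b = x \<cdot> (k \<cdot> pbpair E z (bang E a) s b)"
        by (rule xk[symmetric]) (use s(1-3,5) s' zs a in simp_all)
      also have "\<dots> = x \<cdot> (ev \<cdot> pair E (h1 \<cdot> s) b)"
        using h1k[OF s(1-3) s' s(5)] by simp
      also have "\<dots> = ev' \<cdot> pair E (u \<cdot> (h1 \<cdot> s)) b"
        by (rule u_ev[symmetric]) (use s(1-3,5) s' h1 in simp_all)
      finally show "ev' \<cdot> pair E ((n \<cdot> z) \<cdot> s) b = ev' \<cdot> pair E ((u \<cdot> h1) \<cdot> s) b"
        using s(1-3,5) s' z(1) z1 n u h1 by simp
    qed (use n u z(1) z1 h1 in simp_all)
    define h where "h = pbpair E n u z h1"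
    have h: "h \<in> Arr E" "Dom E h = Dom E z" "Cod E h = pb E n u" "pr2 E n u \<cdot> h = h1"
      using n u z(1) z1 h1 uh1 by (simp_all add: h_def)
    have "e \<cdot> pbpair E y (bang E a) (h \<cdot> s) b = k \<cdot> pbpair E z (bang E a) s b"
      if s: "s \<in> Arr E" "b \<in> Arr E" "Dom E s = Dom E b" "Cod E s = Dom E z" "Cod E b = a" for s b
      using e_app[of "h \<cdot> s" b] comp_assoc[of s h "pr2 E n u"] h1k[OF s] h s n u by (simp add: app_def)
    moreover have "y \<cdot> h = z"
      by (rule to_one_eq) (use y h z(1) z1 in simp_all)
    ultimately show "\<exists>h. h \<in> Hom E (Dom E z) (Dom E y) \<and> y \<cdot> h = z \<and>
        (\<forall>s b. s \<in> Arr E \<longrightarrow> b \<in> Arr E \<longrightarrow> Dom E s = Dom E b \<longrightarrow> Cod E s = Dom E z \<longrightarrow>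
          Cod E b = Dom E (bang E a) \<longrightarrow> z \<cdot> s = bang E a \<cdot> b \<longrightarrow> y \<cdot> (h \<cdot> s) = bang E a \<cdot> b \<longrightarrow>
          e \<cdot> pbpair E y (bang E a) (h \<cdot> s) b = k \<cdot> pbpair E z (bang E a) s b)"
      using h(1-3) y a by (intro exI[of _ h]) simp
  next
    fix h h' assume h: "h \<in> Arr E" "h' \<in> Arr E" "Dom E h = Dom E h'" "Cod E h = Dom E y"
      "Cod E h' = Dom E y" "y \<cdot> h = y \<cdot> h'"
      and eq: "\<And>s b. \<lbrakk>s \<in> Arr E; b \<in> Arr E; Dom E s = Dom E b; Cod E s = Dom E h';
        Cod E b = Dom E (bang E a); y \<cdot> (h \<cdot> s) = bang E a \<cdot> b; y \<cdot> (h' \<cdot> s) = bang E a \<cdot> b\<rbrakk>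
        \<Longrightarrow> e \<cdot> pbpair E y (bang E a) (h \<cdot> s) b = e \<cdot> pbpair E y (bang E a) (h' \<cdot> s) b"
    have h': "Cod E h = pb E n u" "Cod E h' = pb E n u" using h y by simp_all
    show "h = h'"
    proof (rule pb_eqI[of n u])
      show "pr1 E n u \<cdot> h = pr1 E n u \<cdot> h'"
        by (rule to_one_eq) (use h(1-3) h' n u in simp_all)
      show "pr2 E n u \<cdot> h = pr2 E n u \<cdot> h'"
      proof (rule ev_eqI)
        fix s b assume s: "s \<in> Arr E" "b \<in> Arr E" "Dom E s = Dom E b"
          "Cod E s = Dom E (pr2 E n u \<cdot> h')" "Cod E b = a"
        have s': "Cod E s = Dom E h'" using s(4) n u h h' by simp
        have "app (h \<cdot> s) b = e \<cdot> pbpair E y (bang E a) (h \<cdot> s) b"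
          by (rule e_app[symmetric]) (use s(1-3,5) s' h(1-3) h' in simp_all)
        also have "\<dots> = e \<cdot> pbpair E y (bang E a) (h' \<cdot> s) b"
          by (rule eq) (use s(1-3,5) s' h(1-3) h' n u a in \<open>simp_all add: y_def\<close>)
        also have "\<dots> = app (h' \<cdot> s) b"
          by (rule e_app) (use s(1-3,5) s' h(1-3) h' in simp_all)
        finally show "ev \<cdot> pair E ((pr2 E n u \<cdot> h) \<cdot> s) b = ev \<cdot> pair E ((pr2 E n u \<cdot> h') \<cdot> s) b"
          using s(1-3,5) s' h(1-3) h' n u by (simp add: app_def)
      qed (use h(1-3) h' n u in simp_all)
    qed (use h(1-3) h' n u in simp_all)
  qed (use a x y e in simp_all)
  then show ?thesis by blast
qed

section \<open>Slices and the pullback functor\<close>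

lemma slice_simps [simp]:
  "Obj (slice E a) = {x \<in> Arr E. Cod E x = a}"
  "Ide (slice E a) x = (x, Ide E (Dom E x), x)"
  "Comp (slice E a) (x', h', y') (x, h, y) = (x, h' \<cdot> h, y')"
  by (simp_all add: slice_def)

lemma Hom_slice: "t \<in> Hom (slice E a) x y \<longleftrightarrow> (\<exists>h. t = (x, h, y) \<and> x \<in> Arr E \<and> Cod E x = a \<and>
    y \<in> Arr E \<and> Cod E y = a \<and> h \<in> Arr E \<and> Dom E h = Dom E x \<and> Cod E h = Dom E y \<and> y \<cdot> h = x)"
  by (auto simp: slice_def)

lemma slice_HomE:
  assumes "t \<in> Hom (slice E a) x y"
  obtains h where "t = (x, h, y)" "x \<in> Arr E" "Cod E x = a" "y \<in> Arr E" "Cod E y = a"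
    "h \<in> Arr E" "Dom E h = Dom E x" "Cod E h = Dom E y" "y \<cdot> h = x"
  using assms unfolding Hom_slice by blast

lemma category_slice: "category (slice E a)"
proof
  show "Dom (slice E a) f \<in> Obj (slice E a)" "Cod (slice E a) f \<in> Obj (slice E a)"
    if "f \<in> Arr (slice E a)" for f
    using that by (auto simp: slice_def)
  show "Ide (slice E a) x \<in> Hom (slice E a) x x" if "x \<in> Obj (slice E a)" for x
    unfolding Hom_slice using that by simp
  show "Comp (slice E a) g f \<in> Hom (slice E a) x z"
    if "f \<in> Hom (slice E a) x y" "g \<in> Hom (slice E a) y z" for f g x y z
    using that by (elim slice_HomE) (auto simp: Hom_slice simp del: Hom_iff simp flip: comp_assoc)
  show "Comp (slice E a) h (Comp (slice E a) g f) = Comp (slice E a) (Comp (slice E a) h g) f"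
    if "f \<in> Hom (slice E a) x y" "g \<in> Hom (slice E a) y z" "h \<in> Hom (slice E a) z w" for f g h x y z w
    using that by (elim slice_HomE) auto
  show "Comp (slice E a) f (Ide (slice E a) x) = f" if "f \<in> Hom (slice E a) x y" for f x y
    using that by (elim slice_HomE) auto
  show "Comp (slice E a) (Ide (slice E a) y) f = f" if "f \<in> Hom (slice E a) x y" for f x y
    using that by (elim slice_HomE) auto
qed

lemma Delta_simps [simp]:
  "fobj (Delta E f) x = pr2 E x f"
  "farr (Delta E f) (x, h, y) = (pr2 E x f, pbpair E y f (h \<cdot> pr1 E x f) (pr2 E x f), pr2 E y f)"
  by (simp_all add: Delta_def)

text \<open>The compatibility that makes the \<open>pbpair\<close> in the arrow part of
  \<open>Delta\<close> well defined.\<close>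

lemma slice_square:
  assumes "f \<in> Arr E" "x \<in> Arr E" "y \<in> Arr E" "Cod E x = Cod E f" "Cod E y = Cod E f"
    "h \<in> Arr E" "Dom E h = Dom E x" "Cod E h = Dom E y" "y \<cdot> h = x"
  shows "y \<cdot> (h \<cdot> pr1 E x f) = f \<cdot> pr2 E x f"
  using comp_assoc[of "pr1 E x f" h y] pb_square(1)[of x f] assms by simp

lemma functor_Delta:
  assumes f: "f \<in> Arr E"
  shows "is_functor (slice E (Cod E f)) (slice E (Dom E f)) (Delta E f)"
  unfolding is_functor_def
proof (intro conjI category_slice allI ballI)
  show "fobj (Delta E f) x \<in> Obj (slice E (Dom E f))" if "x \<in> Obj (slice E (Cod E f))" for x
    using that f by simp
  show "farr (Delta E f) t \<in> Hom (slice E (Dom E f)) (fobj (Delta E f) x) (fobj (Delta E f) y)"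
    if t: "t \<in> Hom (slice E (Cod E f)) x y" for x y t
  proof -
    obtain h where h: "t = (x, h, y)" "x \<in> Arr E" "Cod E x = Cod E f" "y \<in> Arr E" "Cod E y = Cod E f"
      "h \<in> Arr E" "Dom E h = Dom E x" "Cod E h = Dom E y" "y \<cdot> h = x"
      using t by (elim slice_HomE)
    show ?thesis
      unfolding Hom_slice using h(1-8) f slice_square[OF f, of x y h] h(9) by simp
  qed
  show "farr (Delta E f) (Ide (slice E (Cod E f)) x) = Ide (slice E (Dom E f)) (fobj (Delta E f) x)"
    if "x \<in> Obj (slice E (Cod E f))" for x
    using that f by simp
  show "farr (Delta E f) (Comp (slice E (Cod E f)) t' t) =
      Comp (slice E (Dom E f)) (farr (Delta E f) t') (farr (Delta E f) t)"
    if t: "t \<in> Hom (slice E (Cod E f)) x y" and t': "t' \<in> Hom (slice E (Cod E f)) y z" for x y z t t'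
  proof -
    obtain h where h: "t = (x, h, y)" "x \<in> Arr E" "Cod E x = Cod E f" "y \<in> Arr E" "Cod E y = Cod E f"
      "h \<in> Arr E" "Dom E h = Dom E x" "Cod E h = Dom E y" "y \<cdot> h = x"
      using t by (elim slice_HomE)
    obtain h' where h': "t' = (y, h', z)" "z \<in> Arr E" "Cod E z = Cod E f"
      "h' \<in> Arr E" "Dom E h' = Dom E y" "Cod E h' = Dom E z" "z \<cdot> h' = y"
      using t' by (elim slice_HomE)
    have "y \<cdot> (h \<cdot> pr1 E x f) = f \<cdot> pr2 E x f" "z \<cdot> (h' \<cdot> pr1 E y f) = f \<cdot> pr2 E y f"
      using slice_square[OF f, of x y h] slice_square[OF f, of y z h'] h h' by auto
    then show ?thesis
      using h(1-8) h'(1-6) f by simp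
  qed
qed

text \<open>Whichever adjunction was chosen, \<open>Pi\<close>, \<open>Pi_counit\<close> and
  \<open>Pi_transpose\<close> satisfy its universal property; nothing else about the choice is used
  later. The second claim speaks of the transpose by name, since \<open>qp_curry\<close> is written
  with \<open>Pi_transpose\<close>.\<close>

lemma exponentiableD:
  assumes ef: "exponentiable E f" and x: "x \<in> Arr E" "Cod E x = Dom E f"
  shows is_Pi_Pi: "is_Pi E f x (Pi E f x) (Pi_counit E f x)"
    and "\<lbrakk>z \<in> Arr E; Cod E z = Cod E f; k \<in> Arr E; Dom E k = pb E z f; Cod E k = Dom E x;
      x \<cdot> k = pr2 E z f\<rbrakk> \<Longrightarrow> Pi_transpose E f z x k \<in> Hom E (Dom E z) (Dom E (Pi E f x)) \<and>
      Pi E f x \<cdot> Pi_transpose E f z x k = z \<and>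
      Pi_counit E f x \<cdot>
        pbpair E (Pi E f x) f (Pi_transpose E f z x k \<cdot> pr1 E z f) (pr2 E z f) = k"
proof -
  have f: "f \<in> Arr E" using ef by (simp add: exponentiable_def)
  define R where "R = fst (Pi_adj E f)"
  define \<Phi> where "\<Phi> = snd (Pi_adj E f)"
  have adj: "adjunction (slice E (Cod E f)) (slice E (Dom E f)) (Delta E f) R \<Phi>"
  proof -
    have "\<exists>RF. case RF of (R, \<Phi>) \<Rightarrow>
        adjunction (slice E (Cod E f)) (slice E (Dom E f)) (Delta E f) R \<Phi>"
      using ef by (auto simp: exponentiable_def has_right_adjoint_def)
    from someI_ex[OF this, folded Pi_adj_def] show ?thesis
      by (simp add: R_def \<Phi>_def split: prod.splits)
  qed
  have xo: "x \<in> Obj (slice E (Dom E f))" using x by simp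
  let ?y = "Pi E f x" and ?e = "Pi_counit E f x"
  have Rx: "fobj R x = ?y" by (simp add: R_def Pi_def)
  have y: "?y \<in> Arr E" "Cod E ?y = Cod E f"
    using adj xo unfolding adjunction_def is_functor_def by (auto simp: Rx)
  define \<epsilon> where "\<epsilon> = inv_into (Hom (slice E (Dom E f)) (fobj (Delta E f) (fobj R x)) x)
    (\<Phi> (fobj R x) x) (Ide (slice E (Cod E f)) (fobj R x))"
  note counit = adjunction_counit[OF adj xo, folded \<epsilon>_def, unfolded Rx]
  have "?e = fst (snd \<epsilon>)"
    unfolding \<epsilon>_def Pi_counit_def by (simp add: Rx \<Phi>_def)
  then have eps: "\<epsilon> = (pr2 E ?y f, ?e, x)" and e: "?e \<in> Arr E" "Dom E ?e = pb E ?y f" "Cod E ?e = Dom E x"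
    "x \<cdot> ?e = pr2 E ?y f"
    using counit(1) y f by (auto elim!: slice_HomE simp del: Hom_iff)
  have tr: "Pi_transpose E f z x k \<in> Hom E (Dom E z) (Dom E ?y) \<and> ?y \<cdot> Pi_transpose E f z x k = z \<and>
      ?e \<cdot> pbpair E ?y f (Pi_transpose E f z x k \<cdot> pr1 E z f) (pr2 E z f) = k"
    if z: "z \<in> Arr E" "Cod E z = Cod E f" and k: "k \<in> Arr E" "Dom E k = pb E z f" "Cod E k = Dom E x"
      "x \<cdot> k = pr2 E z f" for z k
  proof -
    let ?k = "(pr2 E z f, k, x)"
    have kH: "?k \<in> Hom (slice E (Dom E f)) (fobj (Delta E f) z) x"
      unfolding Hom_slice using z k f x by simp
    have "\<Phi> z x ?k \<in> Hom (slice E (Cod E f)) z ?y"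
      unfolding Rx[symmetric] by (rule adjunction_Hom[OF adj _ xo kH]) (use z in simp)
    moreover have "Pi_transpose E f z x k = fst (snd (\<Phi> z x ?k))"
      by (simp add: Pi_transpose_def \<Phi>_def)
    ultimately have T: "\<Phi> z x ?k = (z, Pi_transpose E f z x k, ?y)"
      "Pi_transpose E f z x k \<in> Hom E (Dom E z) (Dom E ?y)" "?y \<cdot> Pi_transpose E f z x k = z"
      by (auto elim!: slice_HomE simp del: Hom_iff) (auto)
    have "Comp (slice E (Dom E f)) \<epsilon> (farr (Delta E f) (\<Phi> z x ?k)) = ?k"
      by (rule counit(3)) (use kH z in simp_all)
    then show ?thesis using T by (simp add: eps)
  qed
  then show "\<lbrakk>z \<in> Arr E; Cod E z = Cod E f; k \<in> Arr E; Dom E k = pb E z f; Cod E k = Dom E x;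
      x \<cdot> k = pr2 E z f\<rbrakk> \<Longrightarrow> Pi_transpose E f z x k \<in> Hom E (Dom E z) (Dom E ?y) \<and>
      ?y \<cdot> Pi_transpose E f z x k = z \<and>
      ?e \<cdot> pbpair E ?y f (Pi_transpose E f z x k \<cdot> pr1 E z f) (pr2 E z f) = k" by blast
  show "is_Pi E f x ?y ?e"
    unfolding is_Pi_def
  proof (intro conjI allI impI; (elim conjE)?)
    fix z k assume k: "z \<in> Arr E" "Cod E z = Cod E f" "k \<in> Arr E" "Dom E k = pb E z f"
      "Cod E k = Dom E x" "x \<cdot> k = pr2 E z f"
    show "\<exists>!h. h \<in> Hom E (Dom E z) (Dom E ?y) \<and> ?y \<cdot> h = z \<and>
        ?e \<cdot> pbpair E ?y f (h \<cdot> pr1 E z f) (pr2 E z f) = k"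
    proof (rule ex1I[of _ "Pi_transpose E f z x k"], rule tr[OF k])
      fix h assume h: "h \<in> Hom E (Dom E z) (Dom E ?y) \<and> ?y \<cdot> h = z \<and>
        ?e \<cdot> pbpair E ?y f (h \<cdot> pr1 E z f) (pr2 E z f) = k"
      have "\<Phi> z x (Comp (slice E (Dom E f)) \<epsilon> (farr (Delta E f) (z, h, ?y))) = (z, h, ?y)"
        by (rule counit(2)) (use h k y in \<open>simp add: Hom_slice del: Hom_iff; simp\<close>)
      then show "h = Pi_transpose E f z x k"
        using h by (simp add: eps Pi_transpose_def \<Phi>_def)
    qed
  qed (use y e in auto)
qed

text \<open>Universal arrows chosen one object at a time assemble into a right adjoint;
  functoriality and naturality follow from the uniqueness of transposes, here
  \<open>tr_eqI\<close>.\<close>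

lemma exponentiableI:
  assumes f: "f \<in> Arr E" and ex: "\<And>x. x \<in> Arr E \<Longrightarrow> Cod E x = Dom E f \<Longrightarrow> \<exists>y e. is_Pi E f x y e"
  shows "exponentiable E f"
proof -
  obtain Y e where P: "\<And>x. x \<in> Arr E \<Longrightarrow> Cod E x = Dom E f \<Longrightarrow> is_Pi E f x (Y x) (e x)"
    using ex by metis
  have Y: "Y x \<in> Arr E" "Cod E (Y x) = Cod E f" "e x \<in> Arr E" "Dom E (e x) = pb E (Y x) f"
      "Cod E (e x) = Dom E x" "x \<cdot> e x = pr2 E (Y x) f"
    if "x \<in> Arr E" "Cod E x = Dom E f" for x
    using P[OF that] by (auto simp: is_Pi_def)
  define tr where "tr z x k = (SOME h. h \<in> Arr E \<and> Dom E h = Dom E z \<and> Cod E h = Dom E (Y x) \<and> Y x \<cdot> h = z \<and>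
    (\<forall>s b. s \<in> Arr E \<longrightarrow> b \<in> Arr E \<longrightarrow> Dom E s = Dom E b \<longrightarrow> Cod E s = Dom E z \<longrightarrow> Cod E b = Dom E f \<longrightarrow>
      z \<cdot> s = f \<cdot> b \<longrightarrow> e x \<cdot> pbpair E (Y x) f (h \<cdot> s) b = k \<cdot> pbpair E z f s b))" for z x k
  have tr: "tr z x k \<in> Arr E" "Dom E (tr z x k) = Dom E z" "Cod E (tr z x k) = Dom E (Y x)"
      "Y x \<cdot> tr z x k = z"
      "\<And>s b. \<lbrakk>s \<in> Arr E; b \<in> Arr E; Dom E s = Dom E b; Cod E s = Dom E z; Cod E b = Dom E f;
        z \<cdot> s = f \<cdot> b\<rbrakk> \<Longrightarrow> e x \<cdot> pbpair E (Y x) f (tr z x k \<cdot> s) b = k \<cdot> pbpair E z f s b"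
    if "x \<in> Arr E" "Cod E x = Dom E f" "z \<in> Arr E" "Cod E z = Cod E f" "k \<in> Arr E"
      "Dom E k = pb E z f" "Cod E k = Dom E x" "x \<cdot> k = pr2 E z f" for x z k
  proof -
    have "\<exists>h. h \<in> Arr E \<and> Dom E h = Dom E z \<and> Cod E h = Dom E (Y x) \<and> Y x \<cdot> h = z \<and>
      (\<forall>s b. s \<in> Arr E \<longrightarrow> b \<in> Arr E \<longrightarrow> Dom E s = Dom E b \<longrightarrow> Cod E s = Dom E z \<longrightarrow> Cod E b = Dom E f \<longrightarrow>
        z \<cdot> s = f \<cdot> b \<longrightarrow> e x \<cdot> pbpair E (Y x) f (h \<cdot> s) b = k \<cdot> pbpair E z f s b)"
      by (rule is_Pi_transpose[OF P f, of x z k]) (use that in auto)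
    from someI_ex[OF this, folded tr_def]
    show "tr z x k \<in> Arr E" "Dom E (tr z x k) = Dom E z" "Cod E (tr z x k) = Dom E (Y x)"
      "Y x \<cdot> tr z x k = z"
      "\<And>s b. \<lbrakk>s \<in> Arr E; b \<in> Arr E; Dom E s = Dom E b; Cod E s = Dom E z; Cod E b = Dom E f;
        z \<cdot> s = f \<cdot> b\<rbrakk> \<Longrightarrow> e x \<cdot> pbpair E (Y x) f (tr z x k \<cdot> s) b = k \<cdot> pbpair E z f s b"
      by blast+
  qed
  have tr_eqI: "tr z x k = h"
    if x: "x \<in> Arr E" "Cod E x = Dom E f" and z: "z \<in> Arr E" "Cod E z = Cod E f" and k: "k \<in> Arr E"
      "Dom E k = pb E z f" "Cod E k = Dom E x" "x \<cdot> k = pr2 E z f"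
      and h: "h \<in> Arr E" "Dom E h = Dom E z" "Cod E h = Dom E (Y x)" "Y x \<cdot> h = z"
      and eq: "\<And>s b. \<lbrakk>s \<in> Arr E; b \<in> Arr E; Dom E s = Dom E b; Cod E s = Dom E z; Cod E b = Dom E f;
        z \<cdot> s = f \<cdot> b; Y x \<cdot> (h \<cdot> s) = f \<cdot> b\<rbrakk> \<Longrightarrow> e x \<cdot> pbpair E (Y x) f (h \<cdot> s) b = k \<cdot> pbpair E z f s b"
    for x z k h
  proof (rule is_Pi_eqI[OF P[OF x] f x])
    note t = tr[OF x z k]
    show "tr z x k \<in> Arr E" "h \<in> Arr E" "Dom E (tr z x k) = Dom E h"
      "Cod E (tr z x k) = Dom E (Y x)" "Cod E h = Dom E (Y x)" "Y x \<cdot> tr z x k = Y x \<cdot> h"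
      using t h by simp_all
    fix s b assume s: "s \<in> Arr E" "b \<in> Arr E" "Dom E s = Dom E b" "Cod E s = Dom E (tr z x k)"
      "Cod E b = Dom E f" "Y x \<cdot> (tr z x k \<cdot> s) = f \<cdot> b" "Y x \<cdot> (h \<cdot> s) = f \<cdot> b"
    have s': "Cod E s = Dom E z" using s(4) t by simp
    have zs: "z \<cdot> s = f \<cdot> b"
      using comp_assoc[of s h "Y x"] s(1,7) s' h Y[OF x] by simp
    show "e x \<cdot> pbpair E (Y x) f (tr z x k \<cdot> s) b = e x \<cdot> pbpair E (Y x) f (h \<cdot> s) b"
      using t(5)[OF s(1-3) s' s(5) zs] eq[OF s(1-3) s' s(5) zs s(7)] by simp
  qed
  \<comment> \<open>On arrows the functor transposes \<open>g\<close> composed with the counit, so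
    it acts on a section by applying \<open>g\<close> to the values. That is the content of
    \<open>trge\<close>.\<close>
  define R :: "('a, 'a \<times> 'a \<times> 'a, 'a, 'a \<times> 'a \<times> 'a) func" where
    "R = \<lparr>fobj = Y, farr = (\<lambda>(x, g, x'). (Y x, tr (Y x) x' (g \<cdot> e x), Y x'))\<rparr>"
  define \<Phi> :: "'a \<Rightarrow> 'a \<Rightarrow> 'a \<times> 'a \<times> 'a \<Rightarrow> 'a \<times> 'a \<times> 'a" where
    "\<Phi> z x = (\<lambda>(w, k, w'). (z, tr z x k, Y x))" for z x
  have app: "x \<cdot> (e x \<cdot> pbpair E (Y x) f s b) = b"
    if "x \<in> Arr E" "Cod E x = Dom E f" "s \<in> Arr E" "b \<in> Arr E" "Dom E s = Dom E b"
      "Cod E s = Dom E (Y x)" "Cod E b = Dom E f" "Y x \<cdot> s = f \<cdot> b" for x s b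
    using is_Pi_app[OF P f, of x s b] that by simp
  have ge: "g \<cdot> e x \<in> Arr E" "Dom E (g \<cdot> e x) = pb E (Y x) f" "Cod E (g \<cdot> e x) = Dom E x'"
      "x' \<cdot> (g \<cdot> e x) = pr2 E (Y x) f"
    if "x \<in> Arr E" "Cod E x = Dom E f" "x' \<in> Arr E" "Cod E x' = Dom E f" "g \<in> Arr E" "Dom E g = Dom E x"
      "Cod E g = Dom E x'" "x' \<cdot> g = x" for x x' g
    using comp_assoc[of "e x" g x'] Y[OF that(1,2)] that by simp_all
  have trge: "e x' \<cdot> pbpair E (Y x') f (tr (Y x) x' (g \<cdot> e x) \<cdot> s) b = g \<cdot> (e x \<cdot> pbpair E (Y x) f s b)"
    if x: "x \<in> Arr E" "Cod E x = Dom E f" "x' \<in> Arr E" "Cod E x' = Dom E f" "g \<in> Arr E" "Dom E g = Dom E x"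
      "Cod E g = Dom E x'" "x' \<cdot> g = x"
      and s: "s \<in> Arr E" "b \<in> Arr E" "Dom E s = Dom E b"
      "Cod E s = Dom E (Y x)" "Cod E b = Dom E f" "Y x \<cdot> s = f \<cdot> b" for x x' g s b
    using tr(5)[OF x(3,4) Y(1,2)[OF x(1,2)] ge[OF x] s] Y[OF x(1,2)] x(1-7) s f by simp
  have "is_functor (slice E (Dom E f)) (slice E (Cod E f)) R"
    unfolding is_functor_def
  proof (intro conjI category_slice allI ballI)
    show "fobj R x \<in> Obj (slice E (Cod E f))" if "x \<in> Obj (slice E (Dom E f))" for x
      using that Y by (simp add: R_def)
    show "farr R t \<in> Hom (slice E (Cod E f)) (fobj R x) (fobj R x')"
      if "t \<in> Hom (slice E (Dom E f)) x x'" for t x x'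
      using that
    proof (rule slice_HomE)
      fix g assume g: "t = (x, g, x')" "x \<in> Arr E" "Cod E x = Dom E f" "x' \<in> Arr E" "Cod E x' = Dom E f"
        "g \<in> Arr E" "Dom E g = Dom E x" "Cod E g = Dom E x'" "x' \<cdot> g = x"
      show ?thesis
        unfolding Hom_slice R_def using tr(1-4)[OF g(4,5) Y(1,2)[OF g(2,3)] ge[OF g(2-9)]] g(1) Y[OF g(2,3)] Y[OF g(4,5)]
        by simp
    qed
    show "farr R (Ide (slice E (Dom E f)) x) = Ide (slice E (Cod E f)) (fobj R x)"
      if "x \<in> Obj (slice E (Dom E f))" for x
    proof -
      have x: "x \<in> Arr E" "Cod E x = Dom E f" using that by auto
      have "tr (Y x) x (e x) = Ide E (Dom E (Y x))"
        by (rule tr_eqI) (use x Y[OF x] f in simp_all)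
      then show ?thesis using x Y[OF x] by (simp add: R_def)
    qed
    show "farr R (Comp (slice E (Dom E f)) t' t) = Comp (slice E (Cod E f)) (farr R t') (farr R t)"
      if t: "t \<in> Hom (slice E (Dom E f)) x x'" "t' \<in> Hom (slice E (Dom E f)) x' x''" for t t' x x' x''
      using t
    proof (elim slice_HomE)
      fix g g' assume g: "t = (x, g, x')" "t' = (x', g', x'')" "x \<in> Arr E" "Cod E x = Dom E f"
        "x' \<in> Arr E" "Cod E x' = Dom E f" "g \<in> Arr E" "Dom E g = Dom E x" "Cod E g = Dom E x'" "x' \<cdot> g = x"
        "x'' \<in> Arr E" "Cod E x'' = Dom E f" "g' \<in> Arr E" "Dom E g' = Dom E x'" "Cod E g' = Dom E x''" "x'' \<cdot> g' = x'"
      have g1: "x'' \<cdot> (g' \<cdot> g) = x"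
        using comp_assoc[of g g' x''] g by simp
      note ge1 = ge[OF g(3-10)] and ge2 = ge[OF g(5,6) g(11-16)]
      have ge3: "g' \<cdot> (g \<cdot> e x) \<in> Arr E" "Dom E (g' \<cdot> (g \<cdot> e x)) = pb E (Y x) f"
        "Cod E (g' \<cdot> (g \<cdot> e x)) = Dom E x''" "x'' \<cdot> (g' \<cdot> (g \<cdot> e x)) = pr2 E (Y x) f"
        using ge[of x x'' "g' \<cdot> g"] g(3-9) g(11-15) g1 Y[OF g(3,4)] by simp_all
      note t1 = tr(1-4)[OF g(5,6) Y(1,2)[OF g(3,4)] ge1]
      note t2 = tr(1-4)[OF g(11,12) Y(1,2)[OF g(5,6)] ge2]
      have "tr (Y x) x'' (g' \<cdot> (g \<cdot> e x)) = tr (Y x') x'' (g' \<cdot> e x') \<cdot> tr (Y x) x' (g \<cdot> e x)"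
      proof (rule tr_eqI)
        show "Y x'' \<cdot> (tr (Y x') x'' (g' \<cdot> e x') \<cdot> tr (Y x) x' (g \<cdot> e x)) = Y x"
          using comp_assoc[of "tr (Y x) x' (g \<cdot> e x)" "tr (Y x') x'' (g' \<cdot> e x')" "Y x''"] t1 t2 Y[OF g(11,12)] by simp
        fix s b assume s: "s \<in> Arr E" "b \<in> Arr E" "Dom E s = Dom E b" "Cod E s = Dom E (Y x)" "Cod E b = Dom E f"
          "Y x \<cdot> s = f \<cdot> b"
        have sq: "Y x' \<cdot> (tr (Y x) x' (g \<cdot> e x) \<cdot> s) = f \<cdot> b"
          using comp_assoc[of s "tr (Y x) x' (g \<cdot> e x)" "Y x'"] t1 s Y[OF g(5,6)] by simp
        have "e x'' \<cdot> pbpair E (Y x'') f (tr (Y x') x'' (g' \<cdot> e x') \<cdot> (tr (Y x) x' (g \<cdot> e x) \<cdot> s)) b =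
            g' \<cdot> (e x' \<cdot> pbpair E (Y x') f (tr (Y x) x' (g \<cdot> e x) \<cdot> s) b)"
          by (rule trge) (use g(3-16) s t1 sq in simp_all)
        also have "\<dots> = g' \<cdot> (g \<cdot> (e x \<cdot> pbpair E (Y x) f s b))"
          using trge[OF g(3-10) s] by simp
        finally show "e x'' \<cdot> pbpair E (Y x'') f ((tr (Y x') x'' (g' \<cdot> e x') \<cdot> tr (Y x) x' (g \<cdot> e x)) \<cdot> s) b =
            (g' \<cdot> (g \<cdot> e x)) \<cdot> pbpair E (Y x) f s b"
          using s t1 t2 Y[OF g(3,4)] g(3-9) g(11-15) f by simp
      qed (use t1 t2 ge3 Y[OF g(3,4)] g in simp_all)
      then show ?thesis
        using g(1,2) g(3-9) g(11-15) Y[OF g(3,4)] by (simp add: R_def)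
    qed
  qed
  moreover have "bij_betw (\<Phi> z x) (Hom (slice E (Dom E f)) (fobj (Delta E f) z) x)
      (Hom (slice E (Cod E f)) z (fobj R x))"
    if z: "z \<in> Obj (slice E (Cod E f))" and x: "x \<in> Obj (slice E (Dom E f))" for z x
  proof -
    \<comment> \<open>The inverse bijection: \<open>h\<close> is sent to its map of values, taken at
      the generic element.\<close>
    define \<Psi> where "\<Psi> = (\<lambda>(w::'a, h, w'::'a). (pr2 E z f, e x \<cdot> pbpair E (Y x) f (h \<cdot> pr1 E z f) (pr2 E z f), x))"
    have z: "z \<in> Arr E" "Cod E z = Cod E f" and x: "x \<in> Arr E" "Cod E x = Dom E f"
      using z x by auto
    note Yx = Y[OF x]
    show ?thesis
    proof (rule bij_betw_byWitness[where f' = \<Psi>]; (intro ballI image_subsetI)?)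
      fix t assume "t \<in> Hom (slice E (Dom E f)) (fobj (Delta E f) z) x"
      then obtain k where k: "t = (pr2 E z f, k, x)" "k \<in> Arr E" "Dom E k = pb E z f" "Cod E k = Dom E x"
        "x \<cdot> k = pr2 E z f"
        using z f by (elim slice_HomE) auto
      note t = tr[OF x z k(2-5)]
      show "\<Psi> (\<Phi> z x t) = t"
        using t(5)[of "pr1 E z f" "pr2 E z f"] k z f pb_square(1)[of z f] by (simp add: \<Phi>_def \<Psi>_def)
      show "\<Phi> z x t \<in> Hom (slice E (Cod E f)) z (fobj R x)"
        unfolding Hom_slice using t(1-4) k z Yx by (simp add: \<Phi>_def R_def)
    next
      fix t assume "t \<in> Hom (slice E (Cod E f)) z (fobj R x)"
      then obtain h where h: "t = (z, h, Y x)" "h \<in> Arr E" "Dom E h = Dom E z" "Cod E h = Dom E (Y x)"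
        "Y x \<cdot> h = z"
        by (elim slice_HomE) (auto simp: R_def)
      have sq: "Y x \<cdot> (h \<cdot> pr1 E z f) = f \<cdot> pr2 E z f"
        using slice_square[OF f, of z "Y x" h] h Yx z by simp
      show "\<Phi> z x (\<Psi> t) = t"
        unfolding h \<Phi>_def \<Psi>_def prod.case prod.inject
      proof (intro conjI refl, rule tr_eqI)
        show "x \<cdot> (e x \<cdot> pbpair E (Y x) f (h \<cdot> pr1 E z f) (pr2 E z f)) = pr2 E z f"
          by (rule app) (use sq h(2-4) Yx x z f in simp_all)
      qed (use sq h(2-5) Yx x z f in simp_all)
      have "x \<cdot> (e x \<cdot> pbpair E (Y x) f (h \<cdot> pr1 E z f) (pr2 E z f)) = pr2 E z f"
        by (rule app) (use sq h(2-4) Yx x z f in simp_all)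
      then show "\<Psi> t \<in> Hom (slice E (Dom E f)) (fobj (Delta E f) z) x"
        unfolding Hom_slice h \<Psi>_def using sq h(2-4) Yx x z f by simp
    qed
  qed
  moreover have "\<Phi> z' x' (Comp (slice E (Dom E f)) (Comp (slice E (Dom E f)) g k) (farr (Delta E f) h)) =
      Comp (slice E (Cod E f)) (Comp (slice E (Cod E f)) (farr R g) (\<Phi> z x k)) h"
    if h: "h \<in> Hom (slice E (Cod E f)) z' z" and g: "g \<in> Hom (slice E (Dom E f)) x x'"
      and k: "k \<in> Hom (slice E (Dom E f)) (fobj (Delta E f) z) x" for z' z x x' h g k
  proof -
    obtain h0 where h0: "h = (z', h0, z)" "z' \<in> Arr E" "Cod E z' = Cod E f" "z \<in> Arr E" "Cod E z = Cod E f"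
      "h0 \<in> Arr E" "Dom E h0 = Dom E z'" "Cod E h0 = Dom E z" "z \<cdot> h0 = z'"
      using h by (elim slice_HomE)
    obtain g0 where g0: "g = (x, g0, x')" "x \<in> Arr E" "Cod E x = Dom E f" "x' \<in> Arr E" "Cod E x' = Dom E f"
      "g0 \<in> Arr E" "Dom E g0 = Dom E x" "Cod E g0 = Dom E x'" "x' \<cdot> g0 = x"
      using g by (elim slice_HomE)
    obtain k0 where k0: "k = (pr2 E z f, k0, x)" "k0 \<in> Arr E" "Dom E k0 = pb E z f" "Cod E k0 = Dom E x"
        "x \<cdot> k0 = pr2 E z f"
      using k f h0 by (elim slice_HomE) auto
    note ge1 = ge[OF g0(2-9)]
    note t1 = tr[OF g0(2,3) h0(4,5) k0(2-5)]
    note t2 = tr(1-4)[OF g0(4,5) Y(1,2)[OF g0(2,3)] ge1]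
    have sq: "z \<cdot> (h0 \<cdot> pr1 E z' f) = f \<cdot> pr2 E z' f"
      using slice_square[OF f, of z' z h0] h0 by simp
    let ?k = "(g0 \<cdot> k0) \<cdot> pbpair E z f (h0 \<cdot> pr1 E z' f) (pr2 E z' f)"
    have "x' \<cdot> ?k = (x \<cdot> k0) \<cdot> pbpair E z f (h0 \<cdot> pr1 E z' f) (pr2 E z' f)"
      using g0(2-8) k0(2-4) sq h0(2-8) f
        comp_assoc[of "k0 \<cdot> pbpair E z f (h0 \<cdot> pr1 E z' f) (pr2 E z' f)" g0 x', unfolded g0(9)] by simp
    then have k: "x' \<cdot> ?k = pr2 E z' f"
      unfolding k0(5) using sq h0(2-8) f by simp
    have "tr z' x' ?k = (tr (Y x) x' (g0 \<cdot> e x) \<cdot> tr z x k0) \<cdot> h0"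
    proof (rule tr_eqI)
      show "Y x' \<cdot> ((tr (Y x) x' (g0 \<cdot> e x) \<cdot> tr z x k0) \<cdot> h0) = z'"
      proof -
        have "Y x' \<cdot> ((tr (Y x) x' (g0 \<cdot> e x) \<cdot> tr z x k0) \<cdot> h0) =
            ((Y x' \<cdot> tr (Y x) x' (g0 \<cdot> e x)) \<cdot> tr z x k0) \<cdot> h0"
          using t1(1-3) t2(1-3) h0(2-8) Y[OF g0(4,5)] Y[OF g0(2,3)] by simp
        then show ?thesis by (simp only: t2(4) t1(4) h0(9))
      qed
      fix s b assume s: "s \<in> Arr E" "b \<in> Arr E" "Dom E s = Dom E b" "Cod E s = Dom E z'" "Cod E b = Dom E f"
          "z' \<cdot> s = f \<cdot> b"
      have zs: "z \<cdot> (h0 \<cdot> s) = f \<cdot> b"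
        using comp_assoc[of s h0 z] s h0 by simp
      have Ys: "Y x \<cdot> (tr z x k0 \<cdot> (h0 \<cdot> s)) = f \<cdot> b"
        using comp_assoc[of "h0 \<cdot> s" "tr z x k0" "Y x"] zs t1(1-4) s h0 Y[OF g0(2,3)] by simp
      have "e x' \<cdot> pbpair E (Y x') f (tr (Y x) x' (g0 \<cdot> e x) \<cdot> (tr z x k0 \<cdot> (h0 \<cdot> s))) b =
          g0 \<cdot> (e x \<cdot> pbpair E (Y x) f (tr z x k0 \<cdot> (h0 \<cdot> s)) b)"
        by (rule trge[OF g0(2-9)]) (use s(1-5) h0(2-8) t1(1-3) Ys in simp_all)
      also have "e x \<cdot> pbpair E (Y x) f (tr z x k0 \<cdot> (h0 \<cdot> s)) b = k0 \<cdot> pbpair E z f (h0 \<cdot> s) b"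
        by (rule t1(5)) (use s(1-5) h0(2-8) zs in simp_all)
      finally show "e x' \<cdot> pbpair E (Y x') f (((tr (Y x) x' (g0 \<cdot> e x) \<cdot> tr z x k0) \<cdot> h0) \<cdot> s) b =
          ?k \<cdot> pbpair E z' f s b"
        using s h0(2-8) t1(1-3) t2(1-3) k0(2-4) g0(2-8) f sq zs by simp
    qed (use k h0(2-8) g0(2-8) k0(2-4) t1(1-3) t2(1-3) sq f in \<open>simp_all del: comp_assoc\<close>)
    then show ?thesis
      unfolding h0(1) g0(1) k0(1) by (simp add: R_def \<Phi>_def del: comp_assoc)
  qed
  ultimately have "adjunction (slice E (Cod E f)) (slice E (Dom E f)) (Delta E f) R \<Phi>"
    unfolding adjunction_def using functor_Delta[OF f] by blast
  then show ?thesis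
    using f unfolding exponentiable_def has_right_adjoint_def by blast
qed

section \<open>Stability of exponentiable maps\<close>

lemma exponentiable_arr [simp]: "exponentiable E f \<Longrightarrow> f \<in> Arr E"
  by (simp add: exponentiable_def)

lemma exponentiable_bang: "a \<in> Obj E \<Longrightarrow> exponentiable E (bang E a)"
  by (rule exponentiableI) (use is_Pi_bang in auto)

lemma exponentiable_comp:
  assumes f: "exponentiable E f" and g: "exponentiable E g" and gf: "Cod E g = Dom E f"
  shows "exponentiable E (f \<cdot> g)"
proof (rule exponentiableI)
  fix x assume x: "x \<in> Arr E" "Cod E x = Dom E (f \<cdot> g)"
  have x': "Cod E x = Dom E g" using x f g gf by simp
  note P1 = is_Pi_Pi[OF g x(1) x']
  show "\<exists>y e. is_Pi E (f \<cdot> g) x y e"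
    using is_Pi_comp[OF _ _ gf x(1) x' P1 is_Pi_Pi[OF f]] is_Pi_simps[OF P1] f g gf by auto
qed (use f g gf in simp)

lemma exponentiable_pullback:
  assumes f: "exponentiable E f" and a: "a \<in> Arr E" "Cod E a = Cod E f" and pb: "is_pullback E a f f' b"
  shows "exponentiable E f'"
proof (rule exponentiableI)
  have b: "b \<in> Arr E" "Dom E b = Dom E f'" "Cod E b = Dom E f" and f': "f' \<in> Arr E"
    using pb by (auto simp: is_pullback_def)
  then show "f' \<in> Arr E" by simp
  fix x assume x: "x \<in> Arr E" "Cod E x = Dom E f'"
  show "\<exists>y e. is_Pi E f' x y e"
    by (rule is_Pi_pullback[OF pb _ a x is_Pi_Pi[OF f] is_Pi_Pi[OF f]]) (use f x b in simp_all)
qed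

text \<open>The product of \<open>f\<close> with an object is the pullback of \<open>f\<close> along
  the projection that forgets this object.\<close>

lemma exponentiable_prodmap_left:
  assumes f: "exponentiable E f" and c: "c \<in> Obj E"
  shows "exponentiable E (prodmap E f (Ide E c))"
proof (rule exponentiable_pullback[OF f])
  show "is_pullback E (p1 E (Cod E f) c) f (prodmap E f (Ide E c)) (p1 E (Dom E f) c)"
    unfolding is_pullback_def
  proof (intro conjI allI ballI impI)
    fix d s t
    assume "s \<in> Hom E d (Dom E (p1 E (Cod E f) c))" "t \<in> Hom E d (Dom E f)"
      and eq: "p1 E (Cod E f) c \<cdot> s = f \<cdot> t"
    then have s: "s \<in> Arr E" "Dom E s = d" "Cod E s = prd E (Cod E f) c" and t: "t \<in> Arr E" "Dom E t = d" "Cod E t = Dom E f"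
      using f c by auto
    obtain s1 s2 where s12: "s = pair E s1 s2" "s1 \<in> Arr E" "s2 \<in> Arr E" "Dom E s1 = d" "Dom E s2 = d"
      "Cod E s1 = Cod E f" "Cod E s2 = c"
      by (rule prod_elim[of s d "Cod E f" c]) (use s f c in auto)
    show "\<exists>!h. h \<in> Hom E d (Dom E (prodmap E f (Ide E c))) \<and> prodmap E f (Ide E c) \<cdot> h = s \<and> p1 E (Dom E f) c \<cdot> h = t"
    proof (rule ex1I[of _ "pair E t s2"])
      show "pair E t s2 \<in> Hom E d (Dom E (prodmap E f (Ide E c))) \<and> prodmap E f (Ide E c) \<cdot> pair E t s2 = s \<and>
          p1 E (Dom E f) c \<cdot> pair E t s2 = t"
        using eq t s12(2-7) f c by (simp add: s12(1))
      fix h assume h: "h \<in> Hom E d (Dom E (prodmap E f (Ide E c))) \<and> prodmap E f (Ide E c) \<cdot> h = s \<and> p1 E (Dom E f) c \<cdot> h = t"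
      then have "p2 E (Cod E f) c \<cdot> (prodmap E f (Ide E c) \<cdot> h) = p2 E (Cod E f) c \<cdot> s" by simp
      then have "p2 E (Dom E f) c \<cdot> h = s2"
        using conjunct1[OF h] f c s12(2-7) by (simp add: s12(1))
      moreover have "pair E (p1 E (Dom E f) c \<cdot> h) (p2 E (Dom E f) c \<cdot> h) = h"
        by (rule pair_eta(1)) (use h f c in simp_all)
      ultimately show "h = pair E t s2" using h by simp
    qed
  qed (use f c in simp_all)
qed (use f c in simp_all)

lemma exponentiable_prodmap_right:
  assumes f: "exponentiable E f" and c: "c \<in> Obj E"
  shows "exponentiable E (prodmap E (Ide E c) f)"
proof (rule exponentiable_pullback[OF f])
  show "is_pullback E (p2 E c (Cod E f)) f (prodmap E (Ide E c) f) (p2 E c (Dom E f))"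
    unfolding is_pullback_def
  proof (intro conjI allI ballI impI)
    fix d s t
    assume "s \<in> Hom E d (Dom E (p2 E c (Cod E f)))" "t \<in> Hom E d (Dom E f)"
      and eq: "p2 E c (Cod E f) \<cdot> s = f \<cdot> t"
    then have s: "s \<in> Arr E" "Dom E s = d" "Cod E s = prd E c (Cod E f)" and t: "t \<in> Arr E" "Dom E t = d" "Cod E t = Dom E f"
      using f c by auto
    obtain s1 s2 where s12: "s = pair E s1 s2" "s1 \<in> Arr E" "s2 \<in> Arr E" "Dom E s1 = d" "Dom E s2 = d"
      "Cod E s1 = c" "Cod E s2 = Cod E f"
      by (rule prod_elim[of s d c "Cod E f"]) (use s f c in auto)
    show "\<exists>!h. h \<in> Hom E d (Dom E (prodmap E (Ide E c) f)) \<and> prodmap E (Ide E c) f \<cdot> h = s \<and> p2 E c (Dom E f) \<cdot> h = t"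
    proof (rule ex1I[of _ "pair E s1 t"])
      show "pair E s1 t \<in> Hom E d (Dom E (prodmap E (Ide E c) f)) \<and> prodmap E (Ide E c) f \<cdot> pair E s1 t = s \<and>
          p2 E c (Dom E f) \<cdot> pair E s1 t = t"
        using eq t s12(2-7) f c by (simp add: s12(1))
      fix h assume h: "h \<in> Hom E d (Dom E (prodmap E (Ide E c) f)) \<and> prodmap E (Ide E c) f \<cdot> h = s \<and> p2 E c (Dom E f) \<cdot> h = t"
      then have "p1 E c (Cod E f) \<cdot> (prodmap E (Ide E c) f \<cdot> h) = p1 E c (Cod E f) \<cdot> s" by simp
      then have "p1 E c (Dom E f) \<cdot> h = s1"
        using conjunct1[OF h] f c s12(2-7) by (simp add: s12(1))
      moreover have "pair E (p1 E c (Dom E f) \<cdot> h) (p2 E c (Dom E f) \<cdot> h) = h"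
        by (rule pair_eta(1)) (use h f c in simp_all)
      ultimately show "h = pair E s1 t" using h by simp
    qed
  qed (use f c in simp_all)
qed (use f c in simp_all)

text \<open>Factor as a product of \<open>g\<close> with an identity, followed by a product of
  \<open>f\<close> with an identity.\<close>

lemma exponentiable_prodmap [simp]:
  assumes f: "exponentiable E f" and g: "exponentiable E g"
  shows "exponentiable E (prodmap E f g)"
proof -
  have "prodmap E f g = prodmap E f (Ide E (Cod E g)) \<cdot> prodmap E (Ide E (Dom E f)) g"
    using f g by (simp add: prodmap_def)
  then show ?thesis
    using exponentiable_comp[OF exponentiable_prodmap_left[OF f, of "Cod E g"]
        exponentiable_prodmap_right[OF g, of "Dom E f"]] f g by simp
qed

text \<open>The product of \<open>c\<close> and \<open>a\<close> is the pullback of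
  \<open>bang E a\<close> along \<open>bang E c\<close>. This makes \<open>Pi\<close> available
  along the projection from \<open>Q\<^sup>P \<times> P\<close>, and it also covers one of the two
  factors of \<open>[p, q]\<close>.\<close>

lemma exponentiable_proj1:
  assumes a: "a \<in> Obj E" and c: "c \<in> Obj E"
  shows "exponentiable E (p1 E c a)"
proof (rule exponentiable_pullback[OF exponentiable_bang[OF a], of "bang E c"])
  show "is_pullback E (bang E c) (bang E a) (p1 E c a) (p2 E c a)"
    unfolding is_pullback_def
  proof (intro conjI allI ballI impI)
    fix d s t assume st: "s \<in> Hom E d (Dom E (bang E c))" "t \<in> Hom E d (Dom E (bang E a))"
    show "\<exists>!h. h \<in> Hom E d (Dom E (p1 E c a)) \<and> p1 E c a \<cdot> h = s \<and> p2 E c a \<cdot> h = t"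
    proof (rule ex1I[of _ "pair E s t"])
      fix h assume h: "h \<in> Hom E d (Dom E (p1 E c a)) \<and> p1 E c a \<cdot> h = s \<and> p2 E c a \<cdot> h = t"
      then have "pair E (p1 E c a \<cdot> h) (p2 E c a \<cdot> h) = h"
        using a c by (intro pair_eta(1)) simp_all
      with h show "h = pair E s t" by simp
    qed (use st a c in simp)
  qed (use a c in simp_all)
qed (use a c in simp_all)

text \<open>\<open>pr2 E f a\<close> is the pullback of \<open>f\<close> along \<open>a\<close>; the
  two chosen projections enter \<open>is_pullback\<close> in exchanged order.\<close>

lemma exponentiable_pr2:
  assumes f: "exponentiable E f" and a: "a \<in> Arr E" "Cod E a = Cod E f"
  shows "exponentiable E (pr2 E f a)"
proof (rule exponentiable_pullback[OF f a])
  have f': "f \<in> Arr E" using f by simp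
  show "is_pullback E a f (pr2 E f a) (pr1 E f a)"
    unfolding is_pullback_def
  proof (intro conjI allI ballI impI)
    fix d s t assume st: "s \<in> Hom E d (Dom E a)" "t \<in> Hom E d (Dom E f)" "a \<cdot> s = f \<cdot> t"
    show "\<exists>!h. h \<in> Hom E d (Dom E (pr2 E f a)) \<and> pr2 E f a \<cdot> h = s \<and> pr1 E f a \<cdot> h = t"
    proof (rule ex1I[of _ "pbpair E f a t s"])
      fix h assume h: "h \<in> Hom E d (Dom E (pr2 E f a)) \<and> pr2 E f a \<cdot> h = s \<and> pr1 E f a \<cdot> h = t"
      then have "pbpair E f a (pr1 E f a \<cdot> h) (pr2 E f a \<cdot> h) = h"
        using f' a by (intro pbpair_eta(1)) simp_all
      with h show "h = pbpair E f a t s" by simp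
    qed (use st f' a in simp)
  qed (use f' a pb_square(1)[of f a] in simp_all)
qed

end

section \<open>Polynomials\<close>

lemma Poly_simps [simp]:
  "Obj (Poly E) = {p. exponentiable E p}" "Dom (Poly E) = pdom" "Cod (Poly E) = pcod"
  "Ide (Poly E) = poly_id E" "Comp (Poly E) = poly_comp E"
  by (simp_all add: Poly_def)

text \<open>\<open>sh E \<phi> s t\<close> is \<open>\<phi>\<^sup>\<sharp>(s, t)\<close> for generalised elements \<open>s\<close> of \<open>P\<close> and \<open>t\<close> of \<open>Q\<^sub>*\<close> over the same
  element of \<open>Q\<close>. In these terms \<open>(\<psi> \<circ> \<phi>)\<^sup>\<sharp>(s, t) = \<phi>\<^sup>\<sharp>(s, \<psi>\<^sup>\<sharp>(\<phi>\<^sub>1 s, t))\<close>, without any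
  canonical isomorphism of pullbacks.\<close>

definition sh :: "('o, 'a) cat \<Rightarrow> 'a poly_mor \<Rightarrow> 'a \<Rightarrow> 'a \<Rightarrow> 'a" where
  "sh E \<phi> s t = Comp E (sharp \<phi>) (pbpair E (base \<phi>) (pcod \<phi>) s t)"

context ccc
begin

section \<open>Morphisms of polynomials in terms of elements\<close>

lemma Arr_Poly_iff: "\<phi> \<in> Arr (Poly E) \<longleftrightarrow> exponentiable E (pdom \<phi>) \<and> exponentiable E (pcod \<phi>) \<and>
    base \<phi> \<in> Hom E (Cod E (pdom \<phi>)) (Cod E (pcod \<phi>)) \<and>
    sharp \<phi> \<in> Hom E (pb E (base \<phi>) (pcod \<phi>)) (Dom E (pdom \<phi>)) \<and>
    pdom \<phi> \<cdot> sharp \<phi> = pr1 E (base \<phi>) (pcod \<phi>)"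
  by (simp add: Poly_def)

lemma poly_arr [simp]:
  assumes "\<phi> \<in> Arr (Poly E)"
  shows "exponentiable E (pdom \<phi>)" "exponentiable E (pcod \<phi>)"
    "base \<phi> \<in> Arr E" "Dom E (base \<phi>) = Cod E (pdom \<phi>)" "Cod E (base \<phi>) = Cod E (pcod \<phi>)"
    "sharp \<phi> \<in> Arr E" "Dom E (sharp \<phi>) = pb E (base \<phi>) (pcod \<phi>)" "Cod E (sharp \<phi>) = Dom E (pdom \<phi>)"
  using assms unfolding Arr_Poly_iff by auto

lemma poly_arr_sharp: "\<phi> \<in> Arr (Poly E) \<Longrightarrow> pdom \<phi> \<cdot> sharp \<phi> = pr1 E (base \<phi>) (pcod \<phi>)"
  unfolding Arr_Poly_iff by blast

text \<open>The last clause is naturality in the common domain of \<open>s\<close> and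
  \<open>t\<close>: precomposition is pushed onto the elements, as it is for tuples.\<close>

lemma sh_simps [simp]:
  assumes "\<phi> \<in> Arr (Poly E)" "s \<in> Arr E" "t \<in> Arr E" "Dom E s = Dom E t"
    and "Cod E s = Cod E (pdom \<phi>)" "Cod E t = Dom E (pcod \<phi>)" "base \<phi> \<cdot> s = pcod \<phi> \<cdot> t"
  shows "sh E \<phi> s t \<in> Arr E" "Dom E (sh E \<phi> s t) = Dom E s" "Cod E (sh E \<phi> s t) = Dom E (pdom \<phi>)"
    "pdom \<phi> = p \<Longrightarrow> p \<cdot> sh E \<phi> s t = s"
    "h \<in> Arr E \<Longrightarrow> Cod E h = Dom E s \<Longrightarrow> sh E \<phi> s t \<cdot> h = sh E \<phi> (s \<cdot> h) (t \<cdot> h)"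
proof -
  have ar: "pdom \<phi> \<in> Arr E" "pcod \<phi> \<in> Arr E" using assms(1) by simp_all
  show "sh E \<phi> s t \<in> Arr E" "Dom E (sh E \<phi> s t) = Dom E s" "Cod E (sh E \<phi> s t) = Dom E (pdom \<phi>)"
    "h \<in> Arr E \<Longrightarrow> Cod E h = Dom E s \<Longrightarrow> sh E \<phi> s t \<cdot> h = sh E \<phi> (s \<cdot> h) (t \<cdot> h)"
    using assms ar by (simp_all add: sh_def)
  have "pdom \<phi> \<cdot> sh E \<phi> s t = (pdom \<phi> \<cdot> sharp \<phi>) \<cdot> pbpair E (base \<phi>) (pcod \<phi>) s t"
    using assms ar by (simp add: sh_def)
  also have "\<dots> = s"
    using assms ar by (simp add: poly_arr_sharp)
  finally show "p \<cdot> sh E \<phi> s t = s" if "pdom \<phi> = p" using that by simp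
qed

lemma sh_fold: "pcod \<phi> = q \<Longrightarrow> sharp \<phi> \<cdot> pbpair E (base \<phi>) q s t = sh E \<phi> s t"
  by (simp add: sh_def)

text \<open>The sharp map is its own value at the generic element, the pair of projections of the
  pullback on which it is defined.\<close>

lemma poly_eqI:
  assumes "\<phi> \<in> Arr (Poly E)" "\<psi> \<in> Arr (Poly E)" "pdom \<phi> = pdom \<psi>" "pcod \<phi> = pcod \<psi>"
    and "base \<phi> = base \<psi>"
    and "\<And>z s t. \<lbrakk>s \<in> Arr E; t \<in> Arr E; Dom E s = z; Dom E t = z; Cod E s = Cod E (pdom \<phi>);
      Cod E t = Dom E (pcod \<phi>); base \<phi> \<cdot> s = pcod \<phi> \<cdot> t\<rbrakk> \<Longrightarrow> sh E \<phi> s t = sh E \<psi> s t"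
  shows "\<phi> = \<psi>"
proof -
  have "pcod \<psi> \<in> Arr E" using assms(2) by simp
  then have "sharp \<phi> = sharp \<psi>"
    using assms(6)[of "pr1 E (base \<psi>) (pcod \<psi>)" "pr2 E (base \<psi>) (pcod \<psi>)"]
      assms(1-5) pb_square(1)[of "base \<psi>" "pcod \<psi>"] by (simp add: sh_def)
  then show ?thesis using assms(3-5) by (simp add: poly_mor.expand)
qed

text \<open>A Yoneda argument: the sharp map is \<open>\<sigma>\<close> at the generic element, and
  naturality recovers \<open>\<sigma> s t\<close> on precomposing with
  \<open>pbpair E b q s t\<close>. The morphisms constructed here all have the shape demanded of
  \<open>\<phi>\<close>, possibly after rewriting, so each is analysed by naming its
  \<open>\<sigma>\<close>.\<close>

lemma poly_mk:
  assumes p: "exponentiable E p" and q: "exponentiable E q"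
    and b: "b \<in> Arr E" "Dom E b = Cod E p" "Cod E b = Cod E q"
    and \<sigma>: "\<And>z s t. \<lbrakk>s \<in> Arr E; t \<in> Arr E; Dom E s = z; Dom E t = z; Cod E s = Cod E p; Cod E t = Dom E q;
      b \<cdot> s = q \<cdot> t\<rbrakk> \<Longrightarrow> \<sigma> s t \<in> Arr E \<and> Dom E (\<sigma> s t) = z \<and> Cod E (\<sigma> s t) = Dom E p \<and> p \<cdot> \<sigma> s t = s"
    and \<sigma>_comp: "\<And>z s t h. \<lbrakk>s \<in> Arr E; t \<in> Arr E; Dom E s = z; Dom E t = z; Cod E s = Cod E p;
      Cod E t = Dom E q; b \<cdot> s = q \<cdot> t; h \<in> Arr E; Cod E h = z\<rbrakk> \<Longrightarrow> \<sigma> s t \<cdot> h = \<sigma> (s \<cdot> h) (t \<cdot> h)"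
    and \<phi>: "\<phi> = PMor p q b (\<sigma> (pr1 E b q) (pr2 E b q))"
  shows "\<phi> \<in> Arr (Poly E)"
    and "\<lbrakk>s \<in> Arr E; t \<in> Arr E; Dom E s = Dom E t; Cod E s = Cod E p; Cod E t = Dom E q;
      b \<cdot> s = q \<cdot> t\<rbrakk> \<Longrightarrow> sh E \<phi> s t = \<sigma> s t"
proof -
  note sq = pb_square(1)[of b q]
  have 1: "\<sigma> (pr1 E b q) (pr2 E b q) \<in> Arr E" "Dom E (\<sigma> (pr1 E b q) (pr2 E b q)) = pb E b q"
    "Cod E (\<sigma> (pr1 E b q) (pr2 E b q)) = Dom E p" "p \<cdot> \<sigma> (pr1 E b q) (pr2 E b q) = pr1 E b q"
    using \<sigma>[of "pr1 E b q" "pr2 E b q" "pb E b q"] p q b sq by simp_all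
  then show "\<phi> \<in> Arr (Poly E)"
    unfolding Arr_Poly_iff \<phi> using p q b by simp
  show "\<lbrakk>s \<in> Arr E; t \<in> Arr E; Dom E s = Dom E t; Cod E s = Cod E p; Cod E t = Dom E q;
      b \<cdot> s = q \<cdot> t\<rbrakk> \<Longrightarrow> sh E \<phi> s t = \<sigma> s t"
    using \<sigma>_comp[of "pr1 E b q" "pr2 E b q" "pb E b q" "pbpair E b q s t"] sq q b by (simp add: \<phi> sh_def)
qed

lemma poly_of_iso_simps [simp]:
  "pdom (poly_of_iso E p q f g) = p" "pcod (poly_of_iso E p q f g) = q" "base (poly_of_iso E p q f g) = f"
  by (simp_all add: poly_of_iso_def)

text \<open>The family \<open>\<sigma> s t = g \<cdot> t\<close> does not look at \<open>s\<close>;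
  the last premise says that \<open>p\<close> recovers \<open>s\<close> from it.\<close>

lemma poly_of_iso:
  assumes "exponentiable E p" "exponentiable E q"
    and "f \<in> Arr E" "Dom E f = Cod E p" "Cod E f = Cod E q"
    and "g \<in> Arr E" "Dom E g = Dom E q" "Cod E g = Dom E p"
    and "\<And>z s t. \<lbrakk>s \<in> Arr E; t \<in> Arr E; Dom E s = z; Dom E t = z; Cod E s = Cod E p; Cod E t = Dom E q;
      f \<cdot> s = q \<cdot> t\<rbrakk> \<Longrightarrow> p \<cdot> (g \<cdot> t) = s"
  shows "poly_of_iso E p q f g \<in> Arr (Poly E)"
    and "\<lbrakk>s \<in> Arr E; t \<in> Arr E; Dom E s = Dom E t; Cod E s = Cod E p; Cod E t = Dom E q;
      f \<cdot> s = q \<cdot> t\<rbrakk> \<Longrightarrow> sh E (poly_of_iso E p q f g) s t = g \<cdot> t"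
proof -
  note mk = poly_mk[where \<sigma> = "\<lambda>s t. g \<cdot> t" and \<phi> = "poly_of_iso E p q f g" and b = f]
  show "poly_of_iso E p q f g \<in> Arr (Poly E)"
    by (rule mk(1)[of p q]) (use assms in \<open>simp_all add: poly_of_iso_def\<close>)
  show "sh E (poly_of_iso E p q f g) s t = g \<cdot> t"
    if "s \<in> Arr E" "t \<in> Arr E" "Dom E s = Dom E t" "Cod E s = Cod E p" "Cod E t = Dom E q" "f \<cdot> s = q \<cdot> t"
    by (rule mk(2)[of p q]) (use assms that in \<open>simp_all add: poly_of_iso_def\<close>)
qed

lemma poly_id_simps [simp]:
  "pdom (poly_id E p) = p" "pcod (poly_id E p) = p" "base (poly_id E p) = Ide E (Cod E p)"
  by (simp_all add: poly_id_def)

lemma poly_id [simp]: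
  assumes "exponentiable E p"
  shows "poly_id E p \<in> Arr (Poly E)"
    "\<lbrakk>s \<in> Arr E; t \<in> Arr E; Dom E s = Dom E t; Cod E s = Cod E p; Cod E t = Dom E p; s = p \<cdot> t\<rbrakk>
      \<Longrightarrow> sh E (poly_id E p) s t = t"
proof -
  have p: "p \<in> Arr E" using assms by simp
  note iso = poly_of_iso[of p p "Ide E (Cod E p)" "Ide E (Dom E p)", folded poly_id_def]
  show "poly_id E p \<in> Arr (Poly E)"
    by (rule iso(1)) (use assms p in auto)
  show "sh E (poly_id E p) s t = t" if "s \<in> Arr E" "t \<in> Arr E" "Dom E s = Dom E t"
    "Cod E s = Cod E p" "Cod E t = Dom E p" "s = p \<cdot> t"
    using iso(2)[of s t] assms p that by auto
qed

lemma poly_comp_simps [simp]: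
  "pdom (poly_comp E \<psi> \<phi>) = pdom \<phi>" "pcod (poly_comp E \<psi> \<phi>) = pcod \<psi>"
  "base (poly_comp E \<psi> \<phi>) = base \<psi> \<cdot> base \<phi>"
  by (simp_all add: poly_comp_def Let_def)

text \<open>The maps between pullbacks in the definition are \<open>pbpair\<close>s, so
  \<open>sh_fold\<close> exhibits it as the nested family of values at the generic element, and no
  comparison of pullbacks remains.\<close>

lemma poly_comp [simp]:
  assumes \<phi>: "\<phi> \<in> Arr (Poly E)" and \<psi>: "\<psi> \<in> Arr (Poly E)" and eq: "pcod \<phi> = pdom \<psi>"
  shows "poly_comp E \<psi> \<phi> \<in> Arr (Poly E)"
    "\<lbrakk>s \<in> Arr E; t \<in> Arr E; Dom E s = Dom E t; Cod E s = Cod E (pdom \<phi>); Cod E t = Dom E (pcod \<psi>);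
      base \<psi> \<cdot> (base \<phi> \<cdot> s) = pcod \<psi> \<cdot> t\<rbrakk>
      \<Longrightarrow> sh E (poly_comp E \<psi> \<phi>) s t = sh E \<phi> s (sh E \<psi> (base \<phi> \<cdot> s) t)"
proof -
  note mk = poly_mk[where \<sigma> = "\<lambda>s t. sh E \<phi> s (sh E \<psi> (base \<phi> \<cdot> s) t)" and \<phi> = "poly_comp E \<psi> \<phi>"
    and b = "base \<psi> \<cdot> base \<phi>" and p = "pdom \<phi>" and q = "pcod \<psi>"]
  have ar: "pdom \<phi> \<in> Arr E" "pcod \<phi> \<in> Arr E" "pdom \<psi> \<in> Arr E" "pcod \<psi> \<in> Arr E" "exponentiable E (pdom \<psi>)"
    using \<phi> \<psi> by simp_all
  show "poly_comp E \<psi> \<phi> \<in> Arr (Poly E)"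
    by (rule mk(1)) (use \<phi> \<psi> eq ar in \<open>simp_all add: poly_comp_def Let_def sh_fold\<close>)
  show "sh E (poly_comp E \<psi> \<phi>) s t = sh E \<phi> s (sh E \<psi> (base \<phi> \<cdot> s) t)"
    if "s \<in> Arr E" "t \<in> Arr E" "Dom E s = Dom E t" "Cod E s = Cod E (pdom \<phi>)" "Cod E t = Dom E (pcod \<psi>)"
      "base \<psi> \<cdot> (base \<phi> \<cdot> s) = pcod \<psi> \<cdot> t"
    by (rule mk(2)) (use \<phi> \<psi> eq ar that in \<open>simp_all add: poly_comp_def Let_def sh_fold\<close>)
qed

text \<open>By the element formula for \<open>poly_comp\<close> both bracketings of a triple
  composite unfold to the same nested substitution; the unit laws are substitutions of
  identities.\<close>

lemma category_Poly: "category (Poly E)"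
proof
  have "poly_comp E \<chi> (poly_comp E \<psi> \<phi>) = poly_comp E (poly_comp E \<chi> \<psi>) \<phi>" if "\<phi> \<in> Arr (Poly E)" "\<psi> \<in> Arr (Poly E)"
    "\<chi> \<in> Arr (Poly E)" "pcod \<phi> = pdom \<psi>" "pcod \<psi> = pdom \<chi>" for \<phi> \<psi> \<chi>
  proof -
    have [simp]: "exponentiable E (pdom \<phi>)" "exponentiable E (pdom \<psi>)" "exponentiable E (pdom \<chi>)"
      "exponentiable E (pcod \<chi>)" using that by simp_all
    show ?thesis
      by (rule poly_eqI) (use that in simp_all)
  qed
  then show "Comp (Poly E) \<chi> (Comp (Poly E) \<psi> \<phi>) = Comp (Poly E) (Comp (Poly E) \<chi> \<psi>) \<phi>"
    if "\<phi> \<in> Hom (Poly E) p q" "\<psi> \<in> Hom (Poly E) q r" "\<chi> \<in> Hom (Poly E) r r'" for \<phi> \<psi> \<chi> p q r r'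
    using that by simp
  show "Comp (Poly E) \<phi> (Ide (Poly E) p) = \<phi>" if "\<phi> \<in> Hom (Poly E) p q" for \<phi> p q
  proof -
    have [simp]: "exponentiable E p" "exponentiable E q" using that by auto
    show ?thesis
      by (rule poly_eqI) (use that in auto)
  qed
  show "Comp (Poly E) (Ide (Poly E) q) \<phi> = \<phi>" if "\<phi> \<in> Hom (Poly E) p q" for \<phi> p q
  proof -
    have [simp]: "exponentiable E p" "exponentiable E q" using that by auto
    show ?thesis
      by (rule poly_eqI) (use that in auto)
  qed
qed auto

section \<open>The tensor product\<close>

lemma poly_tensor_simps [simp]:
  "pdom (poly_tensor_mor E \<phi> \<psi>) = prodmap E (pdom \<phi>) (pdom \<psi>)"
  "pcod (poly_tensor_mor E \<phi> \<psi>) = prodmap E (pcod \<phi>) (pcod \<psi>)"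
  "base (poly_tensor_mor E \<phi> \<psi>) = prodmap E (base \<phi>) (base \<psi>)"
  by (simp_all add: poly_tensor_mor_def Let_def)

lemma poly_tensor [simp]:
  assumes \<phi>: "\<phi> \<in> Arr (Poly E)" and \<psi>: "\<psi> \<in> Arr (Poly E)"
  shows "poly_tensor_mor E \<phi> \<psi> \<in> Arr (Poly E)"
    "\<lbrakk>s \<in> Arr E; s' \<in> Arr E; t \<in> Arr E; t' \<in> Arr E; Dom E s = Dom E t; Dom E s' = Dom E t; Dom E t' = Dom E t;
      Cod E s = Cod E (pdom \<phi>); Cod E t = Dom E (pcod \<phi>); Cod E s' = Cod E (pdom \<psi>); Cod E t' = Dom E (pcod \<psi>);
      base \<phi> \<cdot> s = pcod \<phi> \<cdot> t; base \<psi> \<cdot> s' = pcod \<psi> \<cdot> t'\<rbrakk>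
      \<Longrightarrow> sh E (poly_tensor_mor E \<phi> \<psi>) (pair E s s') (pair E t t') = pair E (sh E \<phi> s t) (sh E \<psi> s' t')"
proof -
  let ?p = "pdom \<phi>" and ?p' = "pdom \<psi>" and ?q = "pcod \<phi>" and ?q' = "pcod \<psi>"
  let ?b = "prodmap E (base \<phi>) (base \<psi>)" and ?qq = "prodmap E ?q ?q'"
  \<comment> \<open>Written with projections, since the family must be given on all elements of the
    products; on pairs it becomes the componentwise formula.\<close>
  let ?\<sigma> = "\<lambda>s t. pair E (sh E \<phi> (p1 E (Cod E ?p) (Cod E ?p') \<cdot> s) (p1 E (Dom E ?q) (Dom E ?q') \<cdot> t))
    (sh E \<psi> (p2 E (Cod E ?p) (Cod E ?p') \<cdot> s) (p2 E (Dom E ?q) (Dom E ?q') \<cdot> t))"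
  have ar: "?p \<in> Arr E" "?p' \<in> Arr E" "?q \<in> Arr E" "?q' \<in> Arr E"
    using \<phi> \<psi> by simp_all
  have "poly_tensor_mor E \<phi> \<psi> = PMor (prodmap E ?p ?p') ?qq ?b (?\<sigma> (pr1 E ?b ?qq) (pr2 E ?b ?qq))"
  proof -
    define u v where uv: "u = pr1 E ?b ?qq" "v = pr2 E ?b ?qq"
    have "u \<in> Arr E" "v \<in> Arr E" "Dom E u = Dom E v" "Cod E u = prd E (Cod E ?p) (Cod E ?p')"
      "Cod E v = prd E (Dom E ?q) (Dom E ?q')" "?b \<cdot> u = ?qq \<cdot> v"
      using pb_square(1)[of ?b ?qq] \<phi> \<psi> ar by (simp_all add: uv del: prodmap_comp)
    then show ?thesis
      unfolding poly_tensor_mor_def Let_def uv[symmetric] using \<phi> \<psi> ar by (simp add: sh_def)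
  qed
  note mk = poly_mk[where \<sigma> = ?\<sigma>, OF _ _ _ _ _ _ _ this]
  show "poly_tensor_mor E \<phi> \<psi> \<in> Arr (Poly E)"
    by (rule mk(1)) (use \<phi> \<psi> ar in simp_all)
  show "sh E (poly_tensor_mor E \<phi> \<psi>) (pair E s s') (pair E t t') = pair E (sh E \<phi> s t) (sh E \<psi> s' t')"
    if st: "s \<in> Arr E" "s' \<in> Arr E" "t \<in> Arr E" "t' \<in> Arr E" "Dom E s = Dom E t" "Dom E s' = Dom E t" "Dom E t' = Dom E t"
      "Cod E s = Cod E (pdom \<phi>)" "Cod E t = Dom E (pcod \<phi>)" "Cod E s' = Cod E (pdom \<psi>)" "Cod E t' = Dom E (pcod \<psi>)"
      "base \<phi> \<cdot> s = pcod \<phi> \<cdot> t" "base \<psi> \<cdot> s' = pcod \<psi> \<cdot> t'"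
  proof -
    have "sh E (poly_tensor_mor E \<phi> \<psi>) (pair E s s') (pair E t t') = ?\<sigma> (pair E s s') (pair E t t')"
      by (rule mk(2)) (use \<phi> \<psi> ar st in simp_all)
    then show ?thesis using st ar by simp
  qed
qed

end

section \<open>Opposite and product categories\<close>

lemma op_cat_simps [simp]:
  "Obj (op_cat C) = Obj C" "Arr (op_cat C) = Arr C" "Dom (op_cat C) = Cod C" "Cod (op_cat C) = Dom C"
  "Ide (op_cat C) = Ide C" "Comp (op_cat C) g f = Comp C f g"
  by (simp_all add: op_cat_def)

lemma prod_cat_simps [simp]:
  "Obj (prod_cat C D) = Obj C \<times> Obj D" "Arr (prod_cat C D) = Arr C \<times> Arr D"
  "Dom (prod_cat C D) (f, g) = (Dom C f, Dom D g)" "Cod (prod_cat C D) (f, g) = (Cod C f, Cod D g)"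
  "Ide (prod_cat C D) (a, b) = (Ide C a, Ide D b)"
  "Comp (prod_cat C D) (f', g') (f, g) = (Comp C f' f, Comp D g' g)"
  by (simp_all add: prod_cat_def)

lemma (in category) category_op: "category (op_cat C)"
  by unfold_locales auto

lemma category_prod:
  assumes "category C" "category D"
  shows "category (prod_cat C D)"
proof -
  interpret C: category C by fact
  interpret D: category D by fact
  show ?thesis
    by unfold_locales auto
qed

context ccc
begin

section \<open>Associator and unitors\<close>

lemma prod_assoc_simps [simp]:
  assumes "a \<in> Obj E" "b \<in> Obj E" "c \<in> Obj E"
  shows "prod_assoc E a b c \<in> Arr E" "Dom E (prod_assoc E a b c) = prd E (prd E a b) c"
    "Cod E (prod_assoc E a b c) = prd E a (prd E b c)"
    "\<lbrakk>x \<in> Arr E; y \<in> Arr E; z \<in> Arr E; Dom E x = Dom E y; Dom E z = Dom E y;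
      Cod E x = a; Cod E y = b; Cod E z = c\<rbrakk>
      \<Longrightarrow> prod_assoc E a b c \<cdot> pair E (pair E x y) z = pair E x (pair E y z)"
  using assms by (simp_all add: prod_assoc_def)

lemma prod_assoc_inv_simps [simp]:
  assumes "a \<in> Obj E" "b \<in> Obj E" "c \<in> Obj E"
  shows "prod_assoc_inv E a b c \<in> Arr E" "Dom E (prod_assoc_inv E a b c) = prd E a (prd E b c)"
    "Cod E (prod_assoc_inv E a b c) = prd E (prd E a b) c"
    "\<lbrakk>x \<in> Arr E; y \<in> Arr E; z \<in> Arr E; Dom E x = Dom E y; Dom E z = Dom E y;
      Cod E x = a; Cod E y = b; Cod E z = c\<rbrakk>
      \<Longrightarrow> prod_assoc_inv E a b c \<cdot> pair E x (pair E y z) = pair E (pair E x y) z"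
  using assms by (simp_all add: prod_assoc_inv_def)

lemma prod3_elim:
  assumes "x \<in> Arr E" "Dom E x = d" "Cod E x = prd E (prd E a b) c" "a \<in> Obj E" "b \<in> Obj E" "c \<in> Obj E"
  obtains u v w where "x = pair E (pair E u v) w" "u \<in> Arr E" "v \<in> Arr E" "w \<in> Arr E"
    "Dom E u = d" "Dom E v = d" "Dom E w = d" "Cod E u = a" "Cod E v = b" "Cod E w = c"
proof -
  obtain uv w where 1: "x = pair E uv w" "uv \<in> Arr E" "w \<in> Arr E" "Dom E uv = d" "Dom E w = d"
    "Cod E uv = prd E a b" "Cod E w = c"
    by (rule prod_elim[OF assms(1-3)]) (use assms in simp_all)
  obtain u v where "uv = pair E u v" "u \<in> Arr E" "v \<in> Arr E" "Dom E u = d" "Dom E v = d"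
    "Cod E u = a" "Cod E v = b"
    by (rule prod_elim[OF 1(2,4,6)]) (use assms in simp_all)
  with 1 that show ?thesis by blast
qed

lemma prod3_elim':
  assumes "x \<in> Arr E" "Dom E x = d" "Cod E x = prd E a (prd E b c)" "a \<in> Obj E" "b \<in> Obj E" "c \<in> Obj E"
  obtains u v w where "x = pair E u (pair E v w)" "u \<in> Arr E" "v \<in> Arr E" "w \<in> Arr E"
    "Dom E u = d" "Dom E v = d" "Dom E w = d" "Cod E u = a" "Cod E v = b" "Cod E w = c"
proof -
  obtain u vw where 1: "x = pair E u vw" "u \<in> Arr E" "vw \<in> Arr E" "Dom E u = d" "Dom E vw = d"
    "Cod E u = a" "Cod E vw = prd E b c"
    by (rule prod_elim[OF assms(1-3)]) (use assms in simp_all)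
  obtain v w where "vw = pair E v w" "v \<in> Arr E" "w \<in> Arr E" "Dom E v = d" "Dom E w = d"
    "Cod E v = b" "Cod E w = c"
    by (rule prod_elim[OF 1(3,5,7)]) (use assms in simp_all)
  with 1 that show ?thesis by blast
qed

text \<open>Stated for all elements, although the identity would do, so that an element of a product
  can be split into a tuple before both sides are computed.\<close>

lemma arr_eqI:
  assumes "f \<in> Arr E" "g \<in> Arr E" "Dom E f = a" "Dom E g = a"
    and "\<And>d x. x \<in> Arr E \<Longrightarrow> Dom E x = d \<Longrightarrow> Cod E x = a \<Longrightarrow> f \<cdot> x = g \<cdot> x"
  shows "f = g"
  using assms(5)[of "Ide E a" a] assms(1-4) by auto

lemma poly_assoc_simps [simp]:
  "pdom (poly_assoc E p q r) = prodmap E (prodmap E p q) r"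
  "pcod (poly_assoc E p q r) = prodmap E p (prodmap E q r)"
  "base (poly_assoc E p q r) = prod_assoc E (Cod E p) (Cod E q) (Cod E r)"
  by (simp_all add: poly_assoc_def)

text \<open>The base map is invertible, hence \<open>s\<close> is determined by \<open>x\<close>,
  \<open>y\<close> and \<open>z\<close>; the last premise expresses this directly instead of through
  \<open>prod_assoc\<close>.\<close>

lemma poly_assoc [simp]:
  assumes p: "exponentiable E p" and q: "exponentiable E q" and r: "exponentiable E r"
  shows "poly_assoc E p q r \<in> Arr (Poly E)"
    "\<lbrakk>s \<in> Arr E; Cod E s = prd E (prd E (Cod E p) (Cod E q)) (Cod E r);
      x \<in> Arr E; y \<in> Arr E; z \<in> Arr E; Dom E x = Dom E s; Dom E y = Dom E s; Dom E z = Dom E s;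
      Cod E x = Dom E p; Cod E y = Dom E q; Cod E z = Dom E r;
      s = pair E (pair E (p \<cdot> x) (q \<cdot> y)) (r \<cdot> z)\<rbrakk>
      \<Longrightarrow> sh E (poly_assoc E p q r) s (pair E x (pair E y z)) = pair E (pair E x y) z"
proof -
  have ar: "p \<in> Arr E" "q \<in> Arr E" "r \<in> Arr E" using p q r by simp_all
  note iso = poly_of_iso[of "prodmap E (prodmap E p q) r" "prodmap E p (prodmap E q r)"
    "prod_assoc E (Cod E p) (Cod E q) (Cod E r)" "prod_assoc_inv E (Dom E p) (Dom E q) (Dom E r)",
    folded poly_assoc_def]
  have 1: "prodmap E (prodmap E p q) r \<cdot> (prod_assoc_inv E (Dom E p) (Dom E q) (Dom E r) \<cdot> t) = s"
    if st: "s \<in> Arr E" "t \<in> Arr E" "Dom E s = d" "Dom E t = d" "Cod E s = Cod E (prodmap E (prodmap E p q) r)"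
      "Cod E t = Dom E (prodmap E p (prodmap E q r))"
      "prod_assoc E (Cod E p) (Cod E q) (Cod E r) \<cdot> s = prodmap E p (prodmap E q r) \<cdot> t" for s t d
  proof -
    obtain s1 s2 s3 where s: "s = pair E (pair E s1 s2) s3" "s1 \<in> Arr E" "s2 \<in> Arr E" "s3 \<in> Arr E"
      "Dom E s1 = d" "Dom E s2 = d" "Dom E s3 = d" "Cod E s1 = Cod E p" "Cod E s2 = Cod E q" "Cod E s3 = Cod E r"
      by (rule prod3_elim[of s d "Cod E p" "Cod E q" "Cod E r"]) (use st ar in simp_all)
    obtain t1 t2 t3 where t: "t = pair E t1 (pair E t2 t3)" "t1 \<in> Arr E" "t2 \<in> Arr E" "t3 \<in> Arr E"
      "Dom E t1 = d" "Dom E t2 = d" "Dom E t3 = d" "Cod E t1 = Dom E p" "Cod E t2 = Dom E q" "Cod E t3 = Dom E r"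
      by (rule prod3_elim'[of t d "Dom E p" "Dom E q" "Dom E r"]) (use st ar in simp_all)
    show ?thesis
      using st(7) s(2-) t(2-) ar by (simp add: s(1) t(1))
  qed
  show "poly_assoc E p q r \<in> Arr (Poly E)"
    by (rule iso(1)) (use p q r ar 1 in simp_all)
  show "sh E (poly_assoc E p q r) s (pair E x (pair E y z)) = pair E (pair E x y) z"
    if "s \<in> Arr E" "Cod E s = prd E (prd E (Cod E p) (Cod E q)) (Cod E r)"
      "x \<in> Arr E" "y \<in> Arr E" "z \<in> Arr E" "Dom E x = Dom E s" "Dom E y = Dom E s" "Dom E z = Dom E s"
      "Cod E x = Dom E p" "Cod E y = Dom E q" "Cod E z = Dom E r"
      "s = pair E (pair E (p \<cdot> x) (q \<cdot> y)) (r \<cdot> z)"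
  proof -
    have "sh E (poly_assoc E p q r) s (pair E x (pair E y z)) =
        prod_assoc_inv E (Dom E p) (Dom E q) (Dom E r) \<cdot> pair E x (pair E y z)"
    proof (rule iso(2))
      show "prod_assoc E (Cod E p) (Cod E q) (Cod E r) \<cdot> s = prodmap E p (prodmap E q r) \<cdot> pair E x (pair E y z)"
        unfolding that(12) using that(3-11) ar by simp
    qed (use that(1-11) p q r ar 1 in simp_all)
    then show ?thesis using that(1-11) ar by simp
  qed
qed

text \<open>The identity of the terminal object is its map to the terminal object. Hence the
  monoidal unit is a polynomial.\<close>

lemma exponentiable_ide_one [simp]: "exponentiable E (Ide E (one E))"
  using exponentiable_bang[of "one E"] bang_unique[of "Ide E (one E)" "one E"] by simp

lemma poly_lunit_simps [simp]:
  "pdom (poly_lunit E p) = prodmap E (Ide E (one E)) p" "pcod (poly_lunit E p) = p"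
  "base (poly_lunit E p) = p2 E (one E) (Cod E p)"
  by (simp_all add: poly_lunit_def)

lemma poly_lunit [simp]:
  assumes p: "exponentiable E p"
  shows "poly_lunit E p \<in> Arr (Poly E)"
    "\<lbrakk>s \<in> Arr E; t \<in> Arr E; Dom E s = Dom E t; Cod E s = prd E (one E) (Cod E p); Cod E t = Dom E p;
      p2 E (one E) (Cod E p) \<cdot> s = p \<cdot> t\<rbrakk> \<Longrightarrow> sh E (poly_lunit E p) s t = pair E (bang E (Dom E t)) t"
proof -
  have ar: "p \<in> Arr E" using p by simp
  note iso = poly_of_iso[of "prodmap E (Ide E (one E)) p" p "p2 E (one E) (Cod E p)"
    "pair E (bang E (Dom E p)) (Ide E (Dom E p))", folded poly_lunit_def]
  have 1: "prodmap E (Ide E (one E)) p \<cdot> (pair E (bang E (Dom E p)) (Ide E (Dom E p)) \<cdot> t) = s"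
    if st: "s \<in> Arr E" "t \<in> Arr E" "Dom E s = d" "Dom E t = d" "Cod E s = Cod E (prodmap E (Ide E (one E)) p)"
      "Cod E t = Dom E p" "p2 E (one E) (Cod E p) \<cdot> s = p \<cdot> t" for s t d
  proof -
    obtain s1 s2 where s: "s = pair E s1 s2" "s1 \<in> Arr E" "s2 \<in> Arr E" "Dom E s1 = d" "Dom E s2 = d"
      "Cod E s1 = one E" "Cod E s2 = Cod E p"
      by (rule prod_elim[of s d "one E" "Cod E p"]) (use st ar in simp_all)
    \<comment> \<open>A component in the terminal object carries no information; writing it as
      \<open>bang\<close> lets both sides be compared.\<close>
    have "s1 = bang E d" by (rule bang_unique) (use s in simp_all)
    then show ?thesis
      using st(7) s(2-) st(2,4,6) ar by (simp add: s(1))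
  qed
  show "poly_lunit E p \<in> Arr (Poly E)"
    by (rule iso(1)) (use p ar 1 in simp_all)
  show "sh E (poly_lunit E p) s t = pair E (bang E (Dom E t)) t"
    if "s \<in> Arr E" "t \<in> Arr E" "Dom E s = Dom E t" "Cod E s = prd E (one E) (Cod E p)" "Cod E t = Dom E p"
      "p2 E (one E) (Cod E p) \<cdot> s = p \<cdot> t"
  proof -
    have "sh E (poly_lunit E p) s t = pair E (bang E (Dom E p)) (Ide E (Dom E p)) \<cdot> t"
      by (rule iso(2)) (use p ar 1 that in simp_all)
    then show ?thesis using that ar by simp
  qed
qed

lemma poly_runit_simps [simp]:
  "pdom (poly_runit E p) = prodmap E p (Ide E (one E))" "pcod (poly_runit E p) = p"
  "base (poly_runit E p) = p1 E (Cod E p) (one E)"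
  by (simp_all add: poly_runit_def)

lemma poly_runit [simp]:
  assumes p: "exponentiable E p"
  shows "poly_runit E p \<in> Arr (Poly E)"
    "\<lbrakk>s \<in> Arr E; t \<in> Arr E; Dom E s = Dom E t; Cod E s = prd E (Cod E p) (one E); Cod E t = Dom E p;
      p1 E (Cod E p) (one E) \<cdot> s = p \<cdot> t\<rbrakk> \<Longrightarrow> sh E (poly_runit E p) s t = pair E t (bang E (Dom E t))"
proof -
  have ar: "p \<in> Arr E" using p by simp
  note iso = poly_of_iso[of "prodmap E p (Ide E (one E))" p "p1 E (Cod E p) (one E)"
    "pair E (Ide E (Dom E p)) (bang E (Dom E p))", folded poly_runit_def]
  have 1: "prodmap E p (Ide E (one E)) \<cdot> (pair E (Ide E (Dom E p)) (bang E (Dom E p)) \<cdot> t) = s"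
    if st: "s \<in> Arr E" "t \<in> Arr E" "Dom E s = d" "Dom E t = d" "Cod E s = Cod E (prodmap E p (Ide E (one E)))"
      "Cod E t = Dom E p" "p1 E (Cod E p) (one E) \<cdot> s = p \<cdot> t" for s t d
  proof -
    obtain s1 s2 where s: "s = pair E s1 s2" "s1 \<in> Arr E" "s2 \<in> Arr E" "Dom E s1 = d" "Dom E s2 = d"
      "Cod E s1 = Cod E p" "Cod E s2 = one E"
      by (rule prod_elim[of s d "Cod E p" "one E"]) (use st ar in simp_all)
    have "s2 = bang E d" by (rule bang_unique) (use s in simp_all)
    then show ?thesis
      using st(7) s(2-) st(2,4,6) ar by (simp add: s(1))
  qed
  show "poly_runit E p \<in> Arr (Poly E)"
    by (rule iso(1)) (use p ar 1 in simp_all)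
  show "sh E (poly_runit E p) s t = pair E t (bang E (Dom E t))"
    if "s \<in> Arr E" "t \<in> Arr E" "Dom E s = Dom E t" "Cod E s = prd E (Cod E p) (one E)" "Cod E t = Dom E p"
      "p1 E (Cod E p) (one E) \<cdot> s = p \<cdot> t"
  proof -
    have "sh E (poly_runit E p) s t = pair E (Ide E (Dom E p)) (bang E (Dom E p)) \<cdot> t"
      by (rule iso(2)) (use p ar 1 that in simp_all)
    then show ?thesis using that ar by simp
  qed
qed

text \<open>The inverse is induced by \<open>f'\<close> and \<open>g'\<close> in the opposite
  direction. The square \<open>eq\<close> shows that both induced families lie over the right
  elements, and the four inverse laws cancel the two composites.\<close>

lemma iso_poly_of_iso:
  assumes p: "exponentiable E p" and q: "exponentiable E q"
    and f: "f \<in> Hom E (Cod E p) (Cod E q)" and f': "f' \<in> Hom E (Cod E q) (Cod E p)"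
      "f' \<cdot> f = Ide E (Cod E p)" "f \<cdot> f' = Ide E (Cod E q)"
    and g: "g \<in> Hom E (Dom E q) (Dom E p)" and g': "g' \<in> Hom E (Dom E p) (Dom E q)"
      "g' \<cdot> g = Ide E (Dom E q)" "g \<cdot> g' = Ide E (Dom E p)"
    and eq: "f \<cdot> p = q \<cdot> g'"
  shows "iso (Poly E) (poly_of_iso E p q f g)"
proof -
  have ar: "p \<in> Arr E" "q \<in> Arr E" using p q by simp_all
  have ff: "f' \<cdot> (f \<cdot> h) = h" if "h \<in> Arr E" "Cod E h = Cod E p" for h
    using comp_assoc[of h f f'] f f' that by simp
  have ff': "f \<cdot> (f' \<cdot> h) = h" if "h \<in> Arr E" "Cod E h = Cod E q" for h
    using comp_assoc[of h f' f] f f' that by simp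
  have gg: "g' \<cdot> (g \<cdot> h) = h" if "h \<in> Arr E" "Cod E h = Dom E q" for h
    using comp_assoc[of h g g'] g g' that by simp
  have gg': "g \<cdot> (g' \<cdot> h) = h" if "h \<in> Arr E" "Cod E h = Dom E p" for h
    using comp_assoc[of h g' g] g g' that by simp
  have pg: "f \<cdot> (p \<cdot> h) = q \<cdot> (g' \<cdot> h)" if "h \<in> Arr E" "Cod E h = Dom E p" for h
    by (rule comp_eq_comp) (use eq ar f g' that in simp_all)
  \<comment> \<open>As \<open>f\<close> is invertible, it is enough to compare after applying
    \<open>f\<close>, where \<open>eq\<close> can be used.\<close>
  have 1: "p \<cdot> (g \<cdot> t) = s"
    if "s \<in> Arr E" "t \<in> Arr E" "Dom E s = d" "Dom E t = d" "Cod E s = Cod E p" "Cod E t = Dom E q"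
      "f \<cdot> s = q \<cdot> t" for s t d
  proof -
    have "p \<cdot> (g \<cdot> t) = f' \<cdot> (f \<cdot> (p \<cdot> (g \<cdot> t)))"
      using ff[of "p \<cdot> (g \<cdot> t)"] that ar g by simp
    also have "f \<cdot> (p \<cdot> (g \<cdot> t)) = f \<cdot> s"
      using pg[of "g \<cdot> t"] gg[of t] that ar g by simp
    also have "f' \<cdot> \<dots> = s" by (rule ff[OF that(1,5)])
    finally show ?thesis .
  qed
  have 2: "q \<cdot> (g' \<cdot> t) = s"
    if "s \<in> Arr E" "t \<in> Arr E" "Dom E s = d" "Dom E t = d" "Cod E s = Cod E q" "Cod E t = Dom E p"
      "f' \<cdot> s = p \<cdot> t" for s t d
    using pg[of t] that(2,6) ff'[of s] that(1,5) unfolding that(7)[symmetric] by simp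
  note i1 = poly_of_iso[of p q f g] and i2 = poly_of_iso[of q p f' g']
  have a1: "poly_of_iso E p q f g \<in> Arr (Poly E)"
    by (rule i1(1)) (use p q f g 1 in simp_all)
  have a2: "poly_of_iso E q p f' g' \<in> Arr (Poly E)"
    by (rule i2(1)) (use p q f' g' 2 in simp_all)
  have s1: "sh E (poly_of_iso E p q f g) s t = g \<cdot> t"
    if "s \<in> Arr E" "t \<in> Arr E" "Dom E s = Dom E t" "Cod E s = Cod E p" "Cod E t = Dom E q" "f \<cdot> s = q \<cdot> t" for s t
    by (rule i1(2)) (use p q f g 1 that in simp_all)
  have s2: "sh E (poly_of_iso E q p f' g') s t = g' \<cdot> t"
    if "s \<in> Arr E" "t \<in> Arr E" "Dom E s = Dom E t" "Cod E s = Cod E q" "Cod E t = Dom E p" "f' \<cdot> s = p \<cdot> t" for s t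
    by (rule i2(2)) (use p q f' g' 2 that in simp_all)
  have "poly_comp E (poly_of_iso E q p f' g') (poly_of_iso E p q f g) = poly_id E p"
  proof (rule poly_eqI)
    fix d s t assume "s \<in> Arr E" "t \<in> Arr E" "Dom E s = d" "Dom E t = d"
      "Cod E s = Cod E (pdom (poly_comp E (poly_of_iso E q p f' g') (poly_of_iso E p q f g)))"
      "Cod E t = Dom E (pcod (poly_comp E (poly_of_iso E q p f' g') (poly_of_iso E p q f g)))"
      "base (poly_comp E (poly_of_iso E q p f' g') (poly_of_iso E p q f g)) \<cdot> s =
        pcod (poly_comp E (poly_of_iso E q p f' g') (poly_of_iso E p q f g)) \<cdot> t"
    then have st: "s \<in> Arr E" "t \<in> Arr E" "Dom E s = d" "Dom E t = d" "Cod E s = Cod E p" "Cod E t = Dom E p"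
      "s = p \<cdot> t"
      using f' p by simp_all
    have "f \<cdot> s = q \<cdot> (g' \<cdot> t)" using pg[of t] st by simp
    then show "sh E (poly_comp E (poly_of_iso E q p f' g') (poly_of_iso E p q f g)) s t = sh E (poly_id E p) s t"
      using st(1-6) st(7)[symmetric] p a1 a2 f f'(1) g'(1) ff[of s] gg'[of t] ar by (simp add: s1 s2)
  qed (use a1 a2 p q f' in simp_all)
  moreover have "poly_comp E (poly_of_iso E p q f g) (poly_of_iso E q p f' g') = poly_id E q"
  proof (rule poly_eqI)
    fix d s t assume "s \<in> Arr E" "t \<in> Arr E" "Dom E s = d" "Dom E t = d"
      "Cod E s = Cod E (pdom (poly_comp E (poly_of_iso E p q f g) (poly_of_iso E q p f' g')))"
      "Cod E t = Dom E (pcod (poly_comp E (poly_of_iso E p q f g) (poly_of_iso E q p f' g')))"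
      "base (poly_comp E (poly_of_iso E p q f g) (poly_of_iso E q p f' g')) \<cdot> s =
        pcod (poly_comp E (poly_of_iso E p q f g) (poly_of_iso E q p f' g')) \<cdot> t"
    then have st: "s \<in> Arr E" "t \<in> Arr E" "Dom E s = d" "Dom E t = d" "Cod E s = Cod E q" "Cod E t = Dom E q"
      "s = q \<cdot> t"
      using f' q by simp_all
    have "p \<cdot> (g \<cdot> t) = f' \<cdot> s"
      by (rule 1[of _ _ d]) (use st f' ff' in simp_all)
    then show "sh E (poly_comp E (poly_of_iso E p q f g) (poly_of_iso E q p f' g')) s t = sh E (poly_id E q) s t"
      using st(1-6) st(7)[symmetric] q a1 a2 f f'(1) g ff'[of s] gg[of t] ar by (simp add: s1 s2)
  qed (use a1 a2 p q f' in simp_all)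
  ultimately show ?thesis
    unfolding iso_def using a1 a2 by (auto intro!: exI[of _ "poly_of_iso E q p f' g'"])
qed

lemma iso_poly_assoc:
  assumes p: "exponentiable E p" and q: "exponentiable E q" and r: "exponentiable E r"
  shows "iso (Poly E) (poly_assoc E p q r)"
proof -
  have inv: "prod_assoc_inv E a b c \<cdot> prod_assoc E a b c = Ide E (prd E (prd E a b) c)"
    "prod_assoc E a b c \<cdot> prod_assoc_inv E a b c = Ide E (prd E a (prd E b c))"
    if abc: "a \<in> Obj E" "b \<in> Obj E" "c \<in> Obj E" for a b c
  proof -
    show "prod_assoc_inv E a b c \<cdot> prod_assoc E a b c = Ide E (prd E (prd E a b) c)"
    proof (rule arr_eqI)
      fix d x assume x: "x \<in> Arr E" "Dom E x = d" "Cod E x = prd E (prd E a b) c"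
      show "(prod_assoc_inv E a b c \<cdot> prod_assoc E a b c) \<cdot> x = Ide E (prd E (prd E a b) c) \<cdot> x"
        by (rule prod3_elim[OF x abc]) (use abc in simp)
    qed (use abc in simp_all)
    show "prod_assoc E a b c \<cdot> prod_assoc_inv E a b c = Ide E (prd E a (prd E b c))"
    proof (rule arr_eqI)
      fix d x assume x: "x \<in> Arr E" "Dom E x = d" "Cod E x = prd E a (prd E b c)"
      show "(prod_assoc E a b c \<cdot> prod_assoc_inv E a b c) \<cdot> x = Ide E (prd E a (prd E b c)) \<cdot> x"
        by (rule prod3_elim'[OF x abc]) (use abc in simp)
    qed (use abc in simp_all)
  qed
  have ar: "p \<in> Arr E" "q \<in> Arr E" "r \<in> Arr E" using p q r by simp_all
  show ?thesis
    unfolding poly_assoc_def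
  proof (rule iso_poly_of_iso[where f' = "prod_assoc_inv E (Cod E p) (Cod E q) (Cod E r)"
        and g' = "prod_assoc E (Dom E p) (Dom E q) (Dom E r)"])
    show "prod_assoc E (Cod E p) (Cod E q) (Cod E r) \<cdot> prodmap E (prodmap E p q) r =
        prodmap E p (prodmap E q r) \<cdot> prod_assoc E (Dom E p) (Dom E q) (Dom E r)"
    proof (rule arr_eqI)
      fix d x assume x: "x \<in> Arr E" "Dom E x = d" "Cod E x = prd E (prd E (Dom E p) (Dom E q)) (Dom E r)"
      show "(prod_assoc E (Cod E p) (Cod E q) (Cod E r) \<cdot> prodmap E (prodmap E p q) r) \<cdot> x =
          (prodmap E p (prodmap E q r) \<cdot> prod_assoc E (Dom E p) (Dom E q) (Dom E r)) \<cdot> x"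
        by (rule prod3_elim[OF x]) (use ar in simp_all)
    qed (use ar in simp_all)
  qed (use p q r ar inv in simp_all)
qed

lemma iso_poly_lunit:
  assumes p: "exponentiable E p"
  shows "iso (Poly E) (poly_lunit E p)"
proof -
  have ar: "p \<in> Arr E" using p by simp
  have inv: "pair E (bang E a) (Ide E a) \<cdot> p2 E (one E) a = Ide E (prd E (one E) a)" if "a \<in> Obj E" for a
    by (rule prod_eqI[of _ _ "one E" a]) (use that in \<open>simp_all add: to_one_eq\<close>)
  show ?thesis
    unfolding poly_lunit_def
    by (rule iso_poly_of_iso[where f' = "pair E (bang E (Cod E p)) (Ide E (Cod E p))"
          and g' = "p2 E (one E) (Dom E p)"]) (use p ar inv in simp_all)
qed

lemma iso_poly_runit:
  assumes p: "exponentiable E p"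
  shows "iso (Poly E) (poly_runit E p)"
proof -
  have ar: "p \<in> Arr E" using p by simp
  have inv: "pair E (Ide E a) (bang E a) \<cdot> p1 E a (one E) = Ide E (prd E a (one E))" if "a \<in> Obj E" for a
    by (rule prod_eqI[of _ _ a "one E"]) (use that in \<open>simp_all add: to_one_eq\<close>)
  show ?thesis
    unfolding poly_runit_def
    by (rule iso_poly_of_iso[where f' = "pair E (Ide E (Cod E p)) (bang E (Cod E p))"
          and g' = "p1 E (Dom E p) (one E)"]) (use p ar inv in simp_all)
qed

section \<open>The monoidal axioms\<close>

lemma functor_tensor:
  "is_functor (prod_cat (Poly E) (Poly E)) (Poly E) (Mtensor (Poly_moncat E))"
  unfolding is_functor_def
proof (intro conjI allI ballI category_prod category_Poly)
  note M = Poly_moncat_def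
  show "fobj (Mtensor (Poly_moncat E)) a \<in> Obj (Poly E)" if "a \<in> Obj (prod_cat (Poly E) (Poly E))" for a
    using that by (auto simp: M)
  show "farr (Mtensor (Poly_moncat E)) f \<in> Hom (Poly E) (fobj (Mtensor (Poly_moncat E)) a) (fobj (Mtensor (Poly_moncat E)) b)"
    if "f \<in> Hom (prod_cat (Poly E) (Poly E)) a b" for f a b
    using that by (cases f; cases a; cases b) (auto simp: M)
  show "farr (Mtensor (Poly_moncat E)) (Ide (prod_cat (Poly E) (Poly E)) a) = Ide (Poly E) (fobj (Mtensor (Poly_moncat E)) a)"
    if pq: "a \<in> Obj (prod_cat (Poly E) (Poly E))" for a
  proof -
    obtain p q where a: "a = (p, q)" "exponentiable E p" "exponentiable E q" using pq by auto
    have ar: "p \<in> Arr E" "q \<in> Arr E" using a by auto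
    have "poly_tensor_mor E (poly_id E p) (poly_id E q) = poly_id E (prodmap E p q)"
    proof (rule poly_eqI; (simp only: poly_tensor_simps poly_id_simps)?)
      fix d s t assume st: "s \<in> Arr E" "t \<in> Arr E" "Dom E s = d" "Dom E t = d" "Cod E s = Cod E (prodmap E p q)"
        "Cod E t = Dom E (prodmap E p q)"
        "prodmap E (Ide E (Cod E p)) (Ide E (Cod E q)) \<cdot> s = prodmap E p q \<cdot> t"
      have s: "s = prodmap E p q \<cdot> t" using st ar by simp
      obtain t1 t2 where t: "t = pair E t1 t2" "t1 \<in> Arr E" "t2 \<in> Arr E" "Dom E t1 = d" "Dom E t2 = d"
        "Cod E t1 = Dom E p" "Cod E t2 = Dom E q"
        by (rule prod_elim[of t d "Dom E p" "Dom E q"]) (use st ar in simp_all)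
      show "sh E (poly_tensor_mor E (poly_id E p) (poly_id E q)) s t = sh E (poly_id E (prodmap E p q)) s t"
        unfolding s t(1) using t(2-) a(2,3) ar by simp
    qed (use a ar in simp_all)
    then show ?thesis by (simp add: M a)
  qed
  show "farr (Mtensor (Poly_moncat E)) (Comp (prod_cat (Poly E) (Poly E)) g f) =
      Comp (Poly E) (farr (Mtensor (Poly_moncat E)) g) (farr (Mtensor (Poly_moncat E)) f)"
    if fg: "f \<in> Hom (prod_cat (Poly E) (Poly E)) a b" "g \<in> Hom (prod_cat (Poly E) (Poly E)) b c" for f g a b c
  proof -
    obtain f1 f2 g1 g2 where f: "f = (f1, f2)" "g = (g1, g2)"
      by (cases f; cases g)
    have h: "f1 \<in> Arr (Poly E)" "f2 \<in> Arr (Poly E)" "g1 \<in> Arr (Poly E)" "g2 \<in> Arr (Poly E)"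
      "pcod f1 = pdom g1" "pcod f2 = pdom g2"
      using fg by (auto simp: f)
    have ar: "pdom f1 \<in> Arr E" "pdom f2 \<in> Arr E" "pdom g1 \<in> Arr E" "pdom g2 \<in> Arr E" "pcod g1 \<in> Arr E" "pcod g2 \<in> Arr E"
      using h by simp_all
    have "poly_tensor_mor E (poly_comp E g1 f1) (poly_comp E g2 f2) =
        poly_comp E (poly_tensor_mor E g1 g2) (poly_tensor_mor E f1 f2)"
    proof (rule poly_eqI; (simp only: poly_tensor_simps poly_comp_simps)?)
      show "prodmap E (base g1 \<cdot> base f1) (base g2 \<cdot> base f2) = prodmap E (base g1) (base g2) \<cdot> prodmap E (base f1) (base f2)"
        using h ar by (simp add: prodmap_def)
      fix d s t assume st: "s \<in> Arr E" "t \<in> Arr E" "Dom E s = d" "Dom E t = d"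
        "Cod E s = Cod E (prodmap E (pdom f1) (pdom f2))" "Cod E t = Dom E (prodmap E (pcod g1) (pcod g2))"
        "prodmap E (base g1 \<cdot> base f1) (base g2 \<cdot> base f2) \<cdot> s = prodmap E (pcod g1) (pcod g2) \<cdot> t"
      obtain s1 s2 where s: "s = pair E s1 s2" "s1 \<in> Arr E" "s2 \<in> Arr E" "Dom E s1 = d" "Dom E s2 = d"
        "Cod E s1 = Cod E (pdom f1)" "Cod E s2 = Cod E (pdom f2)"
        by (rule prod_elim[of s d "Cod E (pdom f1)" "Cod E (pdom f2)"]) (use st ar in simp_all)
      obtain t1 t2 where t: "t = pair E t1 t2" "t1 \<in> Arr E" "t2 \<in> Arr E" "Dom E t1 = d" "Dom E t2 = d"
        "Cod E t1 = Dom E (pcod g1)" "Cod E t2 = Dom E (pcod g2)"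
        by (rule prod_elim[of t d "Dom E (pcod g1)" "Dom E (pcod g2)"]) (use st ar in simp_all)
      have eq: "base g1 \<cdot> (base f1 \<cdot> s1) = pcod g1 \<cdot> t1" "base g2 \<cdot> (base f2 \<cdot> s2) = pcod g2 \<cdot> t2"
        using st(7) s(2-) t(2-) h ar by (simp_all add: s(1) t(1))
      show "sh E (poly_tensor_mor E (poly_comp E g1 f1) (poly_comp E g2 f2)) s t =
          sh E (poly_comp E (poly_tensor_mor E g1 g2) (poly_tensor_mor E f1 f2)) s t"
        using eq s(2-) t(2-) h ar by (simp add: s(1) t(1))
    qed (use h ar in simp_all)
    then show ?thesis by (simp add: M f)
  qed
qed

text \<open>With \<open>s\<close> and \<open>t\<close> split into triples, both sides return
  \<open>sh E f s1 t1\<close>, \<open>sh E g s2 t2\<close> and \<open>sh E h s3 t3\<close>,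
  bracketed to the left.\<close>

lemma poly_assoc_natural:
  assumes f: "f \<in> Arr (Poly E)" and g: "g \<in> Arr (Poly E)" and h: "h \<in> Arr (Poly E)"
  shows "poly_comp E (poly_tensor_mor E f (poly_tensor_mor E g h)) (poly_assoc E (pdom f) (pdom g) (pdom h)) =
    poly_comp E (poly_assoc E (pcod f) (pcod g) (pcod h)) (poly_tensor_mor E (poly_tensor_mor E f g) h)"
    (is "?l = ?r")
proof -
  let ?a = "pdom f" and ?b = "pdom g" and ?c = "pdom h" and ?a' = "pcod f" and ?b' = "pcod g" and ?c' = "pcod h"
  have ar: "?a \<in> Arr E" "?b \<in> Arr E" "?c \<in> Arr E" "?a' \<in> Arr E" "?b' \<in> Arr E" "?c' \<in> Arr E"
    using assms by simp_all
  show ?thesis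
  proof (rule poly_eqI)
    show "base ?l = base ?r"
    proof (rule arr_eqI)
      fix d x assume x: "x \<in> Arr E" "Dom E x = d" "Cod E x = prd E (prd E (Cod E ?a) (Cod E ?b)) (Cod E ?c)"
      show "base ?l \<cdot> x = base ?r \<cdot> x"
        by (rule prod3_elim[OF x]) (use assms ar in simp_all)
    qed (use assms ar in simp_all)
    fix d s t assume st0: "s \<in> Arr E" "t \<in> Arr E" "Dom E s = d" "Dom E t = d" "Cod E s = Cod E (pdom ?l)"
      "Cod E t = Dom E (pcod ?l)" "base ?l \<cdot> s = pcod ?l \<cdot> t"
    have st: "s \<in> Arr E" "t \<in> Arr E" "Dom E s = d" "Dom E t = d"
      "Cod E s = prd E (prd E (Cod E ?a) (Cod E ?b)) (Cod E ?c)" "Cod E t = prd E (Dom E ?a') (prd E (Dom E ?b') (Dom E ?c'))"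
      using st0(1-6) assms ar by simp_all
    note eq = st0(7)
    obtain s1 s2 s3 where s: "s = pair E (pair E s1 s2) s3" "s1 \<in> Arr E" "s2 \<in> Arr E" "s3 \<in> Arr E"
      "Dom E s1 = d" "Dom E s2 = d" "Dom E s3 = d" "Cod E s1 = Cod E ?a" "Cod E s2 = Cod E ?b" "Cod E s3 = Cod E ?c"
      by (rule prod3_elim[OF st(1,3,5)]) (use ar in simp_all)
    obtain t1 t2 t3 where t: "t = pair E t1 (pair E t2 t3)" "t1 \<in> Arr E" "t2 \<in> Arr E" "t3 \<in> Arr E"
      "Dom E t1 = d" "Dom E t2 = d" "Dom E t3 = d" "Cod E t1 = Dom E ?a'" "Cod E t2 = Dom E ?b'" "Cod E t3 = Dom E ?c'"
      by (rule prod3_elim'[OF st(2,4,6)]) (use ar in simp_all)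
    have "base f \<cdot> s1 = ?a' \<cdot> t1" "base g \<cdot> s2 = ?b' \<cdot> t2" "base h \<cdot> s3 = ?c' \<cdot> t3"
      using eq s(2-) t(2-) assms ar by (simp_all add: s(1) t(1))
    then show "sh E ?l s t = sh E ?r s t"
      using s(2-) t(2-) assms ar by (simp add: s(1) t(1))
  qed (use assms ar in simp_all)
qed

text \<open>All five morphisms merely rebracket, so on elements each side turns the tuple
  \<open>t\<close>, bracketed to the right, into the one bracketed to the left.\<close>

lemma poly_pentagon:
  assumes p: "exponentiable E p" and q: "exponentiable E q" and r: "exponentiable E r" and w: "exponentiable E w"
  shows "poly_comp E (poly_assoc E p q (prodmap E r w)) (poly_assoc E (prodmap E p q) r w) =
    poly_comp E (poly_tensor_mor E (poly_id E p) (poly_assoc E q r w))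
      (poly_comp E (poly_assoc E p (prodmap E q r) w) (poly_tensor_mor E (poly_assoc E p q r) (poly_id E w)))"
    (is "?l = ?r")
proof -
  have ar: "p \<in> Arr E" "q \<in> Arr E" "r \<in> Arr E" "w \<in> Arr E"
    using assms by simp_all
  let ?d4 = "prd E (prd E (prd E (Cod E p) (Cod E q)) (Cod E r)) (Cod E w)"
  have elim4: thesis
    if s4: "s \<in> Arr E" "Dom E s = d" "Cod E s = ?d4"
      and thesis: "\<And>s1 s2 s3 s4. s = pair E (pair E (pair E s1 s2) s3) s4 \<Longrightarrow> s1 \<in> Arr E \<Longrightarrow> s2 \<in> Arr E \<Longrightarrow> s3 \<in> Arr E \<Longrightarrow> s4 \<in> Arr E \<Longrightarrow>
        Dom E s1 = d \<Longrightarrow> Dom E s2 = d \<Longrightarrow> Dom E s3 = d \<Longrightarrow> Dom E s4 = d \<Longrightarrow> Cod E s1 = Cod E p \<Longrightarrow> Cod E s2 = Cod E q \<Longrightarrow>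
        Cod E s3 = Cod E r \<Longrightarrow> Cod E s4 = Cod E w \<Longrightarrow> thesis" for s d thesis
  proof -
    obtain s12 s3 s4 where s: "s = pair E (pair E s12 s3) s4" "s12 \<in> Arr E" "s3 \<in> Arr E" "s4 \<in> Arr E"
      "Dom E s12 = d" "Dom E s3 = d" "Dom E s4 = d" "Cod E s12 = prd E (Cod E p) (Cod E q)" "Cod E s3 = Cod E r" "Cod E s4 = Cod E w"
      by (rule prod3_elim[OF s4]) (use ar in simp_all)
    obtain s1 s2 where "s12 = pair E s1 s2" "s1 \<in> Arr E" "s2 \<in> Arr E" "Dom E s1 = d" "Dom E s2 = d"
      "Cod E s1 = Cod E p" "Cod E s2 = Cod E q"
      by (rule prod_elim[OF s(2,5,8)]) (use ar in simp_all)
    with s thesis show thesis by blast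
  qed
  show ?thesis
  proof (rule poly_eqI)
    show "base ?l = base ?r"
    proof (rule arr_eqI)
      fix d x assume x: "x \<in> Arr E" "Dom E x = d" "Cod E x = ?d4"
      show "base ?l \<cdot> x = base ?r \<cdot> x"
        by (rule elim4[OF x]) (use assms ar in simp_all)
    qed (use assms ar in simp_all)
    fix d s t assume st0: "s \<in> Arr E" "t \<in> Arr E" "Dom E s = d" "Dom E t = d" "Cod E s = Cod E (pdom ?l)"
      "Cod E t = Dom E (pcod ?l)" "base ?l \<cdot> s = pcod ?l \<cdot> t"
    have st: "s \<in> Arr E" "t \<in> Arr E" "Dom E s = d" "Dom E t = d" "Cod E s = ?d4"
      "Cod E t = prd E (Dom E p) (prd E (Dom E q) (prd E (Dom E r) (Dom E w)))"
      using st0(1-6) assms ar by simp_all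
    note eq = st0(7)
    obtain s1 s2 s3 s4 where s: "s = pair E (pair E (pair E s1 s2) s3) s4" "s1 \<in> Arr E" "s2 \<in> Arr E" "s3 \<in> Arr E" "s4 \<in> Arr E"
      "Dom E s1 = d" "Dom E s2 = d" "Dom E s3 = d" "Dom E s4 = d" "Cod E s1 = Cod E p" "Cod E s2 = Cod E q"
      "Cod E s3 = Cod E r" "Cod E s4 = Cod E w"
      by (rule elim4[OF st(1,3,5)])
    obtain t1 t2 t34 where t: "t = pair E t1 (pair E t2 t34)" "t1 \<in> Arr E" "t2 \<in> Arr E" "t34 \<in> Arr E"
      "Dom E t1 = d" "Dom E t2 = d" "Dom E t34 = d" "Cod E t1 = Dom E p" "Cod E t2 = Dom E q" "Cod E t34 = prd E (Dom E r) (Dom E w)"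
      by (rule prod3_elim'[OF st(2,4,6)]) (use ar in simp_all)
    obtain t3 t4 where t': "t34 = pair E t3 t4" "t3 \<in> Arr E" "t4 \<in> Arr E" "Dom E t3 = d" "Dom E t4 = d"
      "Cod E t3 = Dom E r" "Cod E t4 = Dom E w"
      by (rule prod_elim[OF t(4,7,10)]) (use ar in simp_all)
    \<comment> \<open>The base map is an invertible rebracketing, so the base element is determined
      by \<open>t\<close> and can be eliminated.\<close>
    have "s1 = p \<cdot> t1" "s2 = q \<cdot> t2" "s3 = r \<cdot> t3" "s4 = w \<cdot> t4"
      using eq s(2-) t(2,3,5,6,8,9) t'(2-) assms ar by (simp_all add: s(1) t(1) t'(1))
    then show "sh E ?l s t = sh E ?r s t"
      using t(2,3,5,6,8,9) t'(2-) assms ar by (simp add: s(1) t(1) t'(1))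
  qed (use assms ar in simp_all)
qed

lemma poly_triangle:
  assumes p: "exponentiable E p" and q: "exponentiable E q"
  shows "poly_comp E (poly_tensor_mor E (poly_id E p) (poly_lunit E q)) (poly_assoc E p (Ide E (one E)) q) =
    poly_tensor_mor E (poly_runit E p) (poly_id E q)" (is "?l = ?r")
proof -
  have ar: "p \<in> Arr E" "q \<in> Arr E" using assms by simp_all
  show ?thesis
  proof (rule poly_eqI)
    show "base ?l = base ?r"
    proof (rule arr_eqI)
      fix d x assume x: "x \<in> Arr E" "Dom E x = d" "Cod E x = prd E (prd E (Cod E p) (one E)) (Cod E q)"
      show "base ?l \<cdot> x = base ?r \<cdot> x"
        by (rule prod3_elim[OF x]) (use assms ar in simp_all)
    qed (use assms ar in simp_all)
    fix d s t assume st0: "s \<in> Arr E" "t \<in> Arr E" "Dom E s = d" "Dom E t = d" "Cod E s = Cod E (pdom ?l)"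
      "Cod E t = Dom E (pcod ?l)" "base ?l \<cdot> s = pcod ?l \<cdot> t"
    have st: "s \<in> Arr E" "t \<in> Arr E" "Dom E s = d" "Dom E t = d"
      "Cod E s = prd E (prd E (Cod E p) (one E)) (Cod E q)" "Cod E t = prd E (Dom E p) (Dom E q)"
      using st0(1-6) assms ar by simp_all
    note eq = st0(7)
    obtain s1 u s2 where s: "s = pair E (pair E s1 u) s2" "s1 \<in> Arr E" "u \<in> Arr E" "s2 \<in> Arr E"
      "Dom E s1 = d" "Dom E u = d" "Dom E s2 = d" "Cod E s1 = Cod E p" "Cod E u = one E" "Cod E s2 = Cod E q"
      by (rule prod3_elim[OF st(1,3,5)]) (use ar in simp_all)
    have u: "u = bang E d" "d \<in> Obj E"
      by (rule bang_unique[OF s(3,9,6)]) (use dom_cod_obj(1)[OF s(3)] s(6) in simp)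
    obtain t1 t2 where t: "t = pair E t1 t2" "t1 \<in> Arr E" "t2 \<in> Arr E" "Dom E t1 = d" "Dom E t2 = d"
      "Cod E t1 = Dom E p" "Cod E t2 = Dom E q"
      by (rule prod_elim[OF st(2,4,6)]) (use ar in simp_all)
    have "s1 = p \<cdot> t1" "s2 = q \<cdot> t2"
      using eq s(2,4,5,7,8,10) u(2) t(2-) assms ar by (simp_all add: s(1) t(1) u(1))
    then show "sh E ?l s t = sh E ?r s t"
      using u(2) t(2-) assms ar by (simp add: s(1) t(1) u(1))
  qed (use assms ar in simp_all)
qed

text \<open>Both sides send \<open>t\<close> to \<open>sh E f s2 t\<close>, paired with the unique
  element of the terminal object.\<close>

lemma poly_lunit_natural:
  assumes f: "f \<in> Arr (Poly E)"
  shows "poly_comp E f (poly_lunit E (pdom f)) =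
    poly_comp E (poly_lunit E (pcod f)) (poly_tensor_mor E (poly_id E (Ide E (one E))) f)" (is "?l = ?r")
proof -
  have ar: "pdom f \<in> Arr E" "pcod f \<in> Arr E" using assms by simp_all
  show ?thesis
  proof (rule poly_eqI)
    show "base ?l = base ?r"
      using assms ar by (simp add: prodmap_def)
    fix d s t assume st0: "s \<in> Arr E" "t \<in> Arr E" "Dom E s = d" "Dom E t = d" "Cod E s = Cod E (pdom ?l)"
      "Cod E t = Dom E (pcod ?l)" "base ?l \<cdot> s = pcod ?l \<cdot> t"
    have st: "s \<in> Arr E" "t \<in> Arr E" "Dom E s = d" "Dom E t = d"
      "Cod E s = prd E (one E) (Cod E (pdom f))" "Cod E t = Dom E (pcod f)"
      using st0(1-6) assms ar by simp_all
    note eq = st0(7)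
    obtain u s2 where s: "s = pair E u s2" "u \<in> Arr E" "s2 \<in> Arr E"
      "Dom E u = d" "Dom E s2 = d" "Cod E u = one E" "Cod E s2 = Cod E (pdom f)"
      by (rule prod_elim[OF st(1,3,5)]) (use ar in simp_all)
    have u: "u = bang E d" "d \<in> Obj E"
      by (rule bang_unique[OF s(2,6,4)]) (use dom_cod_obj(1)[OF s(2)] s(4) in simp)
    have "base f \<cdot> s2 = pcod f \<cdot> t"
      using eq s(3,5,7) u(2) st(2,4,6) assms ar by (simp_all add: s(1) u(1))
    then show "sh E ?l s t = sh E ?r s t"
      using u(2) s(3,5,7) st(2,4,6) assms ar by (simp add: s(1) u(1))
  qed (use assms ar in simp_all)
qed

lemma poly_runit_natural:
  assumes f: "f \<in> Arr (Poly E)"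
  shows "poly_comp E f (poly_runit E (pdom f)) =
    poly_comp E (poly_runit E (pcod f)) (poly_tensor_mor E f (poly_id E (Ide E (one E))))" (is "?l = ?r")
proof -
  have ar: "pdom f \<in> Arr E" "pcod f \<in> Arr E" using assms by simp_all
  show ?thesis
  proof (rule poly_eqI)
    show "base ?l = base ?r"
      using assms ar by (simp add: prodmap_def)
    fix d s t assume st0: "s \<in> Arr E" "t \<in> Arr E" "Dom E s = d" "Dom E t = d" "Cod E s = Cod E (pdom ?l)"
      "Cod E t = Dom E (pcod ?l)" "base ?l \<cdot> s = pcod ?l \<cdot> t"
    have st: "s \<in> Arr E" "t \<in> Arr E" "Dom E s = d" "Dom E t = d"
      "Cod E s = prd E (Cod E (pdom f)) (one E)" "Cod E t = Dom E (pcod f)"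
      using st0(1-6) assms ar by simp_all
    note eq = st0(7)
    obtain s2 u where s: "s = pair E s2 u" "s2 \<in> Arr E" "u \<in> Arr E"
      "Dom E s2 = d" "Dom E u = d" "Cod E s2 = Cod E (pdom f)" "Cod E u = one E"
      by (rule prod_elim[OF st(1,3,5)]) (use ar in simp_all)
    have u: "u = bang E d" "d \<in> Obj E"
      by (rule bang_unique[OF s(3,7,5)]) (use dom_cod_obj(1)[OF s(3)] s(5) in simp)
    have "base f \<cdot> s2 = pcod f \<cdot> t"
      using eq s(2,4,6) u(2) st(2,4,6) assms ar by (simp_all add: s(1) u(1))
    then show "sh E ?l s t = sh E ?r s t"
      using u(2) s(2,4,6) st(2,4,6) assms ar by (simp add: s(1) u(1))
  qed (use assms ar in simp_all)
qed

lemma moncat_simps [simp]: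
  "Mcat (Poly_moncat E) = Poly E" "Munit (Poly_moncat E) = Ide E (one E)" "Massoc (Poly_moncat E) = poly_assoc E"
  "Mlunit (Poly_moncat E) = poly_lunit E" "Mrunit (Poly_moncat E) = poly_runit E"
  "tens (Poly_moncat E) = prodmap E" "tensm (Poly_moncat E) = poly_tensor_mor E"
  by (simp_all add: Poly_moncat_def tens_def tensm_def fun_eq_iff)

lemma monoidal_category_Poly: "monoidal_category (Poly_moncat E)"
proof (unfold_locales, unfold moncat_simps Poly_simps mem_Collect_eq Hom_iff; (elim conjE)?)
  show "is_functor (prod_cat (Poly E) (Poly E)) (Poly E) (Mtensor (Poly_moncat E))"
    by (rule functor_tensor)
qed (auto simp: iso_poly_assoc iso_poly_lunit iso_poly_runit poly_pentagon poly_triangle poly_assoc_natural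
    poly_lunit_natural poly_runit_natural)

end

section \<open>The universal property of \<open>q\<^sup>p\<close>\<close>

text \<open>For generalised elements \<open>x\<close> of \<open>q\<^sup>p\<close>, \<open>a\<close> of \<open>P\<close> and \<open>t\<close> of \<open>Q\<^sub>*\<close>, the element \<open>x\<close> is a pair of
  functions \<open>a \<mapsto> ev x a\<close> in \<open>Q\<close> and \<open>(a, t) \<mapsto> us x a t\<close> in the fibre of \<open>p\<close> over \<open>a\<close>, the latter for
  \<open>t\<close> over \<open>ev x a\<close>.\<close>

definition ev :: "('o, 'a) cat \<Rightarrow> 'a \<Rightarrow> 'a \<Rightarrow> 'a \<Rightarrow> 'a \<Rightarrow> 'a" where
  "ev E p q x a = Comp E (qp_eval E p q) (pair E x a)"

definition us :: "('o, 'a) cat \<Rightarrow> 'a \<Rightarrow> 'a \<Rightarrow> 'a \<Rightarrow> 'a \<Rightarrow> 'a \<Rightarrow> 'a" where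
  "us E p q x a t = Comp E (p2 E (qp_obj E p q) (Dom E p)) (sh E (qp_univ E p q) (pair E x a) t)"

context ccc
begin

section \<open>The chosen dependent products in terms of elements\<close>

lemma Pi_simps [simp]:
  assumes "exponentiable E f" "x \<in> Arr E" "Cod E x = Dom E f"
  shows "Pi E f x \<in> Arr E" "Cod E (Pi E f x) = Cod E f"
    "Pi_counit E f x \<in> Arr E" "Dom E (Pi_counit E f x) = pb E (Pi E f x) f" "Cod E (Pi_counit E f x) = Dom E x"
  using is_Pi_simps[OF is_Pi_Pi[OF assms]] by simp_all

lemma Pi_counit_app:
  assumes "exponentiable E f" "x \<in> Arr E" "Cod E x = Dom E f"
    and "r \<in> Arr E" "b \<in> Arr E" "Dom E r = Dom E b" "Cod E r = Dom E (Pi E f x)" "Cod E b = Dom E f"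
    and "Pi E f x \<cdot> r = f \<cdot> b"
  shows "x \<cdot> (Pi_counit E f x \<cdot> pbpair E (Pi E f x) f r b) = b"
  by (rule is_Pi_app[OF is_Pi_Pi[OF assms(1-3)]]) (use assms in simp_all)

text \<open>The named transpose at arbitrary elements, obtained from its value at the generic one as
  in \<open>is_Pi_transpose\<close>. The computations with \<open>qp_curry\<close> concern this very
  term.\<close>

lemma Pi_transpose:
  assumes f: "exponentiable E f" and x: "x \<in> Arr E" "Cod E x = Dom E f"
    and k: "z \<in> Arr E" "Cod E z = Cod E f" "k \<in> Arr E" "Dom E k = pb E z f" "Cod E k = Dom E x"
      "x \<cdot> k = pr2 E z f"
  shows "Pi_transpose E f z x k \<in> Arr E" "Dom E (Pi_transpose E f z x k) = Dom E z"
    "Cod E (Pi_transpose E f z x k) = Dom E (Pi E f x)" "Pi E f x \<cdot> Pi_transpose E f z x k = z"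
    "\<lbrakk>s \<in> Arr E; b \<in> Arr E; Dom E s = Dom E b; Cod E s = Dom E z; Cod E b = Dom E f; z \<cdot> s = f \<cdot> b\<rbrakk> \<Longrightarrow>
      Pi_counit E f x \<cdot> pbpair E (Pi E f x) f (Pi_transpose E f z x k \<cdot> s) b = k \<cdot> pbpair E z f s b"
proof -
  let ?T = "Pi_transpose E f z x k"
  have T: "?T \<in> Arr E" "Dom E ?T = Dom E z" "Cod E ?T = Dom E (Pi E f x)" "Pi E f x \<cdot> ?T = z"
    "Pi_counit E f x \<cdot> pbpair E (Pi E f x) f (?T \<cdot> pr1 E z f) (pr2 E z f) = k"
    using exponentiableD(2)[OF f x k] by auto
  then show "?T \<in> Arr E" "Dom E ?T = Dom E z" "Cod E ?T = Dom E (Pi E f x)" "Pi E f x \<cdot> ?T = z" by auto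
  show "Pi_counit E f x \<cdot> pbpair E (Pi E f x) f (?T \<cdot> s) b = k \<cdot> pbpair E z f s b"
    if s: "s \<in> Arr E" "b \<in> Arr E" "Dom E s = Dom E b" "Cod E s = Dom E z" "Cod E b = Dom E f" "z \<cdot> s = f \<cdot> b"
  proof -
    have ar: "f \<in> Arr E" using f by simp
    have "Pi E f x \<cdot> (?T \<cdot> pr1 E z f) = f \<cdot> pr2 E z f"
      by (rule slice_square) (use ar T k f x in simp_all)
    moreover have "(Pi_counit E f x \<cdot> pbpair E (Pi E f x) f (?T \<cdot> pr1 E z f) (pr2 E z f)) \<cdot> pbpair E z f s b =
        k \<cdot> pbpair E z f s b"
      using T(5) by simp
    ultimately show ?thesis
      using T(1-3) f x k(1-5) s ar by simp
  qed
qed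

lemmas Pi_eqI = is_Pi_eqI[OF is_Pi_Pi exponentiable_arr]

end

text \<open>Fixing \<open>p\<close> and \<open>q\<close> allows the intermediate objects of
  \<open>[p, q]\<close> to be abbreviated. Statements that relate different polynomials need the
  facts for several pairs at once, so these are later exported through
  \<open>poly_pairI\<close>.\<close>

locale poly_pair = ccc +
  fixes p q :: 'b
  assumes p [simp]: "exponentiable E p" and q [simp]: "exponentiable E q"
begin

abbreviation "P \<equiv> Cod E p"
abbreviation "Ps \<equiv> Dom E p"
abbreviation "Q \<equiv> Cod E q"
abbreviation "Qs \<equiv> Dom E q"
abbreviation "H \<equiv> qp_obj E p q"

lemma ar [simp]: "p \<in> Arr E" "q \<in> Arr E"
  by simp_all

section \<open>The object R of maps between fibres\<close>

abbreviation "fR \<equiv> prodmap E q (Ide E P)"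
abbreviation "xR \<equiv> prodmap E (Ide E Qs) p"
abbreviation "R \<equiv> R_map E p q"
abbreviation "cR \<equiv> Pi_counit E fR xR"

lemma R_simps [simp]:
  "exponentiable E fR" "xR \<in> Arr E" "Cod E xR = Dom E fR"
  "R \<in> Arr E" "Cod E R = prd E Q P" "cR \<in> Arr E" "Dom E cR = pb E R fR" "Cod E cR = prd E Qs Ps"
  using Pi_simps[of fR xR] by (simp_all add: R_map_def exponentiable_prodmap_left)

lemma R_counit_def': "R_counit E p q = p2 E Qs Ps \<cdot> cR"
  by (simp add: R_counit_def)

text \<open>An element \<open>r\<close> of the domain of \<open>R\<close> over \<open>(b, a)\<close>
  is a map from the fibre of \<open>q\<close> over \<open>b\<close> to the fibre of \<open>p\<close>
  over \<open>a\<close>, and \<open>rc r t a\<close> is its value at \<open>t\<close>.\<close>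

definition "rc r t a = R_counit E p q \<cdot> pbpair E R fR r (pair E t a)"

lemma rc [simp]:
  assumes "r \<in> Arr E" "t \<in> Arr E" "a \<in> Arr E" "Dom E r = Dom E a" "Dom E t = Dom E a"
    "Cod E r = Dom E R" "Cod E t = Qs" "Cod E a = P" "R \<cdot> r = pair E (q \<cdot> t) a"
  shows "rc r t a \<in> Arr E" "Dom E (rc r t a) = Dom E a" "Cod E (rc r t a) = Ps" "p \<cdot> rc r t a = a"
    "cR \<cdot> pbpair E R fR r (pair E t a) = pair E t (rc r t a)"
    "h \<in> Arr E \<Longrightarrow> Cod E h = Dom E a \<Longrightarrow> rc r t a \<cdot> h = rc (r \<cdot> h) (t \<cdot> h) (a \<cdot> h)"
proof -
  let ?c = "cR \<cdot> pbpair E R fR r (pair E t a)"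
  have c: "?c \<in> Arr E" "Dom E ?c = Dom E a" "Cod E ?c = prd E Qs Ps"
    using assms by simp_all
  obtain c1 c2 where c12: "?c = pair E c1 c2" "c1 \<in> Arr E" "c2 \<in> Arr E" "Dom E c1 = Dom E a" "Dom E c2 = Dom E a"
    "Cod E c1 = Qs" "Cod E c2 = Ps"
    by (rule prod_elim[OF c]) simp_all
  \<comment> \<open>The counit is a map over \<open>Q\<^sub>* \<times> P\<close>: its first
    component can only be \<open>t\<close>, and its second lies over \<open>a\<close>.\<close>
  have "xR \<cdot> ?c = pair E t a"
    using Pi_counit_app[of fR xR r "pair E t a"] assms by (simp add: R_map_def[symmetric])
  then have eq: "c1 = t" "p \<cdot> c2 = a"
    using c12(2-) assms by (simp_all add: c12(1))
  have c2: "rc r t a = c2"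
    using c12 assms by (simp add: rc_def R_counit_def')
  show "rc r t a \<in> Arr E" "Dom E (rc r t a) = Dom E a" "Cod E (rc r t a) = Ps" "p \<cdot> rc r t a = a"
    "?c = pair E t (rc r t a)"
    using c12 eq c2 by simp_all
  show "rc r t a \<cdot> h = rc (r \<cdot> h) (t \<cdot> h) (a \<cdot> h)" if "h \<in> Arr E" "Cod E h = Dom E a"
  proof -
    have "R \<cdot> (r \<cdot> h) = fR \<cdot> pair E (t \<cdot> h) (a \<cdot> h)"
      using comp_assoc[of h r R] assms that by simp
    then show ?thesis
      using assms that by (simp add: rc_def R_counit_def')
  qed
qed

text \<open>Maps between the same fibres are equal when their values are. The base point is given by
  its components \<open>\<beta>\<close> and \<open>a\<close>, so that after a change of domain
  \<open>s\<close> the values are taken at \<open>a \<cdot> s\<close>.\<close>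

lemma R_eqI:
  assumes "r \<in> Arr E" "r' \<in> Arr E" "Dom E r = d" "Dom E r' = d" "Cod E r = Dom E R" "Cod E r' = Dom E R"
    and "R \<cdot> r = pair E \<beta> a" "R \<cdot> r' = pair E \<beta> a"
    and "\<beta> \<in> Arr E" "a \<in> Arr E" "Dom E \<beta> = d" "Dom E a = d" "Cod E \<beta> = Q" "Cod E a = P"
    and "\<And>s t. \<lbrakk>s \<in> Arr E; t \<in> Arr E; Dom E s = Dom E t; Cod E s = d; Cod E t = Qs; q \<cdot> t = \<beta> \<cdot> s\<rbrakk>
      \<Longrightarrow> rc (r \<cdot> s) t (a \<cdot> s) = rc (r' \<cdot> s) t (a \<cdot> s)"
  shows "r = r'"
proof (rule Pi_eqI[of fR xR])
  fix s b assume s: "s \<in> Arr E" "b \<in> Arr E" "Dom E s = Dom E b" "Cod E s = Dom E r" "Cod E b = Dom E fR"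
    "Pi E fR xR \<cdot> (r \<cdot> s) = fR \<cdot> b" "Pi E fR xR \<cdot> (r' \<cdot> s) = fR \<cdot> b"
  have s': "Cod E s = d" using s assms by simp
  define c where "c = Dom E s"
  obtain t a' where t: "b = pair E t a'" "t \<in> Arr E" "a' \<in> Arr E" "Dom E t = c" "Dom E a' = c"
    "Cod E t = Qs" "Cod E a' = P"
    by (rule prod_elim[OF s(2) s(3)[symmetric, folded c_def], of Qs P]) (use s(5) in simp_all)
  note sc = c_def[symmetric]
  have Rr: "R \<cdot> (r \<cdot> s) = pair E (\<beta> \<cdot> s) (a \<cdot> s)"
    using comp_assoc[of s r R] s(1) sc s' assms(1-14) by simp
  have Rr': "R \<cdot> (r' \<cdot> s) = pair E (\<beta> \<cdot> s) (a \<cdot> s)"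
    using comp_assoc[of s r' R] s(1) sc s' assms(1-14) by simp
  have eq: "\<beta> \<cdot> s = q \<cdot> t" "a \<cdot> s = a'"
    using s(6) Rr s(1) sc s' assms(1-14) t(2-) by (simp_all add: t(1) R_map_def[symmetric])
  have "rc (r \<cdot> s) t a' = rc (r' \<cdot> s) t a'"
    using assms(15)[of s t] s(1) sc s' t(2-) eq by simp
  moreover have "cR \<cdot> pbpair E R fR (r \<cdot> s) (pair E t a') = pair E t (rc (r \<cdot> s) t a')"
    by (rule rc(5)) (use assms(1-14) s(1) sc s' t(2-) Rr eq in simp_all)
  moreover have "cR \<cdot> pbpair E R fR (r' \<cdot> s) (pair E t a') = pair E t (rc (r' \<cdot> s) t a')"
    by (rule rc(5)) (use assms(1-14) s(1) sc s' t(2-) Rr' eq in simp_all)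
  ultimately show "cR \<cdot> pbpair E (Pi E fR xR) fR (r \<cdot> s) b = cR \<cdot> pbpair E (Pi E fR xR) fR (r' \<cdot> s) b"
    by (simp add: t(1) R_map_def[symmetric])
qed (use assms in \<open>simp_all add: R_map_def\<close>)

text \<open>A natural family \<open>\<sigma>\<close> in the fibre of \<open>p\<close> over
  \<open>a\<close>, indexed by elements \<open>t\<close> of the fibre of \<open>q\<close> over
  \<open>\<beta>\<close>, is classified by a map to the domain of \<open>R\<close>. \<open>z\<close>
  and \<open>T\<close> enter through equations so that the local terms of \<open>qp_curry\<close>
  can be put in their place.\<close>

lemma R_transpose:
  assumes z: "\<beta> \<in> Arr E" "a \<in> Arr E" "Dom E \<beta> = d" "Dom E a = d" "Cod E \<beta> = Q" "Cod E a = P"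
    and \<sigma>: "\<And>s t. \<lbrakk>s \<in> Arr E; t \<in> Arr E; Dom E s = Dom E t; Cod E s = d; Cod E t = Qs; \<beta> \<cdot> s = q \<cdot> t\<rbrakk>
      \<Longrightarrow> \<sigma> s t \<in> Arr E \<and> Dom E (\<sigma> s t) = Dom E s \<and> Cod E (\<sigma> s t) = Ps \<and> p \<cdot> \<sigma> s t = a \<cdot> s"
    and \<sigma>_comp: "\<And>s t h. \<lbrakk>s \<in> Arr E; t \<in> Arr E; Dom E s = Dom E t; Cod E s = d; Cod E t = Qs; \<beta> \<cdot> s = q \<cdot> t;
      h \<in> Arr E; Cod E h = Dom E s\<rbrakk> \<Longrightarrow> \<sigma> s t \<cdot> h = \<sigma> (s \<cdot> h) (t \<cdot> h)"
    and z_def: "z = pair E \<beta> a"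
    and T: "T = Pi_transpose E fR z xR (pair E (p1 E Qs P \<cdot> pr2 E z fR) (\<sigma> (pr1 E z fR) (p1 E Qs P \<cdot> pr2 E z fR)))"
  shows "T \<in> Arr E" "Dom E T = d" "Cod E T = Dom E R" "R \<cdot> T = pair E \<beta> a"
    "\<lbrakk>s \<in> Arr E; t \<in> Arr E; Dom E s = Dom E t; Cod E s = d; Cod E t = Qs; \<beta> \<cdot> s = q \<cdot> t\<rbrakk>
      \<Longrightarrow> rc (T \<cdot> s) t (a \<cdot> s) = \<sigma> s t"
proof -
  have za: "z \<in> Arr E" "Dom E z = d" "Cod E z = prd E Q P" using z by (simp_all add: z_def)
  define u where "u = pr1 E z fR"
  define v where "v = pr2 E z fR"
  define v1 where "v1 = p1 E Qs P \<cdot> v"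
  define v2 where "v2 = p2 E Qs P \<cdot> v"
  have u: "u \<in> Arr E" "Cod E u = d" "Dom E u = pb E z fR" and v: "v \<in> Arr E" "Dom E v = Dom E u" "Cod E v = prd E Qs P"
    using za by (simp_all add: u_def v_def)
  have v12: "v1 \<in> Arr E" "v2 \<in> Arr E" "Dom E v1 = Dom E u" "Dom E v2 = Dom E u" "Cod E v1 = Qs" "Cod E v2 = P"
    and vp: "v = pair E v1 v2"
    using v by (simp_all add: v1_def v2_def)
  have "z \<cdot> u = fR \<cdot> v"
    unfolding u_def v_def by (rule pb_square) (use za in simp_all)
  then have eq: "\<beta> \<cdot> u = q \<cdot> v1" "a \<cdot> u = v2"
    using z u v12 by (simp_all add: vp z_def)
  define k where "k = pair E v1 (\<sigma> u v1)"
  have su: "\<sigma> u v1 \<in> Arr E" "Dom E (\<sigma> u v1) = Dom E u" "Cod E (\<sigma> u v1) = Ps" "p \<cdot> \<sigma> u v1 = v2"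
    using \<sigma>[of u v1] u v12 eq by simp_all
  have k: "k \<in> Arr E" "Dom E k = pb E z fR" "Cod E k = Dom E xR" "xR \<cdot> k = pr2 E z fR"
    using su v12 u by (simp_all add: k_def vp[symmetric] v_def[symmetric])
  have T': "T = Pi_transpose E fR z xR k"
    unfolding T k_def u_def v1_def v_def ..
  note tr = Pi_transpose[of fR xR z k, folded R_map_def T']
  have kk: "z \<in> Arr E" "Cod E z = Cod E fR" using za by simp_all
  show T1: "T \<in> Arr E" "Dom E T = d" "Cod E T = Dom E R" "R \<cdot> T = pair E \<beta> a"
    using tr(1-4) kk k za by (simp_all add: z_def[symmetric])
  show "rc (T \<cdot> s) t (a \<cdot> s) = \<sigma> s t"
    if s: "s \<in> Arr E" "t \<in> Arr E" "Dom E s = Dom E t" "Cod E s = d" "Cod E t = Qs" "\<beta> \<cdot> s = q \<cdot> t"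
  proof -
    let ?w = "pbpair E z fR s (pair E t (a \<cdot> s))"
    have zs: "z \<cdot> s = fR \<cdot> pair E t (a \<cdot> s)"
      using z s by (simp add: z_def)
    have w: "?w \<in> Arr E" "Dom E ?w = Dom E s" "Cod E ?w = pb E z fR" "u \<cdot> ?w = s" "v \<cdot> ?w = pair E t (a \<cdot> s)"
      unfolding u_def v_def using za zs s z by simp_all
    have v1w: "v1 \<cdot> ?w = t"
      unfolding v1_def using w v u(3) s z by simp
    have "cR \<cdot> pbpair E R fR (T \<cdot> s) (pair E t (a \<cdot> s)) = k \<cdot> ?w"
      by (rule tr(5)) (use kk k za s z zs in simp_all)
    also have "\<dots> = pair E t (\<sigma> s t)"
      unfolding k_def using \<sigma>_comp[of u v1 ?w] su u v12 eq w v1w by simp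
    finally have "p2 E Qs Ps \<cdot> (cR \<cdot> pbpair E R fR (T \<cdot> s) (pair E t (a \<cdot> s))) = \<sigma> s t"
      using s \<sigma>[OF s] by simp
    moreover have "R \<cdot> (T \<cdot> s) = fR \<cdot> pair E t (a \<cdot> s)"
      using comp_assoc[of s T R] T1 s z by simp
    ultimately show ?thesis
      unfolding rc_def R_counit_def' using T1(1-3) s z \<sigma>[OF s] by simp
  qed
qed

section \<open>The exponential of Q by P\<close>

abbreviation "QP \<equiv> exp_obj E p q"
abbreviation "em \<equiv> exp_map E p q"
abbreviation "ec \<equiv> exp_counit E p q"

lemma exp_simps [simp]:
  "exponentiable E (bang E P)" "em \<in> Arr E" "Cod E em = one E" "Dom E em = QP" "QP \<in> Obj E"
  "ec \<in> Arr E" "Dom E ec = prd E QP P" "Cod E ec = prd E Q P"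
proof -
  show 1 [simp]: "exponentiable E (bang E P)" by (simp add: exponentiable_bang)
  show 2 [simp]: "em \<in> Arr E" "Cod E em = one E" "Dom E em = QP"
    using Pi_simps[of "bang E P" "p2 E Q P"] by (simp_all add: exp_map_def exp_obj_def)
  show 3 [simp]: "QP \<in> Obj E" using dom_cod_obj(1)[OF 2(1)] by simp
  have "em \<cdot> p1 E QP P = bang E P \<cdot> p2 E QP P"
    by (rule to_one_eq) simp_all
  then show "ec \<in> Arr E" "Dom E ec = prd E QP P" "Cod E ec = prd E Q P"
    using Pi_simps[of "bang E P" "p2 E Q P"] by (simp_all add: exp_counit_def exp_map_def[symmetric])
qed

text \<open>Application of \<open>w\<close>, an element of \<open>Q\<^sup>P\<close>, to the argument
  \<open>a\<close>.\<close>

definition "val w a = p1 E Q P \<cdot> (ec \<cdot> pair E w a)"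

lemma exp_square: "\<lbrakk>w \<in> Arr E; a \<in> Arr E; Dom E w = Dom E a; Cod E w = QP; Cod E a = P\<rbrakk> \<Longrightarrow> em \<cdot> w = bang E P \<cdot> a"
  by (rule to_one_eq) simp_all

text \<open>The isomorphism from \<open>Q\<^sup>P \<times> P\<close> to a pullback over the terminal
  object, built into \<open>exp_counit\<close>, only turns a \<open>pair\<close> into a
  \<open>pbpair\<close>.\<close>

lemma ec_app:
  assumes "w \<in> Arr E" "a \<in> Arr E" "Dom E w = Dom E a" "Cod E w = QP" "Cod E a = P"
  shows "ec \<cdot> pair E w a = Pi_counit E (bang E P) (p2 E Q P) \<cdot> pbpair E em (bang E P) w a"
  using exp_square[of "p1 E QP P" "p2 E QP P"] Pi_simps[of "bang E P" "p2 E Q P"] assms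
  by (simp add: exp_counit_def exp_map_def[symmetric])

lemma val [simp]:
  assumes "w \<in> Arr E" "a \<in> Arr E" "Dom E w = Dom E a" "Cod E w = QP" "Cod E a = P"
  shows "val w a \<in> Arr E" "Dom E (val w a) = Dom E a" "Cod E (val w a) = Q" "ec \<cdot> pair E w a = pair E (val w a) a"
    "h \<in> Arr E \<Longrightarrow> Cod E h = Dom E a \<Longrightarrow> val w a \<cdot> h = val (w \<cdot> h) (a \<cdot> h)"
proof -
  have 1: "p2 E Q P \<cdot> (ec \<cdot> pair E w a) = a"
    unfolding ec_app[OF assms]
    by (rule Pi_counit_app[of "bang E P" "p2 E Q P", folded exp_map_def])
      (use assms exp_square[OF assms] in simp_all)
  show "ec \<cdot> pair E w a = pair E (val w a) a"
    by (rule prod_eqI[of _ _ Q P]) (use assms 1 in \<open>simp_all add: val_def\<close>)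
  show "val w a \<in> Arr E" "Dom E (val w a) = Dom E a" "Cod E (val w a) = Q"
    "h \<in> Arr E \<Longrightarrow> Cod E h = Dom E a \<Longrightarrow> val w a \<cdot> h = val (w \<cdot> h) (a \<cdot> h)"
    using assms by (simp_all add: val_def)
qed

lemma exp_eqI:
  assumes "w \<in> Arr E" "w' \<in> Arr E" "Dom E w = d" "Dom E w' = d" "Cod E w = QP" "Cod E w' = QP"
    and "\<And>s a. \<lbrakk>s \<in> Arr E; a \<in> Arr E; Dom E s = Dom E a; Cod E s = d; Cod E a = P\<rbrakk>
      \<Longrightarrow> val (w \<cdot> s) a = val (w' \<cdot> s) a"
  shows "w = w'"
proof (rule Pi_eqI[of "bang E P" "p2 E Q P"])
  fix s a assume s: "s \<in> Arr E" "a \<in> Arr E" "Dom E s = Dom E a" "Cod E s = Dom E w" "Cod E a = Dom E (bang E P)"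
  have s': "Cod E s = d" "Cod E a = P" using s assms by simp_all
  show "Pi_counit E (bang E P) (p2 E Q P) \<cdot> pbpair E (Pi E (bang E P) (p2 E Q P)) (bang E P) (w \<cdot> s) a =
    Pi_counit E (bang E P) (p2 E Q P) \<cdot> pbpair E (Pi E (bang E P) (p2 E Q P)) (bang E P) (w' \<cdot> s) a"
    using ec_app[of "w \<cdot> s" a] ec_app[of "w' \<cdot> s" a] assms(7)[of s a] s(1-3) s' assms(1-6)
    by (simp add: exp_map_def[symmetric])
qed (use assms(1-6) in \<open>simp_all add: exp_map_def[symmetric] to_one_eq\<close>)

lemma exp_transpose:
  assumes X: "X \<in> Obj E" and b: "b \<in> Arr E" "Dom E b = prd E X P" "Cod E b = Q"
    and T: "T = Pi_transpose E (bang E P) (bang E X) (p2 E Q P)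
        (pair E b (p2 E X P) \<cdot> pair E (pr1 E (bang E X) (bang E P)) (pr2 E (bang E X) (bang E P)))"
  shows "T \<in> Arr E" "Dom E T = X" "Cod E T = QP"
    "\<lbrakk>s \<in> Arr E; a \<in> Arr E; Dom E s = Dom E a; Cod E s = X; Cod E a = P\<rbrakk> \<Longrightarrow> val (T \<cdot> s) a = b \<cdot> pair E s a"
proof -
  define k where "k = pair E b (p2 E X P) \<cdot> pair E (pr1 E (bang E X) (bang E P)) (pr2 E (bang E X) (bang E P))"
  have k: "k \<in> Arr E" "Dom E k = pb E (bang E X) (bang E P)" "Cod E k = prd E Q P"
    "p2 E Q P \<cdot> k = pr2 E (bang E X) (bang E P)"
    using X b by (simp_all add: k_def)
  note tr = Pi_transpose[of "bang E P" "p2 E Q P" "bang E X" k, folded exp_map_def, folded T[folded k_def]]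
  show T1: "T \<in> Arr E" "Dom E T = X" "Cod E T = QP"
    using tr(1-3) k X by simp_all
  show "val (T \<cdot> s) a = b \<cdot> pair E s a"
    if s: "s \<in> Arr E" "a \<in> Arr E" "Dom E s = Dom E a" "Cod E s = X" "Cod E a = P"
  proof -
    have sq: "bang E X \<cdot> s = bang E P \<cdot> a" by (rule to_one_eq) (use s X in simp_all)
    have "ec \<cdot> pair E (T \<cdot> s) a = Pi_counit E (bang E P) (p2 E Q P) \<cdot> pbpair E em (bang E P) (T \<cdot> s) a"
      by (rule ec_app) (use s T1 in simp_all)
    also have "\<dots> = k \<cdot> pbpair E (bang E X) (bang E P) s a"
      by (rule tr(5)) (use k X s(1-5) sq in simp_all)
    also have "\<dots> = pair E (b \<cdot> pair E s a) a"
      using b X s sq by (simp add: k_def)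
    finally show ?thesis
      unfolding val_def using b X s by simp
  qed
qed

section \<open>The objects B and \<open>q\<^sup>p\<close>\<close>

abbreviation "B \<equiv> B_map E p q"
abbreviation "prQ \<equiv> p1 E QP P"
abbreviation "cB \<equiv> Pi_counit E prQ B"
abbreviation "qm \<equiv> qp_map E p q"
abbreviation "qc \<equiv> qp_counit E p q"

lemma B_simps [simp]:
  "B \<in> Arr E" "Dom E B = pb E R ec" "Cod E B = prd E QP P" "exponentiable E prQ"
  "qm \<in> Arr E" "Dom E qm = H" "Cod E qm = QP" "H \<in> Obj E"
  "cB \<in> Arr E" "Dom E cB = pb E qm prQ" "Cod E cB = pb E R ec"
proof -
  show 1 [simp]: "B \<in> Arr E" "Dom E B = pb E R ec" "Cod E B = prd E QP P" "exponentiable E prQ"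
    by (simp_all add: B_map_def exponentiable_proj1)
  show 2: "qm \<in> Arr E" "Dom E qm = H" "Cod E qm = QP" "cB \<in> Arr E" "Dom E cB = pb E qm prQ" "Cod E cB = pb E R ec"
    using Pi_simps[of prQ B] by (simp_all add: qp_map_def qp_obj_def)
  show "H \<in> Obj E" using dom_cod_obj(1)[OF 2(1)] 2(2) by simp
qed

lemma qc_simps [simp]: "qc \<in> Arr E" "Dom E qc = prd E H P" "Cod E qc = pb E R ec"
  by (simp_all add: qp_counit_def prodmap_def)

lemma qc_app:
  assumes "x \<in> Arr E" "a \<in> Arr E" "Dom E x = Dom E a" "Cod E x = H" "Cod E a = P"
  shows "qc \<cdot> pair E x a = cB \<cdot> pbpair E qm prQ x (pair E (qm \<cdot> x) a)"
  using assms by (simp add: qp_counit_def prodmap_def)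

text \<open>The part of \<open>x\<close> at \<open>a\<close> that lives in \<open>R\<close>, namely
  the map of fibres \<open>t \<mapsto> us x a t\<close>. The other part is
  \<open>qm \<cdot> x\<close>, the function \<open>a \<mapsto> ev x a\<close>.\<close>

definition "rr x a = pr1 E R ec \<cdot> (qc \<cdot> pair E x a)"

lemma rr [simp]:
  assumes "x \<in> Arr E" "a \<in> Arr E" "Dom E x = Dom E a" "Cod E x = H" "Cod E a = P"
  shows "rr x a \<in> Arr E" "Dom E (rr x a) = Dom E a" "Cod E (rr x a) = Dom E R"
    "R \<cdot> rr x a = pair E (val (qm \<cdot> x) a) a" "qc \<cdot> pair E x a = pbpair E R ec (rr x a) (pair E (qm \<cdot> x) a)"
    "h \<in> Arr E \<Longrightarrow> Cod E h = Dom E a \<Longrightarrow> rr x a \<cdot> h = rr (x \<cdot> h) (a \<cdot> h)"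
proof -
  have B: "B \<cdot> (qc \<cdot> pair E x a) = pair E (qm \<cdot> x) a"
    unfolding qc_app[OF assms]
    by (rule Pi_counit_app[of prQ B, folded qp_map_def]) (use assms in simp_all)
  show "rr x a \<in> Arr E" "Dom E (rr x a) = Dom E a" "Cod E (rr x a) = Dom E R"
    "h \<in> Arr E \<Longrightarrow> Cod E h = Dom E a \<Longrightarrow> rr x a \<cdot> h = rr (x \<cdot> h) (a \<cdot> h)"
    using assms by (simp_all add: rr_def)
  have "R \<cdot> rr x a = ec \<cdot> (B \<cdot> (qc \<cdot> pair E x a))"
    unfolding rr_def B_map_def by (rule pb_square) (use assms in simp_all)
  then show Rr: "R \<cdot> rr x a = pair E (val (qm \<cdot> x) a) a"
    unfolding B using assms by simp
  show "qc \<cdot> pair E x a = pbpair E R ec (rr x a) (pair E (qm \<cdot> x) a)"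
    by (rule pb_eqI[of R ec]) (use assms B Rr in \<open>simp_all add: rr_def B_map_def\<close>)
qed

lemma qp_eval_simps [simp]:
  "qp_eval E p q \<in> Arr E" "Dom E (qp_eval E p q) = prd E H P" "Cod E (qp_eval E p q) = Q"
  by (simp_all add: qp_eval_def)

text \<open>Passing from \<open>q\<^sup>p\<close> to \<open>Q\<^sup>P\<close> keeps the underlying
  function, because the counit of \<open>q\<^sup>p\<close> is a map over
  \<open>Q\<^sup>P \<times> P\<close>.\<close>

lemma ev_val:
  assumes "x \<in> Arr E" "a \<in> Arr E" "Dom E x = Dom E a" "Cod E x = H" "Cod E a = P"
  shows "ev E p q x a = val (qm \<cdot> x) a"
proof -
  have "B \<cdot> (qc \<cdot> pair E x a) = pair E (qm \<cdot> x) a"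
    using assms by (simp add: B_map_def)
  then have "ec \<cdot> (B \<cdot> (qc \<cdot> pair E x a)) = pair E (val (qm \<cdot> x) a) a"
    using assms by simp
  then show ?thesis
    using assms by (simp add: ev_def qp_eval_def)
qed

lemma ev [simp]:
  assumes "x \<in> Arr E" "a \<in> Arr E" "Dom E x = Dom E a" "Cod E x = H" "Cod E a = P"
  shows "ev E p q x a \<in> Arr E" "Dom E (ev E p q x a) = Dom E a" "Cod E (ev E p q x a) = Q"
    "h \<in> Arr E \<Longrightarrow> Cod E h = Dom E a \<Longrightarrow> ev E p q x a \<cdot> h = ev E p q (x \<cdot> h) (a \<cdot> h)"
    "qp_eval E p q \<cdot> pair E x a = ev E p q x a"
  using assms by (simp_all add: ev_def)

end

context ccc
begin

text \<open>The identity of \<open>a\<close> is the pullback of the identity of the terminal object.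
  It makes the domain \<open>id \<otimes> p\<close> of the universal element a polynomial.\<close>

lemma exponentiable_ide [simp]:
  assumes a: "a \<in> Obj E"
  shows "exponentiable E (Ide E a)"
proof (rule exponentiable_pullback[OF exponentiable_ide_one, of "bang E a" _ "bang E a"])
  show "is_pullback E (bang E a) (Ide E (one E)) (Ide E a) (bang E a)"
    unfolding is_pullback_def
  proof (intro conjI allI ballI impI)
    fix c s t assume "s \<in> Hom E c (Dom E (bang E a))" "t \<in> Hom E c (Dom E (Ide E (one E)))"
    then have s: "s \<in> Arr E" "Dom E s = c" "Cod E s = a" and t: "t = bang E c"
      using a bang_unique[of t c] by simp_all
    show "\<exists>!h. h \<in> Hom E c (Dom E (Ide E a)) \<and> Ide E a \<cdot> h = s \<and> bang E a \<cdot> h = t"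
      by (rule ex1I[of _ s]) (use s t a in auto)
  qed (use a in simp_all)
qed (use a in simp_all)

end

context poly_pair
begin

abbreviation "ee \<equiv> qp_eval E p q"

text \<open>\<open>us\<close> is defined through \<open>sh\<close> of \<open>qp_univ\<close>, so
  this has to precede its properties; \<open>rc\<close> and \<open>rr\<close> describe the value in
  the meantime.\<close>

lemma qp_univ_mk:
  shows "qp_univ E p q \<in> Arr (Poly E)"
    and "\<lbrakk>x \<in> Arr E; a \<in> Arr E; t \<in> Arr E; Dom E x = Dom E t; Dom E a = Dom E t; Cod E x = H; Cod E a = P;
      Cod E t = Qs; ev E p q x a = q \<cdot> t\<rbrakk> \<Longrightarrow> sh E (qp_univ E p q) (pair E x a) t = pair E x (rc (rr x a) t a)"
proof -
  define \<sigma> where "\<sigma> s t = pair E (p1 E H P \<cdot> s) (rc (pr1 E R ec \<cdot> (qc \<cdot> s)) t (p2 E H P \<cdot> s))" for s t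
  have \<sigma>_pair: "\<sigma> (pair E x a) t = pair E x (rc (rr x a) t a)"
    if "x \<in> Arr E" "a \<in> Arr E" "Dom E x = Dom E a" "Cod E x = H" "Cod E a = P" for x a t
    using that by (simp add: \<sigma>_def rr_def del: rr)
  have eq: "qp_univ E p q = PMor (prodmap E (Ide E H) p) q ee (\<sigma> (pr1 E ee q) (pr2 E ee q))"
    by (simp add: qp_univ_def Let_def \<sigma>_def rc_def)
  have 1: "\<sigma> s t \<in> Arr E \<and> Dom E (\<sigma> s t) = d \<and> Cod E (\<sigma> s t) = Dom E (prodmap E (Ide E H) p) \<and>
      prodmap E (Ide E H) p \<cdot> \<sigma> s t = s \<and> (h \<in> Arr E \<longrightarrow> Cod E h = d \<longrightarrow> \<sigma> s t \<cdot> h = \<sigma> (s \<cdot> h) (t \<cdot> h))"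
    if st: "s \<in> Arr E" "t \<in> Arr E" "Dom E s = d" "Dom E t = d" "Cod E s = Cod E (prodmap E (Ide E H) p)" "Cod E t = Qs"
      "ee \<cdot> s = q \<cdot> t" for s t d h
  proof -
    obtain x a where s: "s = pair E x a" "x \<in> Arr E" "a \<in> Arr E" "Dom E x = d" "Dom E a = d" "Cod E x = H" "Cod E a = P"
      by (rule prod_elim[OF st(1,3), of H P]) (use st(5) in simp_all)
    have "val (qm \<cdot> x) a = q \<cdot> t"
      using st(7) ev_val[of x a] s(2-) by (simp add: s(1))
    then show ?thesis
      using s(2-) st(2,4,6) by (simp add: s(1) \<sigma>_pair)
  qed
  note mk = poly_mk[where \<sigma> = \<sigma>, OF _ _ _ _ _ _ _ eq]
  show "qp_univ E p q \<in> Arr (Poly E)"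
    by (rule mk(1)) ((simp; fail) | use 1 in blast)+
  show "sh E (qp_univ E p q) (pair E x a) t = pair E x (rc (rr x a) t a)"
    if x: "x \<in> Arr E" "a \<in> Arr E" "t \<in> Arr E" "Dom E x = Dom E t" "Dom E a = Dom E t" "Cod E x = H" "Cod E a = P"
      "Cod E t = Qs" "ev E p q x a = q \<cdot> t"
  proof -
    have "sh E (qp_univ E p q) (pair E x a) t = \<sigma> (pair E x a) t"
      by (rule mk(2)) ((use x in \<open>simp; fail\<close>) | use 1 in blast)+
    then show ?thesis using x by (simp add: \<sigma>_pair)
  qed
qed

lemma us_rc:
  assumes "x \<in> Arr E" "a \<in> Arr E" "t \<in> Arr E" "Dom E x = Dom E t" "Dom E a = Dom E t" "Cod E x = H" "Cod E a = P"
      "Cod E t = Qs" "ev E p q x a = q \<cdot> t"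
  shows "us E p q x a t = rc (rr x a) t a"
  using qp_univ_mk(2)[OF assms] ev_val[of x a] assms by (simp add: us_def)

lemma us [simp]:
  assumes "x \<in> Arr E" "a \<in> Arr E" "t \<in> Arr E" "Dom E x = Dom E t" "Dom E a = Dom E t" "Cod E x = H" "Cod E a = P"
      "Cod E t = Qs" "ev E p q x a = q \<cdot> t"
  shows "us E p q x a t \<in> Arr E" "Dom E (us E p q x a t) = Dom E t" "Cod E (us E p q x a t) = Ps"
    "p \<cdot> us E p q x a t = a"
    "h \<in> Arr E \<Longrightarrow> Cod E h = Dom E t \<Longrightarrow> us E p q x a t \<cdot> h = us E p q (x \<cdot> h) (a \<cdot> h) (t \<cdot> h)"
    "sh E (qp_univ E p q) (pair E x a) t = pair E x (us E p q x a t)"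
proof -
  have v: "val (qm \<cdot> x) a = q \<cdot> t" using assms ev_val[of x a] by simp
  show "us E p q x a t \<in> Arr E" "Dom E (us E p q x a t) = Dom E t" "Cod E (us E p q x a t) = Ps"
    "p \<cdot> us E p q x a t = a"
    using assms v by (simp_all add: us_rc)
  show "sh E (qp_univ E p q) (pair E x a) t = pair E x (us E p q x a t)"
    using qp_univ_mk(2)[OF assms] us_rc[OF assms] by simp
  show "us E p q x a t \<cdot> h = us E p q (x \<cdot> h) (a \<cdot> h) (t \<cdot> h)" if h: "h \<in> Arr E" "Cod E h = Dom E t"
  proof -
    have "ev E p q (x \<cdot> h) (a \<cdot> h) = q \<cdot> (t \<cdot> h)"
      using ev(4)[of x a h] assms h by simp
    then show ?thesis
      using us_rc[OF assms] us_rc[of "x \<cdot> h" "a \<cdot> h" "t \<cdot> h"] assms h v by simp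
  qed
qed

lemma qp_univ_simps [simp]:
  "pdom (qp_univ E p q) = prodmap E (Ide E H) p" "pcod (qp_univ E p q) = q" "base (qp_univ E p q) = ee"
  "qp_univ E p q \<in> Arr (Poly E)"
  using qp_univ_mk(1) by (simp_all add: qp_univ_def Let_def)

text \<open>Extensionality for the three right adjoints in turn. Equal \<open>ev\<close> gives equal
  elements of \<open>Q\<^sup>P\<close>; equal \<open>us\<close> then gives equal maps of fibres
  \<open>rr\<close>; together they give equal values in the domain of \<open>B\<close>, hence equal
  elements of \<open>q\<^sup>p\<close>.\<close>

lemma qp_eqI:
  assumes x: "x \<in> Arr E" "x' \<in> Arr E" "Dom E x = d" "Dom E x' = d" "Cod E x = H" "Cod E x' = H"
    and ev_eq: "\<And>s a. \<lbrakk>s \<in> Arr E; a \<in> Arr E; Dom E s = Dom E a; Cod E s = d; Cod E a = P\<rbrakk>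
      \<Longrightarrow> ev E p q (x \<cdot> s) a = ev E p q (x' \<cdot> s) a"
    and us_eq: "\<And>s a t. \<lbrakk>s \<in> Arr E; a \<in> Arr E; t \<in> Arr E; Dom E s = Dom E t; Dom E a = Dom E t; Cod E s = d; Cod E a = P;
      Cod E t = Qs; ev E p q (x \<cdot> s) a = q \<cdot> t; ev E p q (x' \<cdot> s) a = q \<cdot> t\<rbrakk>
      \<Longrightarrow> us E p q (x \<cdot> s) a t = us E p q (x' \<cdot> s) a t"
  shows "x = x'"
proof -
  have qmx: "qm \<cdot> x = qm \<cdot> x'"
  proof (rule exp_eqI)
    fix s a assume s: "s \<in> Arr E" "a \<in> Arr E" "Dom E s = Dom E a" "Cod E s = d" "Cod E a = P"
    show "val ((qm \<cdot> x) \<cdot> s) a = val ((qm \<cdot> x') \<cdot> s) a"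
      using ev_eq[OF s] ev_val[of "x \<cdot> s" a] ev_val[of "x' \<cdot> s" a] s x by simp
  qed (use x in simp_all)
  have qmxs: "qm \<cdot> (x \<cdot> s) = qm \<cdot> (x' \<cdot> s)" if "s \<in> Arr E" "Cod E s = d" for s
    by (rule comp_eq_comp) (use qmx x that in simp_all)
  have rr_eq: "rr (x \<cdot> s) a = rr (x' \<cdot> s) a"
    if s: "s \<in> Arr E" "a \<in> Arr E" "Dom E s = c" "Dom E a = c" "Cod E s = d" "Cod E a = P" for s a c
  proof (rule R_eqI)
    show "R \<cdot> rr (x \<cdot> s) a = pair E (val (qm \<cdot> (x' \<cdot> s)) a) a" "R \<cdot> rr (x' \<cdot> s) a = pair E (val (qm \<cdot> (x' \<cdot> s)) a) a"
      using x s qmxs[of s] by simp_all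
    fix s' t assume s': "s' \<in> Arr E" "t \<in> Arr E" "Dom E s' = Dom E t" "Cod E s' = c" "Cod E t = Qs"
      "q \<cdot> t = val (qm \<cdot> (x' \<cdot> s)) a \<cdot> s'"
    have e: "ev E p q (x \<cdot> (s \<cdot> s')) (a \<cdot> s') = q \<cdot> t" "ev E p q (x' \<cdot> (s \<cdot> s')) (a \<cdot> s') = q \<cdot> t"
      using ev_val[of "x' \<cdot> (s \<cdot> s')" "a \<cdot> s'"] ev_eq[of "s \<cdot> s'" "a \<cdot> s'"] x s s' by simp_all
    then have "us E p q (x \<cdot> (s \<cdot> s')) (a \<cdot> s') t = us E p q (x' \<cdot> (s \<cdot> s')) (a \<cdot> s') t"
      by (intro us_eq) (use x s s' in simp_all)
    then show "rc (rr (x \<cdot> s) a \<cdot> s') t (a \<cdot> s') = rc (rr (x' \<cdot> s) a \<cdot> s') t (a \<cdot> s')"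
      using us_rc[of "x \<cdot> (s \<cdot> s')" "a \<cdot> s'" t] us_rc[of "x' \<cdot> (s \<cdot> s')" "a \<cdot> s'" t] e x s s'(1-5) by simp
  qed (use x s in simp_all)
  show ?thesis
  proof (rule Pi_eqI[of prQ B])
    show "Pi E prQ B \<cdot> x = Pi E prQ B \<cdot> x'"
      using qmx by (simp add: qp_map_def)
    fix s b assume s: "s \<in> Arr E" "b \<in> Arr E" "Dom E s = Dom E b" "Cod E s = Dom E x" "Cod E b = Dom E prQ"
      "Pi E prQ B \<cdot> (x \<cdot> s) = prQ \<cdot> b"
    define c where "c = Dom E s"
    have s': "Cod E s = d" using s(4) x by simp
    obtain w a where b: "b = pair E w a" "w \<in> Arr E" "a \<in> Arr E" "Dom E w = c" "Dom E a = c"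
      "Cod E w = QP" "Cod E a = P"
      by (rule prod_elim[OF s(2) s(3)[symmetric, folded c_def], of QP P]) (use s(5) in simp_all)
    have w: "w = qm \<cdot> (x \<cdot> s)"
      using s(6) b(2-) by (simp add: b(1) qp_map_def)
    \<comment> \<open>An element of the domain of \<open>B\<close> consists of an \<open>rr\<close>
      part and a pair in \<open>Q\<^sup>P \<times> P\<close>; both agree.\<close>
    have "qc \<cdot> pair E (x \<cdot> s) a = qc \<cdot> pair E (x' \<cdot> s) a"
      using rr_eq[of s a c] qmxs[of s] x s(1) s' b(2-) c_def by simp
    then have "cB \<cdot> pbpair E qm prQ (x \<cdot> s) (pair E (qm \<cdot> (x \<cdot> s)) a) = cB \<cdot> pbpair E qm prQ (x' \<cdot> s) (pair E (qm \<cdot> (x' \<cdot> s)) a)"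
      using qc_app[of "x \<cdot> s" a] qc_app[of "x' \<cdot> s" a] x s(1) s' b(3,5,7) c_def by simp
    then show "cB \<cdot> pbpair E (Pi E prQ B) prQ (x \<cdot> s) b = cB \<cdot> pbpair E (Pi E prQ B) prQ (x' \<cdot> s) b"
      using qmxs[OF s(1) s'] by (simp add: b(1) w qp_map_def)
  qed (use x in \<open>simp_all add: qp_map_def[symmetric]\<close>)
qed

text \<open>The existence half of the universal property. The base map of \<open>m\<close> is
  transposed to \<open>Q\<^sup>P\<close>, the component of its sharp map in \<open>P\<^sub>*\<close>
  to \<open>R\<close>; the two combine into a map to the domain of \<open>B\<close>, which is
  transposed once more. The local definitions spell out \<open>qp_curry_def\<close> so that each
  transpose can be treated separately.\<close>

lemma qp_curry:
  assumes X: "X \<in> Obj E" and m: "m \<in> Arr (Poly E)" "pdom m = prodmap E (Ide E X) p" "pcod m = q"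
  shows "qp_curry E p q X m \<in> Arr E" "Dom E (qp_curry E p q X m) = X" "Cod E (qp_curry E p q X m) = H"
    "\<lbrakk>s \<in> Arr E; a \<in> Arr E; Dom E s = Dom E a; Cod E s = X; Cod E a = P\<rbrakk>
      \<Longrightarrow> ev E p q (qp_curry E p q X m \<cdot> s) a = base m \<cdot> pair E s a"
    "\<lbrakk>s \<in> Arr E; a \<in> Arr E; t \<in> Arr E; Dom E s = Dom E t; Dom E a = Dom E t; Cod E s = X; Cod E a = P; Cod E t = Qs;
      base m \<cdot> pair E s a = q \<cdot> t\<rbrakk>
      \<Longrightarrow> us E p q (qp_curry E p q X m \<cdot> s) a t = p2 E X Ps \<cdot> sh E m (pair E s a) t"
proof -
  define \<beta> where "\<beta> = base m"
  have \<beta>: "\<beta> \<in> Arr E" "Dom E \<beta> = prd E X P" "Cod E \<beta> = Q"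
    using m X by (simp_all add: \<beta>_def)
  define z where "z = pair E \<beta> (p2 E X P)"
  \<comment> \<open>The component of the sharp map in \<open>X\<close> is forced by the base element
    \<open>s\<close>, so all the information is in this one.\<close>
  define \<sigma> where "\<sigma> s t = p2 E X Ps \<cdot> sh E m s t" for s t
  define to_R where "to_R = Pi_transpose E fR z xR (pair E (p1 E Qs P \<cdot> pr2 E z fR) (\<sigma> (pr1 E z fR) (p1 E Qs P \<cdot> pr2 E z fR)))"
  define to_exp where "to_exp = Pi_transpose E (bang E P) (bang E X) (p2 E Q P)
        (pair E \<beta> (p2 E X P) \<cdot> pair E (pr1 E (bang E X) (bang E P)) (pr2 E (bang E X) (bang E P)))"
  define to_B where "to_B = pbpair E R ec to_R (prodmap E to_exp (Ide E P))"
  define k where "k = to_B \<cdot> pair E (pr1 E to_exp prQ) (p2 E QP P \<cdot> pr2 E to_exp prQ)"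
  define T where "T = Pi_transpose E prQ to_exp B k"
  have T: "qp_curry E p q X m = T"
    unfolding T_def k_def to_B_def to_exp_def to_R_def z_def \<sigma>_def \<beta>_def qp_curry_def Let_def sh_def m(3) ..
  have \<sigma>: "\<sigma> s t \<in> Arr E \<and> Dom E (\<sigma> s t) = Dom E s \<and> Cod E (\<sigma> s t) = Ps \<and> p \<cdot> \<sigma> s t = p2 E X P \<cdot> s"
    "\<lbrakk>h \<in> Arr E; Cod E h = Dom E s\<rbrakk> \<Longrightarrow> \<sigma> s t \<cdot> h = \<sigma> (s \<cdot> h) (t \<cdot> h)"
    if st: "s \<in> Arr E" "t \<in> Arr E" "Dom E s = Dom E t" "Cod E s = prd E X P" "Cod E t = Qs" "\<beta> \<cdot> s = q \<cdot> t" for s t h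
  proof -
    define w where "w = sh E m s t"
    have w: "w \<in> Arr E" "Dom E w = Dom E s" "Cod E w = prd E X Ps" and pw: "prodmap E (Ide E X) p \<cdot> w = s"
      unfolding w_def using st m X by (simp_all add: \<beta>_def del: prodmap_comp)
    have "p2 E X P \<cdot> s = p2 E X P \<cdot> (prodmap E (Ide E X) p \<cdot> w)"
      by (simp only: pw)
    also have "\<dots> = p \<cdot> (p2 E X Ps \<cdot> w)"
      using w X by simp
    finally show "\<sigma> s t \<in> Arr E \<and> Dom E (\<sigma> s t) = Dom E s \<and> Cod E (\<sigma> s t) = Ps \<and> p \<cdot> \<sigma> s t = p2 E X P \<cdot> s"
      using w X by (simp add: \<sigma>_def w_def[symmetric])
    show "\<sigma> s t \<cdot> h = \<sigma> (s \<cdot> h) (t \<cdot> h)" if "h \<in> Arr E" "Cod E h = Dom E s"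
      using st m X that unfolding \<sigma>_def \<beta>_def by simp
  qed
  have to_R: "to_R \<in> Arr E" "Dom E to_R = prd E X P" "Cod E to_R = Dom E R" "R \<cdot> to_R = pair E \<beta> (p2 E X P)"
    "\<lbrakk>s \<in> Arr E; t \<in> Arr E; Dom E s = Dom E t; Cod E s = prd E X P; Cod E t = Qs; \<beta> \<cdot> s = q \<cdot> t\<rbrakk>
      \<Longrightarrow> rc (to_R \<cdot> s) t (p2 E X P \<cdot> s) = \<sigma> s t" for s t
    by (rule R_transpose[where \<sigma> = \<sigma> and d = "prd E X P", OF _ _ _ _ _ _ _ _ z_def to_R_def];
      ((use \<beta> X in \<open>simp; fail\<close>) | (rule \<sigma>; assumption) | assumption))+
  have to_exp: "to_exp \<in> Arr E" "Dom E to_exp = X" "Cod E to_exp = QP"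
    "\<lbrakk>s \<in> Arr E; a \<in> Arr E; Dom E s = Dom E a; Cod E s = X; Cod E a = P\<rbrakk> \<Longrightarrow> val (to_exp \<cdot> s) a = \<beta> \<cdot> pair E s a" for s a
    using exp_transpose[OF X \<beta> to_exp_def] by blast+
  \<comment> \<open>Both composites to \<open>Q \<times> P\<close> are the pair of
    \<open>\<beta>\<close> and the second projection, so \<open>to_R\<close> and
    \<open>to_exp\<close> induce a map to the pullback that is the domain of
    \<open>B\<close>.\<close>
  have sqB: "R \<cdot> to_R = ec \<cdot> prodmap E to_exp (Ide E P)"
    using to_exp(4)[of "p1 E X P" "p2 E X P"] to_exp(1-3) X \<beta> by (simp add: to_R prodmap_def)
  have to_B: "to_B \<in> Arr E" "Dom E to_B = prd E X P" "Cod E to_B = pb E R ec" "pr1 E R ec \<cdot> to_B = to_R"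
    "B \<cdot> to_B = prodmap E to_exp (Ide E P)"
    using sqB to_R(1-3) to_exp(1-3) X by (simp_all add: to_B_def B_map_def)
  define u v where "u = pr1 E to_exp prQ" and "v = pr2 E to_exp prQ"
  have uv: "u \<in> Arr E" "v \<in> Arr E" "Dom E u = pb E to_exp prQ" "Dom E v = pb E to_exp prQ" "Cod E u = X" "Cod E v = prd E QP P"
    "prQ \<cdot> v = to_exp \<cdot> u"
    using to_exp(1-3) X pb_square(1)[of to_exp prQ] by (simp_all add: u_def v_def)
  have k: "k \<in> Arr E" "Dom E k = pb E to_exp prQ" "Cod E k = pb E R ec"
    using uv to_B X by (simp_all add: k_def u_def[symmetric] v_def[symmetric])
  \<comment> \<open>To be transposed, \<open>k\<close> has to lie over the second projection
    \<open>v\<close>. The first component of \<open>v\<close> is \<open>to_exp \<cdot> u\<close>, so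
    pairing it with the second one gives back \<open>v\<close>.\<close>
  have "B \<cdot> k = (B \<cdot> to_B) \<cdot> pair E u (p2 E QP P \<cdot> v)"
    using uv to_B(1-3) X by (simp add: k_def u_def[symmetric] v_def[symmetric])
  also have "\<dots> = pair E (prQ \<cdot> v) (p2 E QP P \<cdot> v)"
    unfolding to_B(5) using uv to_exp(1-3) X by simp
  also have "\<dots> = v" by (rule pair_eta(1)) (use uv in simp_all)
  finally have Bk: "B \<cdot> k = pr2 E to_exp prQ" by (simp add: v_def)
  note tr = Pi_transpose[of prQ B to_exp k, folded qp_map_def T_def]
  have T1: "T \<in> Arr E" "Dom E T = X" "Cod E T = H" "qm \<cdot> T = to_exp"
    using tr(1-4) to_exp(1-3) k Bk by simp_all
  \<comment> \<open>Undoes the last transposition; the values of \<open>T\<close> can then be read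
    off from \<open>to_R\<close> and \<open>to_exp\<close>.\<close>
  have qc_T: "qc \<cdot> pair E (T \<cdot> s) a = to_B \<cdot> pair E s a" and qm_T: "qm \<cdot> (T \<cdot> s) = to_exp \<cdot> s"
    if s: "s \<in> Arr E" "a \<in> Arr E" "Dom E s = Dom E a" "Cod E s = X" "Cod E a = P" for s a
  proof -
    show qmTs: "qm \<cdot> (T \<cdot> s) = to_exp \<cdot> s"
      using comp_assoc[of s T qm] T1 s by simp
    have "qc \<cdot> pair E (T \<cdot> s) a = cB \<cdot> pbpair E qm prQ (T \<cdot> s) (pair E (to_exp \<cdot> s) a)"
      using qc_app[of "T \<cdot> s" a] qmTs T1 s by simp
    also have "\<dots> = k \<cdot> pbpair E to_exp prQ s (pair E (to_exp \<cdot> s) a)"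
      by (rule tr(5)) (use to_exp(1-3) k Bk s in simp_all)
    also have "\<dots> = to_B \<cdot> pair E s a"
    proof -
      let ?w = "pbpair E to_exp prQ s (pair E (to_exp \<cdot> s) a)"
      have w: "?w \<in> Arr E" "Dom E ?w = Dom E a" "Cod E ?w = pb E to_exp prQ" "u \<cdot> ?w = s" "v \<cdot> ?w = pair E (to_exp \<cdot> s) a"
        using to_exp(1-3) s by (simp_all add: u_def v_def)
      then show ?thesis
        unfolding k_def u_def[symmetric] v_def[symmetric] using uv to_B(1-3) X to_exp(1-3) s by simp
    qed
    finally show "qc \<cdot> pair E (T \<cdot> s) a = to_B \<cdot> pair E s a" .
  qed
  show "qp_curry E p q X m \<in> Arr E" "Dom E (qp_curry E p q X m) = X" "Cod E (qp_curry E p q X m) = H"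
    using T1 by (simp_all add: T)
  show ev_T: "ev E p q (qp_curry E p q X m \<cdot> s) a = base m \<cdot> pair E s a"
    if s: "s \<in> Arr E" "a \<in> Arr E" "Dom E s = Dom E a" "Cod E s = X" "Cod E a = P" for s a
    using ev_val[of "T \<cdot> s" a] qm_T[OF s] to_exp(4)[OF s] T1 s by (simp add: T \<beta>_def)
  show "us E p q (qp_curry E p q X m \<cdot> s) a t = p2 E X Ps \<cdot> sh E m (pair E s a) t"
    if s: "s \<in> Arr E" "a \<in> Arr E" "t \<in> Arr E" "Dom E s = Dom E t" "Dom E a = Dom E t" "Cod E s = X" "Cod E a = P" "Cod E t = Qs"
      and eq: "base m \<cdot> pair E s a = q \<cdot> t"
  proof -
    have "us E p q (T \<cdot> s) a t = rc (rr (T \<cdot> s) a) t a"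
      by (rule us_rc) (use ev_T[of s a] T1 s eq in \<open>simp_all add: T\<close>)
    also have "rr (T \<cdot> s) a = to_R \<cdot> pair E s a"
      using comp_assoc[of "pair E s a" to_B "pr1 E R ec"] qc_T[of s a] to_B s X by (simp add: rr_def)
    also have "rc (to_R \<cdot> pair E s a) t a = \<sigma> (pair E s a) t"
      using to_R(5)[of "pair E s a" t] s X eq by (simp add: \<beta>_def)
    finally show ?thesis by (simp add: T \<sigma>_def)
  qed
qed

section \<open>The closure\<close>

abbreviation "hh \<equiv> poly_hom E p q"

text \<open>The two factors of \<open>hh\<close> are a product projection and a pullback of
  \<open>q\<close>, each exponentiable.\<close>

lemma poly_hom_simps [simp]:
  "exponentiable E hh" "Cod E hh = H" "Dom E hh = pb E q ee"
proof -
  have 1: "exponentiable E (pr2 E q ee)"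
    by (rule exponentiable_pr2) simp_all
  show "exponentiable E hh" "Cod E hh = H" "Dom E hh = pb E q ee"
    using exponentiable_comp[OF exponentiable_proj1[of P H] 1] by (simp_all add: poly_hom_def)
qed

text \<open>The elements of the domain of \<open>[p, q]\<close>: a function \<open>x\<close>, an
  argument \<open>a\<close>, and some \<open>t\<close> over the value
  \<open>ev E p q x a\<close>.\<close>

definition "el t x a = pbpair E q ee t (pair E x a)"

lemma el [simp]:
  assumes "x \<in> Arr E" "a \<in> Arr E" "t \<in> Arr E" "Dom E x = Dom E t" "Dom E a = Dom E t" "Cod E x = H" "Cod E a = P"
      "Cod E t = Qs" "ev E p q x a = q \<cdot> t"
  shows "el t x a \<in> Arr E" "Dom E (el t x a) = Dom E t" "Cod E (el t x a) = pb E q ee"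
    "hh \<cdot> el t x a = x" "pr1 E q ee \<cdot> el t x a = t" "pr2 E q ee \<cdot> el t x a = pair E x a"
    "h \<in> Arr E \<Longrightarrow> Cod E h = Dom E t \<Longrightarrow> el t x a \<cdot> h = el (t \<cdot> h) (x \<cdot> h) (a \<cdot> h)"
  using assms by (simp_all add: el_def poly_hom_def)

lemma el_elim:
  assumes "y \<in> Arr E" "Dom E y = d" "Cod E y = pb E q ee"
  obtains t x a where "y = el t x a" "x \<in> Arr E" "a \<in> Arr E" "t \<in> Arr E" "Dom E x = d" "Dom E a = d" "Dom E t = d"
    "Cod E x = H" "Cod E a = P" "Cod E t = Qs" "ev E p q x a = q \<cdot> t"
proof -
  obtain t w where y: "y = pbpair E q ee t w" "t \<in> Arr E" "w \<in> Arr E" "Dom E t = d" "Dom E w = d" "Cod E t = Qs"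
    "Cod E w = prd E H P" "q \<cdot> t = ee \<cdot> w"
    by (rule pb_elim[OF assms]) simp_all
  obtain x a where w: "w = pair E x a" "x \<in> Arr E" "a \<in> Arr E" "Dom E x = d" "Dom E a = d" "Cod E x = H" "Cod E a = P"
    by (rule prod_elim[OF y(3,5,7)]) simp_all
  show thesis
    by (rule that[of t x a]) (use y(2,4,6,8) w in \<open>simp_all add: el_def y(1)\<close>)
qed

text \<open>Premises 1 and 2 identify the base maps by \<open>qp_eqI\<close>. Premise 3 may use this
  equality, so that both sharp maps are compared at the same element \<open>el\<close>.\<close>

lemma to_hom_eqI:
  assumes \<theta>: "\<theta> \<in> Arr (Poly E)" "\<theta>' \<in> Arr (Poly E)" "pdom \<theta> = r" "pdom \<theta>' = r" "pcod \<theta> = hh" "pcod \<theta>' = hh"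
    and 1: "\<And>s a. \<lbrakk>s \<in> Arr E; a \<in> Arr E; Dom E s = Dom E a; Cod E s = Cod E r; Cod E a = P\<rbrakk>
      \<Longrightarrow> ev E p q (base \<theta> \<cdot> s) a = ev E p q (base \<theta>' \<cdot> s) a"
    and 2: "\<And>s a t. \<lbrakk>s \<in> Arr E; a \<in> Arr E; t \<in> Arr E; Dom E s = Dom E t; Dom E a = Dom E t; Cod E s = Cod E r; Cod E a = P;
      Cod E t = Qs; ev E p q (base \<theta> \<cdot> s) a = q \<cdot> t; ev E p q (base \<theta>' \<cdot> s) a = q \<cdot> t\<rbrakk>
      \<Longrightarrow> us E p q (base \<theta> \<cdot> s) a t = us E p q (base \<theta>' \<cdot> s) a t"
    and 3: "\<And>s a t. \<lbrakk>s \<in> Arr E; a \<in> Arr E; t \<in> Arr E; Dom E s = Dom E t; Dom E a = Dom E t; Cod E s = Cod E r; Cod E a = P;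
      Cod E t = Qs; ev E p q (base \<theta> \<cdot> s) a = q \<cdot> t; ev E p q (base \<theta>' \<cdot> s) a = q \<cdot> t; base \<theta> = base \<theta>'\<rbrakk>
      \<Longrightarrow> sh E \<theta> s (el t (base \<theta> \<cdot> s) a) = sh E \<theta>' s (el t (base \<theta>' \<cdot> s) a)"
  shows "\<theta> = \<theta>'"
proof (rule poly_eqI)
  show base: "base \<theta> = base \<theta>'"
    by (rule qp_eqI[where d = "Cod E r"]) (use \<theta> 1 2 in simp_all)
  fix z s y assume sy: "s \<in> Arr E" "y \<in> Arr E" "Dom E s = z" "Dom E y = z" "Cod E s = Cod E (pdom \<theta>)"
    "Cod E y = Dom E (pcod \<theta>)" "base \<theta> \<cdot> s = pcod \<theta> \<cdot> y"
  obtain t x a where y: "y = el t x a" "x \<in> Arr E" "a \<in> Arr E" "t \<in> Arr E" "Dom E x = z" "Dom E a = z" "Dom E t = z"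
    "Cod E x = H" "Cod E a = P" "Cod E t = Qs" "ev E p q x a = q \<cdot> t"
    by (rule el_elim[OF sy(2,4)]) (use sy(6) \<theta> in simp_all)
  have "base \<theta> \<cdot> s = x"
    using sy(7) y(2-) \<theta>(5) by (simp add: y(1))
  then show "sh E \<theta> s y = sh E \<theta>' s y"
    using 3[of s a t] sy(1,3,5) y(2-) \<theta>(3) base by (simp add: y(1))
qed (use \<theta> in simp_all)

end

section \<open>Functoriality of \<open>[p, q]\<close>\<close>

context ccc
begin

lemma poly_pairI: "exponentiable E p \<Longrightarrow> exponentiable E q \<Longrightarrow> poly_pair E p q"
  by (simp add: poly_pair_def poly_pair_axioms_def ccc_axioms)

lemmas ev_simps [simp] = poly_pair.ev[OF poly_pairI]
lemmas us_simps [simp] = poly_pair.us[OF poly_pairI]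
lemmas qp_univ_facts [simp] = poly_pair.qp_univ_simps[OF poly_pairI]
lemmas qp_eval_facts [simp] = poly_pair.qp_eval_simps[OF poly_pairI]
lemmas qp_obj_Obj [simp] = poly_pair.B_simps(8)[OF poly_pairI]
lemmas poly_hom_facts [simp] = poly_pair.poly_hom_simps[OF poly_pairI]
lemmas el_simps [simp] = poly_pair.el[OF poly_pairI]
lemmas el_fold = poly_pair.el_def[OF poly_pairI]
lemmas el_cases = poly_pair.el_elim[OF poly_pairI]
lemmas hom_eqI = poly_pair.to_hom_eqI[OF poly_pairI]
lemmas qp_curry_facts = poly_pair.qp_curry[OF poly_pairI]

lemma poly_hom_mor_simps [simp]:
  "pdom (poly_hom_mor E \<phi> \<psi>) = poly_hom E (pcod \<phi>) (pdom \<psi>)"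
  "pcod (poly_hom_mor E \<phi> \<psi>) = poly_hom E (pdom \<phi>) (pcod \<psi>)"
  by (simp_all add: poly_hom_mor_def Let_def)

text \<open>Together with \<open>poly_hom_mor_simps\<close> these clauses are all that is used of
  \<open>poly_hom_mor\<close>. Base maps act forwards and sharp maps backwards, so \<open>us\<close>
  becomes a threefold composite: back along \<open>\<psi>\<close>, through \<open>x\<close>, back
  along \<open>\<phi>\<close>. In the last clause \<open>y\<close> is a variable, to be instantiated
  after the base map has been rewritten.\<close>

lemma poly_hom_mor:
  assumes \<phi>: "\<phi> \<in> Arr (Poly E)" "pdom \<phi> = p'" "pcod \<phi> = p" and \<psi>: "\<psi> \<in> Arr (Poly E)" "pdom \<psi> = q" "pcod \<psi> = q'"
  shows "poly_hom_mor E \<phi> \<psi> \<in> Arr (Poly E)"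
    and "\<lbrakk>x \<in> Arr E; a \<in> Arr E; Dom E x = Dom E a; Cod E x = qp_obj E p q; Cod E a = Cod E p'\<rbrakk>
      \<Longrightarrow> ev E p' q' (base (poly_hom_mor E \<phi> \<psi>) \<cdot> x) a = base \<psi> \<cdot> ev E p q x (base \<phi> \<cdot> a)"
    and "\<lbrakk>x \<in> Arr E; a \<in> Arr E; t \<in> Arr E; Dom E x = Dom E t; Dom E a = Dom E t; Cod E x = qp_obj E p q; Cod E a = Cod E p';
      Cod E t = Dom E q'; base \<psi> \<cdot> ev E p q x (base \<phi> \<cdot> a) = q' \<cdot> t\<rbrakk>
      \<Longrightarrow> us E p' q' (base (poly_hom_mor E \<phi> \<psi>) \<cdot> x) a t =
        sh E \<phi> a (us E p q x (base \<phi> \<cdot> a) (sh E \<psi> (ev E p q x (base \<phi> \<cdot> a)) t))"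
    and "\<lbrakk>x \<in> Arr E; a \<in> Arr E; t \<in> Arr E; Dom E x = Dom E t; Dom E a = Dom E t; Cod E x = qp_obj E p q; Cod E a = Cod E p';
      Cod E t = Dom E q'; base \<psi> \<cdot> ev E p q x (base \<phi> \<cdot> a) = q' \<cdot> t; y = base (poly_hom_mor E \<phi> \<psi>) \<cdot> x\<rbrakk>
      \<Longrightarrow> sh E (poly_hom_mor E \<phi> \<psi>) x (poly_pair.el E p' q' t y a) =
        poly_pair.el E p q (sh E \<psi> (ev E p q x (base \<phi> \<cdot> a)) t) x (base \<phi> \<cdot> a)"
proof -
  have [simp]: "exponentiable E p" "exponentiable E p'" "exponentiable E q" "exponentiable E q'"
    using poly_arr(1,2)[OF \<phi>(1)] poly_arr(1,2)[OF \<psi>(1)] \<phi> \<psi> by simp_all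
  let ?H = "qp_obj E p q" and ?H' = "qp_obj E p' q'"
  define M where "M = poly_comp E \<psi> (poly_comp E (qp_univ E p q) (poly_tensor_mor E (poly_id E (Ide E ?H)) \<phi>))"
  define b where "b = qp_curry E p' q' ?H M"
  have M: "M \<in> Arr (Poly E)" "pdom M = prodmap E (Ide E ?H) p'" "pcod M = q'"
    using \<phi> \<psi> by (simp_all add: M_def)
  have M_base: "base M \<cdot> pair E x a = base \<psi> \<cdot> ev E p q x (base \<phi> \<cdot> a)"
    if "x \<in> Arr E" "a \<in> Arr E" "Dom E x = Dom E a" "Cod E x = ?H" "Cod E a = Cod E p'" for x a
    using \<phi> \<psi> that by (simp add: M_def)
  have M_sh: "sh E M (pair E x a) t = pair E x (sh E \<phi> a (us E p q x (base \<phi> \<cdot> a) (sh E \<psi> (ev E p q x (base \<phi> \<cdot> a)) t)))"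
    if "x \<in> Arr E" "a \<in> Arr E" "t \<in> Arr E" "Dom E x = Dom E t" "Dom E a = Dom E t" "Cod E x = ?H" "Cod E a = Cod E p'"
      "Cod E t = Dom E q'" "base \<psi> \<cdot> ev E p q x (base \<phi> \<cdot> a) = q' \<cdot> t" for x a t
    using \<phi> \<psi> that by (simp add: M_def)
  have b: "base (poly_hom_mor E \<phi> \<psi>) = b"
    unfolding poly_hom_mor_def Let_def b_def M_def using \<phi> \<psi> by simp
  note curry = qp_curry_facts[of p' q' ?H M, folded b_def]
  have b1: "b \<in> Arr E" "Dom E b = ?H" "Cod E b = ?H'"
    using curry(1-3) M by simp_all
  show b_ev: "ev E p' q' (base (poly_hom_mor E \<phi> \<psi>) \<cdot> x) a = base \<psi> \<cdot> ev E p q x (base \<phi> \<cdot> a)"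
    if x: "x \<in> Arr E" "a \<in> Arr E" "Dom E x = Dom E a" "Cod E x = ?H" "Cod E a = Cod E p'" for x a
    using curry(4)[of x a] M M_base[OF x] x by (simp add: b)
  show "us E p' q' (base (poly_hom_mor E \<phi> \<psi>) \<cdot> x) a t =
      sh E \<phi> a (us E p q x (base \<phi> \<cdot> a) (sh E \<psi> (ev E p q x (base \<phi> \<cdot> a)) t))"
    if x: "x \<in> Arr E" "a \<in> Arr E" "t \<in> Arr E" "Dom E x = Dom E t" "Dom E a = Dom E t" "Cod E x = ?H" "Cod E a = Cod E p'"
      "Cod E t = Dom E q'" "base \<psi> \<cdot> ev E p q x (base \<phi> \<cdot> a) = q' \<cdot> t"
    using curry(5)[of x a t] M M_base[of x a] M_sh[OF x] x \<phi> \<psi> by (simp add: b)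
  let ?h = "poly_hom E p q" and ?h' = "poly_hom E p' q'" and ?e = "qp_eval E p q" and ?e' = "qp_eval E p' q'"
  \<comment> \<open>\<open>b'\<close> and \<open>a'\<close> are read off the triple
    \<open>t\<close>; its component in \<open>?H'\<close> is fixed by the base equation.\<close>
  define \<sigma> where "\<sigma> s t = (let b' = pr1 E q' ?e' \<cdot> t; a' = p2 E ?H' (Cod E p') \<cdot> (pr2 E q' ?e' \<cdot> t); w = pair E s (base \<phi> \<cdot> a')
    in pbpair E q ?e (sh E \<psi> (?e \<cdot> w) b') w)" for s t
  have eq: "poly_hom_mor E \<phi> \<psi> = PMor ?h ?h' b (\<sigma> (pr1 E b ?h') (pr2 E b ?h'))"
    unfolding poly_hom_mor_def Let_def \<sigma>_def b_def M_def sh_def using \<phi> \<psi> by simp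
  have \<sigma>_el: "\<sigma> x (poly_pair.el E p' q' t y a) = poly_pair.el E p q (sh E \<psi> (ev E p q x (base \<phi> \<cdot> a)) t) x (base \<phi> \<cdot> a)"
    if x: "x \<in> Arr E" "a \<in> Arr E" "t \<in> Arr E" "Dom E x = Dom E t" "Dom E a = Dom E t" "Cod E x = ?H" "Cod E a = Cod E p'"
      "Cod E t = Dom E q'" and y: "y \<in> Arr E" "Dom E y = Dom E t" "Cod E y = ?H'" "ev E p' q' y a = q' \<cdot> t"
    for x a t y
    using x y \<phi> \<psi> by (simp add: \<sigma>_def el_fold)
  have 1: "\<sigma> s t \<in> Arr E \<and> Dom E (\<sigma> s t) = z \<and> Cod E (\<sigma> s t) = Dom E ?h \<and> ?h \<cdot> \<sigma> s t = s \<and>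
      (k \<in> Arr E \<longrightarrow> Cod E k = z \<longrightarrow> \<sigma> s t \<cdot> k = \<sigma> (s \<cdot> k) (t \<cdot> k))"
    if st: "s \<in> Arr E" "t \<in> Arr E" "Dom E s = z" "Dom E t = z" "Cod E s = Cod E ?h" "Cod E t = Dom E ?h'" "b \<cdot> s = ?h' \<cdot> t"
    for s t z k
  proof -
    obtain t' y a where t: "t = poly_pair.el E p' q' t' y a" "y \<in> Arr E" "a \<in> Arr E" "t' \<in> Arr E" "Dom E y = z" "Dom E a = z" "Dom E t' = z"
      "Cod E y = ?H'" "Cod E a = Cod E p'" "Cod E t' = Dom E q'" "ev E p' q' y a = q' \<cdot> t'"
      by (rule el_cases[OF _ _ st(2,4)]) (use st(6) in simp_all)
    \<comment> \<open>The base equation identifies the function stored in \<open>t\<close> with the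
      image of \<open>s\<close>. This places \<open>t'\<close> over
      \<open>base \<psi> \<cdot> ev E p q s (base \<phi> \<cdot> a)\<close>, as
      \<open>sh E \<psi>\<close> requires.\<close>
    have y: "b \<cdot> s = y" using st(7) t(2-) by (simp add: t(1))
    have s: "Cod E s = ?H" using st(5) by simp
    have e: "base \<psi> \<cdot> ev E p q s (base \<phi> \<cdot> a) = q' \<cdot> t'"
      using b_ev[of s a] y t(2-) st(1,3) s by (simp add: b)
    have ek: "ev E p' q' (y \<cdot> k) (a \<cdot> k) = q' \<cdot> (t' \<cdot> k)" if "k \<in> Arr E" "Cod E k = z"
    proof -
      have "ev E p' q' y a \<cdot> k = (q' \<cdot> t') \<cdot> k" by (simp only: t(11))
      then show ?thesis using t(2-10) that by simp
    qed
    show ?thesis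
      using st(1,3) s t(2-) e \<phi> \<psi> ek by (simp add: t(1) \<sigma>_el)
  qed
  note mk = poly_mk[where \<sigma> = \<sigma>, OF _ _ _ _ _ _ _ eq]
  show "poly_hom_mor E \<phi> \<psi> \<in> Arr (Poly E)"
    by (rule mk(1)) ((use b1 in \<open>simp; fail\<close>) | use 1 in blast)+
  show "sh E (poly_hom_mor E \<phi> \<psi>) x (poly_pair.el E p' q' t y a) =
      poly_pair.el E p q (sh E \<psi> (ev E p q x (base \<phi> \<cdot> a)) t) x (base \<phi> \<cdot> a)"
    if x: "x \<in> Arr E" "a \<in> Arr E" "t \<in> Arr E" "Dom E x = Dom E t" "Dom E a = Dom E t" "Cod E x = ?H" "Cod E a = Cod E p'"
      "Cod E t = Dom E q'" "base \<psi> \<cdot> ev E p q x (base \<phi> \<cdot> a) = q' \<cdot> t" and y: "y = base (poly_hom_mor E \<phi> \<psi>) \<cdot> x"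
  proof -
    have y: "y = b \<cdot> x" "y \<in> Arr E" "Dom E y = Dom E t" "Cod E y = ?H'" "ev E p' q' y a = q' \<cdot> t"
      using b_ev[of x a] x b1 by (simp_all add: y b)
    have "sh E (poly_hom_mor E \<phi> \<psi>) x (poly_pair.el E p' q' t y a) = \<sigma> x (poly_pair.el E p' q' t y a)"
      by (rule mk(2)) ((use x y b1 in \<open>simp; fail\<close>) | use 1 in blast)+
    also have "\<dots> = poly_pair.el E p q (sh E \<psi> (ev E p q x (base \<phi> \<cdot> a)) t) x (base \<phi> \<cdot> a)"
      by (rule \<sigma>_el) (use x(1-8) y in simp_all)
    finally show ?thesis .
  qed
qed

end

text \<open>One argument of a bifunctor is held fixed by an identity. Applied to the tensor product
  and to the internal hom, it provides both functors of the adjunction.\<close>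

lemma functor_partial:
  assumes F: "is_functor (prod_cat C D) X F" and C: "category C" and D: "category D" and a: "a \<in> Obj C"
  shows "is_functor D X \<lparr>fobj = (\<lambda>d. fobj F (a, d)), farr = (\<lambda>g. farr F (Ide C a, g))\<rparr>"
proof -
  interpret C: category C by fact
  interpret D: category D by fact
  have F1: "\<And>x. x \<in> Obj (prod_cat C D) \<Longrightarrow> fobj F x \<in> Obj X"
    and F2: "\<And>x y f. f \<in> Hom (prod_cat C D) x y \<Longrightarrow> farr F f \<in> Hom X (fobj F x) (fobj F y)"
    and F3: "\<And>x. x \<in> Obj (prod_cat C D) \<Longrightarrow> farr F (Ide (prod_cat C D) x) = Ide X (fobj F x)"
    and F4: "\<And>x y z f g. f \<in> Hom (prod_cat C D) x y \<Longrightarrow> g \<in> Hom (prod_cat C D) y z \<Longrightarrow>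
      farr F (Comp (prod_cat C D) g f) = Comp X (farr F g) (farr F f)"
    and X: "category X"
    using F unfolding is_functor_def by blast+
  have H: "(Ide C a, g) \<in> Hom (prod_cat C D) (a, d) (a, d')" if "g \<in> Hom D d d'" for g d d'
    using that a by simp
  show ?thesis
    unfolding is_functor_def
  proof (intro conjI allI ballI D X)
    fix d d' d'' g g' assume g: "g \<in> Hom D d d'" "g' \<in> Hom D d' d''"
    show "farr \<lparr>fobj = \<lambda>d. fobj F (a, d), farr = \<lambda>g. farr F (Ide C a, g)\<rparr> (Comp D g' g) =
        Comp X (farr \<lparr>fobj = \<lambda>d. fobj F (a, d), farr = \<lambda>g. farr F (Ide C a, g)\<rparr> g')
          (farr \<lparr>fobj = \<lambda>d. fobj F (a, d), farr = \<lambda>g. farr F (Ide C a, g)\<rparr> g)"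
      using F4[OF H[OF g(1)] H[OF g(2)]] a by simp
  next
    fix d assume "d \<in> Obj D"
    then show "farr \<lparr>fobj = \<lambda>d. fobj F (a, d), farr = \<lambda>g. farr F (Ide C a, g)\<rparr> (Ide D d) =
        Ide X (fobj \<lparr>fobj = \<lambda>d. fobj F (a, d), farr = \<lambda>g. farr F (Ide C a, g)\<rparr> d)"
      using F3[of "(a, d)"] a by simp
  next
    fix d d' g assume "g \<in> Hom D d d'"
    from F2[OF H[OF this]] show "farr \<lparr>fobj = \<lambda>d. fobj F (a, d), farr = \<lambda>g. farr F (Ide C a, g)\<rparr> g \<in>
        Hom X (fobj \<lparr>fobj = \<lambda>d. fobj F (a, d), farr = \<lambda>g. farr F (Ide C a, g)\<rparr> d)
          (fobj \<lparr>fobj = \<lambda>d. fobj F (a, d), farr = \<lambda>g. farr F (Ide C a, g)\<rparr> d')"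
      by (simp del: Hom_iff)
  qed (use F1 a in simp)
qed

context ccc
begin

lemma poly_hom_mor_id:
  assumes p: "exponentiable E p" and q: "exponentiable E q"
  shows "poly_hom_mor E (poly_id E p) (poly_id E q) = poly_id E (poly_hom E p q)" (is "?l = ?r")
proof -
  have ar: "p \<in> Arr E" "q \<in> Arr E" using p q by simp_all
  note F = poly_hom_mor[OF poly_id(1)[OF p] poly_id_simps(1,2) poly_id(1)[OF q] poly_id_simps(1,2)]
  have [simp]: "?l \<in> Arr (Poly E)" "Dom E (base ?l) = qp_obj E p q" "Cod E (base ?l) = qp_obj E p q"
    using F(1) p q poly_arr(4,5)[OF F(1)] by simp_all
  show ?thesis
  proof (rule hom_eqI[OF p q, where r = "poly_hom E p q"])
    fix s a assume s: "s \<in> Arr E" "a \<in> Arr E" "Dom E s = Dom E a" "Cod E s = Cod E (poly_hom E p q)" "Cod E a = Cod E p"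
    show "ev E p q (base ?l \<cdot> s) a = ev E p q (base ?r \<cdot> s) a"
      using F(2)[of s a] s p q ar by simp
  next
    fix s a t assume s: "s \<in> Arr E" "a \<in> Arr E" "t \<in> Arr E" "Dom E s = Dom E t" "Dom E a = Dom E t"
      "Cod E s = Cod E (poly_hom E p q)" "Cod E a = Cod E p" "Cod E t = Dom E q"
      "ev E p q (base ?l \<cdot> s) a = q \<cdot> t" "ev E p q (base ?r \<cdot> s) a = q \<cdot> t"
    have s': "Cod E s = qp_obj E p q" using s(6) p q by simp
    have e: "ev E p q s a = q \<cdot> t" using s(10) s(1) s' p q by simp
    have rs: "base ?r \<cdot> s = s" using s(1) s' p q by simp
    show "us E p q (base ?l \<cdot> s) a t = us E p q (base ?r \<cdot> s) a t"
      unfolding rs using F(3)[of s a t] s(1-5,7,8) s' p q ar e by simp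
    assume "base ?l = base ?r"
    then have ls: "base ?l \<cdot> s = s" using rs by simp
    show "sh E ?l s (poly_pair.el E p q t (base ?l \<cdot> s) a) = sh E ?r s (poly_pair.el E p q t (base ?r \<cdot> s) a)"
      unfolding rs ls using F(4)[of s a t s] ls s(1-5,7,8) s' p q ar e by simp
  qed (use p q in simp_all)
qed

text \<open>Sharp maps run backwards, so on the right the triple is first carried along
  \<open>?B\<close> and then along \<open>?A\<close>, and the four sharp maps involved occur in the
  same order as in the composites on the left.\<close>

lemma poly_hom_mor_comp:
  assumes \<phi>: "\<phi> \<in> Arr (Poly E)" "\<phi>' \<in> Arr (Poly E)" "pcod \<phi>' = pdom \<phi>"
    and \<psi>: "\<psi> \<in> Arr (Poly E)" "\<psi>' \<in> Arr (Poly E)" "pcod \<psi> = pdom \<psi>'"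
  shows "poly_hom_mor E (poly_comp E \<phi> \<phi>') (poly_comp E \<psi>' \<psi>) =
    poly_comp E (poly_hom_mor E \<phi>' \<psi>') (poly_hom_mor E \<phi> \<psi>)" (is "?l = ?r")
proof -
  let ?p = "pcod \<phi>" and ?p' = "pdom \<phi>" and ?p'' = "pdom \<phi>'" and ?q = "pdom \<psi>" and ?q' = "pdom \<psi>'" and ?q'' = "pcod \<psi>'"
  have ar: "?p \<in> Arr E" "?p' \<in> Arr E" "?p'' \<in> Arr E" "?q \<in> Arr E" "?q' \<in> Arr E" "?q'' \<in> Arr E"
    and ex: "exponentiable E ?p" "exponentiable E ?p'" "exponentiable E ?p''"
      "exponentiable E ?q" "exponentiable E ?q'" "exponentiable E ?q''"
    using \<phi> \<psi> by simp_all
  let ?A = "poly_hom_mor E \<phi> \<psi>" and ?B = "poly_hom_mor E \<phi>' \<psi>'"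
  note A = poly_hom_mor[OF \<phi>(1) refl refl \<psi>(1) refl \<psi>(3)]
  note B = poly_hom_mor[OF \<phi>(2) refl \<phi>(3) \<psi>(2) refl refl]
  note L = poly_hom_mor[OF poly_comp(1)[OF \<phi>(2,1,3)] poly_comp_simps(1,2) poly_comp(1)[OF \<psi>] poly_comp_simps(1,2)]
  have bA: "base ?A \<in> Arr E" "Dom E (base ?A) = qp_obj E ?p ?q" "Cod E (base ?A) = qp_obj E ?p' ?q'"
    using poly_arr(3-5)[OF A(1)] ex \<phi> \<psi> by simp_all
  have bB: "base ?B \<in> Arr E" "Dom E (base ?B) = qp_obj E ?p' ?q'" "Cod E (base ?B) = qp_obj E ?p'' ?q''"
    using poly_arr(3-5)[OF B(1)] ex \<phi> \<psi> by simp_all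
  have rs: "base ?r \<cdot> s = base ?B \<cdot> (base ?A \<cdot> s)" if "s \<in> Arr E" "Cod E s = qp_obj E ?p ?q" for s
    using bA bB that by simp
  show ?thesis
  proof (rule hom_eqI[OF ex(3,6), where r = "poly_hom E ?p ?q"])
    fix s a assume s: "s \<in> Arr E" "a \<in> Arr E" "Dom E s = Dom E a" "Cod E s = Cod E (poly_hom E ?p ?q)" "Cod E a = Cod E ?p''"
    have s': "Cod E s = qp_obj E ?p ?q" using s(4) ex by simp
    show "ev E ?p'' ?q'' (base ?l \<cdot> s) a = ev E ?p'' ?q'' (base ?r \<cdot> s) a"
      unfolding rs[OF s(1) s']
      using L(2)[of s a] B(2)[of "base ?A \<cdot> s" a] A(2)[of s "base \<phi>' \<cdot> a"] s(1-3,5) s' bA bB \<phi> \<psi> ar ex by simp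
  next
    fix s a t assume s: "s \<in> Arr E" "a \<in> Arr E" "t \<in> Arr E" "Dom E s = Dom E t" "Dom E a = Dom E t"
      "Cod E s = Cod E (poly_hom E ?p ?q)" "Cod E a = Cod E ?p''" "Cod E t = Dom E ?q''"
      "ev E ?p'' ?q'' (base ?l \<cdot> s) a = ?q'' \<cdot> t"
    have s': "Cod E s = qp_obj E ?p ?q" using s(6) ex by simp
    let ?x = "base ?A \<cdot> s" and ?a = "base \<phi>' \<cdot> a"
    have x: "?x \<in> Arr E" "Dom E ?x = Dom E t" "Cod E ?x = qp_obj E ?p' ?q'"
      and a: "?a \<in> Arr E" "Dom E ?a = Dom E t" "Cod E ?a = Cod E ?p'"
      using s(1-5,7,8) s' bA \<phi> \<psi> by simp_all
    have eA: "ev E ?p' ?q' ?x ?a = base \<psi> \<cdot> ev E ?p ?q s (base \<phi> \<cdot> ?a)"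
      by (rule A(2)) (use s(1-5) s' a in simp_all)
    have e: "base \<psi>' \<cdot> (base \<psi> \<cdot> ev E ?p ?q s (base \<phi> \<cdot> ?a)) = ?q'' \<cdot> t"
      using s(9) L(2)[of s a] s(1-5,7,8) s' a \<phi> \<psi> ar ex by simp
    \<comment> \<open>The element carried back along \<open>\<psi>'\<close>; it is the argument at
      which the clauses for \<open>?A\<close> are applied.\<close>
    let ?t = "sh E \<psi>' (ev E ?p' ?q' ?x ?a) t"
    have t: "?t \<in> Arr E" "Dom E ?t = Dom E t" "Cod E ?t = Dom E ?q'" "?q' \<cdot> ?t = base \<psi> \<cdot> ev E ?p ?q s (base \<phi> \<cdot> ?a)"
      using s(1-5,7,8) s' e a \<phi> \<psi> ex by (simp_all add: eA)
    have uA: "us E ?p' ?q' ?x ?a ?t = sh E \<phi> ?a (us E ?p ?q s (base \<phi> \<cdot> ?a) (sh E \<psi> (ev E ?p ?q s (base \<phi> \<cdot> ?a)) ?t))"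
      by (rule A(3)) (use s(1-5) s' a t in simp_all)
    have uB: "us E ?p'' ?q'' (base ?B \<cdot> ?x) a t = sh E \<phi>' a (us E ?p' ?q' ?x ?a ?t)"
      by (rule B(3)) (use s(1-5,7,8) s' x e in \<open>simp_all add: eA\<close>)
    have uL: "us E ?p'' ?q'' (base ?l \<cdot> s) a t = sh E (poly_comp E \<phi> \<phi>') a
        (us E ?p ?q s (base (poly_comp E \<phi> \<phi>') \<cdot> a) (sh E (poly_comp E \<psi>' \<psi>) (ev E ?p ?q s (base (poly_comp E \<phi> \<phi>') \<cdot> a)) t))"
      by (rule L(3)) (use s(1-5,7,8) s' e a \<phi> \<psi> ex in simp_all)
    show "us E ?p'' ?q'' (base ?l \<cdot> s) a t = us E ?p'' ?q'' (base ?r \<cdot> s) a t"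
      unfolding rs[OF s(1) s'] uL uB uA
      using s(1-5,7,8) s' e a \<phi> \<psi> ex by (simp add: eA)
    assume "base ?l = base ?r"
    have "sh E ?l s (poly_pair.el E ?p'' ?q'' t (base ?l \<cdot> s) a) =
        poly_pair.el E ?p ?q (sh E (poly_comp E \<psi>' \<psi>) (ev E ?p ?q s (base (poly_comp E \<phi> \<phi>') \<cdot> a)) t) s (base (poly_comp E \<phi> \<phi>') \<cdot> a)"
      by (rule L(4)) (use s(1-5,7,8) s' e a \<phi> \<psi> ex in simp_all)
    also have "\<dots> = poly_pair.el E ?p ?q (sh E \<psi> (ev E ?p ?q s (base \<phi> \<cdot> ?a)) ?t) s (base \<phi> \<cdot> ?a)"
      using s(1-5,7,8) s' e a \<phi> \<psi> ex by (simp add: eA)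
    also have "\<dots> = sh E ?A s (poly_pair.el E ?p' ?q' ?t ?x ?a)"
      by (rule A(4)[symmetric]) (use s(1-5) s' a t in simp_all)
    also have "poly_pair.el E ?p' ?q' ?t ?x ?a = sh E ?B ?x (poly_pair.el E ?p'' ?q'' t (base ?B \<cdot> ?x) a)"
      by (rule B(4)[symmetric]) (use s(1-5,7,8) s' x e in \<open>simp_all add: eA\<close>)
    also have "sh E ?A s (sh E ?B ?x (poly_pair.el E ?p'' ?q'' t (base ?B \<cdot> ?x) a)) =
        sh E ?r s (poly_pair.el E ?p'' ?q'' t (base ?B \<cdot> ?x) a)"
    proof (rule poly_comp(2)[symmetric])
      have "ev E ?p'' ?q'' (base ?B \<cdot> ?x) a = ?q'' \<cdot> t"
        using B(2)[of ?x a] s(1-5,7,8) s' x e by (simp add: eA)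
      then show "base ?B \<cdot> (base ?A \<cdot> s) = pcod ?B \<cdot> poly_pair.el E ?p'' ?q'' t (base ?B \<cdot> ?x) a"
        "poly_pair.el E ?p'' ?q'' t (base ?B \<cdot> ?x) a \<in> Arr E"
        "Dom E s = Dom E (poly_pair.el E ?p'' ?q'' t (base ?B \<cdot> ?x) a)"
        "Cod E (poly_pair.el E ?p'' ?q'' t (base ?B \<cdot> ?x) a) = Dom E (pcod ?B)"
        using s(1-5,7,8) s' x bB ex by simp_all
    qed (use A(1) B(1) s(1) s' \<phi> \<psi> ex in simp_all)
    finally show "sh E ?l s (poly_pair.el E ?p'' ?q'' t (base ?l \<cdot> s) a) = sh E ?r s (poly_pair.el E ?p'' ?q'' t (base ?r \<cdot> s) a)"
      unfolding rs[OF s(1) s'] .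
  qed (use A(1) B(1) L(1) \<phi> \<psi> ex in simp_all)
qed

lemma functor_poly_hom: "is_functor (prod_cat (op_cat (Poly E)) (Poly E)) (Poly E) (poly_hom_functor E)"
proof -
  interpret Poly: category "Poly E" by (rule category_Poly)
  note M = poly_hom_functor_def
  show ?thesis
    unfolding is_functor_def
  proof (intro conjI allI ballI category_prod Poly.category_op category_Poly)
    show "fobj (poly_hom_functor E) a \<in> Obj (Poly E)" if "a \<in> Obj (prod_cat (op_cat (Poly E)) (Poly E))" for a
      using that by (auto simp: M)
    show "farr (poly_hom_functor E) f \<in> Hom (Poly E) (fobj (poly_hom_functor E) a) (fobj (poly_hom_functor E) b)"
      if "f \<in> Hom (prod_cat (op_cat (Poly E)) (Poly E)) a b" for f a b
      using that by (cases f; cases a; cases b) (auto simp: M intro!: poly_hom_mor(1))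
    show "farr (poly_hom_functor E) (Ide (prod_cat (op_cat (Poly E)) (Poly E)) a) = Ide (Poly E) (fobj (poly_hom_functor E) a)"
      if "a \<in> Obj (prod_cat (op_cat (Poly E)) (Poly E))" for a
      using that by (auto simp: M poly_hom_mor_id)
    show "farr (poly_hom_functor E) (Comp (prod_cat (op_cat (Poly E)) (Poly E)) g f) =
        Comp (Poly E) (farr (poly_hom_functor E) g) (farr (poly_hom_functor E) f)"
      if "f \<in> Hom (prod_cat (op_cat (Poly E)) (Poly E)) a b" "g \<in> Hom (prod_cat (op_cat (Poly E)) (Poly E)) b c" for f g a b c
      using that by (cases f; cases g) (auto simp: M poly_hom_mor_comp)
  qed
qed

end

text \<open>In terms of elements, the transpose \<open>r \<rightarrow> [p, q]\<close> of \<open>\<phi> : p \<otimes> r \<rightarrow> q\<close> sends \<open>s\<close> to the pair of functions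
  \<open>a \<mapsto> \<phi>\<^sub>1(a, s)\<close> and \<open>(a, t) \<mapsto> \<phi>\<^sup>\<sharp>((a, s), t)\<close> (first component), and its \<open>sharp\<close> is the second component
  of \<open>\<phi>\<^sup>\<sharp>\<close>.\<close>

definition curry_mor :: "('o, 'a) cat \<Rightarrow> 'a \<Rightarrow> 'a \<Rightarrow> 'a poly_mor \<Rightarrow> 'a poly_mor" where
  "curry_mor E p r \<phi> =
     (let P = Cod E p; R = Cod E r; q = pcod \<phi>;
        b = Comp E (base \<phi>) (pair E (p2 E R P) (p1 E R P)); s = pr1 E b q
      in PMor (prodmap E (Ide E R) p) q b
        (pair E (Comp E (p1 E R P) s) (Comp E (p1 E (Dom E p) (Dom E r))
          (sh E \<phi> (pair E (Comp E (p2 E R P) s) (Comp E (p1 E R P) s)) (pr2 E b q)))))"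

definition transpose :: "('o, 'a) cat \<Rightarrow> 'a \<Rightarrow> 'a \<Rightarrow> 'a \<Rightarrow> 'a poly_mor \<Rightarrow> 'a poly_mor" where
  "transpose E p r q \<phi> =
     (let b = qp_curry E p q (Cod E r) (curry_mor E p r \<phi>); h = poly_hom E p q;
        s = pr1 E b h; y = pr2 E b h
      in PMor r h b (Comp E (p2 E (Dom E p) (Dom E r))
        (sh E \<phi> (pair E (Comp E (p2 E (qp_obj E p q) (Cod E p)) (Comp E (pr2 E q (qp_eval E p q)) y)) s)
          (Comp E (pr1 E q (qp_eval E p q)) y))))"

text \<open>The inverse of \<open>transpose\<close>: the two components of the sharp map, separated
  by transposition, are put side by side again.\<close>

definition untranspose :: "('o, 'a) cat \<Rightarrow> 'a \<Rightarrow> 'a \<Rightarrow> 'a \<Rightarrow> 'a poly_mor \<Rightarrow> 'a poly_mor" where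
  "untranspose E p r q \<theta> =
     (let P = Cod E p; R = Cod E r;
        b = ev E p q (Comp E (base \<theta>) (p2 E P R)) (p1 E P R);
        a = Comp E (p1 E P R) (pr1 E b q); s = Comp E (p2 E P R) (pr1 E b q); t = pr2 E b q;
        x = Comp E (base \<theta>) s
      in PMor (prodmap E p r) q b (pair E (us E p q x a t) (sh E \<theta> s (poly_pair.el E p q t x a))))"

section \<open>Transposition and its naturality\<close>

context ccc
begin

text \<open>The value of the sharp map lies over \<open>(a, s)\<close>, so its components
  \<open>u\<close> and \<open>v\<close> lie over \<open>a\<close> and \<open>s\<close>
  separately.\<close>

lemma sh_pair_elim:
  assumes \<phi>: "\<phi> \<in> Arr (Poly E)" "pdom \<phi> = prodmap E p r" "p \<in> Arr E" "r \<in> Arr E"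
    and "a \<in> Arr E" "s \<in> Arr E" "t \<in> Arr E" "Dom E a = d" "Dom E s = d" "Dom E t = d" "Cod E a = Cod E p" "Cod E s = Cod E r"
      "Cod E t = Dom E (pcod \<phi>)" "base \<phi> \<cdot> pair E a s = pcod \<phi> \<cdot> t"
  obtains u v where "sh E \<phi> (pair E a s) t = pair E u v" "u \<in> Arr E" "v \<in> Arr E" "Dom E u = d" "Dom E v = d"
    "Cod E u = Dom E p" "Cod E v = Dom E r" "p \<cdot> u = a" "r \<cdot> v = s"
proof -
  define w where "w = sh E \<phi> (pair E a s) t"
  have w: "w \<in> Arr E" "Dom E w = d" "Cod E w = prd E (Dom E p) (Dom E r)" and pw: "prodmap E p r \<cdot> w = pair E a s"
    unfolding w_def using assms by (simp_all del: prodmap_comp)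
  obtain u v where uv: "w = pair E u v" "u \<in> Arr E" "v \<in> Arr E" "Dom E u = d" "Dom E v = d"
    "Cod E u = Dom E p" "Cod E v = Dom E r"
    by (rule prod_elim[OF w]) (use \<phi> in simp_all)
  have "p \<cdot> u = a" "r \<cdot> v = s"
    using pw uv(2-) assms by (simp_all add: uv(1))
  with uv that show thesis by (simp add: w_def)
qed

text \<open>Replacing the component of the sharp map in the domain of \<open>r\<close> by the base
  element \<open>s\<close> below it leaves a morphism out of \<open>id \<otimes> p\<close>, the kind
  of datum that \<open>qp_curry\<close> accepts. The factors are exchanged because there the
  parameter comes before the argument in \<open>P\<close>.\<close>

lemma curry_mor:
  assumes p: "exponentiable E p" and r: "exponentiable E r"
    and \<phi>: "\<phi> \<in> Arr (Poly E)" "pdom \<phi> = prodmap E p r" "pcod \<phi> = q"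
  shows "curry_mor E p r \<phi> \<in> Arr (Poly E)" "pdom (curry_mor E p r \<phi>) = prodmap E (Ide E (Cod E r)) p"
    "pcod (curry_mor E p r \<phi>) = q"
    "\<lbrakk>s \<in> Arr E; a \<in> Arr E; Dom E s = Dom E a; Cod E s = Cod E r; Cod E a = Cod E p\<rbrakk>
      \<Longrightarrow> base (curry_mor E p r \<phi>) \<cdot> pair E s a = base \<phi> \<cdot> pair E a s"
    "\<lbrakk>s \<in> Arr E; a \<in> Arr E; t \<in> Arr E; Dom E s = Dom E t; Dom E a = Dom E t; Cod E s = Cod E r; Cod E a = Cod E p;
      Cod E t = Dom E q; base \<phi> \<cdot> pair E a s = q \<cdot> t\<rbrakk>
      \<Longrightarrow> sh E (curry_mor E p r \<phi>) (pair E s a) t = pair E s (p1 E (Dom E p) (Dom E r) \<cdot> sh E \<phi> (pair E a s) t)"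
proof -
  have q: "exponentiable E q" using poly_arr(2)[OF \<phi>(1)] \<phi>(3) by simp
  have ar: "p \<in> Arr E" "r \<in> Arr E" "q \<in> Arr E" using p q r by simp_all
  let ?P = "Cod E p" and ?R = "Cod E r"
  let ?b = "base \<phi> \<cdot> pair E (p2 E ?R ?P) (p1 E ?R ?P)"
  define \<sigma> where "\<sigma> s t = pair E (p1 E ?R ?P \<cdot> s) (p1 E (Dom E p) (Dom E r) \<cdot>
    sh E \<phi> (pair E (p2 E ?R ?P \<cdot> s) (p1 E ?R ?P \<cdot> s)) t)" for s t
  have eq: "curry_mor E p r \<phi> = PMor (prodmap E (Ide E ?R) p) q ?b (\<sigma> (pr1 E ?b q) (pr2 E ?b q))"
    by (simp add: curry_mor_def Let_def \<sigma>_def \<phi>(3))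
  then show "pdom (curry_mor E p r \<phi>) = prodmap E (Ide E ?R) p" "pcod (curry_mor E p r \<phi>) = q" by simp_all
  show "base (curry_mor E p r \<phi>) \<cdot> pair E s a = base \<phi> \<cdot> pair E a s"
    if "s \<in> Arr E" "a \<in> Arr E" "Dom E s = Dom E a" "Cod E s = ?R" "Cod E a = ?P" for s a
    unfolding eq using that \<phi> ar by simp
  have 1: "\<sigma> s t \<in> Arr E \<and> Dom E (\<sigma> s t) = d \<and> Cod E (\<sigma> s t) = Dom E (prodmap E (Ide E ?R) p) \<and>
      prodmap E (Ide E ?R) p \<cdot> \<sigma> s t = s \<and> (h \<in> Arr E \<longrightarrow> Cod E h = d \<longrightarrow> \<sigma> s t \<cdot> h = \<sigma> (s \<cdot> h) (t \<cdot> h))"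
    if st: "s \<in> Arr E" "t \<in> Arr E" "Dom E s = d" "Dom E t = d" "Cod E s = Cod E (prodmap E (Ide E ?R) p)" "Cod E t = Dom E q"
      "?b \<cdot> s = q \<cdot> t" for s t d h
  proof -
    obtain x a where s: "s = pair E x a" "x \<in> Arr E" "a \<in> Arr E" "Dom E x = d" "Dom E a = d" "Cod E x = ?R" "Cod E a = ?P"
      by (rule prod_elim[OF st(1,3), of ?R ?P]) (use st(5) ar in simp_all)
    have e: "base \<phi> \<cdot> pair E a x = q \<cdot> t"
      using st(7) s(2-) \<phi> ar by (simp add: s(1))
    obtain u v where uv: "sh E \<phi> (pair E a x) t = pair E u v" "u \<in> Arr E" "v \<in> Arr E" "Dom E u = d" "Dom E v = d"
      "Cod E u = Dom E p" "Cod E v = Dom E r" "p \<cdot> u = a" "r \<cdot> v = x"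
      by (rule sh_pair_elim[OF \<phi>(1,2) ar(1,2) s(3,2) st(2) s(5,4) st(4)]) (use s(2-) st(6) e \<phi>(3) in simp_all)
    have 2: "\<sigma> (pair E x a) t = pair E x u"
      using s(2-) uv(2-) ar by (simp add: \<sigma>_def uv(1))
    have "\<sigma> (pair E x a) t \<cdot> h = \<sigma> (pair E x a \<cdot> h) (t \<cdot> h)" if h: "h \<in> Arr E" "Cod E h = d"
      using s(2-) st(2,4,6) e \<phi> ar h by (simp add: \<sigma>_def)
    then show ?thesis
      using 2 s(2-) uv(2-) ar by (simp add: s(1))
  qed
  note mk = poly_mk[where \<sigma> = \<sigma>, OF _ _ _ _ _ _ _ eq]
  show "curry_mor E p r \<phi> \<in> Arr (Poly E)"
    by (rule mk(1)) ((use p q r ar \<phi> in \<open>simp; fail\<close>) | use 1 in blast)+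
  show "sh E (curry_mor E p r \<phi>) (pair E s a) t = pair E s (p1 E (Dom E p) (Dom E r) \<cdot> sh E \<phi> (pair E a s) t)"
    if x: "s \<in> Arr E" "a \<in> Arr E" "t \<in> Arr E" "Dom E s = Dom E t" "Dom E a = Dom E t" "Cod E s = Cod E r" "Cod E a = Cod E p"
      "Cod E t = Dom E q" "base \<phi> \<cdot> pair E a s = q \<cdot> t"
  proof -
    have "sh E (curry_mor E p r \<phi>) (pair E s a) t = \<sigma> (pair E s a) t"
      by (rule mk(2)) ((use p q r ar \<phi> x in \<open>simp; fail\<close>) | use 1 in blast)+
    then show ?thesis using x ar by (simp add: \<sigma>_def)
  qed
qed

lemma transpose_simps [simp]: "pdom (transpose E p r q \<phi>) = r" "pcod (transpose E p r q \<phi>) = poly_hom E p q"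
  by (simp_all add: transpose_def Let_def)

text \<open>The component of the sharp map in the domain of \<open>p\<close> is absorbed into the
  base map as \<open>us\<close>; the component in the domain of \<open>r\<close> becomes the new
  sharp map. Together they retain all of \<open>\<phi>\<close>.\<close>

lemma transpose:
  assumes p: "exponentiable E p" and r: "exponentiable E r"
    and \<phi>: "\<phi> \<in> Arr (Poly E)" "pdom \<phi> = prodmap E p r" "pcod \<phi> = q"
  shows "transpose E p r q \<phi> \<in> Arr (Poly E)"
    "\<lbrakk>s \<in> Arr E; a \<in> Arr E; Dom E s = Dom E a; Cod E s = Cod E r; Cod E a = Cod E p\<rbrakk>
      \<Longrightarrow> ev E p q (base (transpose E p r q \<phi>) \<cdot> s) a = base \<phi> \<cdot> pair E a s"
    "\<lbrakk>s \<in> Arr E; a \<in> Arr E; t \<in> Arr E; Dom E s = Dom E t; Dom E a = Dom E t; Cod E s = Cod E r; Cod E a = Cod E p;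
      Cod E t = Dom E q; base \<phi> \<cdot> pair E a s = q \<cdot> t\<rbrakk>
      \<Longrightarrow> us E p q (base (transpose E p r q \<phi>) \<cdot> s) a t = p1 E (Dom E p) (Dom E r) \<cdot> sh E \<phi> (pair E a s) t"
    "\<lbrakk>s \<in> Arr E; a \<in> Arr E; t \<in> Arr E; Dom E s = Dom E t; Dom E a = Dom E t; Cod E s = Cod E r; Cod E a = Cod E p;
      Cod E t = Dom E q; base \<phi> \<cdot> pair E a s = q \<cdot> t; x = base (transpose E p r q \<phi>) \<cdot> s\<rbrakk>
      \<Longrightarrow> sh E (transpose E p r q \<phi>) s (poly_pair.el E p q t x a) = p2 E (Dom E p) (Dom E r) \<cdot> sh E \<phi> (pair E a s) t"
proof -
  have q: "exponentiable E q" using poly_arr(2)[OF \<phi>(1)] \<phi>(3) by simp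
  have ar: "p \<in> Arr E" "r \<in> Arr E" "q \<in> Arr E" using p q r by simp_all
  let ?P = "Cod E p" and ?R = "Cod E r" and ?h = "poly_hom E p q" and ?e = "qp_eval E p q" and ?H = "qp_obj E p q"
  note cm = curry_mor[OF p r \<phi>]
  define b where "b = qp_curry E p q ?R (curry_mor E p r \<phi>)"
  note curry = qp_curry_facts[OF p q dom_cod_obj(2)[OF ar(2)] cm(1-3), folded b_def]
  have b: "base (transpose E p r q \<phi>) = b" by (simp add: transpose_def Let_def b_def)
  have b1: "b \<in> Arr E" "Dom E b = ?R" "Cod E b = ?H" using curry(1-3) by simp_all
  show b_ev: "ev E p q (base (transpose E p r q \<phi>) \<cdot> s) a = base \<phi> \<cdot> pair E a s"
    if s: "s \<in> Arr E" "a \<in> Arr E" "Dom E s = Dom E a" "Cod E s = ?R" "Cod E a = ?P" for s a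
    unfolding b using curry(4)[OF s] cm(4)[OF s] by simp
  show "us E p q (base (transpose E p r q \<phi>) \<cdot> s) a t = p1 E (Dom E p) (Dom E r) \<cdot> sh E \<phi> (pair E a s) t"
    if s: "s \<in> Arr E" "a \<in> Arr E" "t \<in> Arr E" "Dom E s = Dom E t" "Dom E a = Dom E t" "Cod E s = ?R" "Cod E a = ?P"
      "Cod E t = Dom E q" "base \<phi> \<cdot> pair E a s = q \<cdot> t" for s a t
  proof -
    have "us E p q (b \<cdot> s) a t = p2 E ?R (Dom E p) \<cdot> sh E (curry_mor E p r \<phi>) (pair E s a) t"
      by (rule curry(5)) (use cm(4)[of s a] s in simp_all)
    then show ?thesis
      unfolding b cm(5)[OF s] using s \<phi> ar by simp
  qed
  \<comment> \<open>\<open>t\<close> and \<open>a\<close> are read off the triple \<open>y\<close>;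
    its component in \<open>?H\<close> is \<open>b \<cdot> s\<close> by the base equation.\<close>
  define \<sigma> where "\<sigma> s y = p2 E (Dom E p) (Dom E r) \<cdot>
    sh E \<phi> (pair E (p2 E ?H ?P \<cdot> (pr2 E q ?e \<cdot> y)) s) (pr1 E q ?e \<cdot> y)" for s y
  have eq: "transpose E p r q \<phi> = PMor r ?h b (\<sigma> (pr1 E b ?h) (pr2 E b ?h))"
    by (simp add: transpose_def Let_def b_def \<sigma>_def)
  have \<sigma>_el: "\<sigma> s (poly_pair.el E p q t x a) = p2 E (Dom E p) (Dom E r) \<cdot> sh E \<phi> (pair E a s) t"
    if "x \<in> Arr E" "a \<in> Arr E" "t \<in> Arr E" "Dom E x = Dom E t" "Dom E a = Dom E t" "Cod E x = ?H" "Cod E a = ?P"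
      "Cod E t = Dom E q" "ev E p q x a = q \<cdot> t" for s t x a
    using that p q ar by (simp add: \<sigma>_def)
  have 1: "\<sigma> s y \<in> Arr E \<and> Dom E (\<sigma> s y) = z \<and> Cod E (\<sigma> s y) = Dom E r \<and> r \<cdot> \<sigma> s y = s \<and>
      (k \<in> Arr E \<longrightarrow> Cod E k = z \<longrightarrow> \<sigma> s y \<cdot> k = \<sigma> (s \<cdot> k) (y \<cdot> k))"
    if st: "s \<in> Arr E" "y \<in> Arr E" "Dom E s = z" "Dom E y = z" "Cod E s = ?R" "Cod E y = Dom E ?h" "b \<cdot> s = ?h \<cdot> y"
    for s y z k
  proof -
    obtain t x a where y: "y = poly_pair.el E p q t x a" "x \<in> Arr E" "a \<in> Arr E" "t \<in> Arr E" "Dom E x = z" "Dom E a = z" "Dom E t = z"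
      "Cod E x = ?H" "Cod E a = ?P" "Cod E t = Dom E q" "ev E p q x a = q \<cdot> t"
      by (rule el_cases[OF p q st(2,4)]) (use st(6) p q in simp_all)
    have bs: "b \<cdot> s = x" using st(7) y(2-) p q by (simp add: y(1))
    have e: "base \<phi> \<cdot> pair E a s = q \<cdot> t"
      using b_ev[of s a] bs y(2-) st(1,3,5) by (simp add: b)
    obtain u v where uv: "sh E \<phi> (pair E a s) t = pair E u v" "u \<in> Arr E" "v \<in> Arr E" "Dom E u = z" "Dom E v = z"
      "Cod E u = Dom E p" "Cod E v = Dom E r" "p \<cdot> u = a" "r \<cdot> v = s"
      by (rule sh_pair_elim[OF \<phi>(1,2) ar(1,2) y(3) st(1) y(4,6) st(3) y(7)]) (use y(2-) st(5) e \<phi>(3) in simp_all)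
    have 2: "\<sigma> s y = v"
      using \<sigma>_el[of x a t s] y(2-) uv(2-) ar by (simp add: y(1) uv(1))
    have "\<sigma> s y \<cdot> k = \<sigma> (s \<cdot> k) (y \<cdot> k)" if k: "k \<in> Arr E" "Cod E k = z"
    proof -
      \<comment> \<open>The condition that makes \<open>t\<close>, \<open>x\<close> and
        \<open>a\<close> a triple is stable under precomposition, which naturality of
        \<open>\<sigma>\<close> depends on.\<close>
      have "ev E p q x a \<cdot> k = (q \<cdot> t) \<cdot> k" by (simp only: y(11))
      then have ek: "ev E p q (x \<cdot> k) (a \<cdot> k) = q \<cdot> (t \<cdot> k)"
        using y(2-10) k p q ar by simp
      have "\<sigma> s y \<cdot> k = p2 E (Dom E p) (Dom E r) \<cdot> sh E \<phi> (pair E (a \<cdot> k) (s \<cdot> k)) (t \<cdot> k)"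
      proof -
        have "\<sigma> s y = p2 E (Dom E p) (Dom E r) \<cdot> sh E \<phi> (pair E a s) t"
          unfolding y(1) by (rule \<sigma>_el) (use y(2-) in simp_all)
        then show ?thesis
          using y(2-10) st(1,3,5) e k \<phi> ar by simp
      qed
      also have "\<dots> = \<sigma> (s \<cdot> k) (poly_pair.el E p q (t \<cdot> k) (x \<cdot> k) (a \<cdot> k))"
        by (rule \<sigma>_el[symmetric]) (use y(2-10) k ek in simp_all)
      finally show ?thesis
        using y(2-) k p q by (simp add: y(1))
    qed
    then show ?thesis using 2 uv(2-) by simp
  qed
  note mk = poly_mk[where \<sigma> = \<sigma>, OF _ _ _ _ _ _ _ eq]
  show "transpose E p r q \<phi> \<in> Arr (Poly E)"
    by (rule mk(1)) ((use p q r b1 in \<open>simp; fail\<close>) | use 1 in blast)+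
  show "sh E (transpose E p r q \<phi>) s (poly_pair.el E p q t x a) = p2 E (Dom E p) (Dom E r) \<cdot> sh E \<phi> (pair E a s) t"
    if s: "s \<in> Arr E" "a \<in> Arr E" "t \<in> Arr E" "Dom E s = Dom E t" "Dom E a = Dom E t" "Cod E s = ?R" "Cod E a = ?P"
      "Cod E t = Dom E q" "base \<phi> \<cdot> pair E a s = q \<cdot> t" and x: "x = base (transpose E p r q \<phi>) \<cdot> s"
  proof -
    have x: "x = b \<cdot> s" "x \<in> Arr E" "Dom E x = Dom E t" "Cod E x = ?H" "ev E p q x a = q \<cdot> t"
      using b_ev[of s a] s b1 by (simp_all add: x b)
    have "sh E (transpose E p r q \<phi>) s (poly_pair.el E p q t x a) = \<sigma> s (poly_pair.el E p q t x a)"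
      by (rule mk(2)) ((use s x p q r b1 in \<open>simp; fail\<close>) | use 1 in blast)+
    then show ?thesis
      using \<sigma>_el[of x a t s] s(1-8) x by simp
  qed
qed

lemma untranspose:
  assumes p: "exponentiable E p" and q: "exponentiable E q"
    and \<theta>: "\<theta> \<in> Arr (Poly E)" "pdom \<theta> = r" "pcod \<theta> = poly_hom E p q"
  shows "untranspose E p r q \<theta> \<in> Arr (Poly E)" "pdom (untranspose E p r q \<theta>) = prodmap E p r"
    "pcod (untranspose E p r q \<theta>) = q"
    "\<lbrakk>s \<in> Arr E; a \<in> Arr E; Dom E s = Dom E a; Cod E s = Cod E r; Cod E a = Cod E p\<rbrakk>
      \<Longrightarrow> base (untranspose E p r q \<theta>) \<cdot> pair E a s = ev E p q (base \<theta> \<cdot> s) a"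
    "\<lbrakk>s \<in> Arr E; a \<in> Arr E; t \<in> Arr E; Dom E s = Dom E t; Dom E a = Dom E t; Cod E s = Cod E r; Cod E a = Cod E p;
      Cod E t = Dom E q; ev E p q (base \<theta> \<cdot> s) a = q \<cdot> t\<rbrakk>
      \<Longrightarrow> sh E (untranspose E p r q \<theta>) (pair E a s) t =
        pair E (us E p q (base \<theta> \<cdot> s) a t) (sh E \<theta> s (poly_pair.el E p q t (base \<theta> \<cdot> s) a))"
proof -
  have r: "exponentiable E r" using poly_arr(1)[OF \<theta>(1)] \<theta>(2) by simp
  have ar: "p \<in> Arr E" "r \<in> Arr E" "q \<in> Arr E" using p q r by simp_all
  let ?P = "Cod E p" and ?R = "Cod E r"
  let ?b = "ev E p q (base \<theta> \<cdot> p2 E ?P ?R) (p1 E ?P ?R)"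
  have \<theta>b: "base \<theta> \<in> Arr E" "Dom E (base \<theta>) = ?R" "Cod E (base \<theta>) = qp_obj E p q"
    using \<theta> p q by simp_all
  define \<sigma> where "\<sigma> w t = (let a = p1 E ?P ?R \<cdot> w; s = p2 E ?P ?R \<cdot> w; x = base \<theta> \<cdot> s in
    pair E (us E p q x a t) (sh E \<theta> s (poly_pair.el E p q t x a)))" for w t
  have eq: "untranspose E p r q \<theta> = PMor (prodmap E p r) q ?b (\<sigma> (pr1 E ?b q) (pr2 E ?b q))"
    by (simp add: untranspose_def Let_def \<sigma>_def)
  then show "pdom (untranspose E p r q \<theta>) = prodmap E p r" "pcod (untranspose E p r q \<theta>) = q" by simp_all
  show "base (untranspose E p r q \<theta>) \<cdot> pair E a s = ev E p q (base \<theta> \<cdot> s) a"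
    if "s \<in> Arr E" "a \<in> Arr E" "Dom E s = Dom E a" "Cod E s = ?R" "Cod E a = ?P" for s a
    unfolding eq using that \<theta>b p q ar by simp
  have \<sigma>_pair: "\<sigma> (pair E a s) t = pair E (us E p q (base \<theta> \<cdot> s) a t) (sh E \<theta> s (poly_pair.el E p q t (base \<theta> \<cdot> s) a))"
    if "s \<in> Arr E" "a \<in> Arr E" "Dom E s = Dom E a" "Cod E s = ?R" "Cod E a = ?P" for s a t
    using that ar by (simp add: \<sigma>_def Let_def)
  have 1: "\<sigma> w t \<in> Arr E \<and> Dom E (\<sigma> w t) = d \<and> Cod E (\<sigma> w t) = Dom E (prodmap E p r) \<and>
      prodmap E p r \<cdot> \<sigma> w t = w \<and> (h \<in> Arr E \<longrightarrow> Cod E h = d \<longrightarrow> \<sigma> w t \<cdot> h = \<sigma> (w \<cdot> h) (t \<cdot> h))"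
    if st: "w \<in> Arr E" "t \<in> Arr E" "Dom E w = d" "Dom E t = d" "Cod E w = Cod E (prodmap E p r)" "Cod E t = Dom E q"
      "?b \<cdot> w = q \<cdot> t" for w t d h
  proof -
    obtain a s where w: "w = pair E a s" "a \<in> Arr E" "s \<in> Arr E" "Dom E a = d" "Dom E s = d" "Cod E a = ?P" "Cod E s = ?R"
      by (rule prod_elim[OF st(1,3), of ?P ?R]) (use st(5) ar in simp_all)
    have e: "ev E p q (base \<theta> \<cdot> s) a = q \<cdot> t"
      using st(7) w(2-) \<theta>b p q ar by (simp add: w(1))
    show ?thesis
      using w(2-) e st(2,4,6) \<theta>b \<theta> p q r ar by (simp add: w(1) \<sigma>_pair)
  qed
  note mk = poly_mk[where \<sigma> = \<sigma>, OF _ _ _ _ _ _ _ eq]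
  show "untranspose E p r q \<theta> \<in> Arr (Poly E)"
    by (rule mk(1)) ((use p q r ar \<theta>b in \<open>simp; fail\<close>) | use 1 in blast)+
  show "sh E (untranspose E p r q \<theta>) (pair E a s) t =
        pair E (us E p q (base \<theta> \<cdot> s) a t) (sh E \<theta> s (poly_pair.el E p q t (base \<theta> \<cdot> s) a))"
    if x: "s \<in> Arr E" "a \<in> Arr E" "t \<in> Arr E" "Dom E s = Dom E t" "Dom E a = Dom E t" "Cod E s = ?R" "Cod E a = ?P"
      "Cod E t = Dom E q" "ev E p q (base \<theta> \<cdot> s) a = q \<cdot> t"
  proof -
    have "sh E (untranspose E p r q \<theta>) (pair E a s) t = \<sigma> (pair E a s) t"
      by (rule mk(2)) ((use p q r ar \<theta>b x in \<open>simp; fail\<close>) | use 1 in blast)+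
    then show ?thesis using x by (simp add: \<sigma>_pair)
  qed
qed

text \<open>One round trip reassembles the two components of a value of the sharp map and is checked
  on pairs; the other is tested by \<open>hom_eqI\<close>, where \<open>us\<close> and
  \<open>sh\<close> each select one component of the pair formed by
  \<open>untranspose\<close>.\<close>

lemma bij_transpose:
  assumes p: "exponentiable E p" and r: "exponentiable E r" and q: "exponentiable E q"
  shows "bij_betw (transpose E p r q) (Hom (Poly E) (prodmap E p r) q) (Hom (Poly E) r (poly_hom E p q))"
proof (rule bij_betw_byWitness[where f' = "untranspose E p r q"]; (intro ballI image_subsetI)?)
  have ar: "p \<in> Arr E" "r \<in> Arr E" "q \<in> Arr E" using p q r by simp_all
  show "transpose E p r q \<phi> \<in> Hom (Poly E) r (poly_hom E p q)" if "\<phi> \<in> Hom (Poly E) (prodmap E p r) q" for \<phi>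
    using transpose(1)[OF p r, of \<phi> q] that by simp
  show "untranspose E p r q \<theta> \<in> Hom (Poly E) (prodmap E p r) q" if "\<theta> \<in> Hom (Poly E) r (poly_hom E p q)" for \<theta>
    using untranspose(1-3)[OF p q, of \<theta> r] that by simp
  show "untranspose E p r q (transpose E p r q \<phi>) = \<phi>" if "\<phi> \<in> Hom (Poly E) (prodmap E p r) q" for \<phi>
  proof -
    have \<phi>: "\<phi> \<in> Arr (Poly E)" "pdom \<phi> = prodmap E p r" "pcod \<phi> = q" using that by auto
    note T = transpose[OF p r \<phi>]
    note U = untranspose[OF p q T(1) transpose_simps]
    show ?thesis
    proof (rule poly_eqI)
      show "base (untranspose E p r q (transpose E p r q \<phi>)) = base \<phi>"
      proof (rule prod_map_eqI[of _ _ "Cod E p" "Cod E r"])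
        fix a s assume s: "a \<in> Arr E" "s \<in> Arr E" "Dom E a = Dom E s" "Cod E a = Cod E p" "Cod E s = Cod E r"
        show "base (untranspose E p r q (transpose E p r q \<phi>)) \<cdot> pair E a s = base \<phi> \<cdot> pair E a s"
          using U(4)[of s a] T(2)[of s a] s by simp
      qed (use U(1-3) \<phi> ar in simp_all)
      fix z w t assume wt: "w \<in> Arr E" "t \<in> Arr E" "Dom E w = z" "Dom E t = z"
        "Cod E w = Cod E (pdom (untranspose E p r q (transpose E p r q \<phi>)))"
        "Cod E t = Dom E (pcod (untranspose E p r q (transpose E p r q \<phi>)))"
        "base (untranspose E p r q (transpose E p r q \<phi>)) \<cdot> w = pcod (untranspose E p r q (transpose E p r q \<phi>)) \<cdot> t"
      obtain a s where w: "w = pair E a s" "a \<in> Arr E" "s \<in> Arr E" "Dom E a = z" "Dom E s = z" "Cod E a = Cod E p" "Cod E s = Cod E r"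
        by (rule prod_elim[OF wt(1,3), of "Cod E p" "Cod E r"]) (use wt(5) U(2) ar in simp_all)
      have ct: "Cod E t = Dom E q" using wt(6) U(3) by simp
      have e0: "ev E p q (base (transpose E p r q \<phi>) \<cdot> s) a = q \<cdot> t"
        using wt(7) U(3) U(4)[of s a] w(2-) by (simp add: w(1))
      then have e: "base \<phi> \<cdot> pair E a s = q \<cdot> t"
        using T(2)[of s a] w(2-) by simp
      obtain u v where uv: "sh E \<phi> (pair E a s) t = pair E u v" "u \<in> Arr E" "v \<in> Arr E" "Dom E u = z" "Dom E v = z"
        "Cod E u = Dom E p" "Cod E v = Dom E r"
        by (rule sh_pair_elim[OF \<phi>(1,2) ar(1,2) w(2,3) wt(2) w(4,5) wt(4)]) (use w(2-) ct e \<phi>(3) in simp_all)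
      show "sh E (untranspose E p r q (transpose E p r q \<phi>)) w t = sh E \<phi> w t"
        using U(5)[of s a t] T(3)[of s a t] T(4)[of s a t, OF _ _ _ _ _ _ _ _ _ refl] e0 e w(2-) wt(2,4) ct uv(2-) ar
        by (simp add: w(1) uv(1))
    qed (use U(1-3) \<phi> in simp_all)
  qed
  show "transpose E p r q (untranspose E p r q \<theta>) = \<theta>" if "\<theta> \<in> Hom (Poly E) r (poly_hom E p q)" for \<theta>
  proof -
    have \<theta>: "\<theta> \<in> Arr (Poly E)" "pdom \<theta> = r" "pcod \<theta> = poly_hom E p q" using that by auto
    have \<theta>b: "base \<theta> \<in> Arr E" "Dom E (base \<theta>) = Cod E r" "Cod E (base \<theta>) = qp_obj E p q"
      using \<theta> p q by simp_all
    note U = untranspose[OF p q \<theta>]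
    note T = transpose[OF p r U(1-3)]
    show ?thesis
    proof (rule hom_eqI[OF p q, where r = r])
      fix s a assume s: "s \<in> Arr E" "a \<in> Arr E" "Dom E s = Dom E a" "Cod E s = Cod E r" "Cod E a = Cod E p"
      show "ev E p q (base (transpose E p r q (untranspose E p r q \<theta>)) \<cdot> s) a = ev E p q (base \<theta> \<cdot> s) a"
        using T(2)[OF s] U(4)[OF s] by simp
    next
      fix s a t assume s: "s \<in> Arr E" "a \<in> Arr E" "t \<in> Arr E" "Dom E s = Dom E t" "Dom E a = Dom E t"
        "Cod E s = Cod E r" "Cod E a = Cod E p" "Cod E t = Dom E q"
        "ev E p q (base (transpose E p r q (untranspose E p r q \<theta>)) \<cdot> s) a = q \<cdot> t" "ev E p q (base \<theta> \<cdot> s) a = q \<cdot> t"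
      have e: "base (untranspose E p r q \<theta>) \<cdot> pair E a s = q \<cdot> t"
        using U(4)[of s a] s(1-8,10) by simp
      have u: "us E p q (base \<theta> \<cdot> s) a t \<in> Arr E" "Dom E (us E p q (base \<theta> \<cdot> s) a t) = Dom E t"
        "Cod E (us E p q (base \<theta> \<cdot> s) a t) = Dom E p"
        using s(1-8,10) \<theta>b p q by simp_all
      have el: "poly_pair.el E p q t (base \<theta> \<cdot> s) a \<in> Arr E" "Dom E (poly_pair.el E p q t (base \<theta> \<cdot> s) a) = Dom E t"
        "Cod E (poly_pair.el E p q t (base \<theta> \<cdot> s) a) = pb E q (qp_eval E p q)"
        "poly_hom E p q \<cdot> poly_pair.el E p q t (base \<theta> \<cdot> s) a = base \<theta> \<cdot> s"
        using s(1-8,10) \<theta>b p q by simp_all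
      have v: "sh E \<theta> s (poly_pair.el E p q t (base \<theta> \<cdot> s) a) \<in> Arr E"
        "Dom E (sh E \<theta> s (poly_pair.el E p q t (base \<theta> \<cdot> s) a)) = Dom E t"
        "Cod E (sh E \<theta> s (poly_pair.el E p q t (base \<theta> \<cdot> s) a)) = Dom E r"
        using s(1-8) \<theta> el p q by simp_all
      show "us E p q (base (transpose E p r q (untranspose E p r q \<theta>)) \<cdot> s) a t = us E p q (base \<theta> \<cdot> s) a t"
        using T(3)[OF s(1-8) e] U(5)[OF s(1-8,10)] u v ar by simp
      show "sh E (transpose E p r q (untranspose E p r q \<theta>)) s
          (poly_pair.el E p q t (base (transpose E p r q (untranspose E p r q \<theta>)) \<cdot> s) a) =
        sh E \<theta> s (poly_pair.el E p q t (base \<theta> \<cdot> s) a)"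
        using T(4)[OF s(1-8) e refl] U(5)[OF s(1-8,10)] u v ar by simp
    qed (use T(1) \<theta> in simp_all)
  qed
qed

text \<open>Let \<open>u\<close> and \<open>v\<close> be the components of the sharp map of
  \<open>h\<close> at \<open>a\<close>, \<open>base f \<cdot> s\<close> and the element
  \<open>?t\<close> brought back along \<open>g\<close>. On both sides \<open>us\<close> equals
  \<open>u\<close> and the sharp value equals \<open>sh E f s v\<close>, since \<open>f\<close> acts
  on the component belonging to \<open>r\<close> alone.\<close>

lemma transpose_natural:
  assumes f: "f \<in> Arr (Poly E)" "pdom f = r'" "pcod f = r" and g: "g \<in> Arr (Poly E)" "pdom g = q" "pcod g = q'"
    and h: "h \<in> Arr (Poly E)" "pdom h = prodmap E p r" "pcod h = q" and p: "exponentiable E p"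
  shows "transpose E p r' q' (poly_comp E (poly_comp E g h) (poly_tensor_mor E (poly_id E p) f)) =
    poly_comp E (poly_comp E (poly_hom_mor E (poly_id E p) g) (transpose E p r q h)) f" (is "?l = ?r")
proof -
  have ex: "exponentiable E r" "exponentiable E r'" "exponentiable E q" "exponentiable E q'"
    using poly_arr(1,2)[OF f(1)] poly_arr(1,2)[OF g(1)] f g by simp_all
  have ar: "p \<in> Arr E" "r \<in> Arr E" "r' \<in> Arr E" "q \<in> Arr E" "q' \<in> Arr E" using p ex by simp_all
  define K where "K = poly_comp E (poly_comp E g h) (poly_tensor_mor E (poly_id E p) f)"
  let ?G = "poly_hom_mor E (poly_id E p) g" and ?T = "transpose E p r q h"
  have K: "K \<in> Arr (Poly E)" "pdom K = prodmap E p r'" "pcod K = q'"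
    using f g h p ar by (simp_all add: K_def)
  note G = poly_hom_mor[OF poly_id(1)[OF p] poly_id_simps(1,2) g]
  note T = transpose[OF p ex(1) h]
  note L = transpose[OF p ex(2) K]
  have bG: "base ?G \<in> Arr E" "Dom E (base ?G) = qp_obj E p q" "Cod E (base ?G) = qp_obj E p q'"
    using poly_arr(3-5)[OF G(1)] g p ex by simp_all
  have bT: "base ?T \<in> Arr E" "Dom E (base ?T) = Cod E r" "Cod E (base ?T) = qp_obj E p q"
    using poly_arr(3-5)[OF T(1)] p ex by simp_all
  have bf: "base f \<in> Arr E" "Dom E (base f) = Cod E r'" "Cod E (base f) = Cod E r"
    using poly_arr(3-5)[OF f(1)] f by simp_all
  have GT: "poly_comp E ?G ?T \<in> Arr (Poly E)"
    by (rule poly_comp(1)) (use G(1) T(1) g in simp_all)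
  have rs: "base ?r \<cdot> s = base ?G \<cdot> (base ?T \<cdot> (base f \<cdot> s))" if "s \<in> Arr E" "Cod E s = Cod E r'" for s
    using bG bT bf that by simp
  have K_base: "base K \<cdot> pair E a s = base g \<cdot> (base h \<cdot> pair E a (base f \<cdot> s))"
    and ev_eq: "ev E p q' (base ?G \<cdot> (base ?T \<cdot> (base f \<cdot> s))) a = base g \<cdot> (base h \<cdot> pair E a (base f \<cdot> s))"
    if s: "s \<in> Arr E" "a \<in> Arr E" "Dom E s = Dom E a" "Cod E s = Cod E r'" "Cod E a = Cod E p" for s a
  proof -
    show "base K \<cdot> pair E a s = base g \<cdot> (base h \<cdot> pair E a (base f \<cdot> s))"
      using s f g h ar by (simp add: K_def)
    show "ev E p q' (base ?G \<cdot> (base ?T \<cdot> (base f \<cdot> s))) a = base g \<cdot> (base h \<cdot> pair E a (base f \<cdot> s))"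
      using G(2)[of "base ?T \<cdot> (base f \<cdot> s)" a] T(2)[of "base f \<cdot> s" a] s bf bT by simp
  qed
  show ?thesis
    unfolding K_def[symmetric]
  proof (rule hom_eqI[OF p ex(4), where r = r'])
    fix s a assume s: "s \<in> Arr E" "a \<in> Arr E" "Dom E s = Dom E a" "Cod E s = Cod E r'" "Cod E a = Cod E p"
    show "ev E p q' (base (transpose E p r' q' K) \<cdot> s) a = ev E p q' (base ?r \<cdot> s) a"
      unfolding rs[OF s(1,4)] ev_eq[OF s] L(2)[OF s] K_base[OF s] ..
  next
    fix s a t assume s: "s \<in> Arr E" "a \<in> Arr E" "t \<in> Arr E" "Dom E s = Dom E t" "Dom E a = Dom E t"
      "Cod E s = Cod E r'" "Cod E a = Cod E p" "Cod E t = Dom E q'"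
      "ev E p q' (base (transpose E p r' q' K) \<cdot> s) a = q' \<cdot> t"
    have sa: "Dom E s = Dom E a" using s by simp
    have Kt: "base K \<cdot> pair E a s = q' \<cdot> t"
      using s(9) L(2)[OF s(1,2) sa s(6,7)] by simp
    have e: "base g \<cdot> (base h \<cdot> pair E a (base f \<cdot> s)) = q' \<cdot> t"
      using Kt K_base[OF s(1,2) sa s(6,7)] by simp
    let ?s = "base f \<cdot> s"
    let ?c = "base h \<cdot> pair E a ?s"
    let ?t = "sh E g ?c t"
    have s1: "?s \<in> Arr E" "Dom E ?s = Dom E t" "Cod E ?s = Cod E r"
      using s(1-8) bf by simp_all
    have c: "?c \<in> Arr E" "Dom E ?c = Dom E t" "Cod E ?c = Cod E q"
      using s(1-8) s1 h ar by simp_all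
    have t: "?t \<in> Arr E" "Dom E ?t = Dom E t" "Cod E ?t = Dom E q" "q \<cdot> ?t = ?c"
      using s(1-8) c e g by simp_all
    obtain u v where uv: "sh E h (pair E a ?s) ?t = pair E u v" "u \<in> Arr E" "v \<in> Arr E" "Dom E u = Dom E t" "Dom E v = Dom E t"
      "Cod E u = Dom E p" "Cod E v = Dom E r" "p \<cdot> u = a" "r \<cdot> v = ?s"
      by (rule sh_pair_elim[OF h(1,2) ar(1,2) s(2) s1(1) t(1) s(5) s1(2) t(2)]) (use s(7) s1 t h in simp_all)
    have f_sh: "sh E f s v \<in> Arr E" "Dom E (sh E f s v) = Dom E t" "Cod E (sh E f s v) = Dom E r'"
      using s(1-8) uv(2-) f by simp_all
    \<comment> \<open>Tensoring with the identity of \<open>p\<close> leaves \<open>u\<close> alone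
      and carries \<open>v\<close> back along \<open>f\<close>.\<close>
    have K_sh: "sh E K (pair E a s) t = pair E u (sh E f s v)"
    proof -
      have "sh E K (pair E a s) t = sh E (poly_tensor_mor E (poly_id E p) f) (pair E a s)
          (sh E (poly_comp E g h) (base (poly_tensor_mor E (poly_id E p) f) \<cdot> pair E a s) t)"
        unfolding K_def by (rule poly_comp(2)) (use s(1-8) e f g h p ar in simp_all)
      also have "base (poly_tensor_mor E (poly_id E p) f) \<cdot> pair E a s = pair E a ?s"
        using s(1-8) f ar by simp
      also have "sh E (poly_comp E g h) (pair E a ?s) t = sh E h (pair E a ?s) ?t"
        by (rule poly_comp(2)) (use s(1-8) s1 e g h ar in simp_all)
      also have "sh E (poly_tensor_mor E (poly_id E p) f) (pair E a s) (sh E h (pair E a ?s) ?t) =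
          pair E (sh E (poly_id E p) a u) (sh E f s v)"
        unfolding uv(1) by (rule poly_tensor(2)) (use s(1-8) uv(2-) f p in simp_all)
      also have "sh E (poly_id E p) a u = u"
        by (rule poly_id(2)) (use s(2,5,7) uv(2-8) p in simp_all)
      finally show ?thesis .
    qed
    let ?x = "base ?T \<cdot> ?s"
    have x: "?x \<in> Arr E" "Dom E ?x = Dom E t" "Cod E ?x = qp_obj E p q"
      using s1 bT by simp_all
    have xa: "ev E p q ?x a = ?c"
      by (rule T(2)) (use s(1-8) s1 in simp_all)
    have ia: "base (poly_id E p) \<cdot> a = a"
      using s(2,7) ar by simp
    have "us E p q' (base ?G \<cdot> ?x) a t = sh E (poly_id E p) a (us E p q ?x (base (poly_id E p) \<cdot> a) (sh E g (ev E p q ?x (base (poly_id E p) \<cdot> a)) t))"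
      by (rule G(3)) (use s(1-8) x in \<open>simp_all only: ia xa e\<close>)
    also have "\<dots> = sh E (poly_id E p) a (us E p q ?x a ?t)"
      unfolding ia xa ..
    also have "us E p q ?x a ?t = p1 E (Dom E p) (Dom E r) \<cdot> sh E h (pair E a ?s) ?t"
      by (rule T(3)) (use s(1-8) s1 t in simp_all)
    also have "\<dots> = u" unfolding uv(1) using uv(2-7) by simp
    also have "sh E (poly_id E p) a u = u"
      by (rule poly_id(2)) (use s(2,5,7) uv(2-8) p in simp_all)
    also have "u = p1 E (Dom E p) (Dom E r') \<cdot> sh E K (pair E a s) t"
      unfolding K_sh using uv(2-7) f_sh by simp
    finally show "us E p q' (base (transpose E p r' q' K) \<cdot> s) a t = us E p q' (base ?r \<cdot> s) a t"
      unfolding rs[OF s(1,6)] L(3)[OF s(1-8) Kt] by simp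
    assume "base (transpose E p r' q' K) = base ?r"
    let ?y = "poly_pair.el E p q' t (base ?G \<cdot> ?x) a"
    have y: "?y \<in> Arr E" "Dom E ?y = Dom E t" "Cod E ?y = Dom E (poly_hom E p q')" "poly_hom E p q' \<cdot> ?y = base ?G \<cdot> ?x"
      using s(1-8) x bG p ex ev_eq[OF s(1,2) sa s(6,7)] e by simp_all
    have Gy: "sh E ?G ?x ?y = poly_pair.el E p q ?t ?x a"
    proof -
      have "sh E ?G ?x ?y = poly_pair.el E p q (sh E g (ev E p q ?x (base (poly_id E p) \<cdot> a)) t) ?x (base (poly_id E p) \<cdot> a)"
        by (rule G(4)) (use s(1-8) x in \<open>simp_all only: ia xa e\<close>)
      then show ?thesis unfolding ia xa .
    qed
    \<comment> \<open>The right side from the inside out: \<open>?G\<close> turns the triple over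
      \<open>q'\<close> into one over \<open>q\<close>, the transpose of \<open>h\<close> selects
      \<open>v\<close>, and \<open>f\<close> acts last.\<close>
    have "sh E ?r s ?y = sh E f s (sh E (poly_comp E ?G ?T) ?s ?y)"
      by (rule poly_comp(2)) (use s(1-8) y f GT bG bT s1 g in simp_all)
    also have "sh E (poly_comp E ?G ?T) ?s ?y = sh E ?T ?s (sh E ?G ?x ?y)"
      by (rule poly_comp(2)) (use y f G(1) T(1) g s1 in simp_all)
    also have "\<dots> = p2 E (Dom E p) (Dom E r) \<cdot> sh E h (pair E a ?s) ?t"
      unfolding Gy by (rule T(4)) (use s(1-8) s1 t in simp_all)
    also have "\<dots> = v" unfolding uv(1) using uv(2-7) by simp
    also have "sh E f s v = p2 E (Dom E p) (Dom E r') \<cdot> sh E K (pair E a s) t"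
      unfolding K_sh using uv(2-7) f_sh by simp
    also have "\<dots> = sh E (transpose E p r' q' K) s (poly_pair.el E p q' t (base (transpose E p r' q' K) \<cdot> s) a)"
      by (rule L(4)[OF s(1-8) Kt refl, symmetric])
    finally show "sh E (transpose E p r' q' K) s (poly_pair.el E p q' t (base (transpose E p r' q' K) \<cdot> s) a) =
        sh E ?r s (poly_pair.el E p q' t (base ?r \<cdot> s) a)"
      unfolding rs[OF s(1,6)] by simp
  qed (use L(1) f g GT in simp_all)
qed

text \<open>Here \<open>k\<close> acts on the component \<open>u\<close>, which transposition stores
  in \<open>us\<close>, while the component \<open>v\<close> that forms the new sharp map is left as
  it is.\<close>

lemma transpose_natural_left:
  assumes k: "k \<in> Arr (Poly E)" "pdom k = p'" "pcod k = p"
    and h: "h \<in> Arr (Poly E)" "pdom h = prodmap E p r" "pcod h = q" and r: "exponentiable E r"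
  shows "transpose E p' r q (poly_comp E h (poly_tensor_mor E k (poly_id E r))) =
    poly_comp E (poly_hom_mor E k (poly_id E q)) (transpose E p r q h)" (is "?l = ?r")
proof -
  have ex: "exponentiable E p" "exponentiable E p'" "exponentiable E q"
    using poly_arr(1,2)[OF k(1)] poly_arr(2)[OF h(1)] k h by simp_all
  have ar: "p \<in> Arr E" "p' \<in> Arr E" "r \<in> Arr E" "q \<in> Arr E" using r ex by simp_all
  define K where "K = poly_comp E h (poly_tensor_mor E k (poly_id E r))"
  let ?G = "poly_hom_mor E k (poly_id E q)" and ?T = "transpose E p r q h"
  have K: "K \<in> Arr (Poly E)" "pdom K = prodmap E p' r" "pcod K = q"
    using k h r ar by (simp_all add: K_def)
  note G = poly_hom_mor[OF k poly_id(1)[OF ex(3)] poly_id_simps(1,2)]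
  note T = transpose[OF ex(1) r h]
  note L = transpose[OF ex(2) r K]
  have bG: "base ?G \<in> Arr E" "Dom E (base ?G) = qp_obj E p q" "Cod E (base ?G) = qp_obj E p' q"
    using poly_arr(3-5)[OF G(1)] k ex by simp_all
  have bT: "base ?T \<in> Arr E" "Dom E (base ?T) = Cod E r" "Cod E (base ?T) = qp_obj E p q"
    using poly_arr(3-5)[OF T(1)] ex by simp_all
  have bk: "base k \<in> Arr E" "Dom E (base k) = Cod E p'" "Cod E (base k) = Cod E p"
    using poly_arr(3-5)[OF k(1)] k by simp_all
  have rs: "base ?r \<cdot> s = base ?G \<cdot> (base ?T \<cdot> s)" if "s \<in> Arr E" "Cod E s = Cod E r" for s
    using bG bT that by simp
  have K_base: "base K \<cdot> pair E a s = base h \<cdot> pair E (base k \<cdot> a) s"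
    and ev_T: "ev E p q (base ?T \<cdot> s) (base k \<cdot> a) = base h \<cdot> pair E (base k \<cdot> a) s"
    and ev_eq: "ev E p' q (base ?G \<cdot> (base ?T \<cdot> s)) a = base h \<cdot> pair E (base k \<cdot> a) s"
    if s: "s \<in> Arr E" "a \<in> Arr E" "Dom E s = Dom E a" "Cod E s = Cod E r" "Cod E a = Cod E p'" for s a
  proof -
    show "base K \<cdot> pair E a s = base h \<cdot> pair E (base k \<cdot> a) s"
      using s k h ar by (simp add: K_def)
    show evT: "ev E p q (base ?T \<cdot> s) (base k \<cdot> a) = base h \<cdot> pair E (base k \<cdot> a) s"
      by (rule T(2)) (use s bk in simp_all)
    show "ev E p' q (base ?G \<cdot> (base ?T \<cdot> s)) a = base h \<cdot> pair E (base k \<cdot> a) s"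
      using G(2)[of "base ?T \<cdot> s" a] evT s bk bT h ar by simp
  qed
  show ?thesis
    unfolding K_def[symmetric]
  proof (rule hom_eqI[OF ex(2,3), where r = r])
    fix s a assume s: "s \<in> Arr E" "a \<in> Arr E" "Dom E s = Dom E a" "Cod E s = Cod E r" "Cod E a = Cod E p'"
    show "ev E p' q (base (transpose E p' r q K) \<cdot> s) a = ev E p' q (base ?r \<cdot> s) a"
      unfolding rs[OF s(1,4)] ev_eq[OF s] L(2)[OF s] K_base[OF s] ..
  next
    fix s a t assume s: "s \<in> Arr E" "a \<in> Arr E" "t \<in> Arr E" "Dom E s = Dom E t" "Dom E a = Dom E t"
      "Cod E s = Cod E r" "Cod E a = Cod E p'" "Cod E t = Dom E q"
      "ev E p' q (base (transpose E p' r q K) \<cdot> s) a = q \<cdot> t"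
    have sa: "Dom E s = Dom E a" using s by simp
    have Kt: "base K \<cdot> pair E a s = q \<cdot> t"
      using s(9) L(2)[OF s(1,2) sa s(6,7)] by simp
    have e: "base h \<cdot> pair E (base k \<cdot> a) s = q \<cdot> t"
      using Kt K_base[OF s(1,2) sa s(6,7)] by simp
    let ?a = "base k \<cdot> a"
    have a1: "?a \<in> Arr E" "Dom E ?a = Dom E t" "Cod E ?a = Cod E p"
      using s(1-8) bk by simp_all
    obtain u v where uv: "sh E h (pair E ?a s) t = pair E u v" "u \<in> Arr E" "v \<in> Arr E" "Dom E u = Dom E t" "Dom E v = Dom E t"
      "Cod E u = Dom E p" "Cod E v = Dom E r" "p \<cdot> u = ?a" "r \<cdot> v = s"
      by (rule sh_pair_elim[OF h(1,2) ar(1,3) a1(1) s(1,3) a1(2) s(4) refl]) (use s(6-8) a1 e h in simp_all)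
    have k_sh: "sh E k a u \<in> Arr E" "Dom E (sh E k a u) = Dom E t" "Cod E (sh E k a u) = Dom E p'"
      using s(1-8) uv(2-8) k by simp_all
    have K_sh: "sh E K (pair E a s) t = pair E (sh E k a u) v"
    proof -
      have "sh E K (pair E a s) t = sh E (poly_tensor_mor E k (poly_id E r)) (pair E a s)
          (sh E h (base (poly_tensor_mor E k (poly_id E r)) \<cdot> pair E a s) t)"
        unfolding K_def by (rule poly_comp(2)) (use s(1-8) e k h r ar in simp_all)
      also have "base (poly_tensor_mor E k (poly_id E r)) \<cdot> pair E a s = pair E ?a s"
        using s(1-8) k ar by simp
      also have "sh E (poly_tensor_mor E k (poly_id E r)) (pair E a s) (sh E h (pair E ?a s) t) =
          pair E (sh E k a u) (sh E (poly_id E r) s v)"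
        unfolding uv(1) by (rule poly_tensor(2)) (use s(1-8) uv(2-) k r in simp_all)
      also have "sh E (poly_id E r) s v = v"
        by (rule poly_id(2)) (use s(1,4,6) uv(3,5,7,9) r in simp_all)
      finally show ?thesis .
    qed
    let ?x = "base ?T \<cdot> s"
    have x: "?x \<in> Arr E" "Dom E ?x = Dom E t" "Cod E ?x = qp_obj E p q"
      using s(1,4,6) bT by simp_all
    have xa: "ev E p q ?x ?a = q \<cdot> t"
      using ev_T[OF s(1,2) sa s(6,7)] e by simp
    \<comment> \<open>The second argument of \<open>poly_hom_mor\<close> is an identity, so both its
      base map and its sharp map act trivially at this element.\<close>
    have qt: "base (poly_id E q) \<cdot> (q \<cdot> t) = q \<cdot> t" "sh E (poly_id E q) (q \<cdot> t) t = t"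
      using s(3,8) ex ar by simp_all
    have "us E p' q (base ?G \<cdot> ?x) a t = sh E k a (us E p q ?x ?a (sh E (poly_id E q) (ev E p q ?x ?a) t))"
      by (rule G(3)) (use s(1-8) x in \<open>simp_all only: xa qt\<close>)
    also have "\<dots> = sh E k a (us E p q ?x ?a t)"
      unfolding xa qt ..
    also have "us E p q ?x ?a t = p1 E (Dom E p) (Dom E r) \<cdot> sh E h (pair E ?a s) t"
      by (rule T(3)) (use s(1-8) a1 e in simp_all)
    also have "\<dots> = u" unfolding uv(1) using uv(2-7) by simp
    also have "sh E k a u = p1 E (Dom E p') (Dom E r) \<cdot> sh E K (pair E a s) t"
      unfolding K_sh using uv(2-7) k_sh by simp
    finally show "us E p' q (base (transpose E p' r q K) \<cdot> s) a t = us E p' q (base ?r \<cdot> s) a t"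
      unfolding rs[OF s(1,6)] L(3)[OF s(1-8) Kt] by simp
    assume "base (transpose E p' r q K) = base ?r"
    let ?y = "poly_pair.el E p' q t (base ?G \<cdot> ?x) a"
    have y: "?y \<in> Arr E" "Dom E ?y = Dom E t" "Cod E ?y = Dom E (poly_hom E p' q)" "poly_hom E p' q \<cdot> ?y = base ?G \<cdot> ?x"
      using s(1-8) x bG ex ev_eq[OF s(1,2) sa s(6,7)] e by simp_all
    have Gy: "sh E ?G ?x ?y = poly_pair.el E p q t ?x ?a"
    proof -
      have "sh E ?G ?x ?y = poly_pair.el E p q (sh E (poly_id E q) (ev E p q ?x ?a) t) ?x ?a"
        by (rule G(4)) (use s(1-8) x in \<open>simp_all only: xa qt\<close>)
      then show ?thesis unfolding xa qt .
    qed
    have "sh E ?r s ?y = sh E ?T s (sh E ?G ?x ?y)"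
      by (rule poly_comp(2)) (use s(1-8) y G(1) T(1) k in simp_all)
    also have "\<dots> = p2 E (Dom E p) (Dom E r) \<cdot> sh E h (pair E ?a s) t"
      unfolding Gy by (rule T(4)) (use s(1-8) a1 e in simp_all)
    also have "\<dots> = p2 E (Dom E p') (Dom E r) \<cdot> sh E K (pair E a s) t"
      unfolding K_sh uv(1) using uv(2-7) k_sh by simp
    also have "\<dots> = sh E (transpose E p' r q K) s (poly_pair.el E p' q t (base (transpose E p' r q K) \<cdot> s) a)"
      by (rule L(4)[OF s(1-8) Kt refl, symmetric])
    finally show "sh E (transpose E p' r q K) s (poly_pair.el E p' q t (base (transpose E p' r q K) \<cdot> s) a) =
        sh E ?r s (poly_pair.el E p' q t (base ?r \<cdot> s) a)"
      unfolding rs[OF s(1,6)] by simp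
  qed (use L(1) k G(1) T(1) in simp_all)
qed

lemma adjunction_transpose:
  assumes p: "exponentiable E p"
  shows "adjunction (Poly E) (Poly E) (tensor_left (Poly_moncat E) p)
    (hom_right (Poly_moncat E) (poly_hom_functor E) p) (transpose E p)"
  unfolding adjunction_def
proof (intro conjI ballI allI)
  interpret Poly: category "Poly E" by (rule category_Poly)
  show "is_functor (Poly E) (Poly E) (tensor_left (Poly_moncat E) p)"
    using functor_partial[OF functor_tensor category_Poly category_Poly, of p] p
    by (simp add: tensor_left_def Poly_moncat_def tens_def[abs_def] tensm_def[abs_def])
  show "is_functor (Poly E) (Poly E) (hom_right (Poly_moncat E) (poly_hom_functor E) p)"
    using functor_partial[OF functor_poly_hom Poly.category_op category_Poly, of p] p
    by (simp add: hom_right_def)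
  show "bij_betw (transpose E p r q) (Hom (Poly E) (fobj (tensor_left (Poly_moncat E) p) r) q)
      (Hom (Poly E) r (fobj (hom_right (Poly_moncat E) (poly_hom_functor E) p) q))"
    if "r \<in> Obj (Poly E)" "q \<in> Obj (Poly E)" for r q
    using bij_transpose[OF p, of r q] that
    by (simp add: tensor_left_def hom_right_def poly_hom_functor_def del: Hom_iff)
  show "transpose E p r' q' (Comp (Poly E) (Comp (Poly E) g h) (farr (tensor_left (Poly_moncat E) p) f)) =
      Comp (Poly E) (Comp (Poly E) (farr (hom_right (Poly_moncat E) (poly_hom_functor E) p) g) (transpose E p r q h)) f"
    if "f \<in> Hom (Poly E) r' r" "g \<in> Hom (Poly E) q q'" "h \<in> Hom (Poly E) (fobj (tensor_left (Poly_moncat E) p) r) q"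
    for r' r q q' f g h
    using transpose_natural[of f r' r g q q' h p] p that
    by (simp add: tensor_left_def hom_right_def poly_hom_functor_def)
qed

text \<open>The single family \<open>transpose E\<close>, indexed by all of \<open>p\<close>,
  \<open>r\<close> and \<open>q\<close>, serves as the witness, so naturality in \<open>p\<close>
  compares its members at \<open>p\<close> and \<open>p'\<close>.\<close>

lemma is_closure_Poly: "is_closure (Poly_moncat E) (poly_hom_functor E)"
  unfolding is_closure_def Let_def
proof (intro conjI exI[of _ "transpose E"] ballI allI impI)
  show "is_functor (prod_cat (op_cat (Mcat (Poly_moncat E))) (Mcat (Poly_moncat E))) (Mcat (Poly_moncat E)) (poly_hom_functor E)"
    using functor_poly_hom by simp
  show "adjunction (Mcat (Poly_moncat E)) (Mcat (Poly_moncat E)) (tensor_left (Poly_moncat E) p)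
      (hom_right (Poly_moncat E) (poly_hom_functor E) p) (transpose E p)" if "p \<in> Obj (Mcat (Poly_moncat E))" for p
    using adjunction_transpose[of p] that by simp
  show "transpose E p' r q (Comp (Mcat (Poly_moncat E)) h (tensm (Poly_moncat E) k (Ide (Mcat (Poly_moncat E)) r))) =
      Comp (Mcat (Poly_moncat E)) (farr (poly_hom_functor E) (k, Ide (Mcat (Poly_moncat E)) q)) (transpose E p r q h)"
    if "k \<in> Hom (Mcat (Poly_moncat E)) p' p" "h \<in> Hom (Mcat (Poly_moncat E)) (tens (Poly_moncat E) p r) q"
      "r \<in> Obj (Mcat (Poly_moncat E))" for p' p r q k h
    using transpose_natural_left[of k p' p h r q] that by (simp add: poly_hom_functor_def)
qed

end

theorem theorem4p11:
  fixes E :: "('o, 'a) cat"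
  assumes "category E" and "has_finite_limits E" and "cartesian_closed E"
  shows "monoidal_category (Poly_moncat E) \<and> is_closure (Poly_moncat E) (poly_hom_functor E)"
proof -
  interpret ccc E
    using assms by (simp add: ccc_def ccc_axioms_def)
  show ?thesis
    using monoidal_category_Poly is_closure_Poly by blast
qed

end
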